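(* Let $R$ be a graded-commutative noetherian ring and $\mathsf T$ a compactly generated $R$-linear triangulated category with arbitrary coproducts that is noetherian and stratified by $R$. Then the map $\mathsf S\mapsto\operatorname{supp}_R\mathsf S$ is a bijection from the localizing subcategories of $\mathsf T$ closed under all products to the subsets of $\operatorname{supp}_R\mathsf T$ closed under generalization. Here a subset $\mathcal U$ of $\operatorname{Spec}R$ is said to be closed under generalization if $\operatorname{Spec}R\setminus\mathcal U$ is specialization closed; more explicitly, $\mathfrak q\in\mathcal U$ and $\mathfrak p\subseteq\mathfrak q$ imply $\mathfrak p\in\mathcal U$. Moreover, if $L\colon\mathsf T\to\mathsf T$ is a localization functor that preserves arbitrary coproducts, then the localizing subcategory $\operatorname{Ker}L=\{X\in\mathsf T\mid LX=0\}$ is generated (as a localizing subcategory) by objects that are compact in $\mathsf T$.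
   Context: Graded-commutative: $R$ is $\mathbb Z$-graded with $rs=(-1)^{|r||s|}sr$ for homogeneous $r,s$. $\operatorname{Spec}R$ is the set of homogeneous prime ideals; $\mathcal V(\mathfrak a)=\{\mathfrak p\in\operatorname{Spec}R\mid\mathfrak p\supseteq\mathfrak a\}$ for a homogeneous ideal $\mathfrak a$. $R$-modules are graded and $M_{\mathfrak p}$ is homogeneous localization. A subset $\mathcal V\subseteq\operatorname{Spec}R$ is specialization closed if $\mathfrak p\in\mathcal V$, $\mathfrak q\in\operatorname{Spec}R$ and $\mathfrak p\subseteq\mathfrak q$ imply $\mathfrak q\in\mathcal V$. $\mathsf T$ has suspension $\Sigma$. A localizing subcategory is a full triangulated subcategory closed under coproducts; $\operatorname{Loc}_{\mathsf T}(\mathsf C)$, the localizing subcategory generated by $\mathsf C$, is the smallest one containing $\mathsf C$. An object $C$ is compact if $\operatorname{Hom}_{\mathsf T}(C,-)$ commutes with coproducts; $\mathsf T^c$ is the full subcategory of compact objects. $\mathsf T$ is compactly generated if $\mathsf T=\operatorname{Loc}_{\mathsf T}(\mathsf G)$ for a set $\mathsf G$ of compact objects (such $\mathsf T$ has arbitrary products). $\mathsf T$ is $R$-linear if there is given a homomorphism of graded rings $R\to Z^*(\mathsf T)$ to the graded center ($Z^n(\mathsf T)$ consists of natural transformations $\eta\colon\mathrm{Id}\to\Sigma^n$ with $\eta\Sigma=(-1)^n\Sigma\eta$); then $\operatorname{Hom}^*_{\mathsf T}(X,Y)=\bigoplus_i\operatorname{Hom}_{\mathsf T}(X,\Sigma^iY)$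 is a graded $R$-module, and $\operatorname{End}^*_{\mathsf T}(X)=\operatorname{Hom}^*_{\mathsf T}(X,X)$. A localization functor is an exact functor $L\colon\mathsf T\to\mathsf T$ with a natural transformation $\eta\colon\mathrm{Id}_{\mathsf T}\to L$ such that $L(\eta X)$ is an isomorphism and $L(\eta X)=\eta(LX)$ for all $X$. For specialization closed $\mathcal V$, let $\mathsf T_{\mathcal V}=\{X\in\mathsf T\mid\operatorname{Hom}^*_{\mathsf T}(C,X)_{\mathfrak p}=0\text{ for all }C\in\mathsf T^c,\ \mathfrak p\in\operatorname{Spec}R\setminus\mathcal V\}$. This is a localizing subcategory and there is a localization functor $L_{\mathcal V}\colon\mathsf T\to\mathsf T$ with $\operatorname{Ker}L_{\mathcal V}=\mathsf T_{\mathcal V}$, giving functorial exact triangles $\varGamma_{\mathcal V}X\to X\to L_{\mathcal V}X\to$ with $\varGamma_{\mathcal V}X\in\mathsf T_{\mathcal V}$ and $\operatorname{Hom}_{\mathsf T}(\mathsf T_{\mathcal V},L_{\mathcal V}X)=0$. For $\mathfrak p\in\operatorname{Spec}R$ put $\mathcal Z(\mathfrak p)=\{\mathfrak q\in\operatorname{Spec}R\mid\mathfrak q\not\subseteq\mathfrak p\}$, $X_{\mathfrak p}=L_{\mathcal Z(\mathfrak p)}X$, $\varGamma_{\mathfrak p}X=\varGamma_{\mathcal V(\mathfrak p)}(X_{\mathfrak p})$. $\varGamma_{\mathfrak p}\mathsf T$ is the essential image of $\varGamma_{\mathfrak p}$, a localizing subcategory of $\mathsf T$. The support of $X$ is $\operatorname{supp}_RX=\{\mathfrak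 p\in\operatorname{Spec}R\mid\varGamma_{\mathfrak p}X\neq0\}$; for a localizing subcategory $\mathsf S$ (in particular for $\mathsf T$ itself) $\operatorname{supp}_R\mathsf S=\bigcup_{X\in\mathsf S}\operatorname{supp}_RX$. $\mathsf T$ is stratified by $R$ if (S1) the local-global principle holds, i.e. $\operatorname{Loc}_{\mathsf T}(X)=\operatorname{Loc}_{\mathsf T}(\{\varGamma_{\mathfrak p}X\mid\mathfrak p\in\operatorname{Spec}R\})$ for every object $X$; and (S2) for each $\mathfrak p\in\operatorname{Spec}R$ the localizing subcategory $\varGamma_{\mathfrak p}\mathsf T$ is either zero or minimal (nonzero with no proper nonzero localizing subcategories). $\mathsf T$ is noetherian if the $R$-module $\operatorname{End}^*_{\mathsf T}(C)$ is finitely generated for every compact object $C$.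
   Formalization: Closed under generalization is taken relative to supp_R T (q in U, p in supp_R T, p ⊆ q imply p in U), not in all of Spec R; the absolute version fails, e.g. for R = Z, T = Loc(Z/p) in D(Z), S = T. *)

theory Defs
  imports "HOL-Algebra.Product_Groups" "HOL-Algebra.Free_Abelian_Groups" "HOL-Algebra.Ring_Divisibility"
begin

section \<open>Small sets\<close>

text \<open>
  As usual for ``large'' categories, size is measured against a fixed universe.  Up to bijection
  the small sets are the subsets of \<open>U\<close> of cardinality less than that of \<open>U\<close>, so that the
  cardinality of \<open>U\<close> plays the role of an uncountable strongly inaccessible cardinal.
  ``Arbitrary'' coproducts and products are those indexed by small subsets of \<open>U\<close>.
\<close>

definition small :: "'u set \<Rightarrow> 'a set \<Rightarrow> bool" where
  "small U A \<longleftrightarrow> (card_of A, card_of U) \<in> ordLess"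

definition universe :: "'u set \<Rightarrow> bool" where
  "universe U \<longleftrightarrow>
     small U (UNIV :: nat set) \<and>
     (\<forall>A \<subseteq> U. small U A \<longrightarrow> small U (Pow A)) \<and>
     (\<forall>\<A> \<subseteq> Pow U. small U \<A> \<and> (\<forall>A\<in>\<A>. small U A) \<longrightarrow> small U (\<Union>\<A>))"


section \<open>Graded-commutative rings\<close>

record 'r graded_ring = "'r ring" +
  grade :: "int \<Rightarrow> 'r set"

definition grade_group :: "'r graded_ring \<Rightarrow> int \<Rightarrow> _" where
  "grade_group R n = (add_monoid R)\<lparr>carrier := grade R n\<rparr>"

definition sum_of_components :: "'r graded_ring \<Rightarrow> (int \<Rightarrow> 'r) \<Rightarrow> 'r" where
  "sum_of_components R x = gfinprod (add_monoid R) x UNIV"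

definition component :: "'r graded_ring \<Rightarrow> 'r \<Rightarrow> int \<Rightarrow> 'r" where
  "component R r = inv_into (carrier (sum_group UNIV (grade_group R))) (sum_of_components R) r"

locale graded_commutative_ring =
  fixes R :: "'r graded_ring" (structure)
  assumes is_ring: "ring R"
    and grade_subgroup: "subgroup (grade R n) (add_monoid R)"
    and direct_sum: "sum_of_components R \<in> iso (sum_group UNIV (grade_group R)) (add_monoid R)"
    and one_grade: "\<one> \<in> grade R 0"
    and mult_grade: "\<lbrakk>r \<in> grade R m; s \<in> grade R n\<rbrakk> \<Longrightarrow> r \<otimes> s \<in> grade R (m + n)"
    and graded_comm: "\<lbrakk>r \<in> grade R m; s \<in> grade R n\<rbrakk> \<Longrightarrow>
      r \<otimes> s = (if odd m \<and> odd n then \<ominus> (s \<otimes> r) else s \<otimes> r)"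

definition homogeneous :: "'r graded_ring \<Rightarrow> 'r set" where
  "homogeneous R = (\<Union>n. grade R n)"

definition homogeneous_ideal :: "'r set \<Rightarrow> 'r graded_ring \<Rightarrow> bool" where
  "homogeneous_ideal I R \<longleftrightarrow> ideal I R \<and> (\<forall>r\<in>I. \<forall>n. component R r n \<in> I)"

definition Spec :: "'r graded_ring \<Rightarrow> 'r set set" where
  "Spec R = {\<pp>. homogeneous_ideal \<pp> R \<and> \<pp> \<noteq> carrier R \<and>
     (\<forall>r \<in> homogeneous R. \<forall>s \<in> homogeneous R. r \<otimes>\<^bsub>R\<^esub> s \<in> \<pp> \<longrightarrow> r \<in> \<pp> \<or> s \<in> \<pp>)}"

definition closed_set :: "'r graded_ring \<Rightarrow> 'r set \<Rightarrow> 'r set set" where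
  "closed_set R \<aa> = {\<pp> \<in> Spec R. \<aa> \<subseteq> \<pp>}"

definition not_below :: "'r graded_ring \<Rightarrow> 'r set \<Rightarrow> 'r set set" where
  "not_below R \<pp> = {\<qq> \<in> Spec R. \<not> \<qq> \<subseteq> \<pp>}"

text \<open>
  Both notions are relative to an ambient set \<open>W\<close> of primes; for \<open>W = Spec R\<close> they are the
  absolute ones.  The relative version is needed for the classification of localizing
  subcategories closed under products, where the ambient set is the support of the whole category.
  That support need not be closed under generalization in \<open>Spec R\<close> (for p-torsion complexes
  of abelian groups it is \<open>{(p)}\<close>), although the whole category is closed under products.
\<close>

definition specialization_closed_in :: "'r set set \<Rightarrow> 'r set set \<Rightarrow> bool" where
  "specialization_closed_in W V \<longleftrightarrow> V \<subseteq> W \<and> (\<forall>\<pp>\<in>V. \<forall>\<qq>\<in>W. \<pp> \<subseteq> \<qq> \<longrightarrow> \<qq> \<in> V)"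

definition generalization_closed_in :: "'r set set \<Rightarrow> 'r set set \<Rightarrow> bool" where
  "generalization_closed_in W V \<longleftrightarrow> V \<subseteq> W \<and> specialization_closed_in W (W - V)"


section \<open>Modules\<close>

text \<open>
  The record of modules is that of the library (the library locale of modules itself is
  restricted to commutative base rings).
\<close>

definition finitely_generated :: "'r graded_ring \<Rightarrow> ('r, 'a) module \<Rightarrow> bool" where
  "finitely_generated R M \<longleftrightarrow>
     (\<exists>F \<subseteq> carrier M. finite F \<and> \<Inter>{N. submodule N R M \<and> F \<subseteq> N} = carrier M)"

text \<open>
  Homogeneous localization at \<open>\<pp>\<close> inverts the homogeneous elements outside \<open>\<pp>\<close>.  As these need
  not be central (odd elements commute up to sign), equality of fractions is that of the (left) Ore
  localization: \<open>(s, m)\<close> and \<open>(s', m')\<close> represent the same fraction iff they can be expanded to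
  a common denominator.
\<close>

definition denominators :: "'r graded_ring \<Rightarrow> 'r set \<Rightarrow> 'r set" where
  "denominators R \<pp> = homogeneous R - \<pp>"

definition fraction_rel ::
    "'r graded_ring \<Rightarrow> 'r set \<Rightarrow> ('r, 'a) module \<Rightarrow> (('r \<times> 'a) \<times> ('r \<times> 'a)) set" where
  "fraction_rel R \<pp> M = {((s, m), (s', m')).
     s \<in> denominators R \<pp> \<and> s' \<in> denominators R \<pp> \<and> m \<in> carrier M \<and> m' \<in> carrier M \<and>
     (\<exists>a\<in>carrier R. \<exists>a'\<in>carrier R. a \<otimes>\<^bsub>R\<^esub> s = a' \<otimes>\<^bsub>R\<^esub> s' \<and>
        a \<otimes>\<^bsub>R\<^esub> s \<in> denominators R \<pp> \<and> a \<odot>\<^bsub>M\<^esub> m = a' \<odot>\<^bsub>M\<^esub> m')}"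

definition localization :: "'r graded_ring \<Rightarrow> 'r set \<Rightarrow> ('r, 'a) module \<Rightarrow> ('r \<times> 'a) set set" where
  "localization R \<pp> M = (denominators R \<pp> \<times> carrier M) // fraction_rel R \<pp> M"

definition localization_zero :: "'r graded_ring \<Rightarrow> 'r set \<Rightarrow> ('r, 'a) module \<Rightarrow> ('r \<times> 'a) set" where
  "localization_zero R \<pp> M = fraction_rel R \<pp> M `` {(\<one>\<^bsub>R\<^esub>, \<zero>\<^bsub>M\<^esub>)}"

definition vanishes_at :: "'r graded_ring \<Rightarrow> 'r set \<Rightarrow> ('r, 'a) module \<Rightarrow> bool" where
  "vanishes_at R \<pp> M \<longleftrightarrow> localization R \<pp> M = {localization_zero R \<pp> M}"


section \<open>Triangulated categories\<close>

text \<open>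
  A category is given by a set of objects and hom-sets, which are pairwise disjoint.  The
  suspension is an automorphism, so that all its integral powers are defined strictly, as is implicit
  in the definition of the graded center.  An exact triangle with vertices \<open>X\<close>, \<open>Y\<close>, \<open>Z\<close>
  is the triple of its three morphisms \<open>X \<rightarrow> Y \<rightarrow> Z \<rightarrow> \<Sigma>X\<close>.
  The last field \<open>center_act\<close> belongs to the linear structure: \<open>center_act T n r X\<close> is the component at
  \<open>X\<close> of the natural transformation from the identity to the \<open>n\<close>-th suspension
  assigned to the element \<open>r\<close> of degree \<open>n\<close>.
\<close>

record ('o, 'm, 'r) linear_category =
  obj :: "'o set"
  mor :: "'o \<Rightarrow> 'o \<Rightarrow> 'm set"
  ide :: "'o \<Rightarrow> 'm"
  cmp :: "'m \<Rightarrow> 'm \<Rightarrow> 'm"  (infixr \<open>\<bullet>\<index>\<close> 70)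
  add_mor :: "'m \<Rightarrow> 'm \<Rightarrow> 'm"
  zero_mor :: "'o \<Rightarrow> 'o \<Rightarrow> 'm"
  susp_ob :: "'o \<Rightarrow> 'o"
  susp_mor :: "'m \<Rightarrow> 'm"
  tri :: "('m \<times> 'm \<times> 'm) set"
  center_act :: "int \<Rightarrow> 'r \<Rightarrow> 'o \<Rightarrow> 'm"

definition hom_group :: "('o, 'm, 'r) linear_category \<Rightarrow> 'o \<Rightarrow> 'o \<Rightarrow> 'm monoid" where
  "hom_group T X Y = \<lparr>carrier = mor T X Y, monoid.mult = add_mor T, one = zero_mor T X Y\<rparr>"

definition minus_mor :: "('o, 'm, 'r) linear_category \<Rightarrow> 'o \<Rightarrow> 'o \<Rightarrow> 'm \<Rightarrow> 'm" where
  "minus_mor T X Y f = inv\<^bsub>hom_group T X Y\<^esub> f"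

definition arrows :: "('o, 'm, 'r) linear_category \<Rightarrow> 'm set" where
  "arrows T = (\<Union>X\<in>obj T. \<Union>Y\<in>obj T. mor T X Y)"

definition int_iterate :: "'a set \<Rightarrow> ('a \<Rightarrow> 'a) \<Rightarrow> int \<Rightarrow> 'a \<Rightarrow> 'a" where
  "int_iterate A f n = (if n \<ge> 0 then f ^^ nat n else the_inv_into A f ^^ nat (- n))"

definition susp_ob_pow :: "('o, 'm, 'r) linear_category \<Rightarrow> int \<Rightarrow> 'o \<Rightarrow> 'o" where
  "susp_ob_pow T = int_iterate (obj T) (susp_ob T)"

definition susp_mor_pow :: "('o, 'm, 'r) linear_category \<Rightarrow> int \<Rightarrow> 'm \<Rightarrow> 'm" where
  "susp_mor_pow T = int_iterate (arrows T) (susp_mor T)"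

definition is_iso :: "('o, 'm, 'r) linear_category \<Rightarrow> 'o \<Rightarrow> 'o \<Rightarrow> 'm \<Rightarrow> bool" where
  "is_iso T X Y f \<longleftrightarrow> f \<in> mor T X Y \<and>
     (\<exists>g \<in> mor T Y X. g \<bullet>\<^bsub>T\<^esub> f = ide T X \<and> f \<bullet>\<^bsub>T\<^esub> g = ide T Y)"

definition isomorphic :: "('o, 'm, 'r) linear_category \<Rightarrow> 'o \<Rightarrow> 'o \<Rightarrow> bool" where
  "isomorphic T X Y \<longleftrightarrow> (\<exists>f. is_iso T X Y f)"

definition is_zero :: "('o, 'm, 'r) linear_category \<Rightarrow> 'o \<Rightarrow> bool" where
  "is_zero T X \<longleftrightarrow> X \<in> obj T \<and> ide T X = zero_mor T X X"

definition is_coproduct ::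
    "('o, 'm, 'r) linear_category \<Rightarrow> 'i set \<Rightarrow> ('i \<Rightarrow> 'o) \<Rightarrow> 'o \<Rightarrow> ('i \<Rightarrow> 'm) \<Rightarrow> bool" where
  "is_coproduct T I A P \<iota> \<longleftrightarrow>
     P \<in> obj T \<and> (\<forall>i\<in>I. A i \<in> obj T \<and> \<iota> i \<in> mor T (A i) P) \<and>
     (\<forall>Y\<in>obj T. \<forall>g. (\<forall>i\<in>I. g i \<in> mor T (A i) Y) \<longrightarrow>
        (\<exists>!u. u \<in> mor T P Y \<and> (\<forall>i\<in>I. u \<bullet>\<^bsub>T\<^esub> \<iota> i = g i)))"

definition is_product ::
    "('o, 'm, 'r) linear_category \<Rightarrow> 'i set \<Rightarrow> ('i \<Rightarrow> 'o) \<Rightarrow> 'o \<Rightarrow> ('i \<Rightarrow> 'm) \<Rightarrow> bool" where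
  "is_product T I A P \<pi> \<longleftrightarrow>
     P \<in> obj T \<and> (\<forall>i\<in>I. A i \<in> obj T \<and> \<pi> i \<in> mor T P (A i)) \<and>
     (\<forall>Y\<in>obj T. \<forall>g. (\<forall>i\<in>I. g i \<in> mor T Y (A i)) \<longrightarrow>
        (\<exists>!u. u \<in> mor T Y P \<and> (\<forall>i\<in>I. \<pi> i \<bullet>\<^bsub>T\<^esub> u = g i)))"

locale additive_category =
  fixes T :: "('o, 'm, 'r) linear_category" (structure)
  assumes mor_disjoint:
      "\<lbrakk>X \<in> obj T; Y \<in> obj T; X' \<in> obj T; Y' \<in> obj T; f \<in> mor T X Y; f \<in> mor T X' Y'\<rbrakk>
       \<Longrightarrow> X = X' \<and> Y = Y'"
    and ide_mor: "X \<in> obj T \<Longrightarrow> ide T X \<in> mor T X X"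
    and cmp_mor: "\<lbrakk>X \<in> obj T; Y \<in> obj T; Z \<in> obj T; f \<in> mor T X Y; g \<in> mor T Y Z\<rbrakk>
      \<Longrightarrow> g \<bullet> f \<in> mor T X Z"
    and cmp_ide: "\<lbrakk>X \<in> obj T; Y \<in> obj T; f \<in> mor T X Y\<rbrakk> \<Longrightarrow> f \<bullet> ide T X = f"
    and ide_cmp: "\<lbrakk>X \<in> obj T; Y \<in> obj T; f \<in> mor T X Y\<rbrakk> \<Longrightarrow> ide T Y \<bullet> f = f"
    and cmp_assoc: "\<lbrakk>W \<in> obj T; X \<in> obj T; Y \<in> obj T; Z \<in> obj T;
      f \<in> mor T W X; g \<in> mor T X Y; h \<in> mor T Y Z\<rbrakk> \<Longrightarrow> (h \<bullet> g) \<bullet> f = h \<bullet> (g \<bullet> f)"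
    and mor_group: "\<lbrakk>X \<in> obj T; Y \<in> obj T\<rbrakk> \<Longrightarrow> comm_group (hom_group T X Y)"
    and cmp_add_left: "\<lbrakk>X \<in> obj T; Y \<in> obj T; Z \<in> obj T; f \<in> mor T X Y; g \<in> mor T Y Z; g' \<in> mor T Y Z\<rbrakk>
      \<Longrightarrow> add_mor T g g' \<bullet> f = add_mor T (g \<bullet> f) (g' \<bullet> f)"
    and cmp_add_right: "\<lbrakk>X \<in> obj T; Y \<in> obj T; Z \<in> obj T; f \<in> mor T X Y; f' \<in> mor T X Y; g \<in> mor T Y Z\<rbrakk>
      \<Longrightarrow> g \<bullet> add_mor T f f' = add_mor T (g \<bullet> f) (g \<bullet> f')"
    and zero_object: "\<exists>X. is_zero T X"
    and binary_coproduct: "\<lbrakk>X \<in> obj T; Y \<in> obj T\<rbrakk> \<Longrightarrow>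
      \<exists>P \<iota>. is_coproduct T (UNIV :: bool set) (\<lambda>b. if b then X else Y) P \<iota>"

locale triangulated_category = additive_category +
  assumes susp_ob_bij: "bij_betw (susp_ob T) (obj T) (obj T)"
    and susp_mor_bij: "\<lbrakk>X \<in> obj T; Y \<in> obj T\<rbrakk> \<Longrightarrow>
      bij_betw (susp_mor T) (mor T X Y) (mor T (susp_ob T X) (susp_ob T Y))"
    and susp_ide: "X \<in> obj T \<Longrightarrow> susp_mor T (ide T X) = ide T (susp_ob T X)"
    and susp_cmp: "\<lbrakk>X \<in> obj T; Y \<in> obj T; Z \<in> obj T; f \<in> mor T X Y; g \<in> mor T Y Z\<rbrakk>
      \<Longrightarrow> susp_mor T (g \<bullet> f) = susp_mor T g \<bullet> susp_mor T f"
    and susp_add: "\<lbrakk>X \<in> obj T; Y \<in> obj T; f \<in> mor T X Y; f' \<in> mor T X Y\<rbrakk>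
      \<Longrightarrow> susp_mor T (add_mor T f f') = add_mor T (susp_mor T f) (susp_mor T f')"
    and tri_mor: "(f, g, h) \<in> tri T \<Longrightarrow> \<exists>X\<in>obj T. \<exists>Y\<in>obj T. \<exists>Z\<in>obj T.
      f \<in> mor T X Y \<and> g \<in> mor T Y Z \<and> h \<in> mor T Z (susp_ob T X)"
    and tri_iso: "\<lbrakk>(f, g, h) \<in> tri T; X \<in> obj T; Y \<in> obj T; Z \<in> obj T; X' \<in> obj T; Y' \<in> obj T; Z' \<in> obj T;
      f \<in> mor T X Y; g \<in> mor T Y Z; h \<in> mor T Z (susp_ob T X);
      f' \<in> mor T X' Y'; g' \<in> mor T Y' Z'; h' \<in> mor T Z' (susp_ob T X');
      is_iso T X X' a; is_iso T Y Y' b; is_iso T Z Z' c;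
      b \<bullet> f = f' \<bullet> a; c \<bullet> g = g' \<bullet> b; susp_mor T a \<bullet> h = h' \<bullet> c\<rbrakk> \<Longrightarrow> (f', g', h') \<in> tri T"
    and tri_ide: "\<lbrakk>X \<in> obj T; is_zero T Z\<rbrakk> \<Longrightarrow>
      (ide T X, zero_mor T X Z, zero_mor T Z (susp_ob T X)) \<in> tri T"
    and tri_cone: "\<lbrakk>X \<in> obj T; Y \<in> obj T; f \<in> mor T X Y\<rbrakk> \<Longrightarrow> \<exists>g h. (f, g, h) \<in> tri T"
    and tri_rotate: "\<lbrakk>X \<in> obj T; Y \<in> obj T; Z \<in> obj T;
      f \<in> mor T X Y; g \<in> mor T Y Z; h \<in> mor T Z (susp_ob T X)\<rbrakk> \<Longrightarrow>
      (f, g, h) \<in> tri T \<longleftrightarrow>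
      (g, h, minus_mor T (susp_ob T X) (susp_ob T Y) (susp_mor T f)) \<in> tri T"
    and tri_complete: "\<lbrakk>(f, g, h) \<in> tri T; (f', g', h') \<in> tri T;
      X \<in> obj T; Y \<in> obj T; Z \<in> obj T; X' \<in> obj T; Y' \<in> obj T; Z' \<in> obj T;
      f \<in> mor T X Y; g \<in> mor T Y Z; f' \<in> mor T X' Y'; g' \<in> mor T Y' Z';
      a \<in> mor T X X'; b \<in> mor T Y Y'; b \<bullet> f = f' \<bullet> a\<rbrakk> \<Longrightarrow>
      \<exists>c \<in> mor T Z Z'. c \<bullet> g = g' \<bullet> b \<and> susp_mor T a \<bullet> h = h' \<bullet> c"
    and octahedral: "\<lbrakk>(f, p, p') \<in> tri T; (g, q, q') \<in> tri T; (g \<bullet> f, r, r') \<in> tri T;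
      X \<in> obj T; Y \<in> obj T; Z \<in> obj T; A \<in> obj T; B \<in> obj T; C \<in> obj T;
      f \<in> mor T X Y; g \<in> mor T Y Z; p \<in> mor T Y A; q \<in> mor T Z B; r \<in> mor T Z C\<rbrakk> \<Longrightarrow>
      \<exists>u \<in> mor T A C. \<exists>v \<in> mor T C B. (u, v, susp_mor T p \<bullet> q') \<in> tri T \<and>
        u \<bullet> p = r \<bullet> g \<and> r' \<bullet> u = p' \<and> v \<bullet> r = q \<and> q' \<bullet> v = susp_mor T f \<bullet> r'"

definition locally_small :: "'u set \<Rightarrow> ('o, 'm, 'r) linear_category \<Rightarrow> bool" where
  "locally_small U T \<longleftrightarrow> (\<forall>X\<in>obj T. \<forall>Y\<in>obj T. small U (mor T X Y))"

definition has_coproducts :: "'u set \<Rightarrow> ('o, 'm, 'r) linear_category \<Rightarrow> bool" where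
  "has_coproducts U T \<longleftrightarrow> (\<forall>I \<subseteq> U. \<forall>A. small U I \<and> (\<forall>i\<in>I. A i \<in> obj T) \<longrightarrow>
     (\<exists>P \<iota>. is_coproduct T I A P \<iota>))"

text \<open>The canonical map in this definition is \<open>\<Oplus>\<^sub>i Hom(C, A\<^sub>i) \<rightarrow> Hom(C, \<Coprod>\<^sub>i A\<^sub>i)\<close>.\<close>

definition compact_objects :: "'u set \<Rightarrow> ('o, 'm, 'r) linear_category \<Rightarrow> 'o set" where
  "compact_objects U T = {C \<in> obj T. \<forall>I \<subseteq> U. \<forall>A P \<iota>. small U I \<and> is_coproduct T I A P \<iota> \<longrightarrow>
     (\<lambda>h. gfinprod (hom_group T C P) (\<lambda>i. \<iota> i \<bullet>\<^bsub>T\<^esub> h i) I)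
       \<in> iso (sum_group I (\<lambda>i. hom_group T C (A i))) (hom_group T C P)}"

text \<open>
  Full subcategories are given by their sets of objects; triangulated subcategories are
  understood to be closed under isomorphism.
\<close>

definition triangulated_subcategory :: "('o, 'm, 'r) linear_category \<Rightarrow> 'o set \<Rightarrow> bool" where
  "triangulated_subcategory T S \<longleftrightarrow>
     S \<subseteq> obj T \<and> S \<noteq> {} \<and>
     (\<forall>X\<in>S. \<forall>Y\<in>obj T. isomorphic T X Y \<longrightarrow> Y \<in> S) \<and>
     (\<forall>X\<in>obj T. X \<in> S \<longleftrightarrow> susp_ob T X \<in> S) \<and>
     (\<forall>X\<in>obj T. \<forall>Y\<in>obj T. \<forall>Z\<in>obj T. \<forall>f\<in>mor T X Y. \<forall>g\<in>mor T Y Z. \<forall>h.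
        (f, g, h) \<in> tri T \<longrightarrow>
        (X \<in> S \<and> Y \<in> S \<longrightarrow> Z \<in> S) \<and> (X \<in> S \<and> Z \<in> S \<longrightarrow> Y \<in> S) \<and> (Y \<in> S \<and> Z \<in> S \<longrightarrow> X \<in> S))"

definition closed_under_coproducts :: "'u set \<Rightarrow> ('o, 'm, 'r) linear_category \<Rightarrow> 'o set \<Rightarrow> bool" where
  "closed_under_coproducts U T S \<longleftrightarrow>
     (\<forall>I \<subseteq> U. \<forall>A P \<iota>. small U I \<and> (\<forall>i\<in>I. A i \<in> S) \<and> is_coproduct T I A P \<iota> \<longrightarrow> P \<in> S)"

definition closed_under_products :: "'u set \<Rightarrow> ('o, 'm, 'r) linear_category \<Rightarrow> 'o set \<Rightarrow> bool" where
  "closed_under_products U T S \<longleftrightarrow>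
     (\<forall>I \<subseteq> U. \<forall>A P \<pi>. small U I \<and> (\<forall>i\<in>I. A i \<in> S) \<and> is_product T I A P \<pi> \<longrightarrow> P \<in> S)"

definition localizing :: "'u set \<Rightarrow> ('o, 'm, 'r) linear_category \<Rightarrow> 'o set \<Rightarrow> bool" where
  "localizing U T S \<longleftrightarrow> triangulated_subcategory T S \<and> closed_under_coproducts U T S"

definition Loc :: "'u set \<Rightarrow> ('o, 'm, 'r) linear_category \<Rightarrow> 'o set \<Rightarrow> 'o set" where
  "Loc U T C = \<Inter>{S. localizing U T S \<and> C \<subseteq> S}"

definition zero_subcategory :: "('o, 'm, 'r) linear_category \<Rightarrow> 'o set \<Rightarrow> bool" where
  "zero_subcategory T S \<longleftrightarrow> (\<forall>X\<in>S. is_zero T X)"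

definition minimal_localizing :: "'u set \<Rightarrow> ('o, 'm, 'r) linear_category \<Rightarrow> 'o set \<Rightarrow> bool" where
  "minimal_localizing U T S \<longleftrightarrow> localizing U T S \<and> \<not> zero_subcategory T S \<and>
     (\<forall>S'. localizing U T S' \<and> S' \<subseteq> S \<longrightarrow> zero_subcategory T S' \<or> S' = S)"

definition compactly_generated :: "'u set \<Rightarrow> ('o, 'm, 'r) linear_category \<Rightarrow> bool" where
  "compactly_generated U T \<longleftrightarrow> (\<exists>G \<subseteq> compact_objects U T. small U G \<and> Loc U T G = obj T)"


section \<open>Localization functors\<close>

record ('o, 'm) endofunctor =
  on_ob :: "'o \<Rightarrow> 'o"
  on_mor :: "'m \<Rightarrow> 'm"

locale additive_endofunctor =
  fixes T :: "('o, 'm, 'r) linear_category" (structure) and F :: "('o, 'm) endofunctor"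
  assumes on_ob: "X \<in> obj T \<Longrightarrow> on_ob F X \<in> obj T"
    and on_mor: "\<lbrakk>X \<in> obj T; Y \<in> obj T; f \<in> mor T X Y\<rbrakk>
      \<Longrightarrow> on_mor F f \<in> mor T (on_ob F X) (on_ob F Y)"
    and on_ide: "X \<in> obj T \<Longrightarrow> on_mor F (ide T X) = ide T (on_ob F X)"
    and on_cmp: "\<lbrakk>X \<in> obj T; Y \<in> obj T; Z \<in> obj T; f \<in> mor T X Y; g \<in> mor T Y Z\<rbrakk>
      \<Longrightarrow> on_mor F (g \<bullet> f) = on_mor F g \<bullet> on_mor F f"
    and on_add: "\<lbrakk>X \<in> obj T; Y \<in> obj T; f \<in> mor T X Y; f' \<in> mor T X Y\<rbrakk>
      \<Longrightarrow> on_mor F (add_mor T f f') = add_mor T (on_mor F f) (on_mor F f')"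

definition exact_functor :: "('o, 'm, 'r) linear_category \<Rightarrow> ('o, 'm) endofunctor \<Rightarrow> bool" where
  "exact_functor T F \<longleftrightarrow> additive_endofunctor T F \<and>
     (\<exists>\<theta>. (\<forall>X\<in>obj T. is_iso T (on_ob F (susp_ob T X)) (susp_ob T (on_ob F X)) (\<theta> X)) \<and>
          (\<forall>X\<in>obj T. \<forall>Y\<in>obj T. \<forall>f\<in>mor T X Y.
             \<theta> Y \<bullet>\<^bsub>T\<^esub> on_mor F (susp_mor T f) = susp_mor T (on_mor F f) \<bullet>\<^bsub>T\<^esub> \<theta> X) \<and>
          (\<forall>X\<in>obj T. \<forall>Y\<in>obj T. \<forall>f\<in>mor T X Y. \<forall>g h. (f, g, h) \<in> tri T \<longrightarrow>
             (on_mor F f, on_mor F g, \<theta> X \<bullet>\<^bsub>T\<^esub> on_mor F h) \<in> tri T))"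

definition localization_functor ::
    "('o, 'm, 'r) linear_category \<Rightarrow> ('o, 'm) endofunctor \<Rightarrow> ('o \<Rightarrow> 'm) \<Rightarrow> bool" where
  "localization_functor T L \<eta> \<longleftrightarrow> exact_functor T L \<and>
     (\<forall>X\<in>obj T. \<eta> X \<in> mor T X (on_ob L X)) \<and>
     (\<forall>X\<in>obj T. \<forall>Y\<in>obj T. \<forall>f\<in>mor T X Y. \<eta> Y \<bullet>\<^bsub>T\<^esub> f = on_mor L f \<bullet>\<^bsub>T\<^esub> \<eta> X) \<and>
     (\<forall>X\<in>obj T. is_iso T (on_ob L X) (on_ob L (on_ob L X)) (on_mor L (\<eta> X)) \<and>
        on_mor L (\<eta> X) = \<eta> (on_ob L X))"

definition functor_kernel :: "('o, 'm, 'r) linear_category \<Rightarrow> ('o, 'm) endofunctor \<Rightarrow> 'o set" where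
  "functor_kernel T L = {X \<in> obj T. is_zero T (on_ob L X)}"

definition preserves_coproducts ::
    "'u set \<Rightarrow> ('o, 'm, 'r) linear_category \<Rightarrow> ('o, 'm) endofunctor \<Rightarrow> bool" where
  "preserves_coproducts U T L \<longleftrightarrow>
     (\<forall>I \<subseteq> U. \<forall>A P \<iota>. small U I \<and> is_coproduct T I A P \<iota> \<longrightarrow>
        is_coproduct T I (\<lambda>i. on_ob L (A i)) (on_ob L P) (\<lambda>i. on_mor L (\<iota> i)))"


section \<open>Linear structure\<close>

definition graded_center :: "('o, 'm, 'r) linear_category \<Rightarrow> int \<Rightarrow> ('o \<Rightarrow> 'm) set" where
  "graded_center T n = {\<eta>.
     (\<forall>X\<in>obj T. \<eta> X \<in> mor T X (susp_ob_pow T n X)) \<and>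
     (\<forall>X\<in>obj T. \<forall>Y\<in>obj T. \<forall>f\<in>mor T X Y. \<eta> Y \<bullet>\<^bsub>T\<^esub> f = susp_mor_pow T n f \<bullet>\<^bsub>T\<^esub> \<eta> X) \<and>
     (\<forall>X\<in>obj T. \<eta> (susp_ob T X) =
        (if even n then susp_mor T (\<eta> X)
         else minus_mor T (susp_ob T X) (susp_ob_pow T n (susp_ob T X)) (susp_mor T (\<eta> X))))}"

text \<open>
  A homomorphism of graded rings from \<open>R\<close> to the graded center, given by its homogeneous
  components.  The product of \<open>\<eta>\<close> of degree \<open>m\<close> and \<open>\<theta>\<close> of degree \<open>n\<close> in the
  graded center is \<open>\<Sigma>\<^sup>n(\<eta>) \<theta>\<close>, in accordance with the product of graded endomorphism rings.
\<close>

locale linear_structure =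
  fixes R :: "'r graded_ring" and T :: "('o, 'm, 'r) linear_category"
  assumes act_center: "r \<in> grade R n \<Longrightarrow> center_act T n r \<in> graded_center T n"
    and act_add: "\<lbrakk>r \<in> grade R n; s \<in> grade R n; X \<in> obj T\<rbrakk> \<Longrightarrow>
      center_act T n (r \<oplus>\<^bsub>R\<^esub> s) X = add_mor T (center_act T n r X) (center_act T n s X)"
    and act_mult: "\<lbrakk>r \<in> grade R m; s \<in> grade R n; X \<in> obj T\<rbrakk> \<Longrightarrow>
      center_act T (m + n) (r \<otimes>\<^bsub>R\<^esub> s) X =
        susp_mor_pow T n (center_act T m r X) \<bullet>\<^bsub>T\<^esub> center_act T n s X"
    and act_one: "X \<in> obj T \<Longrightarrow> center_act T 0 \<one>\<^bsub>R\<^esub> X = ide T X"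

definition graded_hom_group :: "('o, 'm, 'r) linear_category \<Rightarrow> 'o \<Rightarrow> 'o \<Rightarrow> (int \<Rightarrow> 'm) monoid" where
  "graded_hom_group T X Y = sum_group UNIV (\<lambda>i. hom_group T X (susp_ob_pow T i Y))"

text \<open>
  An element \<open>r\<close> of degree \<open>n\<close> acts on \<open>f : X \<rightarrow> \<Sigma>\<^sup>i Y\<close> by composition with its image in the
  graded endomorphisms of \<open>Y\<close>, that is, it yields the composite of \<open>f\<close> with
  \<open>\<Sigma>\<^sup>i(r\<^sub>Y) : \<Sigma>\<^sup>i Y \<rightarrow> \<Sigma>\<^sup>i\<^sup>+\<^sup>n Y\<close>.  The ring operations among the fields of the module
  record are irrelevant.
\<close>

definition graded_hom ::
    "'r graded_ring \<Rightarrow> ('o, 'm, 'r) linear_category \<Rightarrow> 'o \<Rightarrow> 'o \<Rightarrow> ('r, int \<Rightarrow> 'm) module" where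
  "graded_hom R T X Y =
     \<lparr>carrier = carrier (graded_hom_group T X Y),
      monoid.mult = undefined, one = undefined,
      zero = monoid.one (graded_hom_group T X Y),
      add = monoid.mult (graded_hom_group T X Y),
      smult = (\<lambda>r h k. gfinprod (hom_group T X (susp_ob_pow T k Y))
        (\<lambda>n. susp_mor_pow T (k - n) (center_act T n (component R r n) Y) \<bullet>\<^bsub>T\<^esub> h (k - n)) UNIV)\<rparr>"

definition noetherian_category ::
    "'u set \<Rightarrow> 'r graded_ring \<Rightarrow> ('o, 'm, 'r) linear_category \<Rightarrow> bool" where
  "noetherian_category U R T \<longleftrightarrow>
     (\<forall>C \<in> compact_objects U T. finitely_generated R (graded_hom R T C C))"


section \<open>Local cohomology and support\<close>

definition torsion_objects ::
    "'u set \<Rightarrow> 'r graded_ring \<Rightarrow> ('o, 'm, 'r) linear_category \<Rightarrow> 'r set set \<Rightarrow> 'o set" where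
  "torsion_objects U R T V = {X \<in> obj T. \<forall>C \<in> compact_objects U T. \<forall>\<pp> \<in> Spec R - V.
     vanishes_at R \<pp> (graded_hom R T C X)}"

text \<open>
  The functor \<open>L\<^sub>V\<close> (with its natural transformation) exists by Bousfield localization and is
  determined by its kernel up to unique isomorphism; likewise for the third vertex
  \<open>\<Gamma>\<^sub>V X\<close> of the exact triangle over \<open>X \<rightarrow> L\<^sub>V X\<close>.
\<close>

definition L_functor ::
    "'u set \<Rightarrow> 'r graded_ring \<Rightarrow> ('o, 'm, 'r) linear_category \<Rightarrow> 'r set set \<Rightarrow>
     ('o, 'm) endofunctor \<times> ('o \<Rightarrow> 'm)" where
  "L_functor U R T V =
     (SOME (L, \<eta>). localization_functor T L \<eta> \<and> functor_kernel T L = torsion_objects U R T V)"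

definition L_ob ::
    "'u set \<Rightarrow> 'r graded_ring \<Rightarrow> ('o, 'm, 'r) linear_category \<Rightarrow> 'r set set \<Rightarrow> 'o \<Rightarrow> 'o" where
  "L_ob U R T V X = on_ob (fst (L_functor U R T V)) X"

definition Gamma_ob ::
    "'u set \<Rightarrow> 'r graded_ring \<Rightarrow> ('o, 'm, 'r) linear_category \<Rightarrow> 'r set set \<Rightarrow> 'o \<Rightarrow> 'o" where
  "Gamma_ob U R T V X = (SOME W. W \<in> obj T \<and>
     (\<exists>f h. f \<in> mor T W X \<and> (f, snd (L_functor U R T V) X, h) \<in> tri T))"

definition Gamma_at ::
    "'u set \<Rightarrow> 'r graded_ring \<Rightarrow> ('o, 'm, 'r) linear_category \<Rightarrow> 'r set \<Rightarrow> 'o \<Rightarrow> 'o" where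
  "Gamma_at U R T \<pp> X = Gamma_ob U R T (closed_set R \<pp>) (L_ob U R T (not_below R \<pp>) X)"

definition Gamma_image ::
    "'u set \<Rightarrow> 'r graded_ring \<Rightarrow> ('o, 'm, 'r) linear_category \<Rightarrow> 'r set \<Rightarrow> 'o set" where
  "Gamma_image U R T \<pp> = {Y \<in> obj T. \<exists>X \<in> obj T. isomorphic T (Gamma_at U R T \<pp> X) Y}"

definition supp ::
    "'u set \<Rightarrow> 'r graded_ring \<Rightarrow> ('o, 'm, 'r) linear_category \<Rightarrow> 'o \<Rightarrow> 'r set set" where
  "supp U R T X = {\<pp> \<in> Spec R. \<not> is_zero T (Gamma_at U R T \<pp> X)}"

definition supp_sub ::
    "'u set \<Rightarrow> 'r graded_ring \<Rightarrow> ('o, 'm, 'r) linear_category \<Rightarrow> 'o set \<Rightarrow> 'r set set" where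
  "supp_sub U R T S = (\<Union>X\<in>S. supp U R T X)"

definition local_global_principle ::
    "'u set \<Rightarrow> 'r graded_ring \<Rightarrow> ('o, 'm, 'r) linear_category \<Rightarrow> bool" where
  "local_global_principle U R T \<longleftrightarrow>
     (\<forall>X\<in>obj T. Loc U T {X} = Loc U T {Gamma_at U R T \<pp> X |\<pp>. \<pp> \<in> Spec R})"

definition stratified ::
    "'u set \<Rightarrow> 'r graded_ring \<Rightarrow> ('o, 'm, 'r) linear_category \<Rightarrow> bool" where
  "stratified U R T \<longleftrightarrow> local_global_principle U R T \<and>
     (\<forall>\<pp>\<in>Spec R. zero_subcategory T (Gamma_image U R T \<pp>) \<or>
        minimal_localizing U T (Gamma_image U R T \<pp>))"

end

theory Submission
  imports Defs
begin

text \<open>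
  Write \<open>C // \<pp>\<close> for a Koszul object on \<open>C\<close>, where \<open>C\<close> runs through a set of compact generators.
  Then \<open>\<pp>\<close> lies in the support of \<open>X\<close> iff some \<open>C // \<pp> \<rightarrow> \<Sigma>\<^sup>n X\<close> is not annihilated by any
  element outside \<open>\<pp>\<close>, and the objects supported on \<open>\<V>(\<pp>)\<close> are generated by the objects
  \<open>C // \<pp>\<close>.  By stratification a localizing subcategory consists of all objects supported in its
  support.  If \<open>V\<close> is closed under generalization, the objects supported in \<open>V\<close> are those
  orthogonal to the compact objects \<open>C // \<pp>\<close> with \<open>\<pp>\<close> outside \<open>V\<close>; hence they form a localizing
  subcategory closed under products.

  Conversely let \<open>S\<close> be closed under products, \<open>\<qq>\<close> in its support and \<open>\<pp> \<subseteq> \<qq>\<close>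
  in the support of some compact \<open>C\<close>, witnessed by \<open>f : D \<rightarrow> C\<close> with \<open>D\<close> compact.  The
  \<open>\<qq>\<close>-localized Koszul objects on powers of elements generating \<open>\<qq>\<close> up to radical are supported
  at \<open>\<qq>\<close>, so they and their product \<open>P\<close> lie in \<open>S\<close>.  As the endomorphism modules of compact
  objects are noetherian, Krull's intersection theorem applies: no element outside \<open>\<pp>\<close> annihilates
  the morphism \<open>D \<rightarrow> P\<close> induced by \<open>f\<close>, so \<open>\<pp>\<close> is in the support of \<open>P\<close>.

  If \<open>L\<close> preserves coproducts, the right orthogonal of its kernel is localizing and closed under
  products, thus orthogonal to certain compact objects \<open>C // \<pp>\<close>; these generate the kernel.
\<close>

section \<open>Small sets\<close>

text \<open>\<open>L_functor\<close> and \<open>Gamma_ob\<close> are choices, so nothing can be said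
  about them before the localizations are shown to exist. Brown representability is therefore proved
  from scratch and for small families of objects: a family gives the products of the category, a
  single object gives the coreflection from which a localization functor is built. Odd elements
  commute only up to sign, and their action picks up signs under suspension. The square of a
  homogeneous element is even and lies in the same primes. Support and localization are therefore
  expressed by even elements: a graded Hom module vanishes at a prime iff each morphism is killed by
  some even element outside the prime. This also trades graded modules for single morphisms. In the
  converse direction the exponents for which a Koszul object detects \<open>s f\<close> depend on
  the element \<open>s\<close> outside \<pp>. No single Koszul object is known to serve all
  \<open>s\<close>, but one morphism into the product over all tuples of exponents does; this is
  where closure under products is used.\<close>

lemma small_inj: "small U A \<Longrightarrow> inj_on f B \<Longrightarrow> f ` B \<subseteq> A \<Longrightarrow> small U B"
  unfolding small_def by (metis card_of_ordLeq ordLeq_ordLess_trans)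

lemma small_mono: "small U A \<Longrightarrow> B \<subseteq> A \<Longrightarrow> small U B"
  by (rule small_inj[of U A id]) auto

lemma small_image: "small U A \<Longrightarrow> small U (f ` A)"
  unfolding small_def using card_of_image ordLeq_ordLess_trans by blast

lemma small_embeds:
  assumes "small U A"
  obtains f where "inj_on f A" "f ` A \<subseteq> U"
  using assms unfolding small_def by (metis card_of_ordLeq ordLess_imp_ordLeq)

lemma universe_infinite:
  assumes "universe U"
  shows "infinite U"
  using assms unfolding universe_def small_def
  by (metis card_of_ordLeq_finite infinite_UNIV_nat ordLess_imp_ordLeq)

lemma small_countable: "universe U \<Longrightarrow> countable A \<Longrightarrow> small U A"
  unfolding universe_def by (metis countable_def small_inj subset_UNIV)

text \<open>The union axiom of \<open>universe\<close> concerns families of subsets of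
  \<open>U\<close> only. So each fiber is copied into \<open>U\<close>, and the copies are kept
  apart by an injection of \<open>U \<times> U\<close> into \<open>U\<close>, which exists because
  \<open>U\<close> is infinite.\<close>

lemma small_Sigma:
  assumes "universe U" "small U J" "\<And>j. j \<in> J \<Longrightarrow> small U (B j)"
  shows "small U (Sigma J B)"
proof -
  obtain h where h: "inj_on h J" "h ` J \<subseteq> U" by (rule small_embeds[OF assms(2)])
  have "\<exists>k. inj_on k (B j) \<and> k ` B j \<subseteq> U" if "j \<in> J" for j
    using small_embeds[OF assms(3)[OF that]] by metis
  then obtain k where k: "\<And>j. j \<in> J \<Longrightarrow> inj_on (k j) (B j)" "\<And>j. j \<in> J \<Longrightarrow> k j ` B j \<subseteq> U"
    by metis
  have "\<exists>q. inj_on q (U \<times> U) \<and> q ` (U \<times> U) \<subseteq> U"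
    using card_of_Times_same_infinite[OF universe_infinite[OF assms(1)]]
    by (simp add: card_of_ordLeq ordIso_imp_ordLeq)
  then obtain q where q: "inj_on q (U \<times> U)" "q ` (U \<times> U) \<subseteq> U" by blast
  define A where "A j = (\<lambda>b. q (h j, k j b)) ` B j" for j
  have "A ` J \<subseteq> Pow U"
  proof clarsimp
    fix j x assume j: "j \<in> J" and "x \<in> A j"
    then obtain b where b: "b \<in> B j" "x = q (h j, k j b)" unfolding A_def by blast
    have "(h j, k j b) \<in> U \<times> U" using h(2) k(2)[OF j] j b by blast
    then show "x \<in> U" using q(2) b(2) by blast
  qed
  moreover have "small U (A ` J)" by (rule small_image[OF assms(2)])
  moreover have "\<forall>X \<in> A ` J. small U X" using assms(3) unfolding A_def by (auto intro: small_image)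
  ultimately have *: "small U (\<Union>(A ` J))" using assms(1) unfolding universe_def by blast
  show ?thesis
  proof (rule small_inj[OF *])
    show "inj_on (\<lambda>(j, b). q (h j, k j b)) (Sigma J B)"
    proof (rule inj_onI, clarsimp)
      fix j b j' b' assume 1: "j \<in> J" "b \<in> B j" "j' \<in> J" "b' \<in> B j'" "q (h j, k j b) = q (h j', k j' b')"
      then have "(h j, k j b) = (h j', k j' b')"
        using h(2) k(2)[OF 1(1)] k(2)[OF 1(3)] by (intro inj_onD[OF q(1) 1(5)]) (use 1 in blast)+
      then have "j = j'" "k j b = k j' b'" using 1 inj_onD[OF h(1)] by blast+
      then show "j = j' \<and> b = b'" using 1 inj_onD[OF k(1)[OF 1(1)]] by blast
    qed
    show "(\<lambda>(j, b). q (h j, k j b)) ` Sigma J B \<subseteq> \<Union>(A ` J)" unfolding A_def by auto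
  qed
qed

lemma small_Times: "universe U \<Longrightarrow> small U A \<Longrightarrow> small U B \<Longrightarrow> small U (A \<times> B)"
  by (rule small_Sigma)

lemma small_UN:
  assumes "universe U" "small U J" "\<And>j. j \<in> J \<Longrightarrow> small U (B j)"
  shows "small U (\<Union>j\<in>J. B j)"
proof -
  have "(\<Union>j\<in>J. B j) = snd ` Sigma J B" by force
  then show ?thesis using small_image[OF small_Sigma[OF assms]] by simp
qed

lemma small_Pow:
  assumes "universe U" "small U A"
  shows "small U (Pow A)"
proof -
  obtain h where h: "inj_on h A" "h ` A \<subseteq> U" by (rule small_embeds[OF assms(2)])
  have "small U (h ` A)" by (rule small_image[OF assms(2)])
  then have "small U (Pow (h ` A))" using assms(1) h unfolding universe_def by blast
  moreover have "inj_on ((`) h) (Pow A)" using h(1) by (rule inj_on_image_Pow)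
  ultimately show ?thesis by (rule small_inj) auto
qed

text \<open>An extensional function is determined by its graph, a subset of the small set
  \<open>Sigma I B\<close>.\<close>

lemma small_PiE:
  assumes "universe U" "small U I" "\<And>i. i \<in> I \<Longrightarrow> small U (B i)"
  shows "small U (Pi\<^sub>E I B)"
proof (rule small_inj[OF small_Pow[OF assms(1) small_Sigma[OF assms]]])
  let ?g = "\<lambda>x. (\<lambda>i. (i, x i)) ` I"
  show "inj_on ?g (Pi\<^sub>E I B)"
  proof (rule inj_onI)
    fix x y assume x: "x \<in> Pi\<^sub>E I B" and y: "y \<in> Pi\<^sub>E I B" and e: "?g x = ?g y"
    show "x = y"
    proof (rule PiE_ext[OF x y])
      fix i assume "i \<in> I"
      then have "(i, x i) \<in> ?g y" using e by blast
      then show "x i = y i" by auto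
    qed
  qed
  show "?g ` Pi\<^sub>E I B \<subseteq> Pow (Sigma I B)" by (auto simp: PiE_def Pi_def)
qed

section \<open>Triangulated categories\<close>

context additive_category
begin

abbreviation add_arrow :: "'m \<Rightarrow> 'm \<Rightarrow> 'm"  (infixl \<open>\<boxplus>\<close> 65) where "f \<boxplus> g \<equiv> add_mor T f g"

text \<open>
  As hom-sets are disjoint, a morphism determines its source and target; \<open>Hom_iff\<close> below thus
  reduces all typing conditions to equations for the simplifier.
\<close>

definition Hom :: "'o \<Rightarrow> 'o \<Rightarrow> 'm set" where
  "Hom X Y = {f \<in> mor T X Y. X \<in> obj T \<and> Y \<in> obj T}"

definition arr :: "'m \<Rightarrow> bool" where "arr f \<longleftrightarrow> (\<exists>X Y. f \<in> Hom X Y)"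

definition dm :: "'m \<Rightarrow> 'o" where "dm f = (THE X. \<exists>Y. f \<in> Hom X Y)"

definition cd :: "'m \<Rightarrow> 'o" where "cd f = (THE Y. \<exists>X. f \<in> Hom X Y)"

lemma Hom_unique: "f \<in> Hom X Y \<Longrightarrow> f \<in> Hom X' Y' \<Longrightarrow> X = X' \<and> Y = Y'"
  unfolding Hom_def using mor_disjoint by blast

lemma Hom_arr: "f \<in> Hom X Y \<Longrightarrow> arr f \<and> dm f = X \<and> cd f = Y"
  unfolding arr_def dm_def cd_def using Hom_unique
  by (auto intro!: the_equality)

lemma arr_Hom: "arr f \<Longrightarrow> f \<in> Hom (dm f) (cd f)"
  using Hom_arr unfolding arr_def by blast

lemma Hom_obj: "f \<in> Hom X Y \<Longrightarrow> X \<in> obj T \<and> Y \<in> obj T" unfolding Hom_def by blast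

lemma Hom_iff [simp]: "f \<in> Hom X Y \<longleftrightarrow> arr f \<and> dm f = X \<and> cd f = Y \<and> X \<in> obj T \<and> Y \<in> obj T"
  using Hom_arr arr_Hom Hom_obj by blast

lemma mor_iff: "X \<in> obj T \<Longrightarrow> Y \<in> obj T \<Longrightarrow> f \<in> mor T X Y \<longleftrightarrow> arr f \<and> dm f = X \<and> cd f = Y"
  using Hom_iff[of f X Y] unfolding Hom_def by blast

lemma mor_Hom: "X \<in> obj T \<Longrightarrow> Y \<in> obj T \<Longrightarrow> mor T X Y = Hom X Y"
  unfolding Hom_def by blast

lemma dm_obj [simp]: "arr f \<Longrightarrow> dm f \<in> obj T" and cd_obj [simp]: "arr f \<Longrightarrow> cd f \<in> obj T"
  using arr_Hom Hom_obj by blast+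

abbreviation zr :: "'o \<Rightarrow> 'o \<Rightarrow> 'm" where "zr X Y \<equiv> zero_mor T X Y"

text \<open>\<open>minus_mor\<close> depends on the ends of the morphism. Reading them off from
  \<open>f\<close> makes negation a unary operation, convenient for rewriting.\<close>

definition ng :: "'m \<Rightarrow> 'm" where "ng f = minus_mor T (dm f) (cd f) f"

definition sb :: "'m \<Rightarrow> 'm \<Rightarrow> 'm" (infixl \<open>\<boxminus>\<close> 65) where "f \<boxminus> g = f \<boxplus> ng g"

lemma ide_Hom: "X \<in> obj T \<Longrightarrow> ide T X \<in> Hom X X"
  using ide_mor Hom_def by blast

lemma ide_simps [simp]:
  "X \<in> obj T \<Longrightarrow> arr (ide T X)" "X \<in> obj T \<Longrightarrow> dm (ide T X) = X" "X \<in> obj T \<Longrightarrow> cd (ide T X) = X"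
  using ide_Hom Hom_arr by blast+

lemma cmp_Hom:
  assumes "arr f" "arr g" "cd f = dm g" shows "g \<bullet> f \<in> Hom (dm f) (cd g)"
proof -
  have "f \<in> Hom (dm f) (dm g)" "g \<in> Hom (dm g) (cd g)" using assms arr_Hom by fastforce+
  then show ?thesis unfolding Hom_def using cmp_mor by blast
qed

lemma cmp_simps [simp]:
  assumes "arr f" "arr g" "cd f = dm g"
  shows "arr (g \<bullet> f)" "dm (g \<bullet> f) = dm f" "cd (g \<bullet> f) = cd g"
  using cmp_Hom[OF assms] Hom_arr by blast+

lemma cmp_ide_right [simp]: "arr f \<Longrightarrow> dm f = X \<Longrightarrow> f \<bullet> ide T X = f"
  using cmp_ide arr_Hom[of f] unfolding Hom_def by blast

lemma cmp_ide_left [simp]: "arr f \<Longrightarrow> cd f = Y \<Longrightarrow> ide T Y \<bullet> f = f"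
  using ide_cmp arr_Hom[of f] unfolding Hom_def by blast

lemma assoc [simp]:
  assumes "arr f" "arr g" "arr h" "cd f = dm g" "cd g = dm h"
  shows "(h \<bullet> g) \<bullet> f = h \<bullet> g \<bullet> f"
proof -
  have "f \<in> Hom (dm f) (dm g)" "g \<in> Hom (dm g) (dm h)" "h \<in> Hom (dm h) (cd h)"
    using assms arr_Hom by fastforce+
  then show ?thesis unfolding Hom_def by (auto intro: cmp_assoc)
qed

lemma carrier_hom_group: "X \<in> obj T \<Longrightarrow> Y \<in> obj T \<Longrightarrow> carrier (hom_group T X Y) = Hom X Y"
  by (auto simp: hom_group_def mor_Hom)

lemma hom_group_simps [simp]:
  "monoid.mult (hom_group T X Y) = add_mor T" "monoid.one (hom_group T X Y) = zr X Y"
  by (auto simp: hom_group_def)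

lemma Hom_add: "f \<in> Hom X Y \<Longrightarrow> g \<in> Hom X Y \<Longrightarrow> f \<boxplus> g \<in> Hom X Y"
  using mor_group[of X Y] carrier_hom_group[of X Y] Hom_obj[of f X Y]
  by (metis comm_group.axioms(1) comm_monoid.axioms(1) hom_group_simps(1) monoid.m_closed)

lemma Hom_zero: "X \<in> obj T \<Longrightarrow> Y \<in> obj T \<Longrightarrow> zr X Y \<in> Hom X Y"
  using mor_group[of X Y] carrier_hom_group[of X Y]
  by (metis comm_group.axioms(1) comm_monoid.axioms(1) hom_group_simps(2) monoid.one_closed)

lemma zr_simps [simp]:
  "X \<in> obj T \<Longrightarrow> Y \<in> obj T \<Longrightarrow> arr (zr X Y)"
  "X \<in> obj T \<Longrightarrow> Y \<in> obj T \<Longrightarrow> dm (zr X Y) = X"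
  "X \<in> obj T \<Longrightarrow> Y \<in> obj T \<Longrightarrow> cd (zr X Y) = Y"
  using Hom_zero Hom_arr by blast+

lemma add_simps [simp]:
  assumes "arr f" "arr g" "dm f = dm g" "cd f = cd g"
  shows "arr (f \<boxplus> g)" "dm (f \<boxplus> g) = dm g" "cd (f \<boxplus> g) = cd g"
  using Hom_add[of f "dm g" "cd g" g] assms by auto

lemma ng_Hom: assumes "arr f" shows "ng f \<in> Hom (dm f) (cd f)"
proof -
  interpret comm_group "hom_group T (dm f) (cd f)" using mor_group assms by simp
  show ?thesis using inv_closed[of f] assms
    by (simp add: ng_def minus_mor_def carrier_hom_group del: Hom_iff) simp
qed

lemma ng_simps [simp]: assumes "arr f" shows "arr (ng f)" "dm (ng f) = dm f" "cd (ng f) = cd f"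
  using ng_Hom[OF assms] by auto

lemma minus_mor_eq: "arr f \<Longrightarrow> dm f = X \<Longrightarrow> cd f = Y \<Longrightarrow> minus_mor T X Y f = ng f"
  by (simp add: ng_def)

lemma sb_simps [simp]:
  assumes "arr f" "arr g" "dm f = dm g" "cd f = cd g"
  shows "arr (f \<boxminus> g)" "dm (f \<boxminus> g) = dm g" "cd (f \<boxminus> g) = cd g"
  using assms by (auto simp: sb_def)

lemma add_group_laws:
  assumes "arr f" "arr g" "arr h" "dm f = dm g" "cd f = cd g" "dm g = dm h" "cd g = cd h"
  shows "f \<boxplus> g = g \<boxplus> f" "(f \<boxplus> g) \<boxplus> h = f \<boxplus> (g \<boxplus> h)"
    "zr (dm h) (cd h) \<boxplus> f = f" "ng f \<boxplus> f = zr (dm h) (cd h)"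
    "f \<boxplus> g = f \<boxplus> h \<Longrightarrow> g = h"
proof -
  interpret comm_group "hom_group T (dm h) (cd h)" using mor_group assms by simp
  have c: "f \<in> carrier (hom_group T (dm h) (cd h))" "g \<in> carrier (hom_group T (dm h) (cd h))"
      "h \<in> carrier (hom_group T (dm h) (cd h))"
    using assms by (auto simp: carrier_hom_group)
  show "f \<boxplus> g = g \<boxplus> f" "(f \<boxplus> g) \<boxplus> h = f \<boxplus> (g \<boxplus> h)" "zr (dm h) (cd h) \<boxplus> f = f"
    "ng f \<boxplus> f = zr (dm h) (cd h)" "f \<boxplus> g = f \<boxplus> h \<Longrightarrow> g = h"
    using m_comm[OF c(1,2)] m_assoc[OF c] l_one[OF c(1)] l_inv[OF c(1)] l_cancel[OF _ c(2,3,1)] assms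
    by (auto simp: ng_def minus_mor_def)
qed

lemma add_commute: "arr f \<Longrightarrow> arr g \<Longrightarrow> dm f = dm g \<Longrightarrow> cd f = cd g \<Longrightarrow> f \<boxplus> g = g \<boxplus> f"
  using add_group_laws(1)[of f g g] by simp

lemma add_assoc:
  "arr f \<Longrightarrow> arr g \<Longrightarrow> arr h \<Longrightarrow> dm f = dm g \<Longrightarrow> cd f = cd g \<Longrightarrow> dm g = dm h \<Longrightarrow> cd g = cd h \<Longrightarrow>
    f \<boxplus> g \<boxplus> h = f \<boxplus> (g \<boxplus> h)"
  by (rule add_group_laws(2))

lemma zr_add [simp]: "arr f \<Longrightarrow> dm f = X \<Longrightarrow> cd f = Y \<Longrightarrow> zr X Y \<boxplus> f = f"
  using add_group_laws(3)[of f f f] by simp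

lemma add_zr [simp]: "arr f \<Longrightarrow> dm f = X \<Longrightarrow> cd f = Y \<Longrightarrow> f \<boxplus> zr X Y = f"
  using add_commute[of f "zr X Y"] by auto

lemma ng_add [simp]: "arr f \<Longrightarrow> ng f \<boxplus> f = zr (dm f) (cd f)"
  using add_group_laws(4)[of f f f] by simp

lemma sb_self [simp]: "arr f \<Longrightarrow> f \<boxminus> f = zr (dm f) (cd f)"
  by (simp add: sb_def add_commute[of f "ng f"])

lemma add_left_cancel:
  "f \<boxplus> g = f \<boxplus> h \<Longrightarrow> arr f \<Longrightarrow> arr g \<Longrightarrow> arr h \<Longrightarrow> dm f = dm g \<Longrightarrow> cd f = cd g \<Longrightarrow> dm g = dm h \<Longrightarrow> cd g = cd h \<Longrightarrow> g = h"
  using add_group_laws(5) by blast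

lemma sb_add_cancel [simp]:
  assumes "arr f" "arr g" "dm f = dm g" "cd f = cd g"
  shows "f \<boxminus> g \<boxplus> g = f"
  using assms by (simp add: sb_def add_assoc)

lemma sb_eq_zr:
  assumes "f \<boxminus> g = zr X Y" "f \<in> Hom X Y" "g \<in> Hom X Y"
  shows "f = g"
proof -
  have "f = (f \<boxminus> g) \<boxplus> g" using assms(2,3) by simp
  also have "\<dots> = g" using assms(2,3) unfolding assms(1) by simp
  finally show ?thesis .
qed

lemma ng_unique:
  assumes "g \<boxplus> f = zr X Y" "f \<in> Hom X Y" "g \<in> Hom X Y"
  shows "g = ng f"
proof -
  have "f \<boxplus> g = g \<boxplus> f" "ng f \<boxplus> f = f \<boxplus> ng f" "ng f \<boxplus> f = zr X Y"
    using assms(2,3) by (auto simp: add_commute[of f])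
  then have "f \<boxplus> g = f \<boxplus> ng f" using assms(1) by metis
  then show ?thesis by (rule add_left_cancel) (use assms(2,3) in auto)
qed

lemma ng_zr [simp]: "X \<in> obj T \<Longrightarrow> Y \<in> obj T \<Longrightarrow> ng (zr X Y) = zr X Y"
  by (rule ng_unique[symmetric, where X = X and Y = Y]) auto

lemma ng_ng [simp]: "arr f \<Longrightarrow> ng (ng f) = f"
  by (rule ng_unique[symmetric, where X = "dm f" and Y = "cd f"]) (auto simp: add_commute[of f "ng f"])

lemma ng_eq_zr: "arr f \<Longrightarrow> ng f = zr (dm f) (cd f) \<Longrightarrow> f = zr (dm f) (cd f)"
  using ng_ng[of f] by simp

lemma cmp_add_l:
  assumes "arr f" "arr g" "arr g'" "cd f = dm g" "dm g' = dm g" "cd g' = cd g"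
  shows "(g \<boxplus> g') \<bullet> f = g \<bullet> f \<boxplus> g' \<bullet> f"
  using assms by (intro cmp_add_left[of "dm f" "cd f" "cd g"]) (auto simp: mor_iff)

lemma cmp_add_r:
  assumes "arr f" "arr f'" "arr g" "cd f = dm g" "dm f' = dm f" "cd f' = dm g"
  shows "g \<bullet> (f \<boxplus> f') = g \<bullet> f \<boxplus> g \<bullet> f'"
  using assms by (intro cmp_add_right[of "dm f" "cd f" "cd g"]) (auto simp: mor_iff)

lemma cmp_zr_left [simp]:
  assumes "arr f" "cd f = Y" "Z \<in> obj T" shows "zr Y Z \<bullet> f = zr (dm f) Z"
proof -
  have Y: "Y \<in> obj T" using assms by auto
  have "(zr Y Z \<boxplus> zr Y Z) \<bullet> f = zr Y Z \<bullet> f \<boxplus> zr Y Z \<bullet> f"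
    by (rule cmp_add_l) (use assms Y in auto)
  then have "zr Y Z \<bullet> f \<boxplus> zr (dm f) Z = zr Y Z \<bullet> f \<boxplus> zr Y Z \<bullet> f" using assms Y by simp
  from add_left_cancel[OF this] show ?thesis using assms Y by simp
qed

lemma cmp_zr_right [simp]:
  assumes "arr g" "dm g = Y" "X \<in> obj T" shows "g \<bullet> zr X Y = zr X (cd g)"
proof -
  have Y: "Y \<in> obj T" using assms by auto
  have "g \<bullet> (zr X Y \<boxplus> zr X Y) = g \<bullet> zr X Y \<boxplus> g \<bullet> zr X Y"
    by (rule cmp_add_r) (use assms Y in auto)
  then have "g \<bullet> zr X Y \<boxplus> zr X (cd g) = g \<bullet> zr X Y \<boxplus> g \<bullet> zr X Y" using assms Y by simp
  from add_left_cancel[OF this] show ?thesis using assms Y by simp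
qed

lemma cmp_ng_left [simp]:
  assumes "arr f" "arr g" "cd f = dm g" shows "ng g \<bullet> f = ng (g \<bullet> f)"
  by (rule ng_unique[where X = "dm f" and Y = "cd g"])
    (use assms in \<open>auto simp flip: cmp_add_l\<close>)

lemma cmp_ng_right [simp]:
  assumes "arr f" "arr g" "cd f = dm g" shows "g \<bullet> ng f = ng (g \<bullet> f)"
  by (rule ng_unique[where X = "dm f" and Y = "cd g"])
    (use assms in \<open>auto simp flip: cmp_add_r\<close>)

lemma cmp_sb_left:
  assumes "arr f" "arr g" "arr g'" "cd f = dm g" "dm g' = dm g" "cd g' = cd g"
  shows "(g \<boxminus> g') \<bullet> f = g \<bullet> f \<boxminus> g' \<bullet> f"
  using assms by (simp add: sb_def cmp_add_l)

lemma cmp_sb_right: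
  assumes "arr f" "arr f'" "arr g" "cd f = dm g" "dm f' = dm f" "cd f' = dm g"
  shows "g \<bullet> (f \<boxminus> f') = g \<bullet> f \<boxminus> g \<bullet> f'"
  using assms by (simp add: sb_def cmp_add_r)

lemma is_iso_iff:
  "X \<in> obj T \<Longrightarrow> Y \<in> obj T \<Longrightarrow> is_iso T X Y f \<longleftrightarrow>
    f \<in> Hom X Y \<and> (\<exists>g \<in> Hom Y X. g \<bullet> f = ide T X \<and> f \<bullet> g = ide T Y)"
  unfolding is_iso_def by (simp add: mor_Hom del: Hom_iff)

lemma is_zero_iff: "is_zero T X \<longleftrightarrow> X \<in> obj T \<and> ide T X = zr X X"
  unfolding is_zero_def by simp

lemma zero_obj [simp]: "is_zero T X \<Longrightarrow> X \<in> obj T" by (simp add: is_zero_iff)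

lemma from_zero: "is_zero T X \<Longrightarrow> f \<in> Hom X Y \<Longrightarrow> f = zr X Y"
  by (metis Hom_iff cmp_ide_right cmp_zr_right is_zero_iff)

lemma to_zero: "is_zero T Y \<Longrightarrow> f \<in> Hom X Y \<Longrightarrow> f = zr X Y"
  by (metis Hom_iff cmp_ide_left cmp_zr_left is_zero_iff)

lemma is_zeroI: "X \<in> obj T \<Longrightarrow> ide T X = zr X X \<Longrightarrow> is_zero T X" by (simp add: is_zero_iff)

lemma iso_zero:
  assumes "is_iso T X Y f" "is_zero T X" "Y \<in> obj T" shows "is_zero T Y"
proof -
  have X: "X \<in> obj T" using assms by simp
  obtain g where g: "g \<in> Hom Y X" "f \<bullet> g = ide T Y" "f \<in> Hom X Y"
    using assms is_iso_iff[OF X] by blast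
  have "f = zr X Y" by (rule from_zero[OF assms(2) g(3)])
  then show ?thesis using g assms(3) X by (intro is_zeroI) auto
qed

lemma isomorphic_refl: "X \<in> obj T \<Longrightarrow> isomorphic T X X"
  unfolding isomorphic_def using is_iso_iff[of X X "ide T X"] ide_Hom[of X] by auto

lemma isomorphic_sym: "isomorphic T X Y \<Longrightarrow> isomorphic T Y X"
  unfolding isomorphic_def is_iso_def by blast

end

section \<open>Integer powers of the suspension\<close>

lemma int_iterate_0 [simp]: "int_iterate A f 0 x = x"
  by (simp add: int_iterate_def)

lemma int_iterate_1 [simp]: "int_iterate A f 1 x = f x"
  by (simp add: int_iterate_def)

text \<open>The definition splits on the sign of \<open>n\<close>. These one-step equations hold for
  all integers alike, so later proofs can go up and down from \<open>0\<close>.\<close>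

lemma int_iterate_step:
  assumes "bij_betw f A A" "x \<in> A"
  shows "int_iterate A f n x \<in> A \<and> int_iterate A f (n + 1) x = f (int_iterate A f n x) \<and>
    int_iterate A f (n - 1) x = the_inv_into A f (int_iterate A f n x)"
proof -
  let ?g = "the_inv_into A f"
  have fA: "f y \<in> A" if "y \<in> A" for y using assms(1) that by (auto simp: bij_betw_def)
  have gA: "?g y \<in> A" if "y \<in> A" for y
    using assms(1) that by (metis bij_betw_def bij_betw_the_inv_into image_eqI)
  have fg: "f (?g y) = y" if "y \<in> A" for y
    using assms(1) that f_the_inv_into_f_bij_betw by metis
  have gf: "?g (f y) = y" if "y \<in> A" for y
    using assms(1) that by (simp add: bij_betw_def the_inv_into_f_f)
  have fk: "(f ^^ k) x \<in> A" for k by (induction k) (use assms(2) fA in auto)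
  have gk: "(?g ^^ k) x \<in> A" for k by (induction k) (use assms(2) gA in auto)
  show ?thesis
  proof (cases "n > 0")
    case True
    then obtain k where "n = int (Suc k)" by (metis gr0_conv_Suc pos_int_cases)
    then show ?thesis using fk[of k] fk[of "Suc k"] gf fA
      by (simp add: int_iterate_def nat_add_distrib)
  next
    case False
    then obtain k where k: "n = - int k" using that[of "nat (- n)"] by simp
    show ?thesis
    proof (cases k)
      case 0
      then show ?thesis using k assms(2) by (simp add: int_iterate_def)
    next
      case (Suc l)
      \<comment> \<open>For \<open>n = -1\<close> the exponent \<open>n + 1\<close> is
        \<open>0\<close> and falls into the other branch of the definition; the last two facts treat
        this case.\<close>
      have e: "nat (- n) = Suc l" "nat (- (n - 1)) = Suc (Suc l)" "nat (- (n + 1)) = l" "\<not> n \<ge> 0" "\<not> n - 1 \<ge> 0"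
        "n + 1 \<ge> 0 \<longleftrightarrow> l = 0" "l = 0 \<Longrightarrow> nat (n + 1) = 0"
        using k Suc by auto
      have 1: "int_iterate A f n x = (?g ^^ Suc l) x" "int_iterate A f (n - 1) x = (?g ^^ Suc (Suc l)) x"
        unfolding int_iterate_def e(1,2) using e(4,5) by simp_all
      have 2: "int_iterate A f (n + 1) x = (?g ^^ l) x"
        unfolding int_iterate_def e(3) using e(6,7) by (cases "l = 0") simp_all
      show ?thesis unfolding 1 2 using gk[of l] gk[of "Suc l"] fg gA by simp
    qed
  qed
qed

lemma int_iterate_add:
  assumes "bij_betw f A A" "x \<in> A"
  shows "int_iterate A f (m + n) x = int_iterate A f m (int_iterate A f n x)"
proof (induction m rule: int_induct[of _ 0])
  case base then show ?case by simp
next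
  case (step1 i)
  have "int_iterate A f (i + 1 + n) x = f (int_iterate A f (i + n) x)"
    using int_iterate_step[OF assms, of "i + n"] by (simp add: algebra_simps)
  then show ?case using step1 int_iterate_step[OF assms, of n]
      int_iterate_step[OF assms(1), of "int_iterate A f n x" i] by simp
next
  case (step2 i)
  have "int_iterate A f (i - 1 + n) x = the_inv_into A f (int_iterate A f (i + n) x)"
    using int_iterate_step[OF assms, of "i + n"] by (simp add: algebra_simps)
  then show ?case using step2 int_iterate_step[OF assms, of n]
      int_iterate_step[OF assms(1), of "int_iterate A f n x" i] by simp
qed

context triangulated_category
begin

abbreviation sh :: "int \<Rightarrow> 'a \<Rightarrow> 'a" where "sh n X \<equiv> susp_ob_pow T n X"
abbreviation sm :: "int \<Rightarrow> 'b \<Rightarrow> 'b" where "sm n f \<equiv> susp_mor_pow T n f"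

lemma arrows_arr: "arrows T = Collect arr"
  unfolding arrows_def arr_def Hom_def by blast

lemma susp_mor_Hom: "f \<in> Hom X Y \<Longrightarrow> susp_mor T f \<in> Hom (susp_ob T X) (susp_ob T Y)"
proof -
  assume f: "f \<in> Hom X Y"
  then have o: "X \<in> obj T" "Y \<in> obj T" by auto
  have "susp_mor T f \<in> mor T (susp_ob T X) (susp_ob T Y)"
    using susp_mor_bij[OF o] f o by (auto simp: bij_betw_def mor_Hom simp del: Hom_iff)
  then show ?thesis using susp_ob_bij o unfolding Hom_def bij_betw_def by blast
qed

text \<open>\<open>susp_mor_pow\<close> inverts the suspension on the set of all morphisms, whereas
  the axioms give bijections of single hom-sets. These glue because the ends of a suspended morphism
  determine the ends of the morphism.\<close>

lemma susp_mor_bij_arrows: "bij_betw (susp_mor T) (Collect arr) (Collect arr)"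
proof -
  have "inj_on (susp_mor T) (Collect arr)"
  proof (rule inj_onI, clarsimp)
    fix f g assume fg: "arr f" "arr g" "susp_mor T f = susp_mor T g"
    have 1: "susp_mor T f \<in> Hom (susp_ob T (dm f)) (susp_ob T (cd f))"
      "susp_mor T f \<in> Hom (susp_ob T (dm g)) (susp_ob T (cd g))"
      using susp_mor_Hom[OF arr_Hom] fg by metis+
    then have "susp_ob T (dm f) = susp_ob T (dm g)" "susp_ob T (cd f) = susp_ob T (cd g)"
      using Hom_unique[OF 1] by auto
    then have "dm f = dm g" "cd f = cd g"
      using susp_ob_bij fg unfolding bij_betw_def by (meson cd_obj dm_obj inj_onD)+
    then have "f \<in> mor T (dm g) (cd g)" "g \<in> mor T (dm g) (cd g)"
      using fg by (auto simp: mor_iff)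
    then show "f = g" using susp_mor_bij[of "dm g" "cd g"] fg unfolding bij_betw_def
      by (meson cd_obj dm_obj inj_onD)
  qed
  moreover have "susp_mor T ` Collect arr = Collect arr"
  proof
    show "susp_mor T ` Collect arr \<subseteq> Collect arr" using susp_mor_Hom arr_Hom by fastforce
    show "Collect arr \<subseteq> susp_mor T ` Collect arr"
    proof clarsimp
      fix f assume f: "arr f"
      obtain X where X: "X \<in> obj T" "dm f = susp_ob T X"
        using susp_ob_bij dm_obj[OF f] unfolding bij_betw_def by blast
      obtain Y where Y: "Y \<in> obj T" "cd f = susp_ob T Y"
        using susp_ob_bij cd_obj[OF f] unfolding bij_betw_def by blast
      have "f \<in> mor T (susp_ob T X) (susp_ob T Y)" using f X Y
        by (metis cd_obj dm_obj mor_iff)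
      then obtain g where "g \<in> mor T X Y" "f = susp_mor T g"
        using susp_mor_bij[OF X(1) Y(1)] unfolding bij_betw_def by blast
      then show "f \<in> susp_mor T ` Collect arr" using X Y by (auto simp: mor_iff)
    qed
  qed
  ultimately show ?thesis by (simp add: bij_betw_def)
qed

lemma sh_0 [simp]: "sh 0 X = X" and sm_0 [simp]: "sm 0 f = f"
  by (simp_all add: susp_ob_pow_def susp_mor_pow_def)

lemma susp_ob_sh: "susp_ob T X = sh 1 X" and susp_mor_sm: "susp_mor T f = sm 1 f"
  by (simp_all add: susp_ob_pow_def susp_mor_pow_def)

lemma sh_obj [simp]: "X \<in> obj T \<Longrightarrow> sh n X \<in> obj T"
  using int_iterate_step[OF susp_ob_bij] by (simp add: susp_ob_pow_def)

lemma sh_sh [simp]: "X \<in> obj T \<Longrightarrow> sh m (sh n X) = sh (m + n) X"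
  using int_iterate_add[OF susp_ob_bij] by (simp add: susp_ob_pow_def)

lemma sm_arr: "arr f \<Longrightarrow> arr (sm n f)"
  using int_iterate_step[OF susp_mor_bij_arrows] by (simp add: susp_mor_pow_def arrows_arr)

lemma sm_sm [simp]: "arr f \<Longrightarrow> sm m (sm n f) = sm (m + n) f"
  using int_iterate_add[OF susp_mor_bij_arrows] by (simp add: susp_mor_pow_def arrows_arr)

lemma sm_dn: "arr f \<Longrightarrow> sm 1 (sm (-1 + n) f) = sm n f"
  by simp

lemma sm_inj: "arr f \<Longrightarrow> arr g \<Longrightarrow> sm n f = sm n g \<Longrightarrow> f = g"
  by (metis add.left_inverse sm_0 sm_sm)

lemma sm_1_ends: "arr f \<Longrightarrow> dm (sm 1 f) = sh 1 (dm f) \<and> cd (sm 1 f) = sh 1 (cd f)"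
  using susp_mor_Hom[OF arr_Hom, of f] by (simp add: susp_ob_sh susp_mor_sm)

lemma sm_m1_ends: "arr f \<Longrightarrow> dm (sm (-1) f) = sh (-1) (dm f) \<and> cd (sm (-1) f) = sh (-1) (cd f)"
  using sm_1_ends[of "sm (-1) f"] sm_arr[of f "-1"]
  by (metis add.left_inverse add.right_inverse cd_obj dm_obj sh_0 sh_sh sm_0 sm_sm)

text \<open>Two-sided induction, with the steps in the form \<open>1 + n\<close> and
  \<open>-1 + n\<close> in which \<open>sh_sh\<close> and \<open>sm_sm\<close> produce the
  sums.\<close>

lemma int_up_down:
  assumes "P 0" "\<And>n. P n \<Longrightarrow> P (1 + n)" "\<And>n. P n \<Longrightarrow> P (-1 + n)"
  shows "P (n :: int)"
  by (induction n rule: int_induct[of _ 0]) (use assms in \<open>auto simp: add.commute diff_conv_add_uminus simp del: add_uminus_conv_diff\<close>)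

lemma sm_ends: "arr f \<Longrightarrow> dm (sm n f) = sh n (dm f) \<and> cd (sm n f) = sh n (cd f)"
proof (induction n rule: int_up_down)
  case (2 n) then show ?case using sm_1_ends[OF sm_arr, of f n] by simp
next
  case (3 n) then show ?case using sm_m1_ends[OF sm_arr, of f n] by simp
qed simp

lemma sm_simps [simp]:
  assumes "arr f" shows "arr (sm n f)" "dm (sm n f) = sh n (dm f)" "cd (sm n f) = sh n (cd f)"
  using assms sm_arr sm_ends by auto

lemma sm_cmp [simp]: assumes "arr f" "arr g" "cd f = dm g" shows "sm n (g \<bullet> f) = sm n g \<bullet> sm n f"
proof -
  have 1: "sm 1 (g \<bullet> f) = sm 1 g \<bullet> sm 1 f" if "arr f" "arr g" "cd f = dm g" for f g
    using susp_cmp[of "dm f" "cd f" "cd g" f g] that by (simp add: mor_iff susp_mor_sm)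
  show ?thesis
  proof (induction n rule: int_up_down)
    case (2 n) then show ?case using 1[of "sm n f" "sm n g"] assms by (metis cmp_simps(1) sm_simps sm_sm)
  next
    case (3 n)
    \<comment> \<open>Functoriality is known for the suspension itself; its inverse is treated by
      suspending once and cancelling.\<close>
    have "sm 1 (sm (-1 + n) g \<bullet> sm (-1 + n) f) = sm n g \<bullet> sm n f"
      using 1[of "sm (-1 + n) f" "sm (-1 + n) g"] assms by simp
    also have "\<dots> = sm 1 (sm (-1 + n) (g \<bullet> f))"
      using 3 sm_dn[of "g \<bullet> f" n] cmp_simps(1)[OF assms] by metis
    finally show ?case by (rule sm_inj[OF _ _ sym, rotated 2]) (use assms in simp_all)
  qed (use assms in simp)
qed

lemma sm_ide [simp]: assumes "X \<in> obj T" shows "sm n (ide T X) = ide T (sh n X)"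
proof (induction n rule: int_up_down)
  case (2 n) then show ?case using susp_ide[of "sh n X"] assms
    by (metis ide_simps(1) sh_obj sh_sh sm_sm susp_mor_sm susp_ob_sh)
next
  case (3 n)
  have "sm 1 (ide T (sh (-1 + n) X)) = ide T (sh n X)"
    using susp_ide[of "sh (-1 + n) X"] assms by (simp add: susp_mor_sm susp_ob_sh)
  also have "\<dots> = sm 1 (sm (-1 + n) (ide T X))"
      using 3 sm_dn[of "ide T X" n] ide_simps(1)[OF assms] by metis
  finally show ?case by (rule sm_inj[OF _ _ sym, rotated 2]) (use assms in simp_all)
qed (use assms in simp)

lemma sm_add [simp]:
  assumes "arr f" "arr g" "dm f = dm g" "cd f = cd g" shows "sm n (f \<boxplus> g) = sm n f \<boxplus> sm n g"
proof -
  have 1: "sm 1 (f \<boxplus> g) = sm 1 f \<boxplus> sm 1 g" if "arr f" "arr g" "dm f = dm g" "cd f = cd g" for f g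
    using susp_add[of "dm f" "cd f" f g] that by (simp add: mor_iff susp_mor_sm)
  show ?thesis
  proof (induction n rule: int_up_down)
    case (2 n) then show ?case using 1[of "sm n f" "sm n g"] assms by (metis add_simps(1) sm_simps sm_sm)
  next
    case (3 n)
    have "sm 1 (sm (-1 + n) f \<boxplus> sm (-1 + n) g) = sm n f \<boxplus> sm n g"
      using 1[of "sm (-1 + n) f" "sm (-1 + n) g"] assms by simp
    also have "\<dots> = sm 1 (sm (-1 + n) (f \<boxplus> g))"
      using 3 sm_dn[of "f \<boxplus> g" n] add_simps(1)[OF assms] by metis
    finally show ?case by (rule sm_inj[OF _ _ sym, rotated 2]) (use assms in simp_all)
  qed (use assms in simp)
qed

lemma sm_zr [simp]: assumes "X \<in> obj T" "Y \<in> obj T" shows "sm n (zr X Y) = zr (sh n X) (sh n Y)"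
proof -
  have "sm n (zr X Y) = sm n (zr X Y) \<boxplus> sm n (zr X Y)"
    using sm_add[of "zr X Y" "zr X Y" n] assms by simp
  then have "sm n (zr X Y) \<boxplus> zr (sh n X) (sh n Y) = sm n (zr X Y) \<boxplus> sm n (zr X Y)"
    using assms by simp
  from add_left_cancel[OF this] show ?thesis using assms by simp
qed

lemma sm_ng [simp]: assumes "arr f" shows "sm n (ng f) = ng (sm n f)"
  by (rule ng_unique[where X = "sh n (dm f)" and Y = "sh n (cd f)"])
    (use assms in \<open>auto simp flip: sm_add\<close>)

lemma is_zero_sh: "is_zero T X \<Longrightarrow> is_zero T (sh n X)"
  using sm_ide[of X n] sm_zr[of X X n] unfolding is_zero_iff by auto

lemma is_zero_sh_iff: "X \<in> obj T \<Longrightarrow> is_zero T (sh n X) \<longleftrightarrow> is_zero T X"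
  using is_zero_sh[of X n] is_zero_sh[of "sh n X" "-n"] by auto

section \<open>Exact triangles with their vertices\<close>

definition tri3 :: "'a \<Rightarrow> 'a \<Rightarrow> 'a \<Rightarrow> 'b \<Rightarrow> 'b \<Rightarrow> 'b \<Rightarrow> bool" where
  "tri3 X Y Z f g h \<longleftrightarrow> (f, g, h) \<in> tri T \<and> f \<in> Hom X Y \<and> g \<in> Hom Y Z \<and> h \<in> Hom Z (sh 1 X)"

lemma tri3_Hom:
  assumes "tri3 X Y Z f g h"
  shows "arr f" "arr g" "arr h" "dm f = X" "cd f = Y" "dm g = Y" "cd g = Z" "dm h = Z" "cd h = sh 1 X"
    "X \<in> obj T" "Y \<in> obj T" "Z \<in> obj T"
  using assms unfolding tri3_def by auto

text \<open>\<open>tri_mor\<close> yields some typing of the three morphisms; since hom-sets are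
  disjoint, it agrees with any typing already known.\<close>

lemma tri_tri3: "(f, g, h) \<in> tri T \<Longrightarrow> f \<in> Hom X Y \<Longrightarrow> g \<in> Hom Y' Z \<Longrightarrow> tri3 X Y Z f g h \<and> Y' = Y"
proof -
  assume a: "(f, g, h) \<in> tri T" "f \<in> Hom X Y" "g \<in> Hom Y' Z"
  obtain X1 Y1 Z1 where b: "X1 \<in> obj T" "Y1 \<in> obj T" "Z1 \<in> obj T" "f \<in> mor T X1 Y1" "g \<in> mor T Y1 Z1"
      "h \<in> mor T Z1 (susp_ob T X1)"
    using tri_mor[OF a(1)] by blast
  then have "f \<in> Hom X1 Y1" "g \<in> Hom Y1 Z1" "h \<in> Hom Z1 (sh 1 X1)"
    using sh_obj[of X1 1] unfolding Hom_def susp_ob_sh by auto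
  then show ?thesis using Hom_unique[OF a(2)] Hom_unique[OF a(3)] a(1) unfolding tri3_def by auto
qed

lemma ex_cone: assumes "f \<in> Hom X Y" obtains Z g h where "tri3 X Y Z f g h"
proof -
  obtain g h where gh: "(f, g, h) \<in> tri T"
    using tri_cone[of X Y f] assms unfolding Hom_def by blast
  obtain Y' Z where "g \<in> Hom Y' Z" using tri_mor[OF gh] unfolding Hom_def by blast
  then show ?thesis using tri_tri3[OF gh assms] that by blast
qed

lemma tri3_rotate:
  assumes "tri3 X Y Z f g h" shows "tri3 Y Z (sh 1 X) g h (ng (sm 1 f))"
proof -
  note t = tri3_Hom[OF assms]
  have "(g, h, minus_mor T (susp_ob T X) (susp_ob T Y) (susp_mor T f)) \<in> tri T"
    using tri_rotate[of X Y Z f g h] t assms by (auto simp: mor_iff susp_ob_sh tri3_def)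
  then show ?thesis using t by (simp add: tri3_def susp_ob_sh susp_mor_sm minus_mor_eq)
qed

lemma tri3_unrotate:
  assumes "tri3 X Y Z f g h" shows "tri3 (sh (-1) Z) X Y (ng (sm (-1) h)) f g"
proof -
  note t = tri3_Hom[OF assms]
  have "(f, g, minus_mor T (susp_ob T (sh (-1) Z)) (susp_ob T X) (susp_mor T (ng (sm (-1) h)))) \<in> tri T"
    using assms t by (simp add: tri3_def susp_ob_sh susp_mor_sm minus_mor_eq)
  then have "(ng (sm (-1) h), f, g) \<in> tri T"
    using tri_rotate[of "sh (-1) Z" X Y "ng (sm (-1) h)" f g] t by (simp add: mor_iff susp_ob_sh)
  then show ?thesis using t by (simp add: tri3_def)
qed

lemma ex_zero: obtains Z where "is_zero T Z" using zero_object by blast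

lemma tri3_ide: assumes "X \<in> obj T" "is_zero T Z" shows "tri3 X X Z (ide T X) (zr X Z) (zr Z (sh 1 X))"
  using tri_ide[OF assms] assms by (simp add: tri3_def susp_ob_sh)

lemma tri3_complete:
  assumes "tri3 X Y Z f g h" "tri3 X' Y' Z' f' g' h'" "a \<in> Hom X X'" "b \<in> Hom Y Y'" "b \<bullet> f = f' \<bullet> a"
  obtains c where "c \<in> Hom Z Z'" "c \<bullet> g = g' \<bullet> b" "sm 1 a \<bullet> h = h' \<bullet> c"
proof -
  note t = tri3_Hom[OF assms(1)] and t' = tri3_Hom[OF assms(2)]
  have "\<exists>c \<in> mor T Z Z'. c \<bullet> g = g' \<bullet> b \<and> susp_mor T a \<bullet> h = h' \<bullet> c"
    using assms t t' by (intro tri_complete[of f g h f' g' h' X Y Z X' Y' Z' a b]) (auto simp: tri3_def mor_iff)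
  then show ?thesis using that t t' by (auto simp: mor_Hom susp_mor_sm simp del: Hom_iff)
qed

text \<open>Mapping the triangle \<open>X -> X -> 0\<close> to the given one, with the identity and
  \<open>f\<close> as first two components, makes \<open>g \<bullet> f\<close> factor through a zero
  object.\<close>

lemma tri3_comp_zero: assumes "tri3 X Y Z f g h" shows "g \<bullet> f = zr X Z"
proof -
  note t = tri3_Hom[OF assms]
  obtain N where N: "is_zero T N" by (rule ex_zero)
  obtain c where c: "c \<in> Hom N Z" "c \<bullet> zr X N = g \<bullet> f"
    by (rule tri3_complete[OF tri3_ide[OF t(10) N] assms, of "ide T X" f]) (use t in auto)
  then show ?thesis using t N by auto
qed

lemma tri3_comp_zero'': assumes "tri3 X Y Z f g h" shows "sm 1 f \<bullet> h = zr Z (sh 1 Y)"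
  using tri3_comp_zero[OF tri3_rotate[OF tri3_rotate[OF assms]]] tri3_Hom[OF assms]
    ng_eq_zr[of "sm 1 f \<bullet> h"] by simp

text \<open>A morphism \<open>k\<close> with \<open>k \<bullet> f = 0\<close> completes to a
  morphism into the triangle \<open>0 -> W -> W\<close>. This lemma and its variants replace the
  long exact Hom sequences throughout.\<close>

lemma weak_cokernel:
  assumes "tri3 X Y Z f g h" "k \<bullet> f = zr X W" "k \<in> Hom Y W"
  obtains l where "l \<in> Hom Z W" "k = l \<bullet> g"
proof -
  note t = tri3_Hom[OF assms(1)]
  have W: "W \<in> obj T" using assms by simp
  obtain N where N: "is_zero T N" by (rule ex_zero)
  have "tri3 (sh (-1) (sh 1 N)) W W (ng (sm (-1) (zr (sh 1 N) (sh 1 W)))) (ide T W) (zr W (sh 1 N))"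
    by (rule tri3_unrotate[OF tri3_ide]) (use W N is_zero_sh in auto)
  then have "tri3 N W W (zr N W) (ide T W) (zr W (sh 1 N))" using N W
    by simp
  from tri3_complete[OF assms(1) this, of "zr X N" k] obtain c where "c \<in> Hom Z W" "c \<bullet> g = ide T W \<bullet> k"
    using assms t N W by auto
  then show ?thesis using that assms(3) by auto
qed

lemma weak_kernel:
  assumes "tri3 X Y Z f g h" "g \<bullet> k = zr W Z" "k \<in> Hom W Y"
  obtains l where "l \<in> Hom W X" "k = f \<bullet> l"
proof -
  note t = tri3_Hom[OF assms(1)]
  have W: "W \<in> obj T" using assms by simp
  obtain N where N: "is_zero T N" by (rule ex_zero)
  \<comment> \<open>The completion axiom supplies a third morphism only. So both triangles are
    rotated: the wanted morphism appears as \<open>c\<close> from \<open>sh 1 W\<close> to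
    \<open>sh 1 X\<close> and is desuspended at the end.\<close>
  have 1: "tri3 W N (sh 1 W) (zr W N) (zr N (sh 1 W)) (ng (sm 1 (ide T W)))"
    by (rule tri3_rotate[OF tri3_ide]) (use W N in auto)
  obtain c where c: "c \<in> Hom (sh 1 W) (sh 1 X)" "sm 1 k \<bullet> ng (sm 1 (ide T W)) = ng (sm 1 f) \<bullet> c"
    by (rule tri3_complete[OF 1 tri3_rotate[OF assms(1)], of k "zr N Z"]) (use assms t N W in auto)
  have "ng (sm 1 k) = ng (sm 1 f \<bullet> c)" using c assms t W by simp
  then have 2: "sm 1 k = sm 1 f \<bullet> c"
    by (metis assms(3) c(1) Hom_iff cmp_simps(1) ng_ng sm_simps(1,2) t(1,4))
  have "k = sm (-1) (sm 1 k)" using assms(3) by simp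
  also have "\<dots> = f \<bullet> sm (-1) c" unfolding 2 using t c(1) by simp
  finally have "k = f \<bullet> sm (-1) c" .
  then show ?thesis using that[of "sm (-1) c"] c t W by simp
qed

lemma weak_cokernel2:
  assumes "tri3 X Y Z f g h" "k \<bullet> g = zr Y W" "k \<in> Hom Z W"
  obtains l where "l \<in> Hom (sh 1 X) W" "k = l \<bullet> h"
  by (rule weak_cokernel[OF tri3_rotate[OF assms(1)] assms(2,3)])

lemma weak_kernel2:
  assumes "tri3 X Y Z f g h" "h \<bullet> k = zr W (sh 1 X)" "k \<in> Hom W Z"
  obtains l where "l \<in> Hom W Y" "k = g \<bullet> l"
  by (rule weak_kernel[OF tri3_rotate[OF assms(1)] assms(2,3)])

lemma weak_kernel3:
  assumes "tri3 X Y Z f g h" "f \<bullet> k = zr W Y" "k \<in> Hom W X"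
  obtains l where "l \<in> Hom W (sh (-1) Z)" "k = sm (-1) h \<bullet> l"
proof -
  note t = tri3_Hom[OF assms(1)]
  obtain l where l: "l \<in> Hom W (sh (-1) Z)" "k = ng (sm (-1) h) \<bullet> l"
    by (rule weak_kernel[OF tri3_unrotate[OF assms(1)] assms(2,3)])
  then have "k = sm (-1) h \<bullet> ng l" using t by simp
  then show ?thesis using that[of "ng l"] l by simp
qed

lemma weak_kernel_sh:
  assumes "tri3 X Y Z f g h" "sm n g \<bullet> k = zr W (sh n Z)" "k \<in> Hom W (sh n Y)"
  obtains l where "l \<in> Hom W (sh n X)" "k = sm n f \<bullet> l"
proof -
  note t = tri3_Hom[OF assms(1)]
  have "sm (-n) (sm n g \<bullet> k) = sm (-n) (zr W (sh n Z))" using assms(2) by simp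
  then have 1: "g \<bullet> sm (-n) k = zr (sh (-n) W) Z" using assms(3) t by simp
  obtain l where l: "l \<in> Hom (sh (-n) W) X" "sm (-n) k = f \<bullet> l"
    by (rule weak_kernel[OF assms(1) 1]) (use assms(3) t in auto)
  have "k = sm n (sm (-n) k)" using assms(3) by simp
  also have "\<dots> = sm n f \<bullet> sm n l" unfolding l(2) using t l(1) by simp
  finally show ?thesis using that[of "sm n l"] l(1) t assms(3) by simp
qed

lemma weak_kernel2_sh:
  assumes "tri3 X Y Z f g h" "sm n h \<bullet> k = zr W (sh (n + 1) X)" "k \<in> Hom W (sh n Z)"
  obtains l where "l \<in> Hom W (sh n Y)" "k = sm n g \<bullet> l"
proof -
  have "sm n h \<bullet> k = zr W (sh n (sh 1 X))" using assms(2) tri3_Hom[OF assms(1)] by simp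
  then show ?thesis using weak_kernel_sh[OF tri3_rotate[OF assms(1)]] assms(3) that by metis
qed

text \<open>Without the morphisms the signs of rotation disappear, so triangles of objects can be
  rotated and shifted freely.\<close>

definition dist :: "'a \<Rightarrow> 'a \<Rightarrow> 'a \<Rightarrow> bool" where "dist X Y Z \<longleftrightarrow> (\<exists>f g h. tri3 X Y Z f g h)"

lemma dist_rotate: "dist X Y Z \<Longrightarrow> dist Y Z (sh 1 X)"
  unfolding dist_def using tri3_rotate by blast

lemma dist_unrotate: "dist X Y Z \<Longrightarrow> dist (sh (-1) Z) X Y"
  unfolding dist_def using tri3_unrotate by blast

lemma dist_obj: "dist X Y Z \<Longrightarrow> X \<in> obj T \<and> Y \<in> obj T \<and> Z \<in> obj T"
  unfolding dist_def tri3_def by auto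

lemma dist_sh: "dist X Y Z \<Longrightarrow> dist (sh n X) (sh n Y) (sh n Z)"
proof (induction n rule: int_up_down)
  case (2 n)
  then show ?case using dist_rotate[OF dist_rotate[OF dist_rotate]] dist_obj by fastforce
next
  case (3 n)
  then show ?case using dist_unrotate[OF dist_unrotate[OF dist_unrotate]] dist_obj by fastforce
qed simp

lemma tri3_iso_zero:
  assumes "X \<in> obj T" "Y \<in> obj T" "is_iso T X Y f" "is_zero T Z"
  shows "tri3 X Y Z f (zr Y Z) (zr Z (sh 1 X))"
proof -
  obtain g where f: "f \<in> Hom X Y" and g: "g \<in> Hom Y X" "g \<bullet> f = ide T X" "f \<bullet> g = ide T Y"
    using assms is_iso_iff by blast
  have i: "is_iso T V V (ide T V)" if "V \<in> obj T" for V
    unfolding is_iso_iff[OF that that] using ide_Hom[OF that] that by auto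
  have "(f, zr Y Z, zr Z (sh 1 X)) \<in> tri T"
    by (rule tri_iso[of "ide T X" "zr X Z" "zr Z (sh 1 X)" X X Z X Y Z f _ _ "ide T X" f "ide T Z"])
      (use assms f i tri3_ide[OF assms(1,4)] in \<open>auto simp: mor_iff susp_ob_sh susp_mor_sm tri3_def\<close>)
  then show ?thesis using assms(1,2,4) f by (simp add: tri3_def)
qed

text \<open>With a zero cone, \<open>g = 0\<close> yields a section \<open>l\<close> of
  \<open>f\<close>, and \<open>h = 0\<close> makes \<open>f\<close> a monomorphism, so that
  \<open>f \<bullet> (l \<bullet> f \<boxminus> ide T X) = 0\<close> forces \<open>l\<close> to be a
  left inverse too.\<close>

lemma cone_zero_iso:
  assumes "tri3 X Y Z f g h" "is_zero T Z" shows "is_iso T X Y f"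
proof -
  note t = tri3_Hom[OF assms(1)]
  have g: "g = zr Y Z" by (rule to_zero[OF assms(2)]) (use t in simp)
  obtain l where l: "l \<in> Hom Y X" "ide T Y = f \<bullet> l"
    by (rule weak_kernel[OF assms(1), of "ide T Y" Y]) (use g t assms(2) in auto)
  have h: "h = zr Z (sh 1 X)" by (rule from_zero[OF assms(2)]) (use t in simp)
  have 1: "f \<bullet> (l \<bullet> f \<boxminus> ide T X) = zr X Y"
  proof -
    have "f \<bullet> (l \<bullet> f \<boxminus> ide T X) = f \<bullet> l \<bullet> f \<boxminus> f \<bullet> ide T X"
      by (rule cmp_sb_right) (use l(1) t in auto)
    also have "f \<bullet> l \<bullet> f = (f \<bullet> l) \<bullet> f" using l(1) t by simp
    also have "\<dots> \<boxminus> f \<bullet> ide T X = zr X Y" unfolding l(2)[symmetric] using t by simp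
    finally show ?thesis .
  qed
  obtain q where q: "q \<in> Hom X (sh (-1) Z)" "l \<bullet> f \<boxminus> ide T X = sm (-1) h \<bullet> q"
    by (rule weak_kernel3[OF assms(1) 1]) (use l t in auto)
  then have "l \<bullet> f \<boxminus> ide T X = zr X X" using h t assms(2) by simp
  then have "l \<bullet> f = ide T X" by (rule sb_eq_zr) (use l t in auto)
  then show ?thesis using l t by (simp add: is_iso_iff del: Hom_iff) auto
qed

lemma iso_dist: "isomorphic T X Y \<Longrightarrow> X \<in> obj T \<Longrightarrow> Y \<in> obj T \<Longrightarrow> is_zero T Z \<Longrightarrow> dist X Y Z"
  unfolding isomorphic_def dist_def using tri3_iso_zero by blast

section \<open>Triangulated subcategories\<close>

definition triang :: "'a set \<Rightarrow> bool" where
  "triang S \<longleftrightarrow> S \<subseteq> obj T \<and> (\<forall>Z. is_zero T Z \<longrightarrow> Z \<in> S) \<and> (\<forall>X\<in>S. \<forall>n. sh n X \<in> S) \<and>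
     (\<forall>X Y Z. dist X Y Z \<longrightarrow> X \<in> S \<longrightarrow> Y \<in> S \<longrightarrow> Z \<in> S)"

text \<open>Closure under cones and shifts gives the other two closure rules by rotation. Isomorphic
  objects are the first two vertices of a triangle whose third vertex is zero.\<close>

lemma triangD:
  assumes "triang S"
  shows "X \<in> S \<Longrightarrow> X \<in> obj T" "is_zero T Z \<Longrightarrow> Z \<in> S" "X \<in> S \<Longrightarrow> sh n X \<in> S"
    "dist X Y Z \<Longrightarrow> X \<in> S \<Longrightarrow> Y \<in> S \<Longrightarrow> Z \<in> S"
    "dist X Y Z \<Longrightarrow> X \<in> S \<Longrightarrow> Z \<in> S \<Longrightarrow> Y \<in> S"
    "dist X Y Z \<Longrightarrow> Y \<in> S \<Longrightarrow> Z \<in> S \<Longrightarrow> X \<in> S"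
    "X \<in> S \<Longrightarrow> isomorphic T X Y \<Longrightarrow> Y \<in> obj T \<Longrightarrow> Y \<in> S"
    "X \<in> obj T \<Longrightarrow> sh n X \<in> S \<longleftrightarrow> X \<in> S"
proof -
  show 1: "X \<in> S \<Longrightarrow> X \<in> obj T" "is_zero T Z \<Longrightarrow> Z \<in> S" "X \<in> S \<Longrightarrow> sh n X \<in> S"
    "dist X Y Z \<Longrightarrow> X \<in> S \<Longrightarrow> Y \<in> S \<Longrightarrow> Z \<in> S" for X Y Z n
    using assms unfolding triang_def by blast+
  show 2: "X \<in> obj T \<Longrightarrow> sh n X \<in> S \<longleftrightarrow> X \<in> S" for X n
    using 1(3)[of X n] 1(3)[of "sh n X" "-n"] by auto
  show 3: "dist X Y Z \<Longrightarrow> X \<in> S \<Longrightarrow> Z \<in> S \<Longrightarrow> Y \<in> S" for X Y Z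
    using 1(4)[OF dist_unrotate] 1(3) by blast
  show 4: "dist X Y Z \<Longrightarrow> Y \<in> S \<Longrightarrow> Z \<in> S \<Longrightarrow> X \<in> S" for X Y Z
    using 1(4)[OF dist_rotate] 2[of X 1] dist_obj by blast
  show "X \<in> S \<Longrightarrow> isomorphic T X Y \<Longrightarrow> Y \<in> obj T \<Longrightarrow> Y \<in> S"
  proof -
    assume a: "X \<in> S" "isomorphic T X Y" "Y \<in> obj T"
    obtain N where N: "is_zero T N" by (rule ex_zero)
    show "Y \<in> S" by (rule 3[OF iso_dist[OF a(2) 1(1)[OF a(1)] a(3) N] a(1) 1(2)[OF N]])
  qed
qed

lemma triang_iff: "triangulated_subcategory T S \<longleftrightarrow> triang S"
proof
  assume S: "triang S"
  obtain N where N: "is_zero T N" by (rule ex_zero)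
  have D: "(X \<in> S \<and> Y \<in> S \<longrightarrow> Z \<in> S) \<and> (X \<in> S \<and> Z \<in> S \<longrightarrow> Y \<in> S) \<and> (Y \<in> S \<and> Z \<in> S \<longrightarrow> X \<in> S)"
    if "X \<in> obj T" "Y \<in> obj T" "Z \<in> obj T" "f \<in> mor T X Y" "g \<in> mor T Y Z" "(f, g, h) \<in> tri T"
    for X Y Z f g h
  proof -
    have "tri3 X Y Z f g h" using tri_tri3[OF that(6), of X Y Y Z] that by (simp add: mor_Hom)
    then have d: "dist X Y Z" unfolding dist_def by blast
    show ?thesis using triangD(4-6)[OF S d] by blast
  qed
  have iso: "Y \<in> S" if "X \<in> S" "Y \<in> obj T" "isomorphic T X Y" for X Y
    by (rule triangD(7)[OF S that(1,3,2)])
  have sh: "X \<in> S \<longleftrightarrow> sh 1 X \<in> S" if "X \<in> obj T" for X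
    using triangD(8)[OF S that, of 1] by blast
  have ob: "S \<subseteq> obj T" "S \<noteq> {}" using triangD(1)[OF S] triangD(2)[OF S N] by auto
  show "triangulated_subcategory T S"
    unfolding triangulated_subcategory_def susp_ob_sh
  proof (intro conjI ballI)
    show "S \<subseteq> obj T" "S \<noteq> {}" by (fact ob)+
    show "isomorphic T X Y \<longrightarrow> Y \<in> S" if "X \<in> S" "Y \<in> obj T" for X Y using iso that by blast
    show "X \<in> S \<longleftrightarrow> sh 1 X \<in> S" if "X \<in> obj T" for X by (rule sh[OF that])
    show "\<forall>h. (f, g, h) \<in> tri T \<longrightarrow> (X \<in> S \<and> Y \<in> S \<longrightarrow> Z \<in> S) \<and>
        (X \<in> S \<and> Z \<in> S \<longrightarrow> Y \<in> S) \<and> (Y \<in> S \<and> Z \<in> S \<longrightarrow> X \<in> S)"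
      if "X \<in> obj T" "Y \<in> obj T" "Z \<in> obj T" "f \<in> mor T X Y" "g \<in> mor T Y Z" for X Y Z f g
      by (intro allI impI) (rule D[OF that])
  qed
next
  assume S: "triangulated_subcategory T S"
  have 1: "X \<in> S \<longleftrightarrow> sh 1 X \<in> S" if "X \<in> obj T" for X
  proof -
    have "\<forall>X\<in>obj T. X \<in> S \<longleftrightarrow> sh 1 X \<in> S"
      using S unfolding triangulated_subcategory_def susp_ob_sh by (elim conjE)
    then show ?thesis using that by blast
  qed
  have sub: "S \<subseteq> obj T" using S unfolding triangulated_subcategory_def by (elim conjE)
  have ne: "S \<noteq> {}" using S unfolding triangulated_subcategory_def by (elim conjE)
  have 2: "sh n X \<in> S" if "X \<in> S" for n X
  proof -
    have X: "X \<in> obj T" using sub that by blast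
    show ?thesis
    proof (induction n rule: int_up_down)
      case (2 n) then show ?case using 1[of "sh n X"] X by simp
    next
      case (3 n) then show ?case using 1[of "sh (-1 + n) X"] X by simp
    qed (use that in simp)
  qed
  have 3: "Z \<in> S" if d: "dist X Y Z" and XY: "X \<in> S" "Y \<in> S" for X Y Z
  proof -
    obtain f g h where "tri3 X Y Z f g h" using d unfolding dist_def by blast
    then have "X \<in> obj T" "Y \<in> obj T" "Z \<in> obj T" "f \<in> mor T X Y" "g \<in> mor T Y Z" "(f, g, h) \<in> tri T"
      unfolding tri3_def Hom_def by auto
    moreover have "\<forall>X\<in>obj T. \<forall>Y\<in>obj T. \<forall>Z\<in>obj T. \<forall>f\<in>mor T X Y. \<forall>g\<in>mor T Y Z. \<forall>h.
        (f, g, h) \<in> tri T \<longrightarrow>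
        (X \<in> S \<and> Y \<in> S \<longrightarrow> Z \<in> S) \<and> (X \<in> S \<and> Z \<in> S \<longrightarrow> Y \<in> S) \<and> (Y \<in> S \<and> Z \<in> S \<longrightarrow> X \<in> S)"
      using S unfolding triangulated_subcategory_def by (elim conjE)
    ultimately show ?thesis using XY by blast
  qed
  have 4: "Z \<in> S" if Z: "is_zero T Z" for Z
  proof -
    obtain X where "X \<in> S" using ne by blast
    then have "dist X X Z" unfolding dist_def using tri3_ide[OF _ Z] sub by blast
    then show ?thesis using 3 \<open>X \<in> S\<close> by blast
  qed
  show "triang S" unfolding triang_def using 2 3 4 sub by blast
qed

end

section \<open>Coproducts, compact objects and localizing subcategories\<close>

context additive_category
begin

section \<open>Coproducts and their projections\<close>

lemma coprod_Hom:
  assumes "is_coproduct T I A P \<iota>"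
  shows "P \<in> obj T" "i \<in> I \<Longrightarrow> arr (\<iota> i)" "i \<in> I \<Longrightarrow> dm (\<iota> i) = A i" "i \<in> I \<Longrightarrow> cd (\<iota> i) = P"
    "i \<in> I \<Longrightarrow> A i \<in> obj T"
proof -
  have 1: "P \<in> obj T" using assms unfolding is_coproduct_def by (elim conjE)
  have 2: "\<forall>i\<in>I. A i \<in> obj T \<and> \<iota> i \<in> mor T (A i) P"
    using assms unfolding is_coproduct_def by (elim conjE)
  show "P \<in> obj T" "i \<in> I \<Longrightarrow> arr (\<iota> i)" "i \<in> I \<Longrightarrow> dm (\<iota> i) = A i"
    "i \<in> I \<Longrightarrow> cd (\<iota> i) = P" "i \<in> I \<Longrightarrow> A i \<in> obj T"
    using 1 2 by (auto simp: mor_iff)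
qed

lemma coprod_factor:
  assumes "is_coproduct T I A P \<iota>" "Y \<in> obj T" "\<And>i. i \<in> I \<Longrightarrow> g i \<in> Hom (A i) Y"
  obtains u where "u \<in> Hom P Y" "\<And>i. i \<in> I \<Longrightarrow> u \<bullet> \<iota> i = g i"
proof -
  have "\<forall>i\<in>I. g i \<in> mor T (A i) Y" using assms(3) unfolding Hom_def by blast
  then have "\<exists>!u. u \<in> mor T P Y \<and> (\<forall>i\<in>I. u \<bullet> \<iota> i = g i)"
    using assms(1,2) unfolding is_coproduct_def by blast
  then obtain u where "u \<in> mor T P Y" "\<forall>i\<in>I. u \<bullet> \<iota> i = g i" by blast
  then show ?thesis using that[of u] assms(2) coprod_Hom(1)[OF assms(1)] unfolding Hom_def by blast
qed

lemma coprod_eqI: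
  assumes "is_coproduct T I A P \<iota>" "u \<in> Hom P Y" "v \<in> Hom P Y" "\<And>i. i \<in> I \<Longrightarrow> u \<bullet> \<iota> i = v \<bullet> \<iota> i"
  shows "u = v"
proof -
  have "\<forall>i\<in>I. u \<bullet> \<iota> i \<in> mor T (A i) Y"
    using assms(2) coprod_Hom[OF assms(1)] by (auto simp: mor_iff)
  moreover have "Y \<in> obj T" using assms(2) by simp
  moreover have "\<forall>Y\<in>obj T. \<forall>g. (\<forall>i\<in>I. g i \<in> mor T (A i) Y) \<longrightarrow>
      (\<exists>!u. u \<in> mor T P Y \<and> (\<forall>i\<in>I. u \<bullet> \<iota> i = g i))"
    using assms(1) unfolding is_coproduct_def by (elim conjE)
  ultimately have "\<exists>!w. w \<in> mor T P Y \<and> (\<forall>i\<in>I. w \<bullet> \<iota> i = u \<bullet> \<iota> i)"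
    by (elim ballE[of _ _ Y] allE[of _ "\<lambda>i. u \<bullet> \<iota> i"]) auto
  moreover have "u \<in> mor T P Y" "v \<in> mor T P Y" using assms(2,3) unfolding Hom_def by blast+
  ultimately show ?thesis using assms(4) by metis
qed

lemma is_coproductI:
  assumes "P \<in> obj T" "\<And>i. i \<in> I \<Longrightarrow> \<iota> i \<in> Hom (A i) P"
    "\<And>Y g. Y \<in> obj T \<Longrightarrow> (\<And>i. i \<in> I \<Longrightarrow> g i \<in> Hom (A i) Y) \<Longrightarrow> \<exists>u \<in> Hom P Y. \<forall>i\<in>I. u \<bullet> \<iota> i = g i"
    "\<And>Y u v. u \<in> Hom P Y \<Longrightarrow> v \<in> Hom P Y \<Longrightarrow> (\<And>i. i \<in> I \<Longrightarrow> u \<bullet> \<iota> i = v \<bullet> \<iota> i) \<Longrightarrow> u = v"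
  shows "is_coproduct T I A P \<iota>"
  unfolding is_coproduct_def
proof (intro conjI ballI allI impI)
  show "P \<in> obj T" by fact
  show "A i \<in> obj T" "\<iota> i \<in> mor T (A i) P" if "i \<in> I" for i
    using assms(2)[OF that] unfolding Hom_def by blast+
  fix Y g assume Y: "Y \<in> obj T" "\<forall>i\<in>I. g i \<in> mor T (A i) Y"
  then have g: "g i \<in> Hom (A i) Y" if "i \<in> I" for i
    using assms(2)[OF that] that unfolding Hom_def by blast
  show "\<exists>!u. u \<in> mor T P Y \<and> (\<forall>i\<in>I. u \<bullet> \<iota> i = g i)"
    using assms(3)[OF Y(1) g] assms(4)[of _ Y] mor_Hom[OF assms(1) Y(1)] by metis
qed

lemma coprod_cong:
  assumes "is_coproduct T I A P \<iota>" "\<And>i. i \<in> I \<Longrightarrow> A i = A' i" "\<And>i. i \<in> I \<Longrightarrow> \<iota> i = \<iota>' i"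
  shows "is_coproduct T I A' P \<iota>'"
  using assms unfolding is_coproduct_def by simp

lemma coprod_reindex:
  assumes "is_coproduct T I A P \<iota>" "bij_betw k J I"
  shows "is_coproduct T J (\<lambda>j. A (k j)) P (\<lambda>j. \<iota> (k j))"
proof (rule is_coproductI)
  have k: "k j \<in> I" if "j \<in> J" for j using assms(2) that by (auto simp: bij_betw_def)
  show "P \<in> obj T" by (rule coprod_Hom(1)[OF assms(1)])
  show "\<iota> (k j) \<in> Hom (A (k j)) P" if "j \<in> J" for j using coprod_Hom[OF assms(1)] k[OF that] by simp
  have ki: "inv_into J k i \<in> J" "k (inv_into J k i) = i" if "i \<in> I" for i
    using assms(2) that by (auto simp: bij_betw_def inv_into_into f_inv_into_f)
  have ik: "inv_into J k (k j) = j" if "j \<in> J" for j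
    using assms(2) that by (auto simp: bij_betw_def)
  show "\<exists>u\<in>Hom P Y. \<forall>j\<in>J. u \<bullet> \<iota> (k j) = g j"
    if Y: "Y \<in> obj T" and g: "\<And>j. j \<in> J \<Longrightarrow> g j \<in> Hom (A (k j)) Y" for Y g
  proof -
    have "g (inv_into J k i) \<in> Hom (A i) Y" if "i \<in> I" for i using g[OF ki(1)[OF that]] ki(2)[OF that] by simp
    then obtain u where "u \<in> Hom P Y" "\<And>i. i \<in> I \<Longrightarrow> u \<bullet> \<iota> i = g (inv_into J k i)"
      using coprod_factor[OF assms(1) Y, of "\<lambda>i. g (inv_into J k i)"] by blast
    then show ?thesis using k ik by metis
  qed
  show "u = v" if "u \<in> Hom P Y" "v \<in> Hom P Y" "\<And>j. j \<in> J \<Longrightarrow> u \<bullet> \<iota> (k j) = v \<bullet> \<iota> (k j)" for Y u v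
    using coprod_eqI[OF assms(1) that(1,2)] that(3) ki by metis
qed

lemma coprod_proj:
  assumes "is_coproduct T I A P \<iota>" "i \<in> I"
  obtains p where "p \<in> Hom P (A i)" "p \<bullet> \<iota> i = ide T (A i)" "\<And>j. j \<in> I \<Longrightarrow> j \<noteq> i \<Longrightarrow> p \<bullet> \<iota> j = zr (A j) (A i)"
proof -
  note c = coprod_Hom[OF assms(1)]
  have g: "(if j = i then ide T (A i) else zr (A j) (A i)) \<in> Hom (A j) (A i)" if "j \<in> I" for j
    using c(5) assms(2) that by simp
  obtain u where u: "u \<in> Hom P (A i)" "\<And>j. j \<in> I \<Longrightarrow> u \<bullet> \<iota> j = (if j = i then ide T (A i) else zr (A j) (A i))"
    using coprod_factor[OF assms(1) c(5)[OF assms(2)], of "\<lambda>j. if j = i then ide T (A i) else zr (A j) (A i)"] g by blast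
  then show ?thesis using that[of u] assms(2) by simp
qed

text \<open>The endomorphism erasing the summands indexed by \<open>F\<close>. As \<open>F\<close>
  may be any set, finite sets of erased indices can be enlarged and united without side
  conditions.\<close>

lemma coprod_drop:
  assumes "is_coproduct T I A P \<iota>"
  obtains d where "d \<in> Hom P P" "\<And>i. i \<in> I \<Longrightarrow> d \<bullet> \<iota> i = (if i \<in> F then zr (A i) P else \<iota> i)"
proof -
  note c = coprod_Hom[OF assms(1)]
  have "(if i \<in> F then zr (A i) P else \<iota> i) \<in> Hom (A i) P" if "i \<in> I" for i using c that by simp
  then show ?thesis
    using coprod_factor[OF assms(1) c(1), of "\<lambda>i. if i \<in> F then zr (A i) P else \<iota> i"] that by blast
qed

text \<open>Erasing one more summand subtracts the idempotent belonging to it. This lets an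
  induction over \<open>F\<close> restore the erased summands one at a time.\<close>

lemma coprod_drop_insert:
  assumes "is_coproduct T I A P \<iota>" "i \<in> I" "i \<notin> F"
    and p: "p \<in> Hom P (A i)" "p \<bullet> \<iota> i = ide T (A i)" "\<And>j. j \<in> I \<Longrightarrow> j \<noteq> i \<Longrightarrow> p \<bullet> \<iota> j = zr (A j) (A i)"
    and d: "d \<in> Hom P P" "\<And>j. j \<in> I \<Longrightarrow> d \<bullet> \<iota> j = (if j \<in> insert i F then zr (A j) P else \<iota> j)"
    and e: "e \<in> Hom P P" "\<And>j. j \<in> I \<Longrightarrow> e \<bullet> \<iota> j = (if j \<in> F then zr (A j) P else \<iota> j)"
  shows "e = \<iota> i \<bullet> p \<boxplus> d"
proof (rule coprod_eqI[OF assms(1)])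
  note c = coprod_Hom[OF assms(1)]
  have q: "\<iota> i \<bullet> p \<in> Hom P P" using p(1) c assms(2) by simp
  show "e \<in> Hom P P" "\<iota> i \<bullet> p \<boxplus> d \<in> Hom P P" using e(1) q d(1) by auto
  fix j assume j: "j \<in> I"
  have "(\<iota> i \<bullet> p \<boxplus> d) \<bullet> \<iota> j = (\<iota> i \<bullet> p) \<bullet> \<iota> j \<boxplus> d \<bullet> \<iota> j"
    by (rule cmp_add_l) (use q d(1) c j in auto)
  also have "(\<iota> i \<bullet> p) \<bullet> \<iota> j = \<iota> i \<bullet> (p \<bullet> \<iota> j)" using p(1) c assms(2) j by simp
  finally show "e \<bullet> \<iota> j = (\<iota> i \<bullet> p \<boxplus> d) \<bullet> \<iota> j"
    unfolding e(2)[OF j] d(2)[OF j] using p(2) p(3)[OF j] c assms(2,3) j by auto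
qed

end

context triangulated_category
begin

lemma coprod_sh:
  assumes "is_coproduct T I A P \<iota>"
  shows "is_coproduct T I (\<lambda>i. sh n (A i)) (sh n P) (\<lambda>i. sm n (\<iota> i))"
proof (rule is_coproductI)
  note c = coprod_Hom[OF assms]
  show "sh n P \<in> obj T" using c by simp
  show "sm n (\<iota> i) \<in> Hom (sh n (A i)) (sh n P)" if "i \<in> I" for i using c that by simp
  show "\<exists>u\<in>Hom (sh n P) Y. \<forall>i\<in>I. u \<bullet> sm n (\<iota> i) = g i"
    if Y: "Y \<in> obj T" and g: "\<And>i. i \<in> I \<Longrightarrow> g i \<in> Hom (sh n (A i)) Y" for Y g
  proof -
    have "sm (-n) (g i) \<in> Hom (A i) (sh (-n) Y)" if "i \<in> I" for i using g[OF that] c that by simp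
    then obtain u where u: "u \<in> Hom P (sh (-n) Y)" "\<And>i. i \<in> I \<Longrightarrow> u \<bullet> \<iota> i = sm (-n) (g i)"
      using coprod_factor[OF assms, of "sh (-n) Y" "\<lambda>i. sm (-n) (g i)"] Y by auto
    have "sm n u \<bullet> sm n (\<iota> i) = g i" if "i \<in> I" for i
    proof -
      have "sm n (u \<bullet> \<iota> i) = sm n (sm (-n) (g i))" using u(2)[OF that] by simp
      then show ?thesis using u(1) c that g[OF that] by simp
    qed
    then show ?thesis using u(1) Y by (intro bexI[of _ "sm n u"]) auto
  qed
  show "u = v" if uv: "u \<in> Hom (sh n P) Y" "v \<in> Hom (sh n P) Y"
    "\<And>i. i \<in> I \<Longrightarrow> u \<bullet> sm n (\<iota> i) = v \<bullet> sm n (\<iota> i)" for Y u v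
  proof -
    have "sm (-n) u = sm (-n) v"
    proof (rule coprod_eqI[OF assms])
      show "sm (-n) u \<in> Hom P (sh (-n) Y)" "sm (-n) v \<in> Hom P (sh (-n) Y)" using uv c by auto
      fix i assume i: "i \<in> I"
      have "sm (-n) (u \<bullet> sm n (\<iota> i)) = sm (-n) (v \<bullet> sm n (\<iota> i))" using uv(3)[OF i] by simp
      then show "sm (-n) u \<bullet> \<iota> i = sm (-n) v \<bullet> \<iota> i" using uv(1,2) c i by simp
    qed
    then show ?thesis using uv by (intro sm_inj[of u v]) auto
  qed
qed

lemma triang_obj: "triang (obj T)"
  unfolding triang_def using dist_obj by auto

lemma triang_Inter: "\<SS> \<noteq> {} \<Longrightarrow> (\<And>S. S \<in> \<SS> \<Longrightarrow> triang S) \<Longrightarrow> triang (\<Inter>\<SS>)"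
  unfolding triang_def by blast

end

section \<open>Compact objects\<close>

locale cocomplete_category = triangulated_category T for T :: "('o, 'm, 'r) linear_category" (structure) +
  fixes U :: "'u set"
  assumes universe: "universe U" and loc_small: "locally_small U T" and has_coproducts: "has_coproducts U T"
begin

lemma small_Hom: "small U (Hom X Y)"
proof (cases "X \<in> obj T \<and> Y \<in> obj T")
  case True
  then show ?thesis using loc_small unfolding locally_small_def Hom_def by simp
next
  case False
  then have "Hom X Y = {}" unfolding Hom_def by blast
  then show ?thesis using small_countable[OF universe, of "{}"] by simp
qed

lemma coprod_ex:
  assumes "small U J" "\<And>j. j \<in> J \<Longrightarrow> A j \<in> obj T"
  obtains P \<iota> where "is_coproduct T J A P \<iota>"
proof -
  obtain h where h: "inj_on h J" "h ` J \<subseteq> U" by (rule small_embeds[OF assms(1)])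
  have "\<forall>i \<in> h ` J. A (inv_into J h i) \<in> obj T" using assms(2) inv_into_into by metis
  then have "\<exists>P \<iota>. is_coproduct T (h ` J) (\<lambda>i. A (inv_into J h i)) P \<iota>"
    using small_image[OF assms(1)]
    by (intro has_coproducts[unfolded has_coproducts_def, rule_format, OF h(2)] conjI)
  then obtain P \<iota> where P: "is_coproduct T (h ` J) (\<lambda>i. A (inv_into J h i)) P \<iota>" by (elim exE)
  have "is_coproduct T J (\<lambda>j. A (inv_into J h (h j))) P (\<lambda>j. \<iota> (h j))"
    by (rule coprod_reindex[OF P]) (use h(1) in \<open>simp add: bij_betw_def\<close>)
  then have "is_coproduct T J A P (\<lambda>j. \<iota> (h j))" by (rule coprod_cong) (use h(1) in auto)
  then show ?thesis by (rule that)
qed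

text \<open>Compactness and closure under coproducts are stated for index sets inside
  \<open>U\<close>; the index sets arising below are merely small and have to be transported into
  \<open>U\<close>.\<close>

lemma coprod_to_universe:
  assumes "is_coproduct T J A P \<iota>" "small U J"
  obtains k where "inj_on k J" "k ` J \<subseteq> U" "small U (k ` J)"
    "is_coproduct T (k ` J) (\<lambda>i. A (inv_into J k i)) P (\<lambda>i. \<iota> (inv_into J k i))"
proof -
  obtain k where k: "inj_on k J" "k ` J \<subseteq> U" by (rule small_embeds[OF assms(2)])
  have "is_coproduct T (k ` J) (\<lambda>i. A (inv_into J k i)) P (\<lambda>i. \<iota> (inv_into J k i))"
    by (rule coprod_reindex[OF assms(1)]) (use k(1) in \<open>simp add: bij_betw_inv_into inj_on_imp_bij_betw\<close>)
  then show ?thesis using that k small_image[OF assms(2)] by blast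
qed

text \<open>
  Compactness without finite sums: a morphism into a coproduct vanishes after the endomorphism that
  drops finitely many summands.
\<close>

definition cpt :: "'o \<Rightarrow> bool" where
  "cpt C \<longleftrightarrow> C \<in> obj T \<and> (\<forall>I \<subseteq> U. \<forall>A P \<iota>. \<forall>f \<in> Hom C P. small U I \<and> is_coproduct T I A P \<iota> \<longrightarrow>
     (\<exists>F d. finite F \<and> d \<in> Hom P P \<and> (\<forall>i\<in>I. d \<bullet> \<iota> i = (if i \<in> F then zr (A i) P else \<iota> i)) \<and> d \<bullet> f = zr C P))"

context
  fixes I :: "'i set" and A P \<iota> C
  assumes cop: "is_coproduct T I A P \<iota>" and C: "C \<in> obj T"
begin

interpretation G: comm_group "hom_group T C P"
  by (rule mor_group[OF C coprod_Hom(1)[OF cop]])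

lemma iota_cmp_hom: "i \<in> I \<Longrightarrow> (\<lambda>h. \<iota> i \<bullet> h) \<in> hom (hom_group T C (A i)) (hom_group T C P)"
  using coprod_Hom[OF cop] C by (auto simp: hom_def carrier_hom_group cmp_add_r)

lemma sum_carrier_Hom:
  assumes "h \<in> carrier (sum_group I (\<lambda>i. hom_group T C (A i)))" "i \<in> I"
  shows "h i \<in> Hom C (A i)"
proof -
  have "group (hom_group T C (A i))" if "i \<in> I" for i
    by (rule comm_group.axioms(2)[OF mor_group[OF C coprod_Hom(5)[OF cop that]]])
  then have "h i \<in> carrier (hom_group T C (A i))" using assms by (auto simp: carrier_sum_group)
  then show ?thesis using carrier_hom_group C coprod_Hom(5)[OF cop assms(2)] by blast
qed

lemma sum_carrierI:
  assumes "\<And>i. i \<in> I \<Longrightarrow> x i \<in> Hom C (A i)" "finite F" "\<And>i. i \<in> I \<Longrightarrow> i \<notin> F \<Longrightarrow> x i = zr C (A i)"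
  shows "(\<lambda>i\<in>I. x i) \<in> carrier (sum_group I (\<lambda>i. hom_group T C (A i)))"
proof -
  have g: "group (hom_group T C (A i))" if "i \<in> I" for i
    by (rule comm_group.axioms(2)[OF mor_group[OF C coprod_Hom(5)[OF cop that]]])
  have "{i \<in> I. (\<lambda>i\<in>I. x i) i \<noteq> \<one>\<^bsub>hom_group T C (A i)\<^esub>} \<subseteq> F" using assms(3) by auto
  then have "finite {i \<in> I. (\<lambda>i\<in>I. x i) i \<noteq> \<one>\<^bsub>hom_group T C (A i)\<^esub>}" using assms(2) by (rule finite_subset)
  moreover have "(\<lambda>i\<in>I. x i) \<in> (\<Pi>\<^sub>E i\<in>I. carrier (hom_group T C (A i)))"
    using assms(1) carrier_hom_group C coprod_Hom(5)[OF cop] by (auto simp del: Hom_iff)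
  ultimately show ?thesis using carrier_sum_group[of I "\<lambda>i. hom_group T C (A i)"] g by blast
qed

lemma coprod_map_hom: "(\<lambda>h. gfinprod (hom_group T C P) (\<lambda>i. \<iota> i \<bullet> h i) I)
    \<in> hom (sum_group I (\<lambda>i. hom_group T C (A i))) (hom_group T C P)"
proof (rule G.hom_group_sum)
  show "(\<bullet>) (\<iota> i) \<in> hom (hom_group T C (A i)) (hom_group T C P)" if "i \<in> I" for i
    by (rule iota_cmp_hom[OF that])
  show "group (hom_group T C (A i))" if "i \<in> I" for i
    by (rule comm_group.axioms(2)[OF mor_group[OF C coprod_Hom(5)[OF cop that]]])
qed

text \<open>The product is a finite one over the nonzero terms, so it suffices that \<open>Q\<close>
  survives the addition of one term. The subset \<open>J\<close> allows a single index to be left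
  out.\<close>

lemma coprod_map_induct:
  assumes h: "h \<in> carrier (sum_group I (\<lambda>i. hom_group T C (A i)))" and "J \<subseteq> I"
    and "Q (zr C P)" "\<And>f i. Q f \<Longrightarrow> f \<in> Hom C P \<Longrightarrow> i \<in> J \<Longrightarrow> Q (\<iota> i \<bullet> h i \<boxplus> f)"
  shows "Q (gfinprod (hom_group T C P) (\<lambda>i. \<iota> i \<bullet> h i) J)"
proof -
  note c = coprod_Hom[OF cop]
  have grp: "group (hom_group T C (A i))" if "i \<in> I" for i
    by (rule comm_group.axioms(2)[OF mor_group[OF C c(5)[OF that]]])
  have hH: "h i \<in> Hom C (A i)" if "i \<in> I" for i
    by (rule sum_carrier_Hom[OF h that])
  have H: "\<iota> i \<bullet> h i \<in> Hom C P" if "i \<in> I" for i using hH[OF that] c that by auto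
  let ?S = "{i \<in> J. \<iota> i \<bullet> h i \<noteq> zr C P}"
  have "finite {i \<in> I. h i \<noteq> zr C (A i)}" using h by (auto simp: carrier_sum_group grp)
  then have fin: "finite ?S"
    by (rule finite_subset[rotated]) (use assms(2) c C in auto)
  have "Q (finprod (hom_group T C P) (\<lambda>i. \<iota> i \<bullet> h i) F) \<and> finprod (hom_group T C P) (\<lambda>i. \<iota> i \<bullet> h i) F \<in> Hom C P"
    if "finite F" "F \<subseteq> J" for F
    using that
  proof (induction F)
    case empty then show ?case using assms(3) C c by simp
  next
    case (insert i F)
    have 1: "finprod (hom_group T C P) (\<lambda>i. \<iota> i \<bullet> h i) (insert i F)
        = \<iota> i \<bullet> h i \<boxplus> finprod (hom_group T C P) (\<lambda>i. \<iota> i \<bullet> h i) F"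
      using insert.hyps insert.prems H assms(2) C c(1)
      by (subst G.finprod_insert) (auto simp: carrier_hom_group Pi_def simp del: Hom_iff)
    have "i \<in> J" "i \<in> I" using insert.prems assms(2) by auto
    then show ?case unfolding 1 using insert.IH insert.prems H[of i] assms(4) Hom_add by auto
  qed
  from this[OF fin] show ?thesis
    using fin by (auto simp: gfinprod_def)
qed

end

lemma compact_induct0:
  assumes "C \<in> compact_objects U T" "I \<subseteq> U" "small U I" "is_coproduct T I A P \<iota>" "f \<in> Hom C P"
    and "Q (zr C P)" "\<And>f i h. Q f \<Longrightarrow> f \<in> Hom C P \<Longrightarrow> i \<in> I \<Longrightarrow> h \<in> Hom C (A i) \<Longrightarrow> Q (\<iota> i \<bullet> h \<boxplus> f)"
  shows "Q f"
proof -
  note c = coprod_Hom[OF assms(4)]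
  have C: "C \<in> obj T" using assms(1) unfolding compact_objects_def by blast
  have "(\<lambda>h. gfinprod (hom_group T C P) (\<lambda>i. \<iota> i \<bullet> h i) I)
       \<in> iso (sum_group I (\<lambda>i. hom_group T C (A i))) (hom_group T C P)"
    using assms(1-4) unfolding compact_objects_def by blast
  then have "f \<in> (\<lambda>h. gfinprod (hom_group T C P) (\<lambda>i. \<iota> i \<bullet> h i) I) ` carrier (sum_group I (\<lambda>i. hom_group T C (A i)))"
    using assms(5) C c(1) by (auto simp: iso_def bij_betw_def carrier_hom_group simp del: Hom_iff)
  then obtain h where h: "h \<in> carrier (sum_group I (\<lambda>i. hom_group T C (A i)))"
    "f = gfinprod (hom_group T C P) (\<lambda>i. \<iota> i \<bullet> h i) I" by blast
  have grp: "group (hom_group T C (A i))" if "i \<in> I" for i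
    by (rule comm_group.axioms(2)[OF mor_group[OF C c(5)[OF that]]])
  have hH: "h i \<in> Hom C (A i)" if "i \<in> I" for i
    by (rule sum_carrier_Hom[OF assms(4) C h(1) that])
  show ?thesis unfolding h(2)
    by (rule coprod_map_induct[OF assms(4) C h(1) subset_refl]) (use assms(6,7) hH in auto)
qed

lemma compact_cpt:
  assumes "C \<in> compact_objects U T" shows "cpt C"
  unfolding cpt_def
proof (intro conjI allI impI ballI)
  show C: "C \<in> obj T" using assms unfolding compact_objects_def by blast
  fix I A P \<iota> f assume a: "I \<subseteq> U" "f \<in> Hom C P" and a': "small U I \<and> is_coproduct T I A P \<iota>"
  note a = a conjunct1[OF a'] conjunct2[OF a']
  note c = coprod_Hom[OF a(4)]
  show "\<exists>F d. finite F \<and> d \<in> Hom P P \<and> (\<forall>i\<in>I. d \<bullet> \<iota> i = (if i \<in> F then zr (A i) P else \<iota> i)) \<and> d \<bullet> f = zr C P"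
  proof (rule compact_induct0[OF assms a(1,3,4,2)])
    show "\<exists>F d. finite F \<and> d \<in> Hom P P \<and> (\<forall>i\<in>I. d \<bullet> \<iota> i = (if i \<in> F then zr (A i) P else \<iota> i)) \<and> d \<bullet> zr C P = zr C P"
      using c C by (intro exI[of _ "{}"] exI[of _ "ide T P"]) auto
  next
    fix f i h
    assume f: "f \<in> Hom C P" and i: "i \<in> I" and h: "h \<in> Hom C (A i)"
      and "\<exists>F d. finite F \<and> d \<in> Hom P P \<and> (\<forall>i\<in>I. d \<bullet> \<iota> i = (if i \<in> F then zr (A i) P else \<iota> i)) \<and> d \<bullet> f = zr C P"
    then obtain F d where F: "finite F" and d: "d \<in> Hom P P" "d \<bullet> f = zr C P"
      and d': "\<And>i. i \<in> I \<Longrightarrow> d \<bullet> \<iota> i = (if i \<in> F then zr (A i) P else \<iota> i)" by blast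
    obtain e where e: "e \<in> Hom P P" and e': "\<And>j. j \<in> I \<Longrightarrow> e \<bullet> \<iota> j = (if j \<in> insert i F then zr (A j) P else \<iota> j)"
      using coprod_drop[OF a(4), of "insert i F"] by blast
    \<comment> \<open>Erasing \<open>insert i F\<close> after erasing \<open>F\<close> is the same
      as erasing it alone, so \<open>e\<close> annihilates whatever \<open>d\<close>
      annihilates.\<close>
    have ed: "e \<bullet> d = e"
    proof (rule coprod_eqI[OF a(4)])
      show "e \<bullet> d \<in> Hom P P" "e \<in> Hom P P" using e d by auto
      fix j assume j: "j \<in> I"
      have "(e \<bullet> d) \<bullet> \<iota> j = e \<bullet> (d \<bullet> \<iota> j)" using e d c j by simp
      also have "\<dots> = e \<bullet> \<iota> j" unfolding d'[OF j] using e e'[OF j] c j by auto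
      finally show "(e \<bullet> d) \<bullet> \<iota> j = e \<bullet> \<iota> j" .
    qed
    have 1: "e \<bullet> f = e \<bullet> (d \<bullet> f)" using e d(1) f by (subst (1) ed[symmetric]) simp
    have 2: "e \<bullet> (\<iota> i \<bullet> h) = (e \<bullet> \<iota> i) \<bullet> h" using e h c i by simp
    have "e \<bullet> (\<iota> i \<bullet> h \<boxplus> f) = e \<bullet> (\<iota> i \<bullet> h) \<boxplus> e \<bullet> f"
      by (rule cmp_add_r) (use e f h c i in auto)
    also have "\<dots> = zr C P" unfolding 1 2 d(2) e'[OF i] using e h c i C by simp
    finally show "\<exists>F d. finite F \<and> d \<in> Hom P P \<and> (\<forall>i\<in>I. d \<bullet> \<iota> i = (if i \<in> F then zr (A i) P else \<iota> i)) \<and>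
        d \<bullet> (\<iota> i \<bullet> h \<boxplus> f) = zr C P"
      using F e e' by (intro exI[of _ "insert i F"] exI[of _ e]) auto
  qed
qed

lemma cpt_compact:
  assumes "cpt C" shows "C \<in> compact_objects U T"
  unfolding compact_objects_def
proof (intro CollectI conjI allI impI)
  show C: "C \<in> obj T" using assms unfolding cpt_def by blast
  fix I A P \<iota> assume a0: "I \<subseteq> U" and a': "small U I \<and> is_coproduct T I A P \<iota>"
  note a = a0 conjunct1[OF a'] conjunct2[OF a']
  note c = coprod_Hom[OF a(3)]
  let ?S = "sum_group I (\<lambda>i. hom_group T C (A i))" and ?H = "hom_group T C P"
  let ?\<phi> = "\<lambda>h. gfinprod (hom_group T C P) (\<lambda>i. \<iota> i \<bullet> h i) I"
  have grp: "group (hom_group T C (A i))" if "i \<in> I" for i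
    by (rule comm_group.axioms(2)[OF mor_group[OF C c(5)[OF that]]])
  interpret G: comm_group ?H by (rule mor_group[OF C c(1)])
  interpret S: group ?S using grp by simp
  have hom: "?\<phi> \<in> hom ?S ?H" by (rule coprod_map_hom[OF a(3) C])
  then interpret \<phi>: group_hom ?S ?H ?\<phi> by unfold_locales
  have HP: "carrier ?H = Hom C P" using C c(1) by (rule carrier_hom_group)
  have S_Hom: "h i \<in> Hom C (A i)" if "h \<in> carrier ?S" "i \<in> I" for h i
    by (rule sum_carrier_Hom[OF a(3) C that])
  have off: "p \<bullet> gfinprod ?H (\<lambda>i. \<iota> i \<bullet> h i) J = zr C (A j)"
    if h: "h \<in> carrier ?S" and J: "J \<subseteq> I" and p: "p \<in> Hom P (A j)"
      and pJ: "\<And>i. i \<in> J \<Longrightarrow> p \<bullet> \<iota> i = zr (A i) (A j)" for h J p j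
  proof (rule coprod_map_induct[OF a(3) C h J, of "\<lambda>f. p \<bullet> f = zr C (A j)"])
    show "p \<bullet> zr C P = zr C (A j)" using p C c by simp
    fix f i assume f: "p \<bullet> f = zr C (A j)" "f \<in> Hom C P" "i \<in> J"
    then have hi: "h i \<in> Hom C (A i)" "i \<in> I" using S_Hom[OF h] J by blast+
    have "p \<bullet> (\<iota> i \<bullet> h i \<boxplus> f) = p \<bullet> \<iota> i \<bullet> h i \<boxplus> p \<bullet> f"
      by (rule cmp_add_r) (use p f c hi in auto)
    also have "p \<bullet> \<iota> i \<bullet> h i = (p \<bullet> \<iota> i) \<bullet> h i" using p(1) c hi by simp
    finally show "p \<bullet> (\<iota> i \<bullet> h i \<boxplus> f) = zr C (A j)" unfolding pJ[OF f(3)] f(1) using hi C p by simp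
  qed
  \<comment> \<open>The coordinate \<open>h j\<close> is recovered from the sum by the projection
    onto \<open>A j\<close>, which annihilates all other terms by \<open>off\<close>.\<close>
  have inj: "inj_on ?\<phi> (carrier ?S)"
  proof (rule \<phi>.inj_on_one_iff[THEN iffD2], intro allI impI)
    fix h assume h: "h \<in> carrier ?S" and 0: "?\<phi> h = \<one>\<^bsub>?H\<^esub>"
    have "h j = zr C (A j)" if j: "j \<in> I" for j
    proof -
      obtain p where p: "p \<in> Hom P (A j)" "p \<bullet> \<iota> j = ide T (A j)" "\<And>i. i \<in> I \<Longrightarrow> i \<noteq> j \<Longrightarrow> p \<bullet> \<iota> i = zr (A i) (A j)"
        using coprod_proj[OF a(3) j] by blast
      let ?h' = "\<lambda>i\<in>I. if i = j then h j else zr C (A i)" and ?h0 = "\<lambda>i\<in>I. if i = j then zr C (A j) else h i"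
      have fin: "finite {i \<in> I. h i \<noteq> zr C (A i)}" using h by (auto simp: carrier_sum_group grp)
      have h': "?h' \<in> carrier ?S"
        by (rule sum_carrierI[OF a(3) C, of _ "{j}"]) (use S_Hom[OF h j] C c(5) in auto)
      have h0: "?h0 \<in> carrier ?S"
        by (rule sum_carrierI[OF a(3) C _ fin]) (use S_Hom[OF h] C c(5) in auto)
      have "h = ?h' \<otimes>\<^bsub>?S\<^esub> ?h0"
      proof
        show "h i = (?h' \<otimes>\<^bsub>?S\<^esub> ?h0) i" for i
          using h S_Hom[OF h, of i] j C c(5) by (auto simp: carrier_sum_group grp PiE_def extensional_def)
      qed
      then have "?\<phi> h = ?\<phi> ?h' \<boxplus> ?\<phi> ?h0" using \<phi>.hom_mult[OF h' h0] by simp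
      moreover have "?\<phi> ?h' = \<iota> j \<bullet> h j"
      proof -
        have "?\<phi> ?h' = finprod ?H (\<lambda>i. \<iota> i \<bullet> ?h' i) {j}" if "\<iota> j \<bullet> h j \<noteq> zr C P"
        proof -
          have "{i \<in> I. \<iota> i \<bullet> ?h' i \<noteq> zr C P} = {j}" using j c C that by auto
          then show ?thesis by (simp add: gfinprod_def)
        qed
        moreover have "?\<phi> ?h' = \<one>\<^bsub>?H\<^esub>" if "\<iota> j \<bullet> h j = zr C P"
        proof -
          have "{i \<in> I. \<iota> i \<bullet> ?h' i \<noteq> zr C P} = {}" using j c C that by auto
          then show ?thesis by (simp add: gfinprod_def)
        qed
        ultimately show ?thesis using j S_Hom[OF h j] c(1) c(2-5)[of j] C
          by (cases "\<iota> j \<bullet> h j = zr C P") (auto simp: carrier_hom_group)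
      qed
      moreover have "?\<phi> ?h0 = gfinprod ?H (\<lambda>i. \<iota> i \<bullet> ?h0 i) (I - {j})"
      proof -
        have "{i \<in> I. \<iota> i \<bullet> ?h0 i \<noteq> zr C P} = {i \<in> I - {j}. \<iota> i \<bullet> ?h0 i \<noteq> zr C P}" using c(2-5)[of j] C j by auto
        then show ?thesis by (simp add: gfinprod_def)
      qed
      ultimately have 1: "zr C P = \<iota> j \<bullet> h j \<boxplus> gfinprod ?H (\<lambda>i. \<iota> i \<bullet> ?h0 i) (I - {j})"
        using 0 by simp
      have 2: "gfinprod ?H (\<lambda>i. \<iota> i \<bullet> ?h0 i) (I - {j}) \<in> Hom C P"
        by (rule coprod_map_induct[OF a(3) C h0]) (use C c(1) S_Hom[OF h] c in auto)
      have "zr C (A j) = p \<bullet> zr C P" using p C c by simp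
      also have "\<dots> = p \<bullet> (\<iota> j \<bullet> h j) \<boxplus> p \<bullet> gfinprod ?H (\<lambda>i. \<iota> i \<bullet> ?h0 i) (I - {j})"
        unfolding 1 by (rule cmp_add_r) (use p 2 c j S_Hom[OF h j] in auto)
      also have "p \<bullet> gfinprod ?H (\<lambda>i. \<iota> i \<bullet> ?h0 i) (I - {j}) = zr C (A j)"
        by (rule off[OF h0 _ p(1)]) (use p(3) in auto)
      also have "p \<bullet> (\<iota> j \<bullet> h j) = (p \<bullet> \<iota> j) \<bullet> h j" using p(1) c j S_Hom[OF h j] by simp
      finally show ?thesis unfolding p(2) using S_Hom[OF h j] by simp
    qed
    then show "h = \<one>\<^bsub>?S\<^esub>" using h by (auto simp: carrier_sum_group grp PiE_def extensional_def)
  qed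
  have im_add: "x \<boxplus> y \<in> ?\<phi> ` carrier ?S" if xim: "x \<in> ?\<phi> ` carrier ?S" and yim: "y \<in> ?\<phi> ` carrier ?S" for x y
  proof -
    obtain a where a: "x = ?\<phi> a" "a \<in> carrier ?S" using xim by (rule imageE)
    obtain b where b: "y = ?\<phi> b" "b \<in> carrier ?S" using yim by (rule imageE)
    note ab = a(2) b(2) and xy = a(1) b(1)
    have "x \<boxplus> y = ?\<phi> (a \<otimes>\<^bsub>?S\<^esub> b)" unfolding \<phi>.hom_mult[OF ab] xy by simp
    then show ?thesis by (rule image_eqI[OF _ S.m_closed[OF ab]])
  qed
  have im_single: "\<iota> j \<bullet> x \<in> ?\<phi> ` carrier ?S" if j: "j \<in> I" and x: "x \<in> Hom C (A j)" for j x
  proof -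
    let ?h' = "\<lambda>i\<in>I. if i = j then x else zr C (A i)"
    have h': "?h' \<in> carrier ?S"
      by (rule sum_carrierI[OF a(3) C, of _ "{j}"]) (use x C c(5) in auto)
    have "?\<phi> ?h' = \<iota> j \<bullet> x"
    proof (cases "\<iota> j \<bullet> x = zr C P")
      case True
      then have "{i \<in> I. \<iota> i \<bullet> ?h' i \<noteq> zr C P} = {}" using j c C by auto
      then show ?thesis using True by (simp add: gfinprod_def)
    next
      case False
      then have "{i \<in> I. \<iota> i \<bullet> ?h' i \<noteq> zr C P} = {j}" using j c C by auto
      then show ?thesis using j x c(1) c(2-5)[of j] C by (auto simp: gfinprod_def carrier_hom_group)
    qed
    then show ?thesis by (rule image_eqI[OF sym h'])
  qed
  \<comment> \<open>Surjectivity by induction on the erased set. The idempotent \<open>?q\<close>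
    cuts out the summand \<open>i\<close>: the part \<open>?q \<bullet> f\<close> comes from a
    single coordinate, and the rest \<open>f \<boxminus> ?q \<bullet> f\<close> already vanishes
    when one index fewer is erased.\<close>
  have "f \<in> ?\<phi> ` carrier ?S"
    if "finite F" "f \<in> Hom C P" "d \<in> Hom P P" "\<forall>i\<in>I. d \<bullet> \<iota> i = (if i \<in> F then zr (A i) P else \<iota> i)" "d \<bullet> f = zr C P"
    for F f d
    using that
  proof (induction F arbitrary: f d)
    case empty
    have "d = ide T P" by (rule coprod_eqI[OF a(3)]) (use empty c in auto)
    then have "f = \<one>\<^bsub>?H\<^esub>" using empty by simp
    also have "\<dots> = ?\<phi> \<one>\<^bsub>?S\<^esub>" by (rule \<phi>.hom_one[symmetric])
    finally show ?case by (rule image_eqI[OF _ S.one_closed])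
  next
    case (insert i F)
    note d = insert.prems(2,4) and d' = bspec[OF insert.prems(3)]
    show ?case
    proof (cases "i \<in> I")
      case False
      then show ?thesis using insert.IH[OF insert.prems(1) d(1)] insert.prems by auto
    next
      case i: True
      obtain p where p: "p \<in> Hom P (A i)" "p \<bullet> \<iota> i = ide T (A i)" "\<And>j. j \<in> I \<Longrightarrow> j \<noteq> i \<Longrightarrow> p \<bullet> \<iota> j = zr (A j) (A i)"
        using coprod_proj[OF a(3) i] by blast
      obtain e where e: "e \<in> Hom P P" and e': "\<And>j. j \<in> I \<Longrightarrow> e \<bullet> \<iota> j = (if j \<in> F then zr (A j) P else \<iota> j)"
        using coprod_drop[OF a(3), of F] by blast
      let ?q = "\<iota> i \<bullet> p"
      have q: "?q \<in> Hom P P" using p c i by simp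
      have e_eq: "e = ?q \<boxplus> d"
        by (rule coprod_drop_insert[OF a(3) i insert.hyps(2) p d(1) d' e e'])
      have eq: "e \<bullet> ?q = ?q"
      proof -
        have "e \<bullet> ?q = (e \<bullet> \<iota> i) \<bullet> p" using e p c i by simp
        then show ?thesis unfolding e'[OF i] using insert.hyps(2) by simp
      qed
      have f: "f \<in> Hom C P" by fact
      have "(?q \<boxplus> d) \<bullet> f = ?q \<bullet> f \<boxplus> d \<bullet> f" by (rule cmp_add_l) (use q d f in auto)
      then have ef: "e \<bullet> f = ?q \<bullet> f" unfolding e_eq[symmetric] d(2) using q f by simp
      let ?f = "f \<boxminus> ?q \<bullet> f"
      have qf: "?q \<bullet> f \<in> Hom C P" using q f by simp
      have "e \<bullet> ?f = e \<bullet> f \<boxminus> e \<bullet> (?q \<bullet> f)" by (rule cmp_sb_right) (use e f qf in auto)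
      also have "e \<bullet> (?q \<bullet> f) = (e \<bullet> ?q) \<bullet> f" by (rule assoc[symmetric]) (use e q f in auto)
      finally have "e \<bullet> ?f = zr C P" unfolding ef eq using qf by simp
      then have 1: "?f \<in> ?\<phi> ` carrier ?S" using insert.IH[of ?f e] e e' f qf by simp
      have "?q \<bullet> f = \<iota> i \<bullet> (p \<bullet> f)" using p c i f by simp
      then have 2: "?q \<bullet> f \<in> ?\<phi> ` carrier ?S" using im_single[OF i, of "p \<bullet> f"] p f by simp
      have "f = ?f \<boxplus> ?q \<bullet> f" using f qf by simp
      then show ?thesis using im_add[OF 1 2] by simp
    qed
  qed
  note im = this
  have "f \<in> ?\<phi> ` carrier ?S" if f: "f \<in> Hom C P" for f
  proof -
    from cpt_def[THEN iffD1, OF assms, THEN conjunct2, rule_format, OF a0 f a']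
    obtain F d where F: "finite F" and d: "d \<in> Hom P P"
      "\<forall>i\<in>I. d \<bullet> \<iota> i = (if i \<in> F then zr (A i) P else \<iota> i)"
      "d \<bullet> f = zr C P" by (elim exE conjE)
    show ?thesis by (rule im[OF F f d])
  qed
  then have "carrier ?H \<subseteq> ?\<phi> ` carrier ?S" unfolding HP by (intro subsetI)
  moreover have "?\<phi> ` carrier ?S \<subseteq> carrier ?H" using \<phi>.hom_closed by (rule image_subsetI)
  ultimately have "?\<phi> ` carrier ?S = carrier ?H" by (intro subset_antisym)
  then show "?\<phi> \<in> iso ?S ?H" using hom inj unfolding iso_def bij_betw_def by (intro CollectI conjI)
qed

lemma compact_iff_cpt: "C \<in> compact_objects U T \<longleftrightarrow> cpt C"
  using cpt_compact compact_cpt by blast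

lemma cptD:
  assumes "cpt C" "f \<in> Hom C P" "I \<subseteq> U" "small U I" "is_coproduct T I A P \<iota>"
  obtains F d where "finite F" "d \<in> Hom P P" "\<And>i. i \<in> I \<Longrightarrow> d \<bullet> \<iota> i = (if i \<in> F then zr (A i) P else \<iota> i)"
    "d \<bullet> f = zr C P"
proof -
  from cpt_def[THEN iffD1, OF assms(1), THEN conjunct2, rule_format, OF assms(3,2) conjI[OF assms(4,5)]]
  show ?thesis using that by (elim exE conjE) blast
qed

lemma compact_obj: "C \<in> compact_objects U T \<Longrightarrow> C \<in> obj T"
  unfolding compact_objects_def by blast

text \<open>In a triangle \<open>X -> Y -> Z\<close> a morphism from \<open>Z\<close> becomes zero
  on \<open>Y\<close> once finitely many summands are erased. It then factors through the suspension
  of \<open>X\<close>, where erasing finitely many more makes it zero. This replaces the five lemma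
  for direct sums.\<close>

lemma compact_triang: "triang (compact_objects U T)"
  unfolding triang_def
proof (intro conjI allI impI ballI)
  show "compact_objects U T \<subseteq> obj T" using compact_obj by blast
  show "Z \<in> compact_objects U T" if Z: "is_zero T Z" for Z
    unfolding compact_iff_cpt cpt_def
  proof (intro conjI allI impI ballI)
    show "Z \<in> obj T" using Z by simp
    fix I A P \<iota> f
    assume f: "f \<in> Hom Z P" and a: "small U I \<and> is_coproduct T I A P \<iota>"
    note c = coprod_Hom[OF conjunct2[OF a]]
    show "\<exists>F d. finite F \<and> d \<in> Hom P P \<and> (\<forall>i\<in>I. d \<bullet> \<iota> i = (if i \<in> F then zr (A i) P else \<iota> i)) \<and> d \<bullet> f = zr Z P"
      using c from_zero[OF Z f] f by (intro exI[of _ "{}"] exI[of _ "ide T P"]) auto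
  qed
  show "sh n C \<in> compact_objects U T" if C: "C \<in> compact_objects U T" for C n
    unfolding compact_iff_cpt cpt_def
  proof (intro conjI allI impI ballI)
    have Co: "C \<in> obj T" by (rule compact_obj[OF C])
    then show "sh n C \<in> obj T" by simp
    fix I A P \<iota> f
    assume I: "I \<subseteq> U" and f: "f \<in> Hom (sh n C) P" and a: "small U I \<and> is_coproduct T I A P \<iota>"
    note c = coprod_Hom[OF conjunct2[OF a]]
    have f': "sm (-n) f \<in> Hom C (sh (-n) P)" using f Co by simp
    obtain F d where F: "finite F" and d: "d \<in> Hom (sh (-n) P) (sh (-n) P)"
      "\<And>i. i \<in> I \<Longrightarrow> d \<bullet> sm (-n) (\<iota> i) = (if i \<in> F then zr (sh (-n) (A i)) (sh (-n) P) else sm (-n) (\<iota> i))"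
      "d \<bullet> sm (-n) f = zr C (sh (-n) P)"
      using cptD[OF compact_cpt[OF C] f' I conjunct1[OF a] coprod_sh[OF conjunct2[OF a], of "-n"]] by blast
    show "\<exists>F d. finite F \<and> d \<in> Hom P P \<and> (\<forall>i\<in>I. d \<bullet> \<iota> i = (if i \<in> F then zr (A i) P else \<iota> i)) \<and> d \<bullet> f = zr (sh n C) P"
    proof (intro exI[of _ F] exI[of _ "sm n d"] conjI ballI)
      show "finite F" by (rule F)
      show "sm n d \<in> Hom P P" using d(1) c by simp
      show "sm n d \<bullet> \<iota> i = (if i \<in> F then zr (A i) P else \<iota> i)" if i: "i \<in> I" for i
      proof -
        have "sm n d \<bullet> \<iota> i = sm n (d \<bullet> sm (-n) (\<iota> i))" using d(1) c i by simp
        then show ?thesis unfolding d(2)[OF i] using c i by auto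
      qed
      have "sm n d \<bullet> f = sm n (d \<bullet> sm (-n) f)" using d(1) c f by simp
      then show "sm n d \<bullet> f = zr (sh n C) P" unfolding d(3) using c Co by simp
    qed
  qed
  show "Z \<in> compact_objects U T"
    if xyz: "dist X Y Z" and X: "X \<in> compact_objects U T" and Y: "Y \<in> compact_objects U T" for X Y Z
    unfolding compact_iff_cpt cpt_def
  proof (intro conjI allI impI ballI)
    have sX: "sh 1 X \<in> compact_objects U T"
      using \<open>\<And>n C. C \<in> compact_objects U T \<Longrightarrow> sh n C \<in> compact_objects U T\<close> X by blast
    obtain a b c where t: "tri3 X Y Z a b c" using xyz unfolding dist_def by blast
    note T = tri3_Hom[OF t]
    show "Z \<in> obj T" by (rule T)
    fix I A P \<iota> f
    assume I: "I \<subseteq> U" and f: "f \<in> Hom Z P" and cop: "small U I \<and> is_coproduct T I A P \<iota>"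
    note k = coprod_Hom[OF conjunct2[OF cop]]
    have "f \<bullet> b \<in> Hom Y P" using f T by simp
    then obtain F d where F: "finite F" and d: "d \<in> Hom P P"
      "\<And>i. i \<in> I \<Longrightarrow> d \<bullet> \<iota> i = (if i \<in> F then zr (A i) P else \<iota> i)" "d \<bullet> (f \<bullet> b) = zr Y P"
      using cptD[OF compact_cpt[OF Y] _ I conjunct1[OF cop] conjunct2[OF cop]] by blast
    have "(d \<bullet> f) \<bullet> b = zr Y P" using d f T by simp
    then obtain g where g: "g \<in> Hom (sh 1 X) P" "d \<bullet> f = g \<bullet> c"
      by (rule weak_cokernel2[OF t]) (use d(1) f in auto)
    obtain F' d' where F': "finite F'" and d': "d' \<in> Hom P P"
      "\<And>i. i \<in> I \<Longrightarrow> d' \<bullet> \<iota> i = (if i \<in> F' then zr (A i) P else \<iota> i)" "d' \<bullet> g = zr (sh 1 X) P"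
      using cptD[OF compact_cpt[OF sX] g(1) I conjunct1[OF cop] conjunct2[OF cop]] by blast
    show "\<exists>F d. finite F \<and> d \<in> Hom P P \<and> (\<forall>i\<in>I. d \<bullet> \<iota> i = (if i \<in> F then zr (A i) P else \<iota> i)) \<and> d \<bullet> f = zr Z P"
    proof (intro exI[of _ "F \<union> F'"] exI[of _ "d' \<bullet> d"] conjI ballI)
      show "finite (F \<union> F')" using F F' by simp
      show "d' \<bullet> d \<in> Hom P P" using d(1) d'(1) by simp
      show "(d' \<bullet> d) \<bullet> \<iota> i = (if i \<in> F \<union> F' then zr (A i) P else \<iota> i)" if i: "i \<in> I" for i
      proof -
        have "(d' \<bullet> d) \<bullet> \<iota> i = d' \<bullet> (d \<bullet> \<iota> i)" using d(1) d'(1) k i by simp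
        then show ?thesis unfolding d(2)[OF i] using d'(1) d'(2)[OF i] k i by auto
      qed
      have "(d' \<bullet> d) \<bullet> f = d' \<bullet> (d \<bullet> f)" using d(1) d'(1) f by simp
      also have "\<dots> = (d' \<bullet> g) \<bullet> c" unfolding g(2) using d'(1) g(1) T by simp
      finally show "(d' \<bullet> d) \<bullet> f = zr Z P" unfolding d'(3) using T k by simp
    qed
  qed
qed

lemma compact_induct:
  assumes "C \<in> compact_objects U T" "small U J" "is_coproduct T J A P \<iota>" "f \<in> Hom C P"
    and "Q (zr C P)" "\<And>f i h. Q f \<Longrightarrow> f \<in> Hom C P \<Longrightarrow> i \<in> J \<Longrightarrow> h \<in> Hom C (A i) \<Longrightarrow> Q (\<iota> i \<bullet> h \<boxplus> f)"
  shows "Q f"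
proof -
  obtain k where k: "inj_on k J" "k ` J \<subseteq> U" "small U (k ` J)"
    and c: "is_coproduct T (k ` J) (\<lambda>i. A (inv_into J k i)) P (\<lambda>i. \<iota> (inv_into J k i))"
    by (rule coprod_to_universe[OF assms(3,2)])
  show ?thesis
    by (rule compact_induct0[OF assms(1) k(2,3) c assms(4), of Q, OF assms(5)])
      (rule assms(6), auto simp: k(1))
qed

text \<open>A morphism into a coproduct is in general not determined by its coordinates, but from a
  compact object it is: it dies after erasing finitely many summands, and restoring them one at a
  time adds only terms through a projection, which vanish by assumption.\<close>

lemma compact_proj_zero:
  assumes "C \<in> compact_objects U T" "small U J" "is_coproduct T J A P \<iota>" "f \<in> Hom C P"
    and z: "\<And>i p. i \<in> J \<Longrightarrow> p \<in> Hom P (A i) \<Longrightarrow> p \<bullet> \<iota> i = ide T (A i) \<Longrightarrow>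
      (\<And>j. j \<in> J \<Longrightarrow> j \<noteq> i \<Longrightarrow> p \<bullet> \<iota> j = zr (A j) (A i)) \<Longrightarrow> p \<bullet> f = zr C (A i)"
  shows "f = zr C P"
proof -
  note c = coprod_Hom[OF assms(3)]
  have C: "C \<in> obj T" by (rule compact_obj[OF assms(1)])
  have "\<exists>F d. finite F \<and> d \<in> Hom P P \<and> (\<forall>i\<in>J. d \<bullet> \<iota> i = (if i \<in> F then zr (A i) P else \<iota> i)) \<and> d \<bullet> f = zr C P"
  proof (rule compact_induct[OF assms(1-4)])
    show "\<exists>F d. finite F \<and> d \<in> Hom P P \<and> (\<forall>i\<in>J. d \<bullet> \<iota> i = (if i \<in> F then zr (A i) P else \<iota> i)) \<and> d \<bullet> zr C P = zr C P"
      using c C by (intro exI[of _ "{}"] exI[of _ "ide T P"]) auto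
  next
    fix f i h
    assume f: "f \<in> Hom C P" and i: "i \<in> J" and h: "h \<in> Hom C (A i)"
      and "\<exists>F d. finite F \<and> d \<in> Hom P P \<and> (\<forall>i\<in>J. d \<bullet> \<iota> i = (if i \<in> F then zr (A i) P else \<iota> i)) \<and> d \<bullet> f = zr C P"
    then obtain F d where F: "finite F" and d: "d \<in> Hom P P" "d \<bullet> f = zr C P"
      and d': "\<And>i. i \<in> J \<Longrightarrow> d \<bullet> \<iota> i = (if i \<in> F then zr (A i) P else \<iota> i)" by blast
    obtain e where e: "e \<in> Hom P P" and e': "\<And>j. j \<in> J \<Longrightarrow> e \<bullet> \<iota> j = (if j \<in> insert i F then zr (A j) P else \<iota> j)"
      using coprod_drop[OF assms(3), of "insert i F"] by blast
    have ed: "e \<bullet> d = e"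
    proof (rule coprod_eqI[OF assms(3)])
      show "e \<bullet> d \<in> Hom P P" "e \<in> Hom P P" using e d by auto
      fix j assume j: "j \<in> J"
      have "(e \<bullet> d) \<bullet> \<iota> j = e \<bullet> (d \<bullet> \<iota> j)" using e d c j by simp
      also have "\<dots> = e \<bullet> \<iota> j" unfolding d'[OF j] using e e'[OF j] c j by auto
      finally show "(e \<bullet> d) \<bullet> \<iota> j = e \<bullet> \<iota> j" .
    qed
    have 1: "e \<bullet> f = e \<bullet> (d \<bullet> f)" using e d(1) f by (subst (1) ed[symmetric]) simp
    have 2: "e \<bullet> (\<iota> i \<bullet> h) = (e \<bullet> \<iota> i) \<bullet> h" using e h c i by simp
    have "e \<bullet> (\<iota> i \<bullet> h \<boxplus> f) = e \<bullet> (\<iota> i \<bullet> h) \<boxplus> e \<bullet> f"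
      by (rule cmp_add_r) (use e f h c i in auto)
    also have "\<dots> = zr C P" unfolding 1 2 d(2) e'[OF i] using e h c i C by simp
    finally show "\<exists>F d. finite F \<and> d \<in> Hom P P \<and> (\<forall>i\<in>J. d \<bullet> \<iota> i = (if i \<in> F then zr (A i) P else \<iota> i)) \<and>
        d \<bullet> (\<iota> i \<bullet> h \<boxplus> f) = zr C P"
      using F e e' by (intro exI[of _ "insert i F"] exI[of _ e]) auto
  qed
  then obtain F d where F: "finite F" and d: "d \<in> Hom P P" "d \<bullet> f = zr C P"
    and d': "\<And>i. i \<in> J \<Longrightarrow> d \<bullet> \<iota> i = (if i \<in> F then zr (A i) P else \<iota> i)" by blast
  from F d d' show ?thesis
  proof (induction F arbitrary: d)
    case empty
    have "d = ide T P" by (rule coprod_eqI[OF assms(3)]) (use empty c in auto)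
    then show ?case using empty assms(4) by simp
  next
    case (insert i F)
    show ?case
    proof (cases "i \<in> J")
      case False
      show ?thesis by (rule insert.IH[OF insert.prems(1,2)]) (use insert.prems(3) False in auto)
    next
      case i: True
      obtain p where p: "p \<in> Hom P (A i)" "p \<bullet> \<iota> i = ide T (A i)" "\<And>j. j \<in> J \<Longrightarrow> j \<noteq> i \<Longrightarrow> p \<bullet> \<iota> j = zr (A j) (A i)"
        using coprod_proj[OF assms(3) i] by blast
      obtain e where e: "e \<in> Hom P P" and e': "\<And>j. j \<in> J \<Longrightarrow> e \<bullet> \<iota> j = (if j \<in> F then zr (A j) P else \<iota> j)"
        using coprod_drop[OF assms(3), of F] by blast
      have e_eq: "e = \<iota> i \<bullet> p \<boxplus> d"
        by (rule coprod_drop_insert[OF assms(3) i insert.hyps(2) p insert.prems(1,3) e e'])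
      have "e \<bullet> f = (\<iota> i \<bullet> p) \<bullet> f \<boxplus> d \<bullet> f"
        unfolding e_eq by (rule cmp_add_l) (use p(1) c i insert.prems(1) assms(4) in auto)
      also have "(\<iota> i \<bullet> p) \<bullet> f = \<iota> i \<bullet> (p \<bullet> f)" using p(1) c i assms(4) by simp
      finally have "e \<bullet> f = \<iota> i \<bullet> (p \<bullet> f) \<boxplus> d \<bullet> f" .
      moreover have "p \<bullet> f = zr C (A i)" using z[OF i p(1,2)] p(3) by blast
      ultimately have "e \<bullet> f = zr C P" unfolding insert.prems(2) using c i C by simp
      then show ?thesis using insert.IH[OF e _ e'] by blast
    qed
  qed
qed

section \<open>Localizing subcategories and orthogonality\<close>

lemma localizingD: "localizing U T S \<Longrightarrow> triang S"
  unfolding localizing_def triang_iff by blast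

lemma localizing_coprod:
  assumes "localizing U T S" "small U J" "\<And>j. j \<in> J \<Longrightarrow> A j \<in> S" "is_coproduct T J A P \<iota>"
  shows "P \<in> S"
proof -
  obtain k where k: "inj_on k J" "k ` J \<subseteq> U" "small U (k ` J)"
    and c: "is_coproduct T (k ` J) (\<lambda>i. A (inv_into J k i)) P (\<lambda>i. \<iota> (inv_into J k i))"
    by (rule coprod_to_universe[OF assms(4,2)])
  have A: "\<forall>i\<in>k ` J. A (inv_into J k i) \<in> S" using assms(3) k(1) by simp
  have "closed_under_coproducts U T S" using assms(1) by (simp add: localizing_def)
  from this[unfolded closed_under_coproducts_def, rule_format, OF k(2) conjI[OF k(3) conjI[OF A c]]]
  show ?thesis .
qed

lemma localizingI:
  assumes "triang S"
    "\<And>(I :: 'u set) A P \<iota>. I \<subseteq> U \<Longrightarrow> small U I \<Longrightarrow> (\<And>i. i \<in> I \<Longrightarrow> A i \<in> S) \<Longrightarrow> is_coproduct T I A P \<iota> \<Longrightarrow> P \<in> S"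
  shows "localizing U T S"
  unfolding localizing_def closed_under_coproducts_def triang_iff
proof (intro conjI allI impI, goal_cases)
  case 1 show ?case by (rule assms(1))
next
  case (2 I A P \<iota>)
  then have "small U I" "\<And>i. i \<in> I \<Longrightarrow> A i \<in> S" "is_coproduct T I A P \<iota>" by auto
  then show ?case by (rule assms(2)[OF 2(1)])
qed

lemma localizing_obj: "localizing U T (obj T)"
  by (rule localizingI[OF triang_obj]) (rule coprod_Hom(1))

lemma Loc_least: "localizing U T S \<Longrightarrow> C \<subseteq> S \<Longrightarrow> Loc U T C \<subseteq> S"
  unfolding Loc_def by blast

lemma Loc_incl: "C \<subseteq> Loc U T C"
  unfolding Loc_def by blast

lemma Loc_localizing: assumes "C \<subseteq> obj T" shows "localizing U T (Loc U T C)"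
proof (rule localizingI)
  show "triang (Loc U T C)" unfolding Loc_def
    by (rule triang_Inter) (use localizing_obj assms localizingD in auto)
  fix I :: "'u set" and A P \<iota>
  assume a: "I \<subseteq> U" "small U I" "\<And>i. i \<in> I \<Longrightarrow> A i \<in> Loc U T C" "is_coproduct T I A P \<iota>"
  have "P \<in> S" if S: "localizing U T S" "C \<subseteq> S" for S
    by (rule localizing_coprod[OF S(1) a(2) _ a(4)]) (use a(3) S in \<open>auto simp: Loc_def\<close>)
  then show "P \<in> Loc U T C" unfolding Loc_def by blast
qed

text \<open>All suspensions of \<open>G\<close> are built in, so the orthogonal objects form a
  triangulated subcategory although \<open>G\<close> is just a set of objects.\<close>

definition orth :: "'o set \<Rightarrow> 'o \<Rightarrow> bool" where
  "orth G W \<longleftrightarrow> W \<in> obj T \<and> (\<forall>Y\<in>G. \<forall>n. \<forall>f\<in>Hom (sh n Y) W. f = zr (sh n Y) W)"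

lemma orthD: "orth G W \<Longrightarrow> Y \<in> G \<Longrightarrow> f \<in> Hom (sh n Y) W \<Longrightarrow> f = zr (sh n Y) W"
  unfolding orth_def by blast

lemma orthD0: "orth G W \<Longrightarrow> Y \<in> G \<Longrightarrow> f \<in> Hom Y W \<Longrightarrow> f = zr Y W"
  using orthD[of G W Y f 0] by simp

lemma orth_obj: "orth G W \<Longrightarrow> W \<in> obj T" unfolding orth_def by blast

lemma orth_subset: "orth G W \<Longrightarrow> H \<subseteq> G \<Longrightarrow> orth H W" unfolding orth_def by blast

lemma orthI:
  "W \<in> obj T \<Longrightarrow> (\<And>Y n f. Y \<in> G \<Longrightarrow> f \<in> Hom (sh n Y) W \<Longrightarrow> f = zr (sh n Y) W) \<Longrightarrow> orth G W"
  unfolding orth_def by (intro conjI ballI allI)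

text \<open>With \<open>W\<close> fixed and the other object varying one gets a localizing
  subcategory; this is how orthogonality spreads from \<open>G\<close> to
  \<open>Loc U T G\<close>.\<close>

definition left_orth :: "'o \<Rightarrow> 'o set" where "left_orth W = {Y \<in> obj T. orth {Y} W}"

lemma left_orthD: "Y \<in> left_orth W \<Longrightarrow> f \<in> Hom (sh n Y) W \<Longrightarrow> f = zr (sh n Y) W"
  unfolding left_orth_def using orthD[of "{Y}" W Y f n] by simp

lemma left_orthI:
  "Y \<in> obj T \<Longrightarrow> W \<in> obj T \<Longrightarrow> (\<And>n f. f \<in> Hom (sh n Y) W \<Longrightarrow> f = zr (sh n Y) W) \<Longrightarrow> Y \<in> left_orth W"
  unfolding left_orth_def orth_def by simp

lemma left_orth_obj: "Y \<in> left_orth W \<Longrightarrow> Y \<in> obj T" unfolding left_orth_def by simp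

lemma localizing_left_orth:
  assumes W: "W \<in> obj T"
  shows "localizing U T (left_orth W)"
proof (rule localizingI)
  show "triang (left_orth W)"
    unfolding triang_def
  proof (intro conjI allI impI ballI)
    show "left_orth W \<subseteq> obj T" using left_orth_obj by (rule subsetI)
    show "Z \<in> left_orth W" if Z: "is_zero T Z" for Z
      by (rule left_orthI[OF zero_obj[OF Z] W]) (rule from_zero[OF is_zero_sh[OF Z]])
    show "sh n X \<in> left_orth W" if X: "X \<in> left_orth W" for X n
    proof (rule left_orthI[OF _ W])
      have Xo: "X \<in> obj T" by (rule left_orth_obj[OF X])
      then show "sh n X \<in> obj T" by simp
      fix m f assume "f \<in> Hom (sh m (sh n X)) W"
      then have "f \<in> Hom (sh (m + n) X) W" using Xo by simp
      then have "f = zr (sh (m + n) X) W" by (rule left_orthD[OF X])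
      then show "f = zr (sh m (sh n X)) W" using Xo by simp
    qed
    show "Z \<in> left_orth W" if d: "dist X Y Z" and X: "X \<in> left_orth W" and Y: "Y \<in> left_orth W" for X Y Z
    proof (rule left_orthI[OF _ W])
      have Xo: "X \<in> obj T" by (rule left_orth_obj[OF X])
      show "Z \<in> obj T" using dist_obj[OF d] by simp
      fix n f assume f: "f \<in> Hom (sh n Z) W"
      obtain a b c where t: "tri3 (sh n X) (sh n Y) (sh n Z) a b c"
        using dist_sh[OF d] unfolding dist_def by blast
      note T = tri3_Hom[OF t]
      have "f \<bullet> b \<in> Hom (sh n Y) W" using f T by simp
      then have "f \<bullet> b = zr (sh n Y) W" by (rule left_orthD[OF Y])
      then obtain l where l: "l \<in> Hom (sh 1 (sh n X)) W" "f = l \<bullet> c"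
        by (rule weak_cokernel2[OF t]) (use f in auto)
      have "l \<in> Hom (sh (1 + n) X) W" using l(1) Xo by simp
      then have "l = zr (sh (1 + n) X) W" by (rule left_orthD[OF X])
      then show "f = zr (sh n Z) W" using l(2) T W Xo by simp
    qed
  qed
  fix I :: "'u set" and A P \<iota>
  assume a: "\<And>i. i \<in> I \<Longrightarrow> A i \<in> left_orth W" "is_coproduct T I A P \<iota>"
  note c = coprod_Hom[OF a(2)]
  show "P \<in> left_orth W"
  proof (rule left_orthI[OF c(1) W])
    fix n f assume f: "f \<in> Hom (sh n P) W"
    show "f = zr (sh n P) W"
    proof (rule coprod_eqI[OF coprod_sh[OF a(2)] f])
      show "zr (sh n P) W \<in> Hom (sh n P) W" using c(1) W by simp
      fix i assume i: "i \<in> I"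
      have "f \<bullet> sm n (\<iota> i) \<in> Hom (sh n (A i)) W" using f c i by simp
      then have "f \<bullet> sm n (\<iota> i) = zr (sh n (A i)) W" by (rule left_orthD[OF a(1)[OF i]])
      then show "f \<bullet> sm n (\<iota> i) = zr (sh n P) W \<bullet> sm n (\<iota> i)" using c i W by simp
    qed
  qed
qed

lemma orth_Loc:
  assumes "G \<subseteq> obj T" "orth G W" shows "orth (Loc U T G) W"
proof (rule orthI)
  have W: "W \<in> obj T" by (rule orth_obj[OF assms(2)])
  then show "W \<in> obj T" .
  have "G \<subseteq> left_orth W"
    by (rule subsetI, rule left_orthI) (use assms(1) W orthD[OF assms(2)] in blast)+
  then have "Loc U T G \<subseteq> left_orth W" by (rule Loc_least[OF localizing_left_orth[OF W]])
  then show "f = zr (sh n Y) W" if "Y \<in> Loc U T G" "f \<in> Hom (sh n Y) W" for Y n f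
    using left_orthD that by blast
qed

lemma orth_self_zero: assumes "orth S X" "X \<in> S" shows "is_zero T X"
  using orthD0[OF assms ide_Hom] orth_obj[OF assms(1)] by (intro is_zeroI)

lemma orth_zero: "is_zero T X \<Longrightarrow> orth S X"
  by (rule orthI) (rule zero_obj, assumption, rule to_zero)

lemma orth_sh: assumes "orth G W" "G \<subseteq> obj T" shows "orth G (sh m W)"
  unfolding orth_def
proof (intro conjI ballI allI)
  have W: "W \<in> obj T" by (rule orth_obj[OF assms(1)])
  then show "sh m W \<in> obj T" by simp
  fix Y n f assume Y: "Y \<in> G" and f: "f \<in> Hom (sh n Y) (sh m W)"
  have Yo: "Y \<in> obj T" using assms(2) Y by blast
  have "sm (-m) f \<in> Hom (sh (-m + n) Y) W" using f W Yo by simp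
  then have "sm (-m) f = zr (sh (-m + n) Y) W" by (rule orthD[OF assms(1) Y])
  then have "sm m (sm (-m) f) = zr (sh n Y) (sh m W)" using W Yo by simp
  then show "f = zr (sh n Y) (sh m W)" using f by simp
qed

lemma orth_dist: assumes "dist X Y Z" "orth G X" "orth G Y" "G \<subseteq> obj T" shows "orth G Z"
  unfolding orth_def
proof (intro conjI ballI allI)
  obtain a b c where t: "tri3 X Y Z a b c" using assms(1) unfolding dist_def by blast
  note T = tri3_Hom[OF t]
  show "Z \<in> obj T" by (rule T)
  fix V n f assume V: "V \<in> G" and f: "f \<in> Hom (sh n V) Z"
  have Vo: "V \<in> obj T" using assms(4) V by blast
  have "c \<bullet> f \<in> Hom (sh n V) (sh 1 X)" using f T by simp
  then have "c \<bullet> f = zr (sh n V) (sh 1 X)" by (rule orthD[OF orth_sh[OF assms(2,4)] V])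
  then obtain l where l: "l \<in> Hom (sh n V) Y" "f = b \<bullet> l"
    by (rule weak_kernel2[OF t]) (use f in auto)
  have "l = zr (sh n V) Y" by (rule orthD[OF assms(3) V l(1)])
  then show "f = zr (sh n V) Z" unfolding l(2) using T Vo by simp
qed

lemma triang_orth: assumes "G \<subseteq> obj T" shows "triang {W. orth G W}"
  unfolding triang_def
proof (intro conjI allI impI ballI)
  show "{W. orth G W} \<subseteq> obj T" using orth_obj by blast
  show "Z \<in> {W. orth G W}" if "is_zero T Z" for Z using orth_zero[OF that] by simp
  show "sh n X \<in> {W. orth G W}" if "X \<in> {W. orth G W}" for X n using orth_sh[OF _ assms] that by simp
  show "Z \<in> {W. orth G W}" if "dist X Y Z" "X \<in> {W. orth G W}" "Y \<in> {W. orth G W}" for X Y Z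
    using orth_dist[OF that(1) _ _ assms] that(2,3) by simp
qed

text \<open>A morphism from a compact object to a coproduct is a finite sum of morphisms through the
  summands, each of which vanishes.\<close>

lemma localizing_orth:
  assumes "G \<subseteq> compact_objects U T" shows "localizing U T {W. orth G W}"
proof (rule localizingI[OF triang_orth])
  show "G \<subseteq> obj T" using assms compact_obj by blast
  fix I :: "'u set" and A P \<iota>
  assume a: "small U I" "\<And>i. i \<in> I \<Longrightarrow> A i \<in> {W. orth G W}" "is_coproduct T I A P \<iota>"
  note c = coprod_Hom[OF a(3)]
  have "f = zr (sh n V) P" if V: "V \<in> G" and f: "f \<in> Hom (sh n V) P" for f n V
  proof (rule compact_induct[OF _ a(1,3) f])
    show sV: "sh n V \<in> compact_objects U T" using triangD(3)[OF compact_triang] V assms by blast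
    show "zr (sh n V) P = zr (sh n V) P" ..
    fix f i h assume h: "f = zr (sh n V) P" "i \<in> I" "h \<in> Hom (sh n V) (A i)"
    have "orth G (A i)" using a(2)[OF h(2)] by simp
    then have "h = zr (sh n V) (A i)" by (rule orthD[OF _ V h(3)])
    then show "\<iota> i \<bullet> h \<boxplus> f = zr (sh n V) P" using h c compact_obj[OF sV] by simp
  qed
  then show "P \<in> {W. orth G W}" using orthI[OF c(1)] by blast
qed

lemma prod_Hom:
  assumes "is_product T I A P \<pi>"
  shows "P \<in> obj T" "i \<in> I \<Longrightarrow> \<pi> i \<in> Hom P (A i)"
proof -
  show 1: "P \<in> obj T" using assms unfolding is_product_def by (elim conjE)
  have 2: "\<forall>i\<in>I. A i \<in> obj T \<and> \<pi> i \<in> mor T P (A i)"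
    using assms unfolding is_product_def by (elim conjE)
  show "i \<in> I \<Longrightarrow> \<pi> i \<in> Hom P (A i)" using 1 2 unfolding Hom_def by blast
qed

lemma prod_eqI:
  assumes "is_product T I A P \<pi>" "u \<in> Hom Y P" "v \<in> Hom Y P" "\<And>i. i \<in> I \<Longrightarrow> \<pi> i \<bullet> u = \<pi> i \<bullet> v"
  shows "u = v"
proof -
  have "\<forall>i\<in>I. \<pi> i \<bullet> u \<in> mor T Y (A i)"
    using assms(2) prod_Hom[OF assms(1)] by (auto simp: mor_iff)
  moreover have Y: "Y \<in> obj T" using assms(2) by simp
  moreover have "\<forall>Y\<in>obj T. \<forall>g. (\<forall>i\<in>I. g i \<in> mor T Y (A i)) \<longrightarrow>
      (\<exists>!u. u \<in> mor T Y P \<and> (\<forall>i\<in>I. \<pi> i \<bullet> u = g i))"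
    using assms(1) unfolding is_product_def by (elim conjE)
  ultimately have "\<exists>!w. w \<in> mor T Y P \<and> (\<forall>i\<in>I. \<pi> i \<bullet> w = \<pi> i \<bullet> u)"
    by (elim ballE[of _ _ Y] allE[of _ "\<lambda>i. \<pi> i \<bullet> u"]) auto
  moreover have "u \<in> mor T Y P" "v \<in> mor T Y P" using assms(2,3) unfolding Hom_def by blast+
  ultimately show ?thesis using assms(4) by metis
qed

lemma prod_factor:
  assumes "is_product T I A P \<pi>" "Y \<in> obj T" "\<And>i. i \<in> I \<Longrightarrow> g i \<in> Hom Y (A i)"
  obtains u where "u \<in> Hom Y P" "\<And>i. i \<in> I \<Longrightarrow> \<pi> i \<bullet> u = g i"
proof -
  have g: "\<forall>i\<in>I. g i \<in> mor T Y (A i)" using assms(3) unfolding Hom_def by blast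
  have "\<forall>Y\<in>obj T. \<forall>g. (\<forall>i\<in>I. g i \<in> mor T Y (A i)) \<longrightarrow>
      (\<exists>!u. u \<in> mor T Y P \<and> (\<forall>i\<in>I. \<pi> i \<bullet> u = g i))"
    using assms(1) unfolding is_product_def by (elim conjE)
  from this[THEN bspec, OF assms(2), THEN spec, THEN mp, OF g]
  obtain u where "u \<in> mor T Y P" "\<forall>i\<in>I. \<pi> i \<bullet> u = g i" by blast
  then show ?thesis using that[of u] assms(2) prod_Hom(1)[OF assms(1)] unfolding Hom_def by blast
qed

lemma orth_products:
  assumes "G \<subseteq> obj T" "is_product T I A P \<pi>" "\<And>i. i \<in> I \<Longrightarrow> orth G (A i)"
  shows "orth G P"
proof (rule orthI)
  show P: "P \<in> obj T" by (rule prod_Hom(1)[OF assms(2)])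
  fix Y n f assume Y: "Y \<in> G" and f: "f \<in> Hom (sh n Y) P"
  have Yo: "Y \<in> obj T" using assms(1) Y by blast
  show "f = zr (sh n Y) P"
  proof (rule prod_eqI[OF assms(2) f])
    show "zr (sh n Y) P \<in> Hom (sh n Y) P" using P Yo by simp
    fix i assume i: "i \<in> I"
    note p = prod_Hom(2)[OF assms(2) i]
    have "\<pi> i \<bullet> f = zr (sh n Y) (A i)" by (rule orthD[OF assms(3)[OF i] Y]) (use f p in simp)
    then show "\<pi> i \<bullet> f = \<pi> i \<bullet> zr (sh n Y) P" using p Yo by simp
  qed
qed

end

section \<open>Brown representability\<close>

context cocomplete_category
begin

lemma coprod_factor_ex:
  assumes "is_coproduct T J B P \<iota>" "Y \<in> obj T" "\<And>i. i \<in> J \<Longrightarrow> g i \<in> Hom (B i) Y"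
  shows "\<exists>u\<in>Hom P Y. \<forall>i\<in>J. u \<bullet> \<iota> i = g i"
proof (rule coprod_factor[OF assms])
  fix u assume "u \<in> Hom P Y" "\<And>i. i \<in> J \<Longrightarrow> u \<bullet> \<iota> i = g i"
  then show ?thesis by (intro bexI[of _ u] ballI)
qed

lemma coprod_proj_ex:
  assumes "is_coproduct T J B P \<iota>" "i \<in> J"
  shows "\<exists>p\<in>Hom P (B i). p \<bullet> \<iota> i = ide T (B i) \<and> (\<forall>j\<in>J. j \<noteq> i \<longrightarrow> p \<bullet> \<iota> j = zr (B j) (B i))"
proof (rule coprod_proj[OF assms])
  fix p assume "p \<in> Hom P (B i)" "p \<bullet> \<iota> i = ide T (B i)" "\<And>j. j \<in> J \<Longrightarrow> j \<noteq> i \<Longrightarrow> p \<bullet> \<iota> j = zr (B j) (B i)"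
  then show ?thesis by (intro bexI[of _ p] ballI conjI impI)
qed

text \<open>
  With both properties, \<open>Hom(Y, W)\<close> is the product of the groups \<open>Hom(Y, A\<^sub>i)\<close>.  For all objects
  \<open>Y\<close> this makes \<open>W\<close> the product of the \<open>A\<^sub>i\<close>; for a single \<open>A\<close> and \<open>Y \<in> Loc(G)\<close> it makes \<open>W\<close>
  the coreflection of \<open>A\<close> in \<open>Loc(G)\<close>.
\<close>

definition lifts :: "'i set \<Rightarrow> ('i \<Rightarrow> 'o) \<Rightarrow> 'o \<Rightarrow> ('i \<Rightarrow> 'm) \<Rightarrow> 'o \<Rightarrow> bool" where
  "lifts I A W y Y \<longleftrightarrow>
    (\<forall>z. (\<forall>i\<in>I. z i \<in> Hom Y (A i)) \<longrightarrow> (\<exists>f\<in>Hom Y W. \<forall>i\<in>I. y i \<bullet> f = z i))"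

definition separates :: "'i set \<Rightarrow> ('i \<Rightarrow> 'o) \<Rightarrow> 'o \<Rightarrow> ('i \<Rightarrow> 'm) \<Rightarrow> 'o \<Rightarrow> bool" where
  "separates I A W y Y \<longleftrightarrow> (\<forall>f\<in>Hom Y W. (\<forall>i\<in>I. y i \<bullet> f = zr Y (A i)) \<longrightarrow> f = zr Y W)"

lemma liftsD:
  "lifts I A W y Y \<Longrightarrow> (\<And>i. i \<in> I \<Longrightarrow> z i \<in> Hom Y (A i)) \<Longrightarrow> \<exists>f\<in>Hom Y W. \<forall>i\<in>I. y i \<bullet> f = z i"
  unfolding lifts_def by (elim allE[of _ z]) (simp del: Hom_iff)

lemma separatesD:
  "separates I A W y Y \<Longrightarrow> f \<in> Hom Y W \<Longrightarrow> (\<And>i. i \<in> I \<Longrightarrow> y i \<bullet> f = zr Y (A i)) \<Longrightarrow> f = zr Y W"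
  unfolding separates_def by (elim ballE[of _ _ f]) simp_all

context
  fixes I :: "'i set" and A :: "'i \<Rightarrow> 'o" and G :: "'o set"
  assumes I: "small U I" and A: "\<And>i. i \<in> I \<Longrightarrow> A i \<in> obj T"
    and G: "G \<subseteq> compact_objects U T" and Gsmall: "small U G"
begin

text \<open>
  \<open>W\<close> is the telescope of a sequence of steps: what fails to be separated at one stage dies at
  the next.
\<close>

definition brown_step :: "'o \<times> ('i \<Rightarrow> 'm) \<Rightarrow> 'm \<Rightarrow> 'o \<times> ('i \<Rightarrow> 'm) \<Rightarrow> bool" where
  "brown_step V t V' \<longleftrightarrow> t \<in> Hom (fst V) (fst V') \<and> (\<forall>i\<in>I. snd V' i \<bullet> t = snd V i) \<and>
    (\<forall>g\<in>G. \<forall>f\<in>Hom g (fst V). (\<forall>i\<in>I. snd V i \<bullet> f = zr g (A i)) \<longrightarrow> t \<bullet> f = zr g (fst V'))"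

text \<open>Every stage already lifts morphisms from the generators; only separation is left to the
  telescope.\<close>

definition brown_approx :: "'o \<times> ('i \<Rightarrow> 'm) \<Rightarrow> bool" where
  "brown_approx V \<longleftrightarrow> fst V \<in> Loc U T G \<and> (\<forall>i\<in>I. snd V i \<in> Hom (fst V) (A i)) \<and>
    (\<forall>g\<in>G. \<forall>z. (\<forall>i\<in>I. z i \<in> Hom g (A i)) \<longrightarrow> (\<exists>f\<in>Hom g (fst V). \<forall>i\<in>I. snd V i \<bullet> f = z i))"

lemma G_obj: "G \<subseteq> obj T" using G compact_obj by blast

lemma Loc_G: "localizing U T (Loc U T G)" by (rule Loc_localizing[OF G_obj])

text \<open>The coproduct contains one copy of \<open>g\<close> for each family of morphisms from
  \<open>g\<close> to the \<open>A i\<close>, and the coprojection belonging to a family lifts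
  it.\<close>

lemma brown_start: "\<exists>V. brown_approx V"
proof -
  let ?J = "SIGMA g:G. (\<Pi>\<^sub>E i\<in>I. Hom g (A i))"
  have J: "small U ?J" by (intro small_Sigma universe Gsmall small_PiE I small_Hom)
  obtain P \<iota> where c: "is_coproduct T ?J fst P \<iota>"
    by (rule coprod_ex[OF J, of fst]) (use G_obj in auto)
  note k = coprod_Hom[OF c]
  have P: "P \<in> Loc U T G"
    by (rule localizing_coprod[OF Loc_G J _ c]) (use Loc_incl[of G] in auto)
  have "\<exists>u\<in>Hom P (A i). \<forall>j\<in>?J. u \<bullet> \<iota> j = snd j i" if i: "i \<in> I" for i
  proof -
    have "snd j i \<in> Hom (fst j) (A i)" if "j \<in> ?J" for j using that i by (auto simp del: Hom_iff)
    then obtain u where "u \<in> Hom P (A i)" "\<And>j. j \<in> ?J \<Longrightarrow> u \<bullet> \<iota> j = snd j i"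
      using coprod_factor[OF c A[OF i], of "\<lambda>j. snd j i"] by blast
    then show ?thesis by blast
  qed
  then obtain x where x: "\<And>i. i \<in> I \<Longrightarrow> x i \<in> Hom P (A i)" "\<And>i j. i \<in> I \<Longrightarrow> j \<in> ?J \<Longrightarrow> x i \<bullet> \<iota> j = snd j i"
    by metis
  have "brown_approx (P, x)"
    unfolding brown_approx_def fst_conv snd_conv
  proof (intro conjI ballI allI impI)
    show "P \<in> Loc U T G" by (rule P)
    show "x i \<in> Hom P (A i)" if "i \<in> I" for i by (rule x(1)[OF that])
    fix g z assume g: "g \<in> G" and z: "\<forall>i\<in>I. z i \<in> Hom g (A i)"
    \<comment> \<open>The index set contains extensional families only, hence the
      restriction.\<close>
    let ?j = "(g, restrict z I)"
    have j: "?j \<in> ?J" using g z by (simp del: Hom_iff)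
    show "\<exists>f\<in>Hom g P. \<forall>i\<in>I. x i \<bullet> f = z i"
      using k(2-5)[OF j] k(1) x(2)[OF _ j] by (intro bexI[of _ "\<iota> ?j"]) auto
  qed
  then show ?thesis by blast
qed

text \<open>All morphisms from generators that are annihilated by \<open>x\<close> are summed up to
  \<open>\<kappa>\<close>. In the cone of \<open>\<kappa>\<close> they become zero, and since
  \<open>x\<close> annihilates \<open>\<kappa>\<close>, it extends over the cone.\<close>

lemma brown_next:
  assumes V: "brown_approx V"
  shows "\<exists>V'. brown_approx V' \<and> (\<exists>t. brown_step V t V')"
proof -
  obtain W x where Vdef: "V = (W, x)" by fastforce
  have W: "W \<in> Loc U T G" and x: "\<And>i. i \<in> I \<Longrightarrow> x i \<in> Hom W (A i)"
    and xs: "\<And>g z. g \<in> G \<Longrightarrow> \<forall>i\<in>I. z i \<in> Hom g (A i) \<Longrightarrow> \<exists>f\<in>Hom g W. \<forall>i\<in>I. x i \<bullet> f = z i"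
    using V unfolding brown_approx_def Vdef fst_conv snd_conv by (blast, blast, blast)
  have Wo: "W \<in> obj T" using triangD(1)[OF localizingD[OF Loc_G] W] .
  let ?J = "SIGMA g:G. {f \<in> Hom g W. \<forall>i\<in>I. x i \<bullet> f = zr g (A i)}"
  have J: "small U ?J"
    by (intro small_Sigma universe Gsmall) (rule small_mono[OF small_Hom], blast)
  obtain P \<iota> where c: "is_coproduct T ?J fst P \<iota>"
    by (rule coprod_ex[OF J, of fst]) (use G_obj in auto)
  note k = coprod_Hom[OF c]
  have P: "P \<in> Loc U T G"
    by (rule localizing_coprod[OF Loc_G J _ c]) (use Loc_incl[of G] in auto)
  have "snd j \<in> Hom (fst j) W" if "j \<in> ?J" for j using that by (auto simp del: Hom_iff)
  then obtain \<kappa> where \<kappa>: "\<kappa> \<in> Hom P W" "\<And>j. j \<in> ?J \<Longrightarrow> \<kappa> \<bullet> \<iota> j = snd j"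
    using coprod_factor[OF c Wo, of snd] by blast
  obtain W' t h where tr: "tri3 P W W' \<kappa> t h" by (rule ex_cone[OF \<kappa>(1)])
  note Tr = tri3_Hom[OF tr]
  have W': "W' \<in> Loc U T G"
    using triangD(4)[OF localizingD[OF Loc_G] _ P W] tr unfolding dist_def by blast
  have "\<exists>l\<in>Hom W' (A i). x i = l \<bullet> t" if i: "i \<in> I" for i
  proof -
    have "x i \<bullet> \<kappa> = zr P (A i)"
    proof (rule coprod_eqI[OF c])
      show "x i \<bullet> \<kappa> \<in> Hom P (A i)" "zr P (A i) \<in> Hom P (A i)"
        using x[OF i] \<kappa>(1) A[OF i] k(1) by auto
      fix j assume j: "j \<in> ?J"
      have "(x i \<bullet> \<kappa>) \<bullet> \<iota> j = x i \<bullet> (\<kappa> \<bullet> \<iota> j)" using x[OF i] \<kappa>(1) k(2-5)[OF j] by simp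
      also have "\<dots> = zr (fst j) (A i)" unfolding \<kappa>(2)[OF j] using j i by auto
      finally show "(x i \<bullet> \<kappa>) \<bullet> \<iota> j = zr P (A i) \<bullet> \<iota> j" using k(1) k(2-5)[OF j] A[OF i] by simp
    qed
    then show ?thesis using weak_cokernel[OF tr _ x[OF i]] by metis
  qed
  then obtain x' where x': "\<And>i. i \<in> I \<Longrightarrow> x' i \<in> Hom W' (A i)" "\<And>i. i \<in> I \<Longrightarrow> x i = x' i \<bullet> t" by metis
  have t: "t \<in> Hom W W'" using Tr by simp
  have "brown_step V t (W', x')"
    unfolding brown_step_def Vdef fst_conv snd_conv
  proof (intro conjI ballI impI)
    show "t \<in> Hom W W'" by (rule t)
    show "x' i \<bullet> t = x i" if "i \<in> I" for i using x'(2)[OF that] by simp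
    fix g f assume g: "g \<in> G" and f: "f \<in> Hom g W" "\<forall>i\<in>I. x i \<bullet> f = zr g (A i)"
    then have j: "(g, f) \<in> ?J" by blast
    have "t \<bullet> f = t \<bullet> (\<kappa> \<bullet> \<iota> (g, f))" using \<kappa>(2)[OF j] by simp
    also have "\<dots> = (t \<bullet> \<kappa>) \<bullet> \<iota> (g, f)" using t \<kappa>(1) k(2-5)[OF j] by simp
    also have "\<dots> = zr g W'" unfolding tri3_comp_zero[OF tr] using k(1) k(2-5)[OF j] Tr by simp
    finally show "t \<bullet> f = zr g W'" .
  qed
  moreover have "brown_approx (W', x')"
    unfolding brown_approx_def fst_conv snd_conv
  proof (intro conjI ballI allI impI)
    show "W' \<in> Loc U T G" by (rule W')
    show "x' i \<in> Hom W' (A i)" if "i \<in> I" for i by (rule x'(1)[OF that])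
    fix g z assume g: "g \<in> G" and z: "\<forall>i\<in>I. z i \<in> Hom g (A i)"
    obtain f where f: "f \<in> Hom g W" "\<forall>i\<in>I. x i \<bullet> f = z i" using xs[OF g z] by blast
    show "\<exists>f\<in>Hom g W'. \<forall>i\<in>I. x' i \<bullet> f = z i"
    proof (intro bexI[of _ "t \<bullet> f"] ballI)
      fix i assume i: "i \<in> I"
      have "x' i \<bullet> (t \<bullet> f) = (x' i \<bullet> t) \<bullet> f" using x'(1)[OF i] t f(1) by simp
      then show "x' i \<bullet> (t \<bullet> f) = z i" unfolding x'(2)[OF i, symmetric] using f(2) i by simp
    next
      show "t \<bullet> f \<in> Hom g W'" using t f(1) by simp
    qed
  qed
  ultimately show ?thesis by blast
qed

lemma brown_generators:
  obtains W y where "W \<in> Loc U T G" "\<forall>i\<in>I. y i \<in> Hom W (A i)"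
    "\<forall>g\<in>G. lifts I A W y g" "\<forall>g\<in>G. separates I A W y g"
proof -
  have "\<exists>V. \<forall>n. brown_approx (V n) \<and> (\<exists>t. brown_step (V n) t (V (Suc n)))"
    by (rule dependent_nat_choice) (use brown_start brown_next in blast)+
  then obtain V where V: "\<And>n. brown_approx (V n)" "\<And>n. \<exists>t. brown_step (V n) t (V (Suc n))" by auto
  then obtain t where t: "\<And>n. brown_step (V n) (t n) (V (Suc n))" by metis
  define X where "X n = fst (V n)" for n
  define x where "x n = snd (V n)" for n
  have X: "X n \<in> Loc U T G" and xH: "i \<in> I \<Longrightarrow> x n i \<in> Hom (X n) (A i)"
    and xs: "g \<in> G \<Longrightarrow> \<forall>i\<in>I. z i \<in> Hom g (A i) \<Longrightarrow> \<exists>f\<in>Hom g (X n). \<forall>i\<in>I. x n i \<bullet> f = z i" for n i g z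
    using V(1)[of n] unfolding brown_approx_def X_def x_def by (blast, blast, blast)
  have tH: "t n \<in> Hom (X n) (X (Suc n))" and xt: "i \<in> I \<Longrightarrow> x (Suc n) i \<bullet> t n = x n i"
    and tz: "g \<in> G \<Longrightarrow> f \<in> Hom g (X n) \<Longrightarrow> \<forall>i\<in>I. x n i \<bullet> f = zr g (A i) \<Longrightarrow> t n \<bullet> f = zr g (X (Suc n))" for n i g f
    using t[of n] unfolding brown_step_def X_def x_def by (blast, blast, blast)
  have Xo: "X n \<in> obj T" for n using triangD(1)[OF localizingD[OF Loc_G] X] .
  have N: "small U (UNIV :: nat set)" using universe unfolding universe_def by blast
  obtain P \<iota> where c: "is_coproduct T (UNIV :: nat set) X P \<iota>"
    by (rule coprod_ex[OF N, of X]) (rule Xo)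
  note k = coprod_Hom[OF c]
  have P: "P \<in> Loc U T G" by (rule localizing_coprod[OF Loc_G N X c])
  have io: "\<iota> n \<in> Hom (X n) P" for n using k Xo by auto
  have st: "\<iota> (Suc n) \<bullet> t n \<in> Hom (X n) P" for n using io[of "Suc n"] tH[of n] by simp
  have "\<exists>u\<in>Hom P P. \<forall>n\<in>UNIV. u \<bullet> \<iota> n = \<iota> (Suc n) \<bullet> t n"
    by (rule coprod_factor_ex[OF c k(1)]) (rule st)
  then obtain s where s1: "s \<in> Hom P P" and s2: "\<forall>n\<in>UNIV. s \<bullet> \<iota> n = \<iota> (Suc n) \<bullet> t n" by (elim bexE)
  have s3: "s \<bullet> \<iota> n = \<iota> (Suc n) \<bullet> t n" for n using s2 by simp
  note s = s1 s3
  \<comment> \<open>The cone of identity minus shift is the homotopy colimit of the stages.\<close>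
  let ?\<phi> = "ide T P \<boxminus> s"
  have \<phi>: "?\<phi> \<in> Hom P P" using s(1) k(1) by simp
  have \<phi>\<iota>: "?\<phi> \<bullet> \<iota> n = \<iota> n \<boxminus> \<iota> (Suc n) \<bullet> t n" for n
  proof -
    have "?\<phi> \<bullet> \<iota> n = ide T P \<bullet> \<iota> n \<boxminus> s \<bullet> \<iota> n"
      by (rule cmp_sb_left) (use s(1) k(1) io[of n] in auto)
    then show ?thesis unfolding s(2) using io[of n] by simp
  qed
  obtain W q \<delta> where tr: "tri3 P P W ?\<phi> q \<delta>" by (rule ex_cone[OF \<phi>])
  note Tr = tri3_Hom[OF tr]
  have W: "W \<in> Loc U T G"
    using triangD(4)[OF localizingD[OF Loc_G] _ P P] tr unfolding dist_def by blast
  define j where "j n = q \<bullet> \<iota> n" for n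
  have jH: "j n \<in> Hom (X n) W" for n unfolding j_def using io[of n] Tr by simp
  have jt: "j (Suc n) \<bullet> t n = j n" for n
  proof -
    have "zr (X n) W = (q \<bullet> ?\<phi>) \<bullet> \<iota> n" unfolding tri3_comp_zero[OF tr] using io[of n] Tr by simp
    also have "\<dots> = q \<bullet> (?\<phi> \<bullet> \<iota> n)" using Tr \<phi> io[of n] by simp
    also have "\<dots> = q \<bullet> \<iota> n \<boxminus> q \<bullet> (\<iota> (Suc n) \<bullet> t n)"
      unfolding \<phi>\<iota> by (rule cmp_sb_right) (use Tr io[of n] st[of n] in auto)
    also have "q \<bullet> (\<iota> (Suc n) \<bullet> t n) = j (Suc n) \<bullet> t n"
      unfolding j_def using Tr io[of "Suc n"] tH[of n] by simp
    finally have "j n \<boxminus> j (Suc n) \<bullet> t n = zr (X n) W" unfolding j_def by simp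
    then have "j n = j (Suc n) \<bullet> t n" by (rule sb_eq_zr) (use jH[of n] jH[of "Suc n"] tH[of n] in auto)
    then show ?thesis by simp
  qed
  \<comment> \<open>The morphisms from the stages to \<open>A i\<close> are compatible, so together
    they annihilate identity minus shift and descend to \<open>W\<close>.\<close>
  have "\<exists>l\<in>Hom W (A i). \<forall>n. l \<bullet> j n = x n i" if i: "i \<in> I" for i
  proof -
    have "\<exists>u\<in>Hom P (A i). \<forall>n\<in>UNIV. u \<bullet> \<iota> n = x n i"
      by (rule coprod_factor_ex[OF c A[OF i]]) (rule xH[OF i])
    then obtain u where u1: "u \<in> Hom P (A i)" and u2: "\<forall>n\<in>UNIV. u \<bullet> \<iota> n = x n i" by (elim bexE)
    have u3: "u \<bullet> \<iota> n = x n i" for n using u2 by simp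
    note u = u1 u3
    have "u \<bullet> ?\<phi> = zr P (A i)"
    proof (rule coprod_eqI[OF c])
      show "u \<bullet> ?\<phi> \<in> Hom P (A i)" "zr P (A i) \<in> Hom P (A i)" using u(1) \<phi> A[OF i] k(1) by auto
      fix n
      have "(u \<bullet> ?\<phi>) \<bullet> \<iota> n = u \<bullet> (?\<phi> \<bullet> \<iota> n)" using u(1) \<phi> io[of n] by simp
      also have "\<dots> = u \<bullet> \<iota> n \<boxminus> u \<bullet> (\<iota> (Suc n) \<bullet> t n)"
        unfolding \<phi>\<iota> by (rule cmp_sb_right) (use u(1) io[of n] st[of n] in auto)
      also have "u \<bullet> (\<iota> (Suc n) \<bullet> t n) = (u \<bullet> \<iota> (Suc n)) \<bullet> t n" using u(1) io[of "Suc n"] tH[of n] by simp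
      also have "\<dots> = x n i" unfolding u(2) by (rule xt[OF i])
      finally show "(u \<bullet> ?\<phi>) \<bullet> \<iota> n = zr P (A i) \<bullet> \<iota> n"
        unfolding u(2) using xH[OF i, of n] io[of n] A[OF i] by simp
    qed
    then obtain l where l: "l \<in> Hom W (A i)" "u = l \<bullet> q" using weak_cokernel[OF tr _ u(1)] by metis
    have "l \<bullet> j n = x n i" for n
    proof -
      have "l \<bullet> j n = (l \<bullet> q) \<bullet> \<iota> n" unfolding j_def using l(1) Tr io[of n] by simp
      then show ?thesis unfolding l(2)[symmetric] u(2) .
    qed
    then show ?thesis using l(1) by blast
  qed
  then obtain y where yH: "\<And>i. i \<in> I \<Longrightarrow> y i \<in> Hom W (A i)" and yj: "\<And>i n. i \<in> I \<Longrightarrow> y i \<bullet> j n = x n i"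
    by metis
  have push: "\<exists>r'. r' \<in> Hom D (X (n + m)) \<and> j n \<bullet> r = j (n + m) \<bullet> r'" if r: "r \<in> Hom D (X n)" for D n m r
  proof (induction m)
    case 0 then show ?case using r by auto
  next
    case (Suc m)
    then obtain r' where r': "r' \<in> Hom D (X (n + m))" "j n \<bullet> r = j (n + m) \<bullet> r'" by blast
    have "j (Suc (n + m)) \<bullet> (t (n + m) \<bullet> r') = (j (Suc (n + m)) \<bullet> t (n + m)) \<bullet> r'"
      using r'(1) tH[of "n + m"] jH[of "Suc (n + m)"] by simp
    then show ?case unfolding jt r'(2)[symmetric]
      using r'(1) tH[of "n + m"] by (intro exI[of _ "t (n + m) \<bullet> r'"]) auto
  qed
  \<comment> \<open>Identity minus shift is injective on morphisms from a generator. If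
    \<open>k\<close> equals its own shift, its zeroth coordinate is zero and each further one is the
    image of its predecessor under \<open>t\<close>. So all coordinates vanish, and compactness
    gives \<open>k = 0\<close>.\<close>
  have inj: "k = zr g (sh m P)" if g: "g \<in> G" and k: "k \<in> Hom g (sh m P)" and z: "sm m ?\<phi> \<bullet> k = zr g (sh m P)" for g k m
  proof (rule compact_proj_zero[OF _ N coprod_sh[OF c] k])
    show "g \<in> compact_objects U T" using g G by blast
    have go: "g \<in> obj T" using g G_obj by blast
    have sk: "k = sm m s \<bullet> k"
    proof -
      have 1: "sm m ?\<phi> = ide T (sh m P) \<boxminus> sm m s" using s(1) k(1) coprod_Hom(1)[OF c] by (simp add: sb_def)
      have "(ide T (sh m P) \<boxminus> sm m s) \<bullet> k = ide T (sh m P) \<bullet> k \<boxminus> sm m s \<bullet> k"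
        by (rule cmp_sb_left) (use s(1) k coprod_Hom(1)[OF c] in auto)
      then have "k \<boxminus> sm m s \<bullet> k = zr g (sh m P)" using z k unfolding 1 by simp
      then show ?thesis by (rule sb_eq_zr) (use s(1) k in auto)
    qed
    have "p \<bullet> k = zr g (sh m (X n))"
      if "p \<in> Hom (sh m P) (sh m (X n))" "p \<bullet> sm m (\<iota> n) = ide T (sh m (X n))"
        "\<And>i. i \<noteq> n \<Longrightarrow> p \<bullet> sm m (\<iota> i) = zr (sh m (X i)) (sh m (X n))" for n p
      using that
    proof (induction n arbitrary: p)
      case (0 p)
      have "p \<bullet> sm m s = zr (sh m P) (sh m (X 0))"
      proof (rule coprod_eqI[OF coprod_sh[OF c]])
        show "p \<bullet> sm m s \<in> Hom (sh m P) (sh m (X 0))" "zr (sh m P) (sh m (X 0)) \<in> Hom (sh m P) (sh m (X 0))"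
          using 0(1) s(1) Xo by auto
        fix i
        have "(p \<bullet> sm m s) \<bullet> sm m (\<iota> i) = p \<bullet> sm m (s \<bullet> \<iota> i)" using 0(1) s(1) io[of i] by simp
        also have "\<dots> = (p \<bullet> sm m (\<iota> (Suc i))) \<bullet> sm m (t i)"
          unfolding s(2) using 0(1) io[of "Suc i"] tH[of i] by simp
        also have "\<dots> = zr (sh m P) (sh m (X 0)) \<bullet> sm m (\<iota> i)"
          unfolding 0(3)[of "Suc i", simplified] using tH[of i] Xo io[of i] by simp
        finally show "(p \<bullet> sm m s) \<bullet> sm m (\<iota> i) = zr (sh m P) (sh m (X 0)) \<bullet> sm m (\<iota> i)" .
      qed
      moreover have "p \<bullet> k = (p \<bullet> sm m s) \<bullet> k" using 0(1) s(1) k by (subst sk) simp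
      ultimately show ?case using k Xo by simp
    next
      case (Suc n p)
      from coprod_proj_ex[OF coprod_sh[OF c, of m] UNIV_I[of n]]
      obtain p' where p1: "p' \<in> Hom (sh m P) (sh m (X n))" "p' \<bullet> sm m (\<iota> n) = ide T (sh m (X n))"
        and p2: "\<forall>i\<in>UNIV. i \<noteq> n \<longrightarrow> p' \<bullet> sm m (\<iota> i) = zr (sh m (X i)) (sh m (X n))" by (elim bexE conjE)
      have p3: "p' \<bullet> sm m (\<iota> i) = zr (sh m (X i)) (sh m (X n))" if "i \<noteq> n" for i using p2 that by simp
      note p' = p1 p3
      have "p \<bullet> sm m s = sm m (t n) \<bullet> p'"
      proof (rule coprod_eqI[OF coprod_sh[OF c]])
        show "p \<bullet> sm m s \<in> Hom (sh m P) (sh m (X (Suc n)))" "sm m (t n) \<bullet> p' \<in> Hom (sh m P) (sh m (X (Suc n)))"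
          using Suc.prems(1) s(1) p'(1) tH[of n] Xo by auto
        fix i
        have "(p \<bullet> sm m s) \<bullet> sm m (\<iota> i) = p \<bullet> sm m (s \<bullet> \<iota> i)" using Suc.prems(1) s(1) io[of i] by simp
        also have "\<dots> = (p \<bullet> sm m (\<iota> (Suc i))) \<bullet> sm m (t i)"
          unfolding s(2) using Suc.prems(1) io[of "Suc i"] tH[of i] by simp
        also have "\<dots> = (if i = n then sm m (t n) else zr (sh m (X i)) (sh m (X (Suc n))))"
          using Suc.prems(2) Suc.prems(3)[of "Suc i"] tH[of i] Xo by auto
        also have "\<dots> = sm m (t n) \<bullet> (p' \<bullet> sm m (\<iota> i))"
          using p'(2) p'(3)[of i] tH[of n] Xo by auto
        also have "\<dots> = (sm m (t n) \<bullet> p') \<bullet> sm m (\<iota> i)" using p'(1) tH[of n] io[of i] by simp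
        finally show "(p \<bullet> sm m s) \<bullet> sm m (\<iota> i) = (sm m (t n) \<bullet> p') \<bullet> sm m (\<iota> i)" .
      qed
      moreover have "p \<bullet> k = (p \<bullet> sm m s) \<bullet> k" using Suc.prems(1) s(1) k by (subst sk) simp
      ultimately have "p \<bullet> k = sm m (t n) \<bullet> (p' \<bullet> k)" using p'(1) k tH[of n] by simp
      moreover have "p' \<bullet> k = zr g (sh m (X n))" by (rule Suc.IH[OF p1 p3])
      ultimately show ?case using tH[of n] go by simp
    qed
    then show "p \<bullet> k = zr g (sh m (X n))"
      if "p \<in> Hom (sh m P) (sh m (X n))" "p \<bullet> sm m (\<iota> n) = ide T (sh m (X n))"
        "\<And>i. i \<in> UNIV \<Longrightarrow> i \<noteq> n \<Longrightarrow> p \<bullet> sm m (\<iota> i) = zr (sh m (X i)) (sh m (X n))" for n p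
      using that by blast
  qed
  \<comment> \<open>By injectivity the boundary of \<open>f\<close> vanishes, so \<open>f\<close>
    lifts to the coproduct. Compactness leaves finitely many stages, and \<open>push\<close> moves
    them to a common one.\<close>
  have fac: "\<exists>n r. r \<in> Hom g (X n) \<and> f = j n \<bullet> r" if g: "g \<in> G" and f: "f \<in> Hom g W" for g f
  proof -
    have gc: "g \<in> compact_objects U T" using g G by blast
    have go: "g \<in> obj T" using g G_obj by blast
    have df: "\<delta> \<bullet> f \<in> Hom g (sh 1 P)" using f Tr by simp
    have "sm 1 ?\<phi> \<bullet> (\<delta> \<bullet> f) = (sm 1 ?\<phi> \<bullet> \<delta>) \<bullet> f" using f Tr by simp
    also have "\<dots> = zr g (sh 1 P)" unfolding tri3_comp_zero''[OF tr] using f Tr by simp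
    finally have "\<delta> \<bullet> f = zr g (sh 1 P)" using inj[OF g df] by blast
    then obtain f' where f': "f' \<in> Hom g P" "f = q \<bullet> f'" by (rule weak_kernel2[OF tr _ f])
    have "\<exists>n r. r \<in> Hom g (X n) \<and> q \<bullet> f' = j n \<bullet> r"
    proof (rule compact_induct[OF gc N c f'(1)])
      show "\<exists>n r. r \<in> Hom g (X n) \<and> q \<bullet> zr g P = j n \<bullet> r"
        using Tr go Xo[of 0] jH[of 0] by (intro exI[of _ 0] exI[of _ "zr g (X 0)"]) auto
    next
      fix f' i h assume "\<exists>n r. r \<in> Hom g (X n) \<and> q \<bullet> f' = j n \<bullet> r" and f': "f' \<in> Hom g P" and h: "h \<in> Hom g (X i)"
      then obtain n r where r: "r \<in> Hom g (X n)" "q \<bullet> f' = j n \<bullet> r" by blast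
      obtain r1 where r1: "r1 \<in> Hom g (X (n + i))" "j n \<bullet> r = j (n + i) \<bullet> r1" using push[OF r(1)] by blast
      obtain r2 where r2: "r2 \<in> Hom g (X (i + n))" "j i \<bullet> h = j (i + n) \<bullet> r2" using push[OF h] by blast
      have e: "i + n = n + i" by simp
      have "q \<bullet> (\<iota> i \<bullet> h \<boxplus> f') = q \<bullet> (\<iota> i \<bullet> h) \<boxplus> q \<bullet> f'"
        by (rule cmp_add_r) (use Tr h io[of i] f' in auto)
      also have "q \<bullet> (\<iota> i \<bullet> h) = j i \<bullet> h" unfolding j_def using Tr h io[of i] by simp
      also have "j i \<bullet> h \<boxplus> q \<bullet> f' = j (n + i) \<bullet> (r2 \<boxplus> r1)"
        unfolding r(2) r1(2) r2(2) e
        by (rule cmp_add_r[symmetric]) (use r1(1) r2(1) jH[of "n + i"] in \<open>auto simp: e\<close>)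
      finally show "\<exists>n r. r \<in> Hom g (X n) \<and> q \<bullet> (\<iota> i \<bullet> h \<boxplus> f') = j n \<bullet> r"
        using r1(1) r2(1) unfolding e by (intro exI[of _ "n + i"] exI[of _ "r2 \<boxplus> r1"]) auto
    qed
    then show ?thesis unfolding f'(2) .
  qed
  show ?thesis
  proof (rule that[OF W])
    show "\<forall>i\<in>I. y i \<in> Hom W (A i)" using yH by (rule ballI)
    show "\<forall>g\<in>G. lifts I A W y g" unfolding lifts_def
    proof (intro ballI allI impI)
    fix g z assume g: "g \<in> G" and z: "\<forall>i\<in>I. z i \<in> Hom g (A i)"
    obtain f where f: "f \<in> Hom g (X 0)" "\<forall>i\<in>I. x 0 i \<bullet> f = z i" using xs[OF g, of z 0] z by blast
    show "\<exists>f\<in>Hom g W. \<forall>i\<in>I. y i \<bullet> f = z i"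
    proof (intro bexI[of _ "j 0 \<bullet> f"] ballI)
      fix i assume i: "i \<in> I"
      have "y i \<bullet> (j 0 \<bullet> f) = (y i \<bullet> j 0) \<bullet> f" using yH[OF i] jH[of 0] f(1) by simp
      then show "y i \<bullet> (j 0 \<bullet> f) = z i" unfolding yj[OF i] using f(2) i by simp
    next
      show "j 0 \<bullet> f \<in> Hom g W" using jH[of 0] f(1) by simp
    qed
    qed
    show "\<forall>g\<in>G. separates I A W y g" unfolding separates_def
    proof (intro ballI impI)
    fix g f assume g: "g \<in> G" and f: "f \<in> Hom g W" and z: "\<forall>i\<in>I. y i \<bullet> f = zr g (A i)"
    \<comment> \<open>If \<open>y\<close> annihilates \<open>f = j n \<bullet> r\<close>, then
      \<open>x n\<close> annihilates \<open>r\<close>, so \<open>r\<close> dies in the next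
      stage.\<close>
    obtain n r where r: "r \<in> Hom g (X n)" "f = j n \<bullet> r" using fac[OF g f] by blast
    have "x n i \<bullet> r = zr g (A i)" if i: "i \<in> I" for i
    proof -
      have "(y i \<bullet> j n) \<bullet> r = y i \<bullet> f" unfolding r(2) using yH[OF i] jH[of n] r(1) by simp
      then show ?thesis unfolding yj[OF i] bspec[OF z i] .
    qed
    then have tr0: "t n \<bullet> r = zr g (X (Suc n))" using tz[OF g r(1)] by blast
    have "f = (j (Suc n) \<bullet> t n) \<bullet> r" unfolding jt by (rule r(2))
    also have "\<dots> = j (Suc n) \<bullet> (t n \<bullet> r)" using jH[of "Suc n"] tH[of n] r(1) by simp
    finally show "f = zr g W" unfolding tr0 using jH[of "Suc n"] r(1) by simp
    qed
  qed
qed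

end

text \<open>\<open>lifts\<close> and \<open>separates\<close> spread from the generators to the
  localizing subcategory by the two halves of the five lemma. They are not stated for suspensions,
  so the suspensions of \<open>G\<close> are added to the generators and \<open>good\<close> asks
  for all suspensions of an object.\<close>

lemma brown:
  assumes I: "small U I" and A: "\<And>i. i \<in> I \<Longrightarrow> A i \<in> obj T"
    and G: "G \<subseteq> compact_objects U T" and Gs: "small U G"
  obtains W y where "W \<in> Loc U T G" "\<forall>i\<in>I. y i \<in> Hom W (A i)"
    "\<forall>Y\<in>Loc U T G. lifts I A W y Y" "\<forall>Y\<in>Loc U T G. separates I A W y Y"
proof -
  define G' where "G' = (\<lambda>(g, n). sh n g) ` (G \<times> UNIV)"
  have Go: "G \<subseteq> obj T" using G compact_obj by blast
  have G'c: "G' \<subseteq> compact_objects U T"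
    using triangD(3)[OF compact_triang] G unfolding G'_def by auto
  have G's: "small U G'" unfolding G'_def
    by (intro small_image small_Times universe Gs small_countable) auto
  have shG: "sh n g \<in> G'" if "g \<in> G" for g n using that unfolding G'_def by force
  note LG = Loc_localizing[OF Go]
  have "G' \<subseteq> Loc U T G"
    using triangD(3)[OF localizingD[OF LG]] Loc_incl[of G] unfolding G'_def by auto
  then have LL: "Loc U T G' \<subseteq> Loc U T G" by (rule Loc_least[OF LG])
  obtain W y where W: "W \<in> Loc U T G'" and y': "\<forall>i\<in>I. y i \<in> Hom W (A i)"
    and yE: "\<forall>g\<in>G'. lifts I A W y g" and yM: "\<forall>g\<in>G'. separates I A W y g"
    by (rule brown_generators[OF I A G'c G's])
  have y: "y i \<in> Hom W (A i)" if "i \<in> I" for i using y' that by blast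
  have Wo: "W \<in> obj T" using W LL triangD(1)[OF localizingD[OF LG]] by blast
  let ?E = "lifts I A W y" and ?M = "separates I A W y"
  note ED = liftsD[of I A W y] and MD = separatesD[of I A W y]
  \<comment> \<open>Here \<open>f\<close> factors through \<open>sh 1 X\<close> as \<open>k\<close>.
    The images of \<open>k\<close> in the \<open>A i\<close> come from \<open>sh 1 Y\<close> and
    lift there; by separation on \<open>sh 1 X\<close> the lift accounts for \<open>k\<close>, so
    \<open>f\<close> factors through \<open>sm 1 a \<bullet> c = 0\<close>.\<close>
  have Mtri: "?M Z" if t: "tri3 X Y Z a b c" and s: "?E (sh 1 Y)" "?M (sh 1 X)" "?M Y" for X Y Z a b c
    unfolding separates_def
  proof (intro ballI impI)
    note T = tri3_Hom[OF t]
    fix f assume f: "f \<in> Hom Z W" and yf: "\<forall>i\<in>I. y i \<bullet> f = zr Z (A i)"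
    have "f \<bullet> b = zr Y W"
    proof (rule MD[OF s(3)])
      show "f \<bullet> b \<in> Hom Y W" using f T by simp
      fix i assume i: "i \<in> I"
      have "y i \<bullet> (f \<bullet> b) = (y i \<bullet> f) \<bullet> b" using y[OF i] f T by simp
      then show "y i \<bullet> (f \<bullet> b) = zr Y (A i)" using yf i T A[OF i] by simp
    qed
    then obtain k where k: "k \<in> Hom (sh 1 X) W" "f = k \<bullet> c" by (rule weak_cokernel2[OF t _ f])
    have "\<exists>l\<in>Hom (sh 1 Y) (A i). y i \<bullet> k = l \<bullet> ng (sm 1 a)" if i: "i \<in> I" for i
    proof -
      have "(y i \<bullet> k) \<bullet> c = y i \<bullet> f" unfolding k(2) using y[OF i] k(1) T by simp
      then have "(y i \<bullet> k) \<bullet> c = zr Z (A i)" using yf i by simp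
      then show ?thesis
        using weak_cokernel2[OF tri3_rotate[OF t], of "y i \<bullet> k"] y[OF i] k(1) by (metis Hom_iff cmp_simps)
    qed
    then obtain l where l: "\<And>i. i \<in> I \<Longrightarrow> l i \<in> Hom (sh 1 Y) (A i)" "\<And>i. i \<in> I \<Longrightarrow> y i \<bullet> k = l i \<bullet> ng (sm 1 a)" by metis
    obtain m where m: "m \<in> Hom (sh 1 Y) W" "\<forall>i\<in>I. y i \<bullet> m = l i" using ED[of "sh 1 Y" l, OF s(1) l(1)] by blast
    have ma: "m \<bullet> ng (sm 1 a) \<in> Hom (sh 1 X) W" using m(1) T by simp
    have "k \<boxminus> m \<bullet> ng (sm 1 a) = zr (sh 1 X) W"
    proof (rule MD[OF s(2)])
      show "k \<boxminus> m \<bullet> ng (sm 1 a) \<in> Hom (sh 1 X) W" using k(1) ma by simp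
      fix i assume i: "i \<in> I"
      have "y i \<bullet> (k \<boxminus> m \<bullet> ng (sm 1 a)) = y i \<bullet> k \<boxminus> y i \<bullet> (m \<bullet> ng (sm 1 a))"
        by (rule cmp_sb_right) (use y[OF i] k(1) ma in auto)
      also have "y i \<bullet> (m \<bullet> ng (sm 1 a)) = (y i \<bullet> m) \<bullet> ng (sm 1 a)" using y[OF i] m(1) T by simp
      also have "\<dots> = y i \<bullet> k" using l(2)[OF i] m(2) i by simp
      finally show "y i \<bullet> (k \<boxminus> m \<bullet> ng (sm 1 a)) = zr (sh 1 X) (A i)" using y[OF i] k(1) by simp
    qed
    then have "k = m \<bullet> ng (sm 1 a)" by (rule sb_eq_zr[OF _ k(1) ma])
    then have "f = ng (m \<bullet> (sm 1 a \<bullet> c))" unfolding k(2) using m(1) T by simp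
    then show "f = zr Z W" unfolding tri3_comp_zero''[OF t] using m(1) T by simp
  qed
  \<comment> \<open>Lift on \<open>Y\<close>, descend to \<open>v\<close> on \<open>Z\<close> by
    separation on \<open>X\<close>, and correct the defect of \<open>v\<close>, which factors
    through \<open>sh 1 X\<close>, by lifting there.\<close>
  have Etri: "?E Z" if t: "tri3 X Y Z a b c" and s: "?E Y" "?M X" "?E (sh 1 X)" for X Y Z a b c
    unfolding lifts_def
  proof (intro allI impI)
    note T = tri3_Hom[OF t]
    fix z assume "\<forall>i\<in>I. z i \<in> Hom Z (A i)"
    then have z: "z i \<in> Hom Z (A i)" if "i \<in> I" for i using that by blast
    have "z i \<bullet> b \<in> Hom Y (A i)" if "i \<in> I" for i using z[OF that] T by simp
    from ED[of Y "\<lambda>i. z i \<bullet> b", OF s(1) this]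
    obtain u where u: "u \<in> Hom Y W" "\<forall>i\<in>I. y i \<bullet> u = z i \<bullet> b" by blast
    have "u \<bullet> a = zr X W"
    proof (rule MD[OF s(2)])
      show "u \<bullet> a \<in> Hom X W" using u(1) T by simp
      fix i assume i: "i \<in> I"
      have "y i \<bullet> (u \<bullet> a) = (y i \<bullet> u) \<bullet> a" using y[OF i] u(1) T by simp
      also have "\<dots> = z i \<bullet> (b \<bullet> a)" using u(2) i z[OF i] T by simp
      finally show "y i \<bullet> (u \<bullet> a) = zr X (A i)" unfolding tri3_comp_zero[OF t] using z[OF i] T by simp
    qed
    then obtain v where v: "v \<in> Hom Z W" "u = v \<bullet> b" by (rule weak_cokernel[OF t _ u(1)])
    have "\<exists>l\<in>Hom (sh 1 X) (A i). z i \<boxminus> y i \<bullet> v = l \<bullet> c" if i: "i \<in> I" for i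
    proof -
      have yv: "y i \<bullet> v \<in> Hom Z (A i)" using y[OF i] v(1) by simp
      have "(z i \<boxminus> y i \<bullet> v) \<bullet> b = z i \<bullet> b \<boxminus> (y i \<bullet> v) \<bullet> b"
        by (rule cmp_sb_left) (use z[OF i] yv T in auto)
      also have "(y i \<bullet> v) \<bullet> b = y i \<bullet> u" unfolding v(2) using y[OF i] v(1) T by simp
      also have "\<dots> = z i \<bullet> b" using u(2) i by simp
      finally have 0: "(z i \<boxminus> y i \<bullet> v) \<bullet> b = zr Y (A i)" using z[OF i] T by simp
      have "z i \<boxminus> y i \<bullet> v \<in> Hom Z (A i)" using z[OF i] yv by simp
      then show ?thesis using weak_cokernel2[OF t 0] by metis
    qed
    then obtain l where l: "\<And>i. i \<in> I \<Longrightarrow> l i \<in> Hom (sh 1 X) (A i)" "\<And>i. i \<in> I \<Longrightarrow> z i \<boxminus> y i \<bullet> v = l i \<bullet> c" by metis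
    obtain m where m: "m \<in> Hom (sh 1 X) W" "\<forall>i\<in>I. y i \<bullet> m = l i" using ED[of "sh 1 X" l, OF s(3) l(1)] by blast
    show "\<exists>f\<in>Hom Z W. \<forall>i\<in>I. y i \<bullet> f = z i"
    proof (intro bexI[of _ "m \<bullet> c \<boxplus> v"] ballI)
      show "m \<bullet> c \<boxplus> v \<in> Hom Z W" using m(1) v(1) T by simp
      fix i assume i: "i \<in> I"
      have "y i \<bullet> (m \<bullet> c \<boxplus> v) = y i \<bullet> (m \<bullet> c) \<boxplus> y i \<bullet> v"
        by (rule cmp_add_r) (use y[OF i] m(1) v(1) T in auto)
      also have "y i \<bullet> (m \<bullet> c) = (y i \<bullet> m) \<bullet> c" using y[OF i] m(1) T by simp
      also have "\<dots> = z i \<boxminus> y i \<bullet> v" unfolding l(2)[OF i] using m(2) i by simp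
      finally show "y i \<bullet> (m \<bullet> c \<boxplus> v) = z i" using z[OF i] y[OF i] v(1) by simp
    qed
  qed
  define good where "good = {Y \<in> obj T. \<forall>n. ?E (sh n Y) \<and> ?M (sh n Y)}"
  have goodI: "Y \<in> good" if "Y \<in> obj T" "\<And>n. ?E (sh n Y)" "\<And>n. ?M (sh n Y)" for Y
    using that unfolding good_def by blast
  have goodD: "?E (sh n Y)" "?M (sh n Y)" "Y \<in> obj T" if "Y \<in> good" for Y n
    using that unfolding good_def by blast+
  have "localizing U T good"
  proof (rule localizingI)
    show "triang good"
      unfolding triang_def
    proof (intro conjI allI impI ballI)
      show "good \<subseteq> obj T" unfolding good_def by blast
      show "Z \<in> good" if Z: "is_zero T Z" for Z
      proof (rule goodI[OF zero_obj[OF Z]])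
        fix n
        note zn = is_zero_sh[OF Z, of n]
        show "?M (sh n Z)" unfolding separates_def using from_zero[OF zn] by blast
        show "?E (sh n Z)" unfolding lifts_def
        proof (intro allI impI bexI[of _ "zr (sh n Z) W"] ballI)
          show "zr (sh n Z) W \<in> Hom (sh n Z) W" using zn Wo by simp
          fix z i assume z: "\<forall>i\<in>I. z i \<in> Hom (sh n Z) (A i)" and i: "i \<in> I"
          have "z i = zr (sh n Z) (A i)" by (rule from_zero[OF zn]) (use z i in blast)
          then show "y i \<bullet> zr (sh n Z) W = z i" using y[OF i] zn by simp
        qed
      qed
      show "sh n X \<in> good" if X: "X \<in> good" for X n
        by (rule goodI) (use goodD[OF X] in simp_all)
      show "Z \<in> good" if d: "dist X Y Z" and X: "X \<in> good" and Y: "Y \<in> good" for X Y Z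
      proof (rule goodI)
        show "Z \<in> obj T" using dist_obj[OF d] by simp
        fix n
        obtain a b c where t: "tri3 (sh n X) (sh n Y) (sh n Z) a b c"
          using dist_sh[OF d] unfolding dist_def by blast
        have e: "sh 1 (sh n X) = sh (1 + n) X" "sh 1 (sh n Y) = sh (1 + n) Y" using goodD(3) X Y by simp_all
        show "?E (sh n Z)" by (rule Etri[OF t]) (simp_all only: e goodD[OF X] goodD[OF Y])
        show "?M (sh n Z)" by (rule Mtri[OF t]) (simp_all only: e goodD[OF X] goodD[OF Y])
      qed
    qed
    fix J :: "'u set" and B P \<iota>
    assume a: "\<And>j. j \<in> J \<Longrightarrow> B j \<in> good" "is_coproduct T J B P \<iota>"
    show "P \<in> good"
    proof (rule goodI[OF coprod_Hom(1)[OF a(2)]])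
      fix n
      note c = coprod_sh[OF a(2), of n]
      note k = coprod_Hom[OF c]
      show "?M (sh n P)" unfolding separates_def
      proof (intro ballI impI)
        fix f assume f: "f \<in> Hom (sh n P) W" and yf: "\<forall>i\<in>I. y i \<bullet> f = zr (sh n P) (A i)"
        show "f = zr (sh n P) W"
        proof (rule coprod_eqI[OF c f])
          show "zr (sh n P) W \<in> Hom (sh n P) W" using k(1) Wo by simp
          fix j assume j: "j \<in> J"
          have "f \<bullet> sm n (\<iota> j) = zr (sh n (B j)) W"
          proof (rule MD[OF goodD(2)[OF a(1)[OF j]]])
            show "f \<bullet> sm n (\<iota> j) \<in> Hom (sh n (B j)) W" using f k(2-5)[OF j] by simp
            fix i assume i: "i \<in> I"
            have "y i \<bullet> (f \<bullet> sm n (\<iota> j)) = (y i \<bullet> f) \<bullet> sm n (\<iota> j)" using y[OF i] f k(2-5)[OF j] by simp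
            also have "\<dots> = zr (sh n P) (A i) \<bullet> sm n (\<iota> j)" using yf i by simp
            finally show "y i \<bullet> (f \<bullet> sm n (\<iota> j)) = zr (sh n (B j)) (A i)" using k(1) k(2-5)[OF j] A[OF i] by simp
          qed
          then show "f \<bullet> sm n (\<iota> j) = zr (sh n P) W \<bullet> sm n (\<iota> j)" using k(1) k(2-5)[OF j] Wo by simp
        qed
      qed
      show "?E (sh n P)" unfolding lifts_def
      proof (intro allI impI)
        fix z assume "\<forall>i\<in>I. z i \<in> Hom (sh n P) (A i)"
        then have z: "z i \<in> Hom (sh n P) (A i)" if "i \<in> I" for i using that by blast
        have "\<exists>f\<in>Hom (sh n (B j)) W. \<forall>i\<in>I. y i \<bullet> f = z i \<bullet> sm n (\<iota> j)" if j: "j \<in> J" for j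
          by (rule ED[OF goodD(1)[OF a(1)[OF j]]]) (use z k(2-5)[OF j] in simp)
        then obtain f where f: "\<And>j. j \<in> J \<Longrightarrow> f j \<in> Hom (sh n (B j)) W"
          "\<And>j i. j \<in> J \<Longrightarrow> i \<in> I \<Longrightarrow> y i \<bullet> f j = z i \<bullet> sm n (\<iota> j)" by metis
        have "\<exists>v\<in>Hom (sh n P) W. \<forall>j\<in>J. v \<bullet> sm n (\<iota> j) = f j"
          by (rule coprod_factor_ex[OF c Wo]) (rule f(1))
        then obtain v where v: "v \<in> Hom (sh n P) W" "\<forall>j\<in>J. v \<bullet> sm n (\<iota> j) = f j" by (elim bexE)
        show "\<exists>f\<in>Hom (sh n P) W. \<forall>i\<in>I. y i \<bullet> f = z i"
        proof (intro bexI[OF _ v(1)] ballI)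
          fix i assume i: "i \<in> I"
          show "y i \<bullet> v = z i"
          proof (rule coprod_eqI[OF c])
            show "y i \<bullet> v \<in> Hom (sh n P) (A i)" using y[OF i] v(1) by simp
            show "z i \<in> Hom (sh n P) (A i)" by (rule z[OF i])
            fix j assume j: "j \<in> J"
            have "(y i \<bullet> v) \<bullet> sm n (\<iota> j) = y i \<bullet> (v \<bullet> sm n (\<iota> j))" using y[OF i] v(1) k(2-5)[OF j] by simp
            also have "\<dots> = y i \<bullet> f j" using v(2) j by simp
            finally show "(y i \<bullet> v) \<bullet> sm n (\<iota> j) = z i \<bullet> sm n (\<iota> j)" unfolding f(2)[OF j i] .
          qed
        qed
      qed
    qed
  qed
  moreover have "G \<subseteq> good"
  proof
    fix g assume g: "g \<in> G"
    show "g \<in> good"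
    proof (rule goodI)
      show "g \<in> obj T" using g Go by blast
      show "?E (sh n g)" "?M (sh n g)" for n using yE yM shG[OF g] by blast+
    qed
  qed
  ultimately have "Loc U T G \<subseteq> good" by (rule Loc_least)
  then have EM: "?E Y" "?M Y" if "Y \<in> Loc U T G" for Y
    using that goodD(1)[of Y 0] goodD(2)[of Y 0] by auto
  show ?thesis using that[of W y] W LL y' EM by blast
qed

section \<open>Products and coreflections\<close>

lemma prod_ex:
  assumes "compactly_generated U T" "small U I" "\<And>i. i \<in> I \<Longrightarrow> A i \<in> obj T"
  obtains P \<pi> where "is_product T I A P \<pi>"
proof -
  obtain G where G: "G \<subseteq> compact_objects U T" "small U G" "Loc U T G = obj T"
    using assms(1) unfolding compactly_generated_def by blast
  obtain P \<pi> where P0: "P \<in> Loc U T G" "\<forall>i\<in>I. \<pi> i \<in> Hom P (A i)"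
    "\<forall>Y\<in>Loc U T G. lifts I A P \<pi> Y" "\<forall>Y\<in>Loc U T G. separates I A P \<pi> Y"
    by (rule brown[OF assms(2,3) G(1,2)])
  then have P: "P \<in> Loc U T G" "\<And>i. i \<in> I \<Longrightarrow> \<pi> i \<in> Hom P (A i)" by blast+
  note E = liftsD[OF bspec[OF P0(3)]] and M = separatesD[OF bspec[OF P0(4)]]
  have "is_product T I A P \<pi>"
    unfolding is_product_def
  proof (intro conjI ballI allI impI)
    show Po: "P \<in> obj T" using P(1) G(3) by simp
    show "A i \<in> obj T" if "i \<in> I" for i by (rule assms(3)[OF that])
    show "\<pi> i \<in> mor T P (A i)" if "i \<in> I" for i using P(2)[OF that] unfolding Hom_def by blast
    fix Y g assume Y: "Y \<in> obj T" and g0: "\<forall>i\<in>I. g i \<in> mor T Y (A i)"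
    have g: "g i \<in> Hom Y (A i)" if "i \<in> I" for i
      using assms(3)[OF that] g0 Y that unfolding Hom_def by blast
    obtain u where u: "u \<in> Hom Y P" "\<forall>i\<in>I. \<pi> i \<bullet> u = g i" using E[of Y g] g Y G(3) by blast
    show "\<exists>!u. u \<in> mor T Y P \<and> (\<forall>i\<in>I. \<pi> i \<bullet> u = g i)"
    proof (rule ex1I[of _ u])
      show "u \<in> mor T Y P \<and> (\<forall>i\<in>I. \<pi> i \<bullet> u = g i)" using u unfolding Hom_def by blast
      fix v assume "v \<in> mor T Y P \<and> (\<forall>i\<in>I. \<pi> i \<bullet> v = g i)"
      then have v: "v \<in> Hom Y P" "\<forall>i\<in>I. \<pi> i \<bullet> v = g i" using Y Po by (auto simp: mor_Hom simp del: Hom_iff)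
      have "v \<boxminus> u = zr Y P"
      proof (rule M)
        show "Y \<in> Loc U T G" using Y G(3) by simp
        show "v \<boxminus> u \<in> Hom Y P" using u(1) v(1) by simp
        fix i assume i: "i \<in> I"
        have "\<pi> i \<bullet> (v \<boxminus> u) = \<pi> i \<bullet> v \<boxminus> \<pi> i \<bullet> u" by (rule cmp_sb_right) (use P(2)[OF i] u(1) v(1) in auto)
        then show "\<pi> i \<bullet> (v \<boxminus> u) = zr Y (A i)" using u(2) v(2) i g[OF i] by simp
      qed
      then show "v = u" by (rule sb_eq_zr[OF _ v(1) u(1)])
    qed
  qed
  then show ?thesis by (rule that)
qed

text \<open>For a one-element family, \<open>lifts\<close> and \<open>separates\<close> say that
  \<open>C -> X\<close> induces bijections on morphisms from \<open>Loc U T G\<close>. The third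
  vertex of its triangle is then orthogonal to \<open>Loc U T G\<close>.\<close>

lemma coreflection:
  assumes G: "G \<subseteq> compact_objects U T" "small U G" and X: "X \<in> obj T"
  obtains C W f g h where "C \<in> Loc U T G" "tri3 C X W f g h" "orth (Loc U T G) W"
proof -
  have Go: "G \<subseteq> obj T" using G compact_obj by blast
  have 1: "small U {()}" by (rule small_countable[OF universe]) simp
  obtain C y where C: "C \<in> Loc U T G" "\<forall>i\<in>{()}. y i \<in> Hom C X"
    and EM: "\<forall>Y\<in>Loc U T G. lifts {()} (\<lambda>_. X) C y Y" "\<forall>Y\<in>Loc U T G. separates {()} (\<lambda>_. X) C y Y"
    by (rule brown[where A = "\<lambda>_. X", OF 1 _ G]) (use X in auto)
  note E = liftsD[OF bspec[OF EM(1)]] and M = separatesD[OF bspec[OF EM(2)]]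
  let ?e = "y ()"
  have e: "?e \<in> Hom C X" using C(2) by blast
  obtain W g h where t: "tri3 C X W ?e g h" by (rule ex_cone[OF e])
  note T = tri3_Hom[OF t]
  note tr = localizingD[OF Loc_localizing[OF Go]]
  have "orth (Loc U T G) W"
  proof (rule orthI)
    show "W \<in> obj T" by (rule T)
    fix Y n k assume Y: "Y \<in> Loc U T G" and k: "k \<in> Hom (sh n Y) W"
    have Yo: "Y \<in> obj T" by (rule triangD(1)[OF tr Y])
    have s: "sh m Y \<in> Loc U T G" for m by (rule triangD(3)[OF tr Y])
    have hk: "h \<bullet> k \<in> Hom (sh n Y) (sh 1 C)" using k T by simp
    \<comment> \<open>As \<open>sm 1 ?e \<bullet> h = 0\<close>, the desuspension of
      \<open>h \<bullet> k\<close> is annihilated by \<open>?e\<close> and vanishes by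
      separation.\<close>
    have "sm (-1) (h \<bullet> k) = zr (sh (-1 + n) Y) C"
    proof (rule M[OF s])
      show "sm (-1) (h \<bullet> k) \<in> Hom (sh (-1 + n) Y) C" using hk Yo T by simp
      fix i :: unit
      have "sm 1 (?e \<bullet> sm (-1) (h \<bullet> k)) = (sm 1 ?e \<bullet> h) \<bullet> k" using T k by simp
      also have "\<dots> = zr (sh n Y) (sh 1 X)" unfolding tri3_comp_zero''[OF t] using T k by simp
      finally have "sm 1 (y i \<bullet> sm (-1) (h \<bullet> k)) = sm 1 (zr (sh (-1 + n) Y) X)" using X Yo by simp
      then show "y i \<bullet> sm (-1) (h \<bullet> k) = zr (sh (-1 + n) Y) X"
        by (rule sm_inj[rotated 2]) (use T hk X Yo in simp_all)
    qed
    then have "sm 1 (sm (-1) (h \<bullet> k)) = zr (sh n Y) (sh 1 C)" using T Yo by simp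
    then have "h \<bullet> k = zr (sh n Y) (sh 1 C)" using T k by simp
    then obtain l where l: "l \<in> Hom (sh n Y) X" "k = g \<bullet> l" by (rule weak_kernel2[OF t _ k])
    obtain f where f: "f \<in> Hom (sh n Y) C" "\<forall>i\<in>{()}. y i \<bullet> f = l" using E[OF s, of "\<lambda>_. l"] l(1) by blast
    have "k = g \<bullet> (?e \<bullet> f)" unfolding l(2) using f(2) by simp
    also have "\<dots> = (g \<bullet> ?e) \<bullet> f" using f(1) T by simp
    finally show "k = zr (sh n Y) W" unfolding tri3_comp_zero[OF t] using f(1) T by simp
  qed
  then show ?thesis by (rule that[OF C(1) t])
qed

end

section \<open>Bousfield localization\<close>

context triangulated_category
begin

lemma iso_cone_zero:
  assumes "tri3 X Y Z f g h" "is_iso T X Y f" shows "is_zero T Z"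
proof -
  note t = tri3_Hom[OF assms(1)]
  obtain k where k: "k \<in> Hom Y X" "k \<bullet> f = ide T X" "f \<bullet> k = ide T Y"
    using assms(2) is_iso_iff[OF t(10,11)] by blast
  have "g = (g \<bullet> f) \<bullet> k" using t k(1) k(3) by simp
  then have g: "g = zr Y Z" unfolding tri3_comp_zero[OF assms(1)] using t k(1) by simp
  have "sm 1 (k \<bullet> f) \<bullet> h = sm 1 k \<bullet> (sm 1 f \<bullet> h)" using t k(1) by simp
  then have h: "h = zr Z (sh 1 X)" unfolding tri3_comp_zero''[OF assms(1)] k(2) using t k(1) by simp
  obtain l where l: "l \<in> Hom Z Y" "ide T Z = g \<bullet> l"
    by (rule weak_kernel2[OF assms(1), of "ide T Z" Z]) (use h t in auto)
  show ?thesis using l g t by (intro is_zeroI) auto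
qed

end

context cocomplete_category
begin

text \<open>The universal morphism from \<open>X\<close> to an object orthogonal to
  \<open>S\<close>. Uniqueness is stated for zero composites, the form in which weak cokernels
  deliver it.\<close>

definition reflection :: "'o set \<Rightarrow> 'o \<Rightarrow> 'o \<Rightarrow> 'm \<Rightarrow> bool" where
  "reflection S X V v \<longleftrightarrow> v \<in> Hom X V \<and> orth S V \<and>
     (\<forall>V' k. orth S V' \<longrightarrow> k \<in> Hom X V' \<longrightarrow> (\<exists>l\<in>Hom V V'. l \<bullet> v = k)) \<and>
     (\<forall>V' l. orth S V' \<longrightarrow> l \<in> Hom V V' \<longrightarrow> l \<bullet> v = zr X V' \<longrightarrow> l = zr V V')"

lemma reflectionD:
  assumes "reflection S X V v"
  shows "v \<in> Hom X V" "orth S V"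
  using assms unfolding reflection_def by blast+

lemma reflection_Hom:
  assumes "reflection S X V v"
  shows "arr v" "dm v = X" "cd v = V" "X \<in> obj T" "V \<in> obj T"
  using reflectionD(1)[OF assms] by auto

lemma reflection_lift:
  assumes "reflection S X V v" "orth S V'" "k \<in> Hom X V'"
  obtains l where "l \<in> Hom V V'" "l \<bullet> v = k"
  using assms unfolding reflection_def by blast

lemma reflection_zero:
  assumes "reflection S X V v" "orth S V'" "l \<in> Hom V V'" "l \<bullet> v = zr X V'"
  shows "l = zr V V'"
  using assms unfolding reflection_def by blast

lemma reflection_unique:
  assumes "reflection S X V v" "orth S V'" "l \<in> Hom V V'" "l' \<in> Hom V V'" "l \<bullet> v = l' \<bullet> v"
  shows "l = l'"
proof -
  note v = reflectionD(1)[OF assms(1)]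
  have "(l \<boxminus> l') \<bullet> v = l \<bullet> v \<boxminus> l' \<bullet> v" by (rule cmp_sb_left) (use v assms(3,4) in auto)
  also have "\<dots> = zr X V'" unfolding assms(5) using v assms(4) by simp
  finally have "l \<boxminus> l' = zr V V'"
    by (intro reflection_zero[OF assms(1,2)]) (use assms(3,4) in auto)
  then show ?thesis by (rule sb_eq_zr[OF _ assms(3,4)])
qed

lemma reflectionI:
  assumes "v \<in> Hom X V" "orth S V"
    "\<And>V' k. orth S V' \<Longrightarrow> k \<in> Hom X V' \<Longrightarrow> \<exists>l\<in>Hom V V'. l \<bullet> v = k"
    "\<And>V' l. orth S V' \<Longrightarrow> l \<in> Hom V V' \<Longrightarrow> l \<bullet> v = zr X V' \<Longrightarrow> l = zr V V'"
  shows "reflection S X V v"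
  unfolding reflection_def using assms by (intro conjI allI impI)

lemma reflection_iso:
  assumes "reflection S X V v" "reflection S X V' v'" "u \<in> Hom V V'" "u \<bullet> v = v'"
  shows "is_iso T V V' u"
proof -
  note v = reflectionD[OF assms(1)] and v' = reflectionD[OF assms(2)]
  obtain w where w: "w \<in> Hom V' V" "w \<bullet> v' = v" by (rule reflection_lift[OF assms(2) v(2) v(1)])
  have "w \<bullet> u = ide T V"
  proof (rule reflection_unique[OF assms(1) v(2)])
    have "(w \<bullet> u) \<bullet> v = w \<bullet> (u \<bullet> v)" using w(1) assms(3) v(1) by simp
    then show "(w \<bullet> u) \<bullet> v = ide T V \<bullet> v" unfolding assms(4) w(2) using v(1) by simp
  qed (use w(1) assms(3) in auto)
  moreover have "u \<bullet> w = ide T V'"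
  proof (rule reflection_unique[OF assms(2) v'(2)])
    have "(u \<bullet> w) \<bullet> v' = u \<bullet> (w \<bullet> v')" using w(1) assms(3) v'(1) by simp
    then show "(u \<bullet> w) \<bullet> v' = ide T V' \<bullet> v'" unfolding w(2) assms(4) using v'(1) by simp
  qed (use w(1) assms(3) in auto)
  ultimately show ?thesis using w(1) assms(3) by (subst is_iso_iff) (auto simp del: Hom_iff, auto)
qed

lemma reflection_of_triangle:
  assumes t: "tri3 C X V f v h" and C: "C \<in> S" and V: "orth S V"
  shows "reflection S X V v"
proof (rule reflectionI[OF _ V])
  note T = tri3_Hom[OF t]
  show v: "v \<in> Hom X V" using T by simp
  show "\<exists>l\<in>Hom V V'. l \<bullet> v = k" if V': "orth S V'" and k: "k \<in> Hom X V'" for V' k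
  proof -
    have "k \<bullet> f = zr C V'" by (rule orthD0[OF V' C]) (use k T in simp)
    then obtain l where "l \<in> Hom V V'" "k = l \<bullet> v" by (rule weak_cokernel[OF t _ k])
    then show ?thesis by blast
  qed
  show "l = zr V V'" if V': "orth S V'" and l: "l \<in> Hom V V'" and z: "l \<bullet> v = zr X V'" for V' l
  proof -
    obtain m where m: "m \<in> Hom (sh 1 C) V'" "l = m \<bullet> h" by (rule weak_cokernel2[OF t z l])
    have "m = zr (sh 1 C) V'" by (rule orthD[OF V' C m(1)])
    then show ?thesis using m T l by simp
  qed
qed

lemma reflection_sh:
  assumes "reflection S X V v" "S \<subseteq> obj T" shows "reflection S (sh n X) (sh n V) (sm n v)"
proof (rule reflectionI)
  note v = reflectionD[OF assms(1)]
  have vo: "X \<in> obj T" "V \<in> obj T" using v(1) by auto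
  show "sm n v \<in> Hom (sh n X) (sh n V)" using v(1) by simp
  show "orth S (sh n V)" by (rule orth_sh[OF v(2) assms(2)])
  show "\<exists>l\<in>Hom (sh n V) V'. l \<bullet> sm n v = k" if V': "orth S V'" and k: "k \<in> Hom (sh n X) V'" for V' k
  proof -
    have "sm (-n) k \<in> Hom X (sh (-n) V')" using k vo by simp
    then obtain l where l: "l \<in> Hom V (sh (-n) V')" "l \<bullet> v = sm (-n) k"
      by (rule reflection_lift[OF assms(1) orth_sh[OF V' assms(2)]])
    have "sm n l \<bullet> sm n v = sm n (l \<bullet> v)" using l(1) v(1) by simp
    also have "\<dots> = k" unfolding l(2) using k by simp
    finally show ?thesis using l(1) orth_obj[OF V'] by (intro bexI[of _ "sm n l"]) auto
  qed
  show "l = zr (sh n V) V'" if V': "orth S V'" and l: "l \<in> Hom (sh n V) V'" and z: "l \<bullet> sm n v = zr (sh n X) V'" for V' l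
  proof -
    have "sm (-n) l \<bullet> v = sm (-n) (l \<bullet> sm n v)" using l v(1) by simp
    also have "\<dots> = zr X (sh (-n) V')" unfolding z using l vo by simp
    finally have "sm (-n) l = zr V (sh (-n) V')"
      by (intro reflection_zero[OF assms(1) orth_sh[OF V' assms(2)]]) (use l vo in auto)
    then have "sm n (sm (-n) l) = zr (sh n V) V'" using vo l by simp
    then show ?thesis using l by simp
  qed
qed

text \<open>The five lemma for morphisms into an object orthogonal to \<open>S\<close>: reflections
  of the first two vertices induce one of the third. Exactness of the localization functor rests on
  this.\<close>

lemma reflection_cone:
  assumes S: "S \<subseteq> obj T" and X: "reflection S X X' x" and Y: "reflection S Y Y' y"
    and t: "tri3 X Y Z f g h" and t': "tri3 X' Y' Z' f' g' h'"
    and c: "c \<in> Hom Z Z'" and fx: "y \<bullet> f = f' \<bullet> x" and gy: "c \<bullet> g = g' \<bullet> y" and hc: "sm 1 x \<bullet> h = h' \<bullet> c"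
  shows "reflection S Z Z' c"
proof (rule reflectionI[OF c])
  note T = tri3_Hom[OF t] and T' = tri3_Hom[OF t'] and xH = reflection_Hom[OF X] and yH = reflection_Hom[OF Y]
  note sX = reflection_sh[OF X S, of 1] and sY = reflection_sh[OF Y S, of 1]
  show "orth S Z'"
    by (rule orth_dist[OF _ reflectionD(2)[OF X] reflectionD(2)[OF Y] S]) (use t' in \<open>auto simp: dist_def\<close>)
  show "\<exists>l\<in>Hom Z' V. l \<bullet> c = k" if V: "orth S V" and k: "k \<in> Hom Z V" for V k
  proof -
    have Vo: "V \<in> obj T" using k by simp
    have "k \<bullet> g \<in> Hom Y V" using k T by simp
    then obtain l where l: "l \<in> Hom Y' V" "l \<bullet> y = k \<bullet> g" by (rule reflection_lift[OF Y V])
    have "(l \<bullet> f') \<bullet> x = l \<bullet> (y \<bullet> f)" unfolding fx using l(1) T' xH by simp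
    also have "\<dots> = (l \<bullet> y) \<bullet> f" using l(1) yH T by simp
    also have "\<dots> = k \<bullet> (g \<bullet> f)" unfolding l(2) using k T by simp
    finally have "(l \<bullet> f') \<bullet> x = zr X V" unfolding tri3_comp_zero[OF t] using k T by simp
    then have "l \<bullet> f' = zr X' V" by (intro reflection_zero[OF X V]) (use l(1) T' in auto)
    then obtain m where m: "m \<in> Hom Z' V" "l = m \<bullet> g'" by (rule weak_cokernel[OF t' _ l(1)])
    have mc: "m \<bullet> c \<in> Hom Z V" using m(1) c by simp
    have "(k \<boxminus> m \<bullet> c) \<bullet> g = k \<bullet> g \<boxminus> (m \<bullet> c) \<bullet> g" by (rule cmp_sb_left) (use k mc T in auto)
    also have "(m \<bullet> c) \<bullet> g = m \<bullet> (c \<bullet> g)" using m(1) c T by simp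
    also have "\<dots> = k \<bullet> g" unfolding gy l(2)[symmetric] m(2) using m(1) T' yH by simp
    finally have "(k \<boxminus> m \<bullet> c) \<bullet> g = zr Y V" using k T by simp
    \<comment> \<open>The error of \<open>m\<close> vanishes on \<open>Y\<close>, hence comes from
      \<open>sh 1 X\<close> and extends along the reflection of \<open>sh 1 X\<close>.\<close>
    then obtain n where n: "n \<in> Hom (sh 1 X) V" "k \<boxminus> m \<bullet> c = n \<bullet> h"
      by (rule weak_cokernel2[OF t]) (use k mc in auto)
    obtain n' where n': "n' \<in> Hom (sh 1 X') V" "n' \<bullet> sm 1 x = n" by (rule reflection_lift[OF sX V n(1)])
    have "n \<bullet> h = n' \<bullet> (sm 1 x \<bullet> h)" unfolding n'(2)[symmetric] using n'(1) xH T by simp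
    also have "\<dots> = (n' \<bullet> h') \<bullet> c" unfolding hc using n'(1) T' c by simp
    finally have nh: "k \<boxminus> m \<bullet> c = (n' \<bullet> h') \<bullet> c" unfolding n(2) .
    have "(n' \<bullet> h' \<boxplus> m) \<bullet> c = (n' \<bullet> h') \<bullet> c \<boxplus> m \<bullet> c"
      by (rule cmp_add_l) (use n'(1) T' m(1) c in auto)
    also have "\<dots> = k" unfolding nh[symmetric] using k mc by simp
    finally show ?thesis using n'(1) T' m(1) by (intro bexI[of _ "n' \<bullet> h' \<boxplus> m"]) auto
  qed
  show "l = zr Z' V" if V: "orth S V" and l: "l \<in> Hom Z' V" and z: "l \<bullet> c = zr Z V" for V l
  proof -
    have Vo: "V \<in> obj T" using l by simp
    have "(l \<bullet> g') \<bullet> y = l \<bullet> (c \<bullet> g)" unfolding gy using l T' yH by simp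
    also have "\<dots> = (l \<bullet> c) \<bullet> g" using l c T by simp
    finally have "(l \<bullet> g') \<bullet> y = zr Y V" unfolding z using T Vo by simp
    then have "l \<bullet> g' = zr Y' V" by (intro reflection_zero[OF Y V]) (use l T' in auto)
    then obtain m where m: "m \<in> Hom (sh 1 X') V" "l = m \<bullet> h'" by (rule weak_cokernel2[OF t' _ l])
    have mx: "m \<bullet> sm 1 x \<in> Hom (sh 1 X) V" using m(1) xH by simp
    have "(m \<bullet> sm 1 x) \<bullet> h = m \<bullet> (sm 1 x \<bullet> h)" using m(1) xH T by simp
    also have "\<dots> = (m \<bullet> h') \<bullet> c" unfolding hc using m(1) T' c by simp
    finally have "(m \<bullet> sm 1 x) \<bullet> h = zr Z V" unfolding m(2)[symmetric] z .
    then obtain n where n: "n \<in> Hom (sh 1 Y) V" "m \<bullet> sm 1 x = n \<bullet> ng (sm 1 f)"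
      by (rule weak_cokernel2[OF tri3_rotate[OF t] _ mx])
    obtain n' where n': "n' \<in> Hom (sh 1 Y') V" "n' \<bullet> sm 1 y = n" by (rule reflection_lift[OF sY V n(1)])
    have "sm 1 y \<bullet> sm 1 f = sm 1 (y \<bullet> f)" using yH T by simp
    also have "\<dots> = sm 1 f' \<bullet> sm 1 x" unfolding fx using T' xH by simp
    finally have e: "sm 1 y \<bullet> sm 1 f = sm 1 f' \<bullet> sm 1 x" .
    have nf: "ng (n' \<bullet> sm 1 f') \<in> Hom (sh 1 X') V" using n'(1) T' by simp
    have "m \<bullet> sm 1 x = ng (n' \<bullet> (sm 1 y \<bullet> sm 1 f))"
      unfolding n(2) n'(2)[symmetric] using n'(1) yH T by simp
    also have "\<dots> = ng (n' \<bullet> sm 1 f') \<bullet> sm 1 x" unfolding e using n'(1) T' xH by simp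
    \<comment> \<open>Consequently \<open>l\<close> factors through
      \<open>sm 1 f' \<bullet> h' = 0\<close>.\<close>
    finally have "m = ng (n' \<bullet> sm 1 f')" by (rule reflection_unique[OF sX V m(1) nf])
    then have "l = ng (n' \<bullet> (sm 1 f' \<bullet> h'))" unfolding m(2) using n'(1) T' by simp
    then show ?thesis unfolding tri3_comp_zero''[OF t'] using n'(1) T' Vo by simp
  qed
qed

text \<open>The universal property dictates the whole structure: \<open>Q\<close> and
  \<open>\<eta>\<close> are read off from the triangles, and the action on morphisms and its laws
  follow by unique extension along the reflections.\<close>

lemma bousfield:
  assumes S: "localizing U T S"
    and tri: "\<And>X. X \<in> obj T \<Longrightarrow> \<exists>C W f g h. C \<in> S \<and> tri3 C X W f g h \<and> orth S W"
  shows "\<exists>L \<eta>. localization_functor T L \<eta> \<and> functor_kernel T L = S"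
proof -
  note tS = localizingD[OF S]
  have So: "S \<subseteq> obj T" using triangD(1)[OF tS] by blast
  have "\<exists>W g. \<exists>C f h. C \<in> S \<and> tri3 C X W f g h \<and> orth S W" if "X \<in> obj T" for X
    using tri[OF that] by metis
  then obtain Q \<eta> where Q: "\<And>X. X \<in> obj T \<Longrightarrow> \<exists>C f h. C \<in> S \<and> tri3 C X (Q X) f (\<eta> X) h \<and> orth S (Q X)"
    by metis
  have R: "reflection S X (Q X) (\<eta> X)" if "X \<in> obj T" for X
    using Q[OF that] reflection_of_triangle by blast
  have Qo: "Q X \<in> obj T" if "X \<in> obj T" for X using reflection_Hom(5)[OF R[OF that]] .
  have Qorth: "orth S (Q X)" if "X \<in> obj T" for X using reflectionD(2)[OF R[OF that]] .
  have \<eta>H: "\<eta> X \<in> Hom X (Q X)" if "X \<in> obj T" for X using reflectionD(1)[OF R[OF that]] .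
  have "\<exists>k\<in>Hom (Q (dm f)) (Q (cd f)). k \<bullet> \<eta> (dm f) = \<eta> (cd f) \<bullet> f" if "arr f" for f
  proof -
    have "\<eta> (cd f) \<bullet> f \<in> Hom (dm f) (Q (cd f))" using \<eta>H[of "cd f"] that by simp
    then show ?thesis using reflection_lift[OF R[of "dm f"] Qorth[of "cd f"]] that by (metis cd_obj dm_obj)
  qed
  then obtain F where F: "\<And>f. arr f \<Longrightarrow> F f \<in> Hom (Q (dm f)) (Q (cd f))"
    and F\<eta>: "\<And>f. arr f \<Longrightarrow> F f \<bullet> \<eta> (dm f) = \<eta> (cd f) \<bullet> f" by metis
  have Funiq: "F f = k" if f: "f \<in> Hom X Y" and k: "k \<in> Hom (Q X) (Q Y)" "k \<bullet> \<eta> X = \<eta> Y \<bullet> f" for f k X Y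
  proof (rule reflection_unique[OF R Qorth])
    show "X \<in> obj T" "Y \<in> obj T" "F f \<in> Hom (Q X) (Q Y)" using f F[of f] by auto
    show "k \<in> Hom (Q X) (Q Y)" by (rule k(1))
    show "F f \<bullet> \<eta> X = k \<bullet> \<eta> X" unfolding k(2) using F\<eta>[of f] f by simp
  qed
  have FH: "F f \<in> Hom (Q X) (Q Y)" if "f \<in> Hom X Y" for f X Y using F[of f] that by simp
  have FE: "F f \<bullet> \<eta> X = \<eta> Y \<bullet> f" if "f \<in> Hom X Y" for f X Y using F\<eta>[of f] that by simp
  let ?L = "\<lparr>on_ob = Q, on_mor = F\<rparr>"
  have add: "additive_endofunctor T ?L"
  proof
    show "on_ob ?L X \<in> obj T" if "X \<in> obj T" for X using Qo[OF that] by simp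
    show "on_mor ?L f \<in> mor T (on_ob ?L X) (on_ob ?L Y)" if "X \<in> obj T" "Y \<in> obj T" "f \<in> mor T X Y" for X Y f
      using FH[of f X Y] that unfolding Hom_def by simp
    show "on_mor ?L (ide T X) = ide T (on_ob ?L X)" if X: "X \<in> obj T" for X
      using Funiq[OF ide_Hom[OF X] ide_Hom[OF Qo[OF X]]] \<eta>H[OF X] X by simp
    show "on_mor ?L (g \<bullet> f) = on_mor ?L g \<bullet> on_mor ?L f"
      if "X \<in> obj T" "Y \<in> obj T" "Z \<in> obj T" "f \<in> mor T X Y" "g \<in> mor T Y Z" for X Y Z f g
    proof -
      have fg: "f \<in> Hom X Y" "g \<in> Hom Y Z" using that unfolding Hom_def by blast+
      have "F (g \<bullet> f) = F g \<bullet> F f"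
      proof (rule Funiq)
        show "g \<bullet> f \<in> Hom X Z" "F g \<bullet> F f \<in> Hom (Q X) (Q Z)" using fg FH[OF fg(1)] FH[OF fg(2)] by auto
        have "(F g \<bullet> F f) \<bullet> \<eta> X = F g \<bullet> (F f \<bullet> \<eta> X)" using FH[OF fg(1)] FH[OF fg(2)] \<eta>H[OF that(1)] by simp
        also have "\<dots> = (F g \<bullet> \<eta> Y) \<bullet> f" unfolding FE[OF fg(1)] using FH[OF fg(2)] \<eta>H[OF that(2)] fg by simp
        also have "\<dots> = \<eta> Z \<bullet> (g \<bullet> f)" unfolding FE[OF fg(2)] using \<eta>H[OF that(3)] fg by simp
        finally show "(F g \<bullet> F f) \<bullet> \<eta> X = \<eta> Z \<bullet> (g \<bullet> f)" .
      qed
      then show ?thesis by simp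
    qed
    show "on_mor ?L (f \<boxplus> f') = on_mor ?L f \<boxplus> on_mor ?L f'"
      if "X \<in> obj T" "Y \<in> obj T" "f \<in> mor T X Y" "f' \<in> mor T X Y" for X Y f f'
    proof -
      have ff: "f \<in> Hom X Y" "f' \<in> Hom X Y" using that unfolding Hom_def by blast+
      have "F (f \<boxplus> f') = F f \<boxplus> F f'"
      proof (rule Funiq)
        show "f \<boxplus> f' \<in> Hom X Y" "F f \<boxplus> F f' \<in> Hom (Q X) (Q Y)" using ff FH[OF ff(1)] FH[OF ff(2)] by auto
        have "(F f \<boxplus> F f') \<bullet> \<eta> X = F f \<bullet> \<eta> X \<boxplus> F f' \<bullet> \<eta> X"
          by (rule cmp_add_l) (use FH[OF ff(1)] FH[OF ff(2)] \<eta>H[OF that(1)] in auto)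
        also have "\<dots> = \<eta> Y \<bullet> (f \<boxplus> f')" unfolding FE[OF ff(1)] FE[OF ff(2)]
          by (rule cmp_add_r[symmetric]) (use ff \<eta>H[OF that(2)] in auto)
        finally show "(F f \<boxplus> F f') \<bullet> \<eta> X = \<eta> Y \<bullet> (f \<boxplus> f')" .
      qed
      then show ?thesis by simp
    qed
  qed
  \<comment> \<open>Both \<open>Q (sh 1 X)\<close> and \<open>sh 1 (Q X)\<close> reflect
    \<open>sh 1 X\<close>, and \<open>\<theta>\<close> compares them.\<close>
  have "\<exists>\<theta>. \<theta> \<in> Hom (Q (sh 1 X)) (sh 1 (Q X)) \<and> \<theta> \<bullet> \<eta> (sh 1 X) = sm 1 (\<eta> X)" if X: "X \<in> obj T" for X
    using reflection_lift[OF R[OF sh_obj[OF X]] orth_sh[OF Qorth[OF X] So], of "sm 1 (\<eta> X)" 1 1] \<eta>H[OF X] by (metis Hom_iff sh_obj sm_simps)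
  then obtain \<theta> where \<theta>: "\<And>X. X \<in> obj T \<Longrightarrow> \<theta> X \<in> Hom (Q (sh 1 X)) (sh 1 (Q X))"
    and \<theta>\<eta>: "\<And>X. X \<in> obj T \<Longrightarrow> \<theta> X \<bullet> \<eta> (sh 1 X) = sm 1 (\<eta> X)" by metis
  have \<theta>nat: "\<theta> Y \<bullet> F (sm 1 f) = sm 1 (F f) \<bullet> \<theta> X" if f: "f \<in> Hom X Y" for f X Y
  proof (rule reflection_unique[OF R])
    have XY: "X \<in> obj T" "Y \<in> obj T" using f by auto
    have sf: "sm 1 f \<in> Hom (sh 1 X) (sh 1 Y)" using f by simp
    show "sh 1 X \<in> obj T" using XY by simp
    show "orth S (sh 1 (Q Y))" by (rule orth_sh[OF Qorth[OF XY(2)] So])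
    show "\<theta> Y \<bullet> F (sm 1 f) \<in> Hom (Q (sh 1 X)) (sh 1 (Q Y))" using \<theta>[OF XY(2)] FH[OF sf] by simp
    show "sm 1 (F f) \<bullet> \<theta> X \<in> Hom (Q (sh 1 X)) (sh 1 (Q Y))" using \<theta>[OF XY(1)] FH[OF f] by simp
    have "(\<theta> Y \<bullet> F (sm 1 f)) \<bullet> \<eta> (sh 1 X) = \<theta> Y \<bullet> (F (sm 1 f) \<bullet> \<eta> (sh 1 X))"
      using \<theta>[OF XY(2)] FH[OF sf] \<eta>H[of "sh 1 X"] XY by simp
    also have "\<dots> = (\<theta> Y \<bullet> \<eta> (sh 1 Y)) \<bullet> sm 1 f" unfolding FE[OF sf] using \<theta>[OF XY(2)] \<eta>H[of "sh 1 Y"] sf XY by simp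
    also have "\<dots> = sm 1 (\<eta> Y \<bullet> f)" unfolding \<theta>\<eta>[OF XY(2)] using \<eta>H[OF XY(2)] f by simp
    also have "\<dots> = sm 1 (F f) \<bullet> sm 1 (\<eta> X)" unfolding FE[OF f, symmetric] using FH[OF f] \<eta>H[OF XY(1)] by simp
    also have "\<dots> = (sm 1 (F f) \<bullet> \<theta> X) \<bullet> \<eta> (sh 1 X)"
      unfolding \<theta>\<eta>[OF XY(1), symmetric] using \<theta>[OF XY(1)] FH[OF f] \<eta>H[of "sh 1 X"] XY by simp
    finally show "(\<theta> Y \<bullet> F (sm 1 f)) \<bullet> \<eta> (sh 1 X) = (sm 1 (F f) \<bullet> \<theta> X) \<bullet> \<eta> (sh 1 X)" .
  qed
  \<comment> \<open>The cone of \<open>F f\<close> is a reflection of \<open>Z\<close> by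
    \<open>reflection_cone\<close>, hence isomorphic to \<open>Q Z\<close>; along this isomorphism
    the chosen triangle becomes the required one.\<close>
  have \<theta>tri: "(F f, F g, \<theta> X \<bullet> F h) \<in> tri T" if t: "tri3 X Y Z f g h" for X Y Z f g h
  proof -
    note H = tri3_Hom[OF t]
    have fH: "f \<in> Hom X Y" and gH: "g \<in> Hom Y Z" and hH: "h \<in> Hom Z (sh 1 X)" using H by auto
    obtain Z' g' h' where t': "tri3 (Q X) (Q Y) Z' (F f) g' h'" by (rule ex_cone[OF FH[OF fH]])
    note H' = tri3_Hom[OF t']
    obtain c where c: "c \<in> Hom Z Z'" "c \<bullet> g = g' \<bullet> \<eta> Y" "sm 1 (\<eta> X) \<bullet> h = h' \<bullet> c"
      by (rule tri3_complete[OF t t' \<eta>H[OF H(10)] \<eta>H[OF H(11)] FE[OF fH, symmetric]])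
    have Z': "reflection S Z Z' c"
      by (rule reflection_cone[OF So R[OF H(10)] R[OF H(11)] t t' c(1) FE[OF fH, symmetric] c(2,3)])
    obtain w where w: "w \<in> Hom Z' (Q Z)" "w \<bullet> c = \<eta> Z"
      by (rule reflection_lift[OF Z' Qorth[OF H(12)] \<eta>H[OF H(12)]])
    have wi: "is_iso T Z' (Q Z) w" by (rule reflection_iso[OF Z' R[OF H(12)] w])
    have wg: "w \<bullet> g' = F g"
    proof (rule Funiq[OF gH, symmetric])
      show "w \<bullet> g' \<in> Hom (Q Y) (Q Z)" using w(1) H' by simp
      have "(w \<bullet> g') \<bullet> \<eta> Y = w \<bullet> (c \<bullet> g)" unfolding c(2) using w(1) H' \<eta>H[OF H(11)] by simp
      also have "\<dots> = (w \<bullet> c) \<bullet> g" using w(1) c(1) gH by simp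
      finally show "(w \<bullet> g') \<bullet> \<eta> Y = \<eta> Z \<bullet> g" unfolding w(2) .
    qed
    have wh: "h' = (\<theta> X \<bullet> F h) \<bullet> w"
    proof (rule reflection_unique[OF Z' orth_sh[OF Qorth[OF H(10)] So]])
      show "h' \<in> Hom Z' (sh 1 (Q X))" "(\<theta> X \<bullet> F h) \<bullet> w \<in> Hom Z' (sh 1 (Q X))"
        using H' \<theta>[OF H(10)] FH[OF hH] w(1) by auto
      have "((\<theta> X \<bullet> F h) \<bullet> w) \<bullet> c = \<theta> X \<bullet> (F h \<bullet> (w \<bullet> c))" using \<theta>[OF H(10)] FH[OF hH] w(1) c(1) by simp
      also have "\<dots> = (\<theta> X \<bullet> \<eta> (sh 1 X)) \<bullet> h"
        unfolding w(2) FE[OF hH] using \<theta>[OF H(10)] \<eta>H[of "sh 1 X"] hH by simp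
      also have "\<dots> = h' \<bullet> c" unfolding \<theta>\<eta>[OF H(10)] c(3) ..
      finally show "h' \<bullet> c = ((\<theta> X \<bullet> F h) \<bullet> w) \<bullet> c" by simp
    qed
    have i: "is_iso T V V (ide T V)" if "V \<in> obj T" for V
      using isomorphic_refl[OF that] is_iso_iff[OF that that] ide_Hom[OF that] that by auto
    show ?thesis
    proof (rule tri_iso[of "F f" g' h' "Q X" "Q Y" Z' "Q X" "Q Y" "Q Z" "F f" "F g" "\<theta> X \<bullet> F h" "ide T (Q X)" "ide T (Q Y)" w])
      show "(F f, g', h') \<in> tri T" using t' unfolding tri3_def by blast
      show "w \<bullet> g' = F g \<bullet> ide T (Q Y)" unfolding wg using FH[OF gH] by simp
      show "susp_mor T (ide T (Q X)) \<bullet> h' = (\<theta> X \<bullet> F h) \<bullet> w"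
        using wh H' by (simp add: susp_mor_sm)
    qed (use H H' wi i FH[OF fH] FH[OF gH] FH[OF hH] \<theta>[OF H(10)] in \<open>auto simp: mor_iff susp_ob_sh\<close>)
  qed
  have ex: "exact_functor T ?L"
    unfolding exact_functor_def susp_ob_sh susp_mor_sm
  proof (intro conjI exI[of _ \<theta>] ballI allI impI)
    show "additive_endofunctor T ?L" by (rule add)
    fix X assume X: "X \<in> obj T"
    show "is_iso T (on_ob ?L (sh 1 X)) (sh 1 (on_ob ?L X)) (\<theta> X)"
      using reflection_iso[OF R[OF sh_obj[OF X]] reflection_sh[OF R[OF X] So] \<theta>[OF X] \<theta>\<eta>[OF X]] by simp
    fix Y f assume Y: "Y \<in> obj T" and f: "f \<in> mor T X Y"
    then have f: "f \<in> Hom X Y" using X unfolding Hom_def by blast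
    show "\<theta> Y \<bullet> on_mor ?L (sm 1 f) = sm 1 (on_mor ?L f) \<bullet> \<theta> X" using \<theta>nat[OF f] by simp
    fix g h assume t: "(f, g, h) \<in> tri T"
    obtain Y' Z where "g \<in> Hom Y' Z" using tri_mor[OF t] unfolding Hom_def by blast
    then have "tri3 X Y Z f g h" using tri_tri3[OF t f] by blast
    then show "(on_mor ?L f, on_mor ?L g, \<theta> X \<bullet> on_mor ?L h) \<in> tri T" using \<theta>tri by simp
  qed
  have "localization_functor T ?L \<eta>"
    unfolding localization_functor_def
  proof (intro conjI ballI)
    show "exact_functor T ?L" by (rule ex)
    fix X assume X: "X \<in> obj T"
    show "\<eta> X \<in> mor T X (on_ob ?L X)" using \<eta>H[OF X] unfolding Hom_def by simp
    show "\<eta> Y \<bullet> f = on_mor ?L f \<bullet> \<eta> X" if "Y \<in> obj T" "f \<in> mor T X Y" for Y f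
      using FE[of f X Y] that X unfolding Hom_def by simp
    \<comment> \<open>\<open>F (\<eta> X)\<close> and \<open>\<eta> (Q X)\<close> extend the same
      morphism along \<open>\<eta> X\<close>.\<close>
    have Fe: "F (\<eta> X) = \<eta> (Q X)" by (rule Funiq[OF \<eta>H[OF X] \<eta>H[OF Qo[OF X]]]) simp
    then show "on_mor ?L (\<eta> X) = \<eta> (on_ob ?L X)" by simp
    have "reflection S (Q X) (Q X) (ide T (Q X))"
      using Qo[OF X] Qorth[OF X] by (intro reflectionI) (auto intro: bexI)
    then have "is_iso T (Q X) (Q (Q X)) (\<eta> (Q X))"
      by (rule reflection_iso[OF _ R[OF Qo[OF X]] \<eta>H[OF Qo[OF X]]]) (use \<eta>H[OF Qo[OF X]] in simp)
    then show "is_iso T (on_ob ?L X) (on_ob ?L (on_ob ?L X)) (on_mor ?L (\<eta> X))" unfolding Fe[symmetric] by simp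
  qed
  moreover have "functor_kernel T ?L = S"
  proof (intro subset_antisym subsetI)
    fix X assume "X \<in> functor_kernel T ?L"
    then have X: "X \<in> obj T" and z: "is_zero T (Q X)" unfolding functor_kernel_def by auto
    obtain C f h where "C \<in> S" "tri3 C X (Q X) f (\<eta> X) h" using Q[OF X] by blast
    then show "X \<in> S" using triangD(5)[OF tS _ _ triangD(2)[OF tS z]] unfolding dist_def by blast
  next
    fix X assume XS: "X \<in> S"
    then have X: "X \<in> obj T" using So by blast
    obtain C f h where "C \<in> S" "tri3 C X (Q X) f (\<eta> X) h" using Q[OF X] by blast
    then have "Q X \<in> S" using triangD(4)[OF tS _ _ XS] unfolding dist_def by blast
    then have "is_zero T (Q X)" by (rule orth_self_zero[OF Qorth[OF X]])
    then show "X \<in> functor_kernel T ?L" using X unfolding functor_kernel_def by simp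
  qed
  ultimately show ?thesis by blast
qed


lemma triang_zero: "triang {Z. is_zero T Z}"
proof -
  have "{Z. is_zero T Z} = {W. orth (obj T) W}"
    using orth_zero orth_self_zero orth_obj by blast
  then show ?thesis using triang_orth[of "obj T"] by simp
qed

section \<open>Kernel and local objects of a localization functor\<close>

context
  fixes L :: "('o, 'm) endofunctor" and \<eta> :: "'o \<Rightarrow> 'm"
  assumes L: "localization_functor T L \<eta>"
begin

lemma L_exact: "exact_functor T L" using L unfolding localization_functor_def by blast

lemma L_additive: "additive_endofunctor T L" using L_exact unfolding exact_functor_def by blast

lemma L_obj [simp]: "X \<in> obj T \<Longrightarrow> on_ob L X \<in> obj T"
  using additive_endofunctor.on_ob[OF L_additive] .

lemma L_Hom: "f \<in> Hom X Y \<Longrightarrow> on_mor L f \<in> Hom (on_ob L X) (on_ob L Y)"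
  using additive_endofunctor.on_mor[OF L_additive, of X Y f] L_obj unfolding Hom_def by blast

lemma eta_Hom: "X \<in> obj T \<Longrightarrow> \<eta> X \<in> Hom X (on_ob L X)"
  using L L_obj unfolding localization_functor_def Hom_def by blast

lemma eta_natural: "f \<in> Hom X Y \<Longrightarrow> \<eta> Y \<bullet> f = on_mor L f \<bullet> \<eta> X"
  using L unfolding localization_functor_def Hom_def by blast

lemma L_eta:
  assumes "X \<in> obj T"
  shows "is_iso T (on_ob L X) (on_ob L (on_ob L X)) (on_mor L (\<eta> X))" "on_mor L (\<eta> X) = \<eta> (on_ob L X)"
  using L assms unfolding localization_functor_def by blast+

lemma L_zr:
  assumes "X \<in> obj T" "Y \<in> obj T" shows "on_mor L (zr X Y) = zr (on_ob L X) (on_ob L Y)"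
proof -
  let ?z = "on_mor L (zr X Y)"
  have H: "?z \<in> Hom (on_ob L X) (on_ob L Y)" using L_Hom[OF Hom_zero[OF assms]] .
  have "zr X Y \<in> mor T X Y" using Hom_zero[OF assms] unfolding Hom_def by blast
  then have "on_mor L (zr X Y \<boxplus> zr X Y) = ?z \<boxplus> ?z"
    using additive_endofunctor.on_add[OF L_additive assms] by blast
  then have "?z \<boxplus> zr (on_ob L X) (on_ob L Y) = ?z \<boxplus> ?z" using assms H by simp
  from add_left_cancel[OF this] show ?thesis using H assms by simp
qed

abbreviation (input) K where "K \<equiv> functor_kernel T L"

lemma KI: "X \<in> obj T \<Longrightarrow> is_zero T (on_ob L X) \<Longrightarrow> X \<in> K" unfolding functor_kernel_def by blast

lemma KD: assumes "X \<in> K" shows "X \<in> obj T" "is_zero T (on_ob L X)"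
  using assms unfolding functor_kernel_def by blast+

lemma L_tri3: assumes "tri3 X Y Z f g h"
  shows "\<exists>h'. tri3 (on_ob L X) (on_ob L Y) (on_ob L Z) (on_mor L f) (on_mor L g) h'"
proof -
  note t = tri3_Hom[OF assms]
  obtain \<theta> where "\<forall>X\<in>obj T. \<forall>Y\<in>obj T. \<forall>f\<in>mor T X Y. \<forall>g h. (f, g, h) \<in> tri T \<longrightarrow>
             (on_mor L f, on_mor L g, \<theta> X \<bullet> on_mor L h) \<in> tri T"
    using L_exact unfolding exact_functor_def by (elim conjE exE)
  moreover have "f \<in> mor T X Y" "(f, g, h) \<in> tri T" using assms unfolding tri3_def Hom_def by blast+
  ultimately have 1: "(on_mor L f, on_mor L g, \<theta> X \<bullet> on_mor L h) \<in> tri T" using t(10,11) by blast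
  have "on_mor L f \<in> Hom (on_ob L X) (on_ob L Y)" "on_mor L g \<in> Hom (on_ob L Y) (on_ob L Z)"
    by (rule L_Hom, use t in simp)+
  then show ?thesis using tri_tri3[OF 1] by blast
qed

lemma L_sh1_zero: assumes "X \<in> obj T" shows "is_zero T (on_ob L (sh 1 X)) \<longleftrightarrow> is_zero T (on_ob L X)"
proof -
  obtain \<theta> where "\<forall>X\<in>obj T. is_iso T (on_ob L (susp_ob T X)) (susp_ob T (on_ob L X)) (\<theta> X)"
    using L_exact unfolding exact_functor_def by (elim conjE exE)
  then have i: "isomorphic T (on_ob L (sh 1 X)) (sh 1 (on_ob L X))"
    using assms unfolding isomorphic_def susp_ob_sh by blast
  have o: "on_ob L (sh 1 X) \<in> obj T" "sh 1 (on_ob L X) \<in> obj T" using assms by auto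
  have "is_zero T (on_ob L (sh 1 X)) \<longleftrightarrow> is_zero T (sh 1 (on_ob L X))"
    using i isomorphic_sym[OF i] iso_zero o unfolding isomorphic_def by blast
  then show ?thesis using is_zero_sh_iff[OF L_obj[OF assms]] by simp
qed

lemma K_triang: "triang K"
  unfolding triang_def
proof (intro conjI allI impI ballI)
  show "K \<subseteq> obj T" using KD by blast
  show "Z \<in> K" if Z: "is_zero T Z" for Z
  proof (rule KI)
    show "Z \<in> obj T" using Z by simp
    have "ide T (on_ob L Z) = on_mor L (ide T Z)" using additive_endofunctor.on_ide[OF L_additive] Z by simp
    also have "\<dots> = zr (on_ob L Z) (on_ob L Z)" using Z L_zr[of Z Z] unfolding is_zero_iff by simp
    finally show "is_zero T (on_ob L Z)" using Z by (intro is_zeroI) auto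
  qed
  show "sh n X \<in> K" if X: "X \<in> K" for X n
  proof -
    have Xo: "X \<in> obj T" by (rule KD[OF X])
    show ?thesis
    proof (induction n rule: int_up_down)
      case (2 n)
      have "is_zero T (on_ob L (sh 1 (sh n X)))"
        using L_sh1_zero[of "sh n X"] KD[OF 2] by simp
      then show ?case using Xo by (intro KI) auto
    next
      case (3 n)
      have "is_zero T (on_ob L (sh 1 (sh (-1 + n) X)))" using KD[OF 3] Xo by simp
      then show ?case using L_sh1_zero[of "sh (-1 + n) X"] Xo by (intro KI) auto
    qed (use X in simp)
  qed
  show "Z \<in> K" if d: "dist X Y Z" and X: "X \<in> K" and Y: "Y \<in> K" for X Y Z
  proof -
    have "dist (on_ob L X) (on_ob L Y) (on_ob L Z)" using d L_tri3 unfolding dist_def by blast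
    then have "is_zero T (on_ob L Z)" using triangD(4)[OF triang_zero] KD(2)[OF X] KD(2)[OF Y] by blast
    then show ?thesis using dist_obj[OF d] by (intro KI) auto
  qed
qed

text \<open>As \<open>\<eta>\<close> is invertible on \<open>on_ob L X\<close>, a morphism
  \<open>f\<close> into this object is recovered from its composite with \<open>\<eta>\<close>. By
  naturality that composite passes through \<open>L\<close> of the source, which is zero.\<close>

lemma L_orth: assumes "X \<in> obj T" shows "orth K (on_ob L X)"
proof (rule orthI)
  show "on_ob L X \<in> obj T" using assms by simp
  fix Y n f assume Y: "Y \<in> K" and f: "f \<in> Hom (sh n Y) (on_ob L X)"
  let ?V = "on_ob L X" and ?Y = "sh n Y"
  have Y': "?Y \<in> K" by (rule triangD(3)[OF K_triang Y])
  note Yo = KD[OF Y']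
  obtain w where w: "w \<in> Hom (on_ob L ?V) ?V" "w \<bullet> \<eta> ?V = ide T ?V"
    using L_eta[OF assms] is_iso_iff[of ?V "on_ob L ?V" "\<eta> ?V"] assms by auto
  have e: "\<eta> ?Y = zr ?Y (on_ob L ?Y)" by (rule to_zero[OF Yo(2) eta_Hom[OF Yo(1)]])
  have "f = (w \<bullet> \<eta> ?V) \<bullet> f" unfolding w(2) using f by simp
  also have "\<dots> = w \<bullet> (\<eta> ?V \<bullet> f)" using w(1) eta_Hom[of ?V] assms f by simp
  also have "\<dots> = w \<bullet> (on_mor L f \<bullet> \<eta> ?Y)" using eta_natural[OF f] by simp
  also have "\<dots> = zr ?Y ?V" unfolding e using w(1) L_Hom[OF f] Yo(1) by simp
  finally show "f = zr (sh n Y) (on_ob L X)" .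
qed

text \<open>\<open>L\<close> turns \<open>\<eta> X\<close> into an isomorphism and hence the
  remaining vertex into zero.\<close>

lemma K_triangle: assumes "tri3 C X (on_ob L X) f (\<eta> X) h" shows "C \<in> K"
proof -
  note t = tri3_Hom[OF assms]
  obtain h' where "tri3 (on_ob L C) (on_ob L X) (on_ob L (on_ob L X)) (on_mor L f) (on_mor L (\<eta> X)) h'"
    using L_tri3[OF assms] by blast
  from iso_cone_zero[OF tri3_rotate[OF this] L_eta(1)[OF t(11)]]
  have "is_zero T (on_ob L C)" using is_zero_sh_iff t(10) by simp
  then show ?thesis using t(10) by (intro KI)
qed

lemma ex_K_triangle: assumes "X \<in> obj T" obtains C f h where "C \<in> K" "tri3 C X (on_ob L X) f (\<eta> X) h"
proof -
  obtain Z b c where t: "tri3 X (on_ob L X) Z (\<eta> X) b c" by (rule ex_cone[OF eta_Hom[OF assms]])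
  from tri3_unrotate[OF t] K_triangle show ?thesis using that by blast
qed

lemma triangle_zero_iff:
  assumes t: "tri3 C X (on_ob L X) f (\<eta> X) h"
  shows "is_zero T C \<longleftrightarrow> orth K X"
proof -
  note T = tri3_Hom[OF t]
  have KO: "K \<subseteq> obj T" using KD by blast
  have d: "dist C X (on_ob L X)" using t unfolding dist_def by blast
  show ?thesis
  proof
    assume "is_zero T C"
    then show "orth K X"
      using triangD(5)[OF triang_orth[OF KO] d] orth_zero L_orth[OF T(11)] by blast
  next
    assume "orth K X"
    then have "orth K C" using triangD(6)[OF triang_orth[OF KO] d] L_orth[OF T(11)] by blast
    then show "is_zero T C" by (rule orth_self_zero[OF _ K_triangle[OF t]])
  qed
qed

lemma orth_iso: assumes "orth K X" shows "is_iso T X (on_ob L X) (\<eta> X)"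
proof -
  obtain C f h where C: "C \<in> K" "tri3 C X (on_ob L X) f (\<eta> X) h"
    by (rule ex_K_triangle[OF orth_obj[OF assms]])
  then have "is_zero T (sh 1 C)" using triangle_zero_iff[OF C(2)] assms is_zero_sh by blast
  then show ?thesis using cone_zero_iso[OF tri3_rotate[OF C(2)]] by blast
qed

text \<open>If \<open>X\<close> is left orthogonal to the local object \<open>on_ob L X\<close>,
  then by the triangle of \<open>X\<close> that object is left orthogonal to itself, hence zero.
  Left orthogonals are closed under coproducts, so this description makes the kernel
  localizing.\<close>

lemma K_iff_left_orth: "X \<in> K \<longleftrightarrow> X \<in> obj T \<and> (\<forall>Y. orth K Y \<longrightarrow> X \<in> left_orth Y)"
proof
  assume X: "X \<in> K"
  then show "X \<in> obj T \<and> (\<forall>Y. orth K Y \<longrightarrow> X \<in> left_orth Y)"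
    using KD(1) orthD[OF _ X] by (auto intro!: left_orthI intro: orth_obj simp del: Hom_iff)
next
  assume a: "X \<in> obj T \<and> (\<forall>Y. orth K Y \<longrightarrow> X \<in> left_orth Y)"
  then have X: "X \<in> obj T" by blast
  obtain C f h where C: "C \<in> K" "tri3 C X (on_ob L X) f (\<eta> X) h" by (rule ex_K_triangle[OF X])
  have "X \<in> left_orth (on_ob L X)" using a L_orth[OF X] by blast
  moreover have "C \<in> left_orth (on_ob L X)"
    by (rule left_orthI) (use KD(1)[OF C(1)] X orthD[OF L_orth[OF X] C(1)] in \<open>auto simp del: Hom_iff\<close>)
  ultimately have "on_ob L X \<in> left_orth (on_ob L X)"
    using triangD(4)[OF localizingD[OF localizing_left_orth[OF L_obj[OF X]]]] C(2) unfolding dist_def by blast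
  then have "ide T (on_ob L X) = zr (on_ob L X) (on_ob L X)"
    using left_orthD[of "on_ob L X" "on_ob L X" "ide T (on_ob L X)" 0] X by simp
  then show "X \<in> K" using X by (intro KI is_zeroI) auto
qed

lemma K_localizing: "localizing U T K"
proof (rule localizingI[OF K_triang])
  fix I :: "'u set" and A P \<iota>
  assume a: "small U I" "\<And>i. i \<in> I \<Longrightarrow> A i \<in> K" "is_coproduct T I A P \<iota>"
  have "P \<in> left_orth Y" if Y: "orth K Y" for Y
    by (rule localizing_coprod[OF localizing_left_orth[OF orth_obj[OF Y]] a(1) _ a(3)])
      (use a(2) Y K_iff_left_orth in blast)
  then show "P \<in> K" using coprod_Hom(1)[OF a(3)] K_iff_left_orth by blast
qed

text \<open>On local objects \<open>\<eta>\<close> is invertible. If \<open>L\<close> preserves the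
  coproduct, the inverses on the summands assemble to an inverse \<open>u\<close> of
  \<open>\<eta> P\<close>, so \<open>P\<close> is isomorphic to a local object.\<close>

lemma orth_K_localizing:
  assumes "preserves_coproducts U T L" shows "localizing U T {X. orth K X}"
proof (rule localizingI)
  have KO: "K \<subseteq> obj T" using KD by blast
  show tr: "triang {X. orth K X}" by (rule triang_orth[OF KO])
  fix I :: "'u set" and A P \<iota>
  assume a: "I \<subseteq> U" "small U I" "\<And>i. i \<in> I \<Longrightarrow> A i \<in> {X. orth K X}" "is_coproduct T I A P \<iota>"
  note c = coprod_Hom[OF a(4)]
  have c': "is_coproduct T I (\<lambda>i. on_ob L (A i)) (on_ob L P) (\<lambda>i. on_mor L (\<iota> i))"
    using assms[unfolded preserves_coproducts_def, rule_format, OF a(1) conjI[OF a(2,4)]] .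
  note k = coprod_Hom[OF c']
  have "\<exists>w\<in>Hom (on_ob L (A i)) (A i). \<eta> (A i) \<bullet> w = ide T (on_ob L (A i)) \<and> w \<bullet> \<eta> (A i) = ide T (A i)"
    if i: "i \<in> I" for i
    using orth_iso[of "A i"] a(3)[OF i] is_iso_iff[OF c(5)[OF i] k(5)[OF i]] by auto
  then obtain w where w: "\<And>i. i \<in> I \<Longrightarrow> w i \<in> Hom (on_ob L (A i)) (A i)"
    "\<And>i. i \<in> I \<Longrightarrow> \<eta> (A i) \<bullet> w i = ide T (on_ob L (A i))" "\<And>i. i \<in> I \<Longrightarrow> w i \<bullet> \<eta> (A i) = ide T (A i)" by metis
  have "\<exists>u\<in>Hom (on_ob L P) P. \<forall>i\<in>I. u \<bullet> on_mor L (\<iota> i) = \<iota> i \<bullet> w i"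
    by (rule coprod_factor_ex[OF c' c(1)]) (use w(1) c in auto)
  then obtain u where u: "u \<in> Hom (on_ob L P) P" "\<forall>i\<in>I. u \<bullet> on_mor L (\<iota> i) = \<iota> i \<bullet> w i" by (elim bexE)
  note eP = eta_Hom[OF c(1)]
  have eA: "\<eta> (A i) \<in> Hom (A i) (on_ob L (A i))" if "i \<in> I" for i by (rule eta_Hom[OF c(5)[OF that]])
  have iH: "\<iota> i \<in> Hom (A i) P" if "i \<in> I" for i using c that by simp
  note LiH = L_Hom[OF iH]
  have 1: "u \<bullet> \<eta> P = ide T P"
  proof (rule coprod_eqI[OF a(4)])
    show "u \<bullet> \<eta> P \<in> Hom P P" "ide T P \<in> Hom P P" using u(1) eP c(1) by auto
    fix i assume i: "i \<in> I"
    have "(u \<bullet> \<eta> P) \<bullet> \<iota> i = u \<bullet> (\<eta> P \<bullet> \<iota> i)" using u(1) eP iH[OF i] by simp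
    also have "\<dots> = (u \<bullet> on_mor L (\<iota> i)) \<bullet> \<eta> (A i)"
      unfolding eta_natural[OF iH[OF i]] using u(1) LiH[OF i] eA[OF i] by simp
    also have "\<dots> = \<iota> i \<bullet> (w i \<bullet> \<eta> (A i))" using u(2) i w(1)[OF i] iH[OF i] eA[OF i] by simp
    finally show "(u \<bullet> \<eta> P) \<bullet> \<iota> i = ide T P \<bullet> \<iota> i" unfolding w(3)[OF i] using iH[OF i] by simp
  qed
  have 2: "\<eta> P \<bullet> u = ide T (on_ob L P)"
  proof (rule coprod_eqI[OF c'])
    show "\<eta> P \<bullet> u \<in> Hom (on_ob L P) (on_ob L P)" "ide T (on_ob L P) \<in> Hom (on_ob L P) (on_ob L P)"
      using u(1) eP c(1) by auto
    fix i assume i: "i \<in> I"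
    have "(\<eta> P \<bullet> u) \<bullet> on_mor L (\<iota> i) = \<eta> P \<bullet> (u \<bullet> on_mor L (\<iota> i))" using u(1) eP LiH[OF i] by simp
    also have "\<dots> = (\<eta> P \<bullet> \<iota> i) \<bullet> w i" using u(2) i w(1)[OF i] iH[OF i] eP by simp
    also have "\<dots> = on_mor L (\<iota> i) \<bullet> (\<eta> (A i) \<bullet> w i)"
      unfolding eta_natural[OF iH[OF i]] using LiH[OF i] eA[OF i] w(1)[OF i] by simp
    finally show "(\<eta> P \<bullet> u) \<bullet> on_mor L (\<iota> i) = ide T (on_ob L P) \<bullet> on_mor L (\<iota> i)"
      unfolding w(2)[OF i] using LiH[OF i] by simp
  qed
  have "is_iso T (on_ob L P) P u"
    unfolding is_iso_iff[OF L_obj[OF c(1)] c(1)] using u(1) 1 2 eP by blast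
  then show "P \<in> {X. orth K X}"
    using triangD(7)[OF tr _ _ c(1)] L_orth[OF c(1)] unfolding isomorphic_def by blast
qed

end

end

section \<open>Torsion with respect to even elements\<close>

context graded_commutative_ring
begin

section \<open>Homogeneous components and even elements\<close>

sublocale ring R by (rule is_ring)

lemma grade_carrier: "r \<in> grade R n \<Longrightarrow> r \<in> carrier R"
  using subgroup.mem_carrier[OF grade_subgroup[of n]] by simp

lemma grade_zero [simp]: "\<zero> \<in> grade R n"
  using subgroup.one_closed[OF grade_subgroup[of n]] by simp

lemma grade_add: "r \<in> grade R n \<Longrightarrow> s \<in> grade R n \<Longrightarrow> r \<oplus> s \<in> grade R n"
  using subgroup.m_closed[OF grade_subgroup[of n]] by simp

lemma grade_minus: "r \<in> grade R n \<Longrightarrow> \<ominus> r \<in> grade R n"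
  using subgroup.m_inv_closed[OF grade_subgroup[of n]] by (simp add: a_inv_def)

lemma grade_even_comm: "r \<in> grade R m \<Longrightarrow> s \<in> grade R n \<Longrightarrow> even m \<Longrightarrow> r \<otimes> s = s \<otimes> r"
  using graded_comm[of r m s n] by simp

lemma grade_group_group: "group (grade_group R n)"
  unfolding grade_group_def
  by (rule subgroup.subgroup_is_group[OF grade_subgroup]) (rule a_group)

lemma carrier_components: "carrier (sum_group UNIV (grade_group R)) =
    {x. (\<forall>n. x n \<in> grade R n) \<and> finite {n. x n \<noteq> \<zero>}}"
  using carrier_sum_group[of UNIV "grade_group R"] grade_group_group by (auto simp: grade_group_def)

lemma component:
  assumes "r \<in> carrier R"
  shows "component R r n \<in> grade R n" "finite {n. component R r n \<noteq> \<zero>}" "sum_of_components R (component R r) = r"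
proof -
  have bij: "bij_betw (sum_of_components R) (carrier (sum_group UNIV (grade_group R))) (carrier R)"
    using direct_sum by (simp add: iso_def)
  then have r: "r \<in> sum_of_components R ` carrier (sum_group UNIV (grade_group R))"
    using assms by (simp add: bij_betw_def)
  then have "component R r \<in> carrier (sum_group UNIV (grade_group R))"
    unfolding component_def by (rule inv_into_into)
  then show "component R r n \<in> grade R n" "finite {n. component R r n \<noteq> \<zero>}"
    unfolding carrier_components by auto
  show "sum_of_components R (component R r) = r"
    unfolding component_def using f_inv_into_f[OF r] .
qed

lemma component_sum:
  assumes "\<And>n. x n \<in> grade R n" "finite {n. x n \<noteq> \<zero>}"
  shows "component R (sum_of_components R x) = x"
proof -
  have "inj_on (sum_of_components R) (carrier (sum_group UNIV (grade_group R)))"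
    using direct_sum by (simp add: iso_def bij_betw_def)
  moreover have "x \<in> carrier (sum_group UNIV (grade_group R))" unfolding carrier_components using assms by blast
  ultimately show ?thesis unfolding component_def by (rule inv_into_f_f)
qed

lemma sum_of_components_single:
  assumes "r \<in> carrier R" shows "sum_of_components R (\<lambda>k. if k = n then r else \<zero>) = r"
proof -
  let ?x = "\<lambda>k. if k = n then r else \<zero>"
  have "gfinprod (add_monoid R) ?x UNIV = gfinprod (add_monoid R) ?x {n}"
    by (rule comm_monoid.gfinprod_mono_neutral_cong_right[OF a_comm_monoid]) (use assms in auto)
  also have "\<dots> = finprod (add_monoid R) ?x {n}"
    by (rule comm_monoid.gfinprod_eq_finprod[OF a_comm_monoid]) (use assms in auto)
  also have "\<dots> = r" using comm_monoid.finprod_insert[OF a_comm_monoid, of "{}" n ?x] assms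
    by (simp add: comm_monoid.finprod_empty[OF a_comm_monoid])
  finally show ?thesis by (simp add: sum_of_components_def)
qed

lemma component_homogeneous:
  assumes "r \<in> grade R n" shows "component R r = (\<lambda>k. if k = n then r else \<zero>)"
proof -
  have "finite {k. (if k = n then r else \<zero>) \<noteq> \<zero>}" by (rule finite_subset[of _ "{n}"]) auto
  then have "component R (sum_of_components R (\<lambda>k. if k = n then r else \<zero>)) = (\<lambda>k. if k = n then r else \<zero>)"
    using assms by (intro component_sum) auto
  then show ?thesis unfolding sum_of_components_single[OF grade_carrier[OF assms]] .
qed

lemma component_add:
  assumes "r \<in> carrier R" "s \<in> carrier R"
  shows "component R (r \<oplus> s) n = component R r n \<oplus> component R s n"
proof -
  let ?S = "sum_group UNIV (grade_group R)"
  have c: "component R r \<in> carrier ?S" "component R s \<in> carrier ?S"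
    unfolding carrier_components using component[OF assms(1)] component[OF assms(2)] by auto
  have "sum_of_components R (component R r \<otimes>\<^bsub>?S\<^esub> component R s) = r \<oplus> s"
    using hom_mult[OF iso_imp_homomorphism[OF direct_sum] c] component(3) assms by simp
  moreover have "component R r \<otimes>\<^bsub>?S\<^esub> component R s = (\<lambda>n. component R r n \<oplus> component R s n)"
    by (auto simp: grade_group_def)
  ultimately have e: "sum_of_components R (\<lambda>n. component R r n \<oplus> component R s n) = r \<oplus> s" by simp
  have "finite {n. component R r n \<oplus> component R s n \<noteq> \<zero>}"
    by (rule finite_subset[OF _ finite_UnI[OF component(2)[OF assms(1)] component(2)[OF assms(2)]]])
      (use grade_carrier component(1) assms in auto)
  then have "component R (sum_of_components R (\<lambda>n. component R r n \<oplus> component R s n))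
      = (\<lambda>n. component R r n \<oplus> component R s n)"
    using component(1) assms grade_add by (intro component_sum) auto
  then show ?thesis unfolding e by simp
qed

text \<open>
  An element of \<open>even_elements\<close> carries its degree along; as it commutes with all of \<open>R\<close> and
  its action commutes with the suspension strictly, working with squares avoids all signs.
\<close>

definition even_elements :: "(int \<times> 'r) set" where
  "even_elements = {(n, r). even n \<and> r \<in> grade R n}"

definition mul :: "int \<times> 'r \<Rightarrow> int \<times> 'r \<Rightarrow> int \<times> 'r" where
  "mul a b = (fst a + fst b, snd a \<otimes> snd b)"

primrec pw :: "int \<times> 'r \<Rightarrow> nat \<Rightarrow> int \<times> 'r" where
  "pw a 0 = (0, \<one>)"
| "pw a (Suc k) = mul a (pw a k)"

lemma evenD: assumes "a \<in> even_elements" shows "even (fst a)" "snd a \<in> grade R (fst a)" "snd a \<in> carrier R"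
  using assms grade_carrier unfolding even_elements_def by auto

lemma evenI: "even n \<Longrightarrow> r \<in> grade R n \<Longrightarrow> (n, r) \<in> even_elements"
  unfolding even_elements_def by blast

lemma one_even: "(0, \<one>) \<in> even_elements"
  using one_grade by (intro evenI) auto

lemma mul_even: "a \<in> even_elements \<Longrightarrow> b \<in> even_elements \<Longrightarrow> mul a b \<in> even_elements"
  unfolding mul_def using evenD mult_grade by (intro evenI) auto

lemma mul_comm: "a \<in> even_elements \<Longrightarrow> b \<in> even_elements \<Longrightarrow> mul a b = mul b a"
  unfolding mul_def using grade_even_comm[OF evenD(2) evenD(2) evenD(1)] by simp

lemma mul_assoc: "a \<in> even_elements \<Longrightarrow> b \<in> even_elements \<Longrightarrow> c \<in> even_elements \<Longrightarrow>
    mul (mul a b) c = mul a (mul b c)"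
  unfolding mul_def using evenD(3) by (simp add: m_assoc)

lemma mul_one: "a \<in> even_elements \<Longrightarrow> mul a (0, \<one>) = a" "a \<in> even_elements \<Longrightarrow> mul (0, \<one>) a = a"
  unfolding mul_def using evenD(3)[of a] by simp_all

lemma pw_even: "a \<in> even_elements \<Longrightarrow> pw a k \<in> even_elements"
  by (induction k) (auto intro: one_even mul_even)

lemma pw_add: "a \<in> even_elements \<Longrightarrow> pw a (j + k) = mul (pw a j) (pw a k)"
  by (induction j) (auto simp: mul_one pw_even mul_assoc)

text \<open>The multiplicative set that stands in for \<open>denominators\<close>: it contains the
  squares of all homogeneous elements outside \<pp>, so making its elements invertible does the same
  to every denominator.\<close>

definition avoiding :: "'r set \<Rightarrow> (int \<times> 'r) set" where
  "avoiding \<pp> = {a \<in> even_elements. snd a \<notin> \<pp>}"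

definition mult_closed :: "(int \<times> 'r) set \<Rightarrow> bool" where
  "mult_closed M \<longleftrightarrow> M \<subseteq> even_elements \<and> (0, \<one>) \<in> M \<and> (\<forall>a\<in>M. \<forall>b\<in>M. mul a b \<in> M)"

lemma SpecD:
  assumes "\<pp> \<in> Spec R"
  shows "homogeneous_ideal \<pp> R" "ideal \<pp> R" "\<pp> \<noteq> carrier R" "\<one> \<notin> \<pp>" "\<zero> \<in> \<pp>"
    "r \<in> \<pp> \<Longrightarrow> component R r n \<in> \<pp>"
    "r \<in> grade R m \<Longrightarrow> s \<in> grade R n \<Longrightarrow> r \<otimes> s \<in> \<pp> \<Longrightarrow> r \<in> \<pp> \<or> s \<in> \<pp>"
    "r \<in> \<pp> \<Longrightarrow> r \<in> carrier R"
proof -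
  have 1: "homogeneous_ideal \<pp> R" "\<pp> \<noteq> carrier R"
    and 2: "\<forall>r \<in> homogeneous R. \<forall>s \<in> homogeneous R. r \<otimes> s \<in> \<pp> \<longrightarrow> r \<in> \<pp> \<or> s \<in> \<pp>"
    using assms unfolding Spec_def by blast+
  show "homogeneous_ideal \<pp> R" "\<pp> \<noteq> carrier R" by (fact 1)+
  show I: "ideal \<pp> R" using 1(1) unfolding homogeneous_ideal_def by blast
  show "\<one> \<notin> \<pp>" using ideal.one_imp_carrier[OF I] 1(2) by blast
  show "\<zero> \<in> \<pp>" using additive_subgroup.zero_closed[OF ideal.axioms(1)[OF I]] .
  show "r \<in> \<pp> \<Longrightarrow> component R r n \<in> \<pp>" using 1(1) unfolding homogeneous_ideal_def by blast
  show "r \<in> grade R m \<Longrightarrow> s \<in> grade R n \<Longrightarrow> r \<otimes> s \<in> \<pp> \<Longrightarrow> r \<in> \<pp> \<or> s \<in> \<pp>"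
    using 2 unfolding homogeneous_def by blast
  show "r \<in> \<pp> \<Longrightarrow> r \<in> carrier R" using additive_subgroup.a_Hcarr[OF ideal.axioms(1)[OF I]] .
qed

lemma avoiding_mult_closed: assumes "\<pp> \<in> Spec R" shows "mult_closed (avoiding \<pp>)"
  unfolding mult_closed_def avoiding_def
proof (intro conjI ballI)
  show "(0, \<one>) \<in> {a \<in> even_elements. snd a \<notin> \<pp>}" using one_even SpecD(4)[OF assms] by simp
  show "mul a b \<in> {a \<in> even_elements. snd a \<notin> \<pp>}"
    if a: "a \<in> {a \<in> even_elements. snd a \<notin> \<pp>}" and b: "b \<in> {a \<in> even_elements. snd a \<notin> \<pp>}" for a b
  proof -
    have "snd a \<otimes> snd b \<notin> \<pp>" using SpecD(7)[OF assms evenD(2) evenD(2), of a b] a b by auto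
    then show ?thesis using a b mul_even by (simp add: mul_def)
  qed
qed auto

lemma square_even: "r \<in> grade R n \<Longrightarrow> (n + n, r \<otimes> r) \<in> even_elements"
  by (rule evenI[OF _ mult_grade]) auto

lemma square_avoiding:
  "\<pp> \<in> Spec R \<Longrightarrow> r \<in> grade R n \<Longrightarrow> r \<notin> \<pp> \<Longrightarrow> (n + n, r \<otimes> r) \<in> avoiding \<pp>"
  unfolding avoiding_def using square_even SpecD(7)[of \<pp> r n r n] by auto

lemma powers_mult_closed: assumes "a \<in> even_elements" shows "mult_closed (range (pw a))"
  unfolding mult_closed_def
proof (intro conjI ballI)
  show "range (pw a) \<subseteq> even_elements" using pw_even[OF assms] by blast
  show "(0, \<one>) \<in> range (pw a)" by (rule image_eqI[of _ _ 0]) auto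
  show "mul b c \<in> range (pw a)" if bc: "b \<in> range (pw a)" "c \<in> range (pw a)" for b c
  proof -
    obtain j where j: "b = pw a j" using bc(1) by blast
    obtain k where k: "c = pw a k" using bc(2) by blast
    have "mul b c = pw a (j + k)" unfolding j k by (rule pw_add[OF assms, symmetric])
    then show ?thesis by (rule range_eqI)
  qed
qed

end

section \<open>The action of even elements on morphisms\<close>

locale linear_cocomplete = cocomplete_category T U + R: graded_commutative_ring R
  for T :: "('o, 'm, 'r) linear_category" (structure) and U :: "'u set" and R :: "'r graded_ring" +
  assumes linear: "linear_structure R T"
begin

abbreviation "E \<equiv> R.even_elements"

lemma center_Hom: "r \<in> grade R n \<Longrightarrow> X \<in> obj T \<Longrightarrow> center_act T n r X \<in> Hom X (sh n X)"
  using linear_structure.act_center[OF linear, of r n] sh_obj unfolding graded_center_def Hom_def by blast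

lemma center_natural:
  "r \<in> grade R n \<Longrightarrow> f \<in> Hom X Y \<Longrightarrow> center_act T n r Y \<bullet> f = sm n f \<bullet> center_act T n r X"
  using linear_structure.act_center[OF linear, of r n] unfolding graded_center_def Hom_def by blast

lemma center_zero: assumes "X \<in> obj T" shows "center_act T n \<zero>\<^bsub>R\<^esub> X = zr X (sh n X)"
proof -
  let ?z = "center_act T n \<zero>\<^bsub>R\<^esub> X"
  have H: "?z \<in> Hom X (sh n X)" using center_Hom[OF R.grade_zero assms] .
  have "?z = ?z \<boxplus> ?z"
    using linear_structure.act_add[OF linear R.grade_zero R.grade_zero assms, of n] by simp
  then have "?z \<boxplus> zr X (sh n X) = ?z \<boxplus> ?z" using H by simp
  from add_left_cancel[OF this] show ?thesis using H assms by simp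
qed

definition act :: "int \<times> 'r \<Rightarrow> 'o \<Rightarrow> 'm" where "act a X = center_act T (fst a) (snd a) X"

lemma act_Hom: "a \<in> E \<Longrightarrow> X \<in> obj T \<Longrightarrow> act a X \<in> Hom X (sh (fst a) X)"
  unfolding act_def using center_Hom R.evenD(2) by blast

lemma act_simps [simp]:
  assumes "a \<in> E" "X \<in> obj T"
  shows "arr (act a X)" "dm (act a X) = X" "cd (act a X) = sh (fst a) X"
  using act_Hom[OF assms] by auto

lemma act_natural: "a \<in> E \<Longrightarrow> f \<in> Hom X Y \<Longrightarrow> act a Y \<bullet> f = sm (fst a) f \<bullet> act a X"
  unfolding act_def using center_natural R.evenD(2) by blast

text \<open>In even degree the sign in the definition of the graded center disappears.\<close>

lemma act_sh: assumes "a \<in> E" "X \<in> obj T" shows "act a (sh i X) = sm i (act a X)"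
proof -
  have 1: "act a (sh 1 Y) = sm 1 (act a Y)" if "Y \<in> obj T" for Y
  proof -
    have "center_act T (fst a) (snd a) \<in> graded_center T (fst a)"
      using linear_structure.act_center[OF linear R.evenD(2)[OF assms(1)]] .
    then show ?thesis using that R.evenD(1)[OF assms(1)]
      unfolding graded_center_def act_def susp_ob_sh susp_mor_sm by simp
  qed
  show ?thesis
  proof (induction i rule: int_up_down)
    case (2 n)
    then show ?case using 1[of "sh n X"] assms by simp
  next
    case (3 n)
    have "sm 1 (act a (sh (-1 + n) X)) = sm n (act a X)" using 1[of "sh (-1 + n) X"] 3 assms by simp
    also have "\<dots> = sm 1 (sm (-1 + n) (act a X))" using sm_dn[of "act a X" n] assms by simp
    finally show ?case by (rule sm_inj[rotated 2]) (use assms in simp_all)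
  qed simp
qed

lemma act_mul: assumes "a \<in> E" "b \<in> E" "X \<in> obj T"
  shows "act (R.mul a b) X = act a (sh (fst b) X) \<bullet> act b X"
  unfolding act_sh[OF assms(1,3)]
  using linear_structure.act_mult[OF linear R.evenD(2)[OF assms(1)] R.evenD(2)[OF assms(2)] assms(3)]
  by (simp add: act_def R.mul_def)

lemma act_one [simp]: "X \<in> obj T \<Longrightarrow> act (0, \<one>\<^bsub>R\<^esub>) X = ide T X"
  unfolding act_def using linear_structure.act_one[OF linear] by simp

definition kills :: "int \<times> 'r \<Rightarrow> 'm \<Rightarrow> bool" where
  "kills a f \<longleftrightarrow> act a (cd f) \<bullet> f = zr (dm f) (sh (fst a) (cd f))"

lemma kills_Hom: "f \<in> Hom X Y \<Longrightarrow> kills a f \<longleftrightarrow> act a Y \<bullet> f = zr X (sh (fst a) Y)"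
  unfolding kills_def by simp

text \<open>By naturality an element may act on the source instead of the target.\<close>

lemma kills_right_iff:
  assumes "a \<in> E" "f \<in> Hom X Y" shows "kills a f \<longleftrightarrow> sm (fst a) f \<bullet> act a X = zr X (sh (fst a) Y)"
  unfolding kills_Hom[OF assms(2)] act_natural[OF assms] ..

lemma kills_zr: "a \<in> E \<Longrightarrow> X \<in> obj T \<Longrightarrow> Y \<in> obj T \<Longrightarrow> kills a (zr X Y)"
  by (simp add: kills_def)

lemma kills_left:
  assumes "a \<in> E" "f \<in> Hom X Y" "g \<in> Hom Y Z" "kills a f" shows "kills a (g \<bullet> f)"
proof -
  have gf: "g \<bullet> f \<in> Hom X Z" using assms(2,3) by simp
  have "act a Z \<bullet> (g \<bullet> f) = (act a Z \<bullet> g) \<bullet> f" using assms(1-3) by simp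
  also have "\<dots> = sm (fst a) g \<bullet> (act a Y \<bullet> f)"
    unfolding act_natural[OF assms(1,3)] using assms(1-3) by simp
  also have "\<dots> = zr X (sh (fst a) Z)" using assms(4) unfolding kills_Hom[OF assms(2)] using assms(2,3) by simp
  finally show ?thesis unfolding kills_Hom[OF gf] .
qed

lemma kills_right:
  assumes "a \<in> E" "f \<in> Hom X Y" "g \<in> Hom W X" "kills a f" shows "kills a (f \<bullet> g)"
proof -
  have fg: "f \<bullet> g \<in> Hom W Y" using assms(2,3) by simp
  have "act a Y \<bullet> (f \<bullet> g) = (act a Y \<bullet> f) \<bullet> g" using assms(1-3) by simp
  also have "\<dots> = zr W (sh (fst a) Y)" using assms(4) unfolding kills_Hom[OF assms(2)] using assms(2,3) by simp
  finally show ?thesis unfolding kills_Hom[OF fg] .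
qed

lemma kills_mul_act:
  assumes "a \<in> E" "b \<in> E" "f \<in> Hom X Y"
  shows "kills (R.mul a b) f \<longleftrightarrow> kills a (act b Y \<bullet> f)"
proof -
  have bf: "act b Y \<bullet> f \<in> Hom X (sh (fst b) Y)" using assms by simp
  have "act (R.mul a b) Y \<bullet> f = act a (sh (fst b) Y) \<bullet> (act b Y \<bullet> f)"
    using assms act_mul[OF assms(1,2), of Y] by simp
  then show ?thesis unfolding kills_Hom[OF assms(3)] kills_Hom[OF bf]
    using assms(3) by (simp add: R.mul_def)
qed

lemma kills_mul_right: "a \<in> E \<Longrightarrow> b \<in> E \<Longrightarrow> f \<in> Hom X Y \<Longrightarrow> kills b f \<Longrightarrow> kills (R.mul a b) f"
proof -
  assume a: "a \<in> E" "b \<in> E" "f \<in> Hom X Y" "kills b f"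
  show ?thesis unfolding kills_mul_act[OF a(1-3)]
    using a kills_zr[of a X "sh (fst b) Y"] unfolding kills_Hom[OF a(3)] by simp
qed

lemma kills_mul_left: "a \<in> E \<Longrightarrow> b \<in> E \<Longrightarrow> f \<in> Hom X Y \<Longrightarrow> kills a f \<Longrightarrow> kills (R.mul a b) f"
  using kills_mul_right[of b a f X Y] R.mul_comm[of a b] by simp

lemma kills_add:
  assumes "a \<in> E" "f \<in> Hom X Y" "g \<in> Hom X Y" "kills a f" "kills a g" shows "kills a (f \<boxplus> g)"
proof -
  have fg: "f \<boxplus> g \<in> Hom X Y" using assms(2,3) by simp
  have "act a Y \<bullet> (f \<boxplus> g) = act a Y \<bullet> f \<boxplus> act a Y \<bullet> g"
    by (rule cmp_add_r) (use assms(1-3) in auto)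
  then show ?thesis using assms unfolding kills_Hom[OF fg] kills_Hom[OF assms(2)] kills_Hom[OF assms(3)] by simp
qed

lemma kills_sm:
  assumes "a \<in> E" "f \<in> Hom X Y" shows "kills a (sm i f) \<longleftrightarrow> kills a f"
proof -
  have 1: "kills a (sm i f)" if f: "f \<in> Hom X Y" and k: "kills a f" for f X Y i
  proof -
    have sf: "sm i f \<in> Hom (sh i X) (sh i Y)" using f by simp
    have Y: "Y \<in> obj T" "X \<in> obj T" using f by auto
    have "act a (sh i Y) \<bullet> sm i f = sm i (act a Y \<bullet> f)" unfolding act_sh[OF assms(1) Y(1)] using assms(1) f by simp
    also have "\<dots> = sm i (zr X (sh (fst a) Y))" using k unfolding kills_Hom[OF f] by simp
    also have "\<dots> = zr (sh i X) (sh (fst a) (sh i Y))" using Y by (simp add: add.commute)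
    finally show ?thesis unfolding kills_Hom[OF sf] .
  qed
  have sf: "sm i f \<in> Hom (sh i X) (sh i Y)" using assms(2) by simp
  show ?thesis using 1[OF assms(2), of i] 1[OF sf, of "-i"] assms(2) by auto
qed

text \<open>For \<open>M = avoiding \<pp>\<close> this is vanishing of the graded Hom module at
  \<pp>; for the powers of \<open>u\<close> it says that inverting \<open>u\<close> makes this
  module zero.\<close>

definition tors :: "(int \<times> 'r) set \<Rightarrow> 'o \<Rightarrow> 'o \<Rightarrow> bool" where
  "tors M D Y \<longleftrightarrow> (\<forall>n. \<forall>f\<in>Hom (sh n D) Y. \<exists>a\<in>M. kills a f)"

lemma torsD: "tors M D Y \<Longrightarrow> f \<in> Hom (sh n D) Y \<Longrightarrow> \<exists>a\<in>M. kills a f" unfolding tors_def by blast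

lemma torsD': 
  assumes "tors M D Y" "M \<subseteq> E" "f \<in> Hom (sh n D) (sh m Y)" "D \<in> obj T" "Y \<in> obj T"
  shows "\<exists>a\<in>M. kills a f"
proof -
  have "sm (-m) f \<in> Hom (sh (-m + n) D) Y" using assms(3-5) by simp
  then obtain a where a: "a \<in> M" "kills a (sm (-m) f)" using torsD[OF assms(1)] by blast
  then show ?thesis using kills_sm[of a f _ _ "-m", OF _ assms(3)] assms(2) by blast
qed

lemma tors_mono: "tors M D Y \<Longrightarrow> M \<subseteq> N \<Longrightarrow> tors N D Y" unfolding tors_def by blast

lemma mult_closedD:
  assumes "R.mult_closed M"
  shows "a \<in> M \<Longrightarrow> a \<in> E" "M \<subseteq> E" "(0, \<one>\<^bsub>R\<^esub>) \<in> M" "a \<in> M \<Longrightarrow> b \<in> M \<Longrightarrow> R.mul a b \<in> M"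
  using assms unfolding R.mult_closed_def by blast+

text \<open>Localization is exact and, for compact \<open>D\<close>, compatible with coproducts. In
  terms of morphisms: if \<open>s\<close> kills the composite of \<open>f\<close> with the boundary,
  then \<open>s f\<close> lifts to \<open>Y\<close>; if \<open>r\<close> kills the lift, then
  \<open>r s\<close> kills \<open>f\<close>. For coproducts the annihilators of finitely many terms
  are multiplied.\<close>

lemma localizing_tors:
  assumes M: "R.mult_closed M" and D: "D \<in> compact_objects U T"
  shows "localizing U T {Y \<in> obj T. tors M D Y}"
proof (rule localizingI)
  have Do: "D \<in> obj T" by (rule compact_obj[OF D])
  note Mc = mult_closedD[OF M]
  show "triang {Y \<in> obj T. tors M D Y}"
    unfolding triang_def
  proof (intro conjI allI impI ballI)
    show "Z \<in> {Y \<in> obj T. tors M D Y}" if Z: "is_zero T Z" for Z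
    proof -
      have "kills (0, \<one>\<^bsub>R\<^esub>) f" if f: "f \<in> Hom (sh n D) Z" for n f
        using to_zero[OF Z f] kills_zr[OF R.one_even, of "sh n D" Z] Do Z by simp
      then show ?thesis using Z Mc(3) unfolding tors_def by (auto simp del: Hom_iff)
    qed
    show "sh m X \<in> {Y \<in> obj T. tors M D Y}" if X: "X \<in> {Y \<in> obj T. tors M D Y}" for X m
    proof -
      have "tors M D (sh m X)" unfolding tors_def using torsD'[of M D X] X Mc(2) Do by blast
      then show ?thesis using X by simp
    qed
    show "Z \<in> {Y \<in> obj T. tors M D Y}" if d: "dist X Y Z" and X: "X \<in> {Y \<in> obj T. tors M D Y}"
      and Y: "Y \<in> {Y \<in> obj T. tors M D Y}" for X Y Z
    proof -
      obtain a b c where t: "tri3 X Y Z a b c" using d unfolding dist_def by blast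
      note H = tri3_Hom[OF t]
      have "\<exists>r\<in>M. kills r f" if f: "f \<in> Hom (sh n D) Z" for n f
      proof -
        have cf: "c \<bullet> f \<in> Hom (sh n D) (sh 1 X)" using f H by simp
        then obtain s where s: "s \<in> M" "kills s (c \<bullet> f)" using torsD'[of M D X] X Mc(2) Do by blast
        have sE: "s \<in> E" by (rule Mc(1)[OF s(1)])
        have sf: "act s Z \<bullet> f \<in> Hom (sh n D) (sh (fst s) Z)" using f sE by simp
        have "sm (fst s) c \<bullet> (act s Z \<bullet> f) = (sm (fst s) c \<bullet> act s Z) \<bullet> f" using f sE H by simp
        also have "\<dots> = (act s (sh 1 X) \<bullet> c) \<bullet> f"
          using act_natural[OF sE, of c Z "sh 1 X"] H by simp
        also have "\<dots> = act s (sh 1 X) \<bullet> (c \<bullet> f)" using H f sE by simp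
        also have "\<dots> = zr (sh n D) (sh (fst s + 1) X)" using s(2) H unfolding kills_Hom[OF cf] by simp
        finally obtain y where y: "y \<in> Hom (sh n D) (sh (fst s) Y)" "act s Z \<bullet> f = sm (fst s) b \<bullet> y"
          by (rule weak_kernel2_sh[OF t _ sf])
        obtain r where r: "r \<in> M" "kills r y" using torsD'[of M D Y] Y Mc(2) Do y(1) by blast
        have rE: "r \<in> E" by (rule Mc(1)[OF r(1)])
        have "kills r (act s Z \<bullet> f)" unfolding y(2)
          by (rule kills_left[where Z = "sh (fst s) Z", OF rE y(1) _ r(2)]) (use H in simp)
        then have "kills (R.mul r s) f" using kills_mul_act[OF rE sE f] by simp
        then show ?thesis using Mc(4)[OF r(1) s(1)] by blast
      qed
      then show ?thesis using H unfolding tors_def by blast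
    qed
  qed auto
  fix I :: "'u set" and A P \<iota>
  assume a: "small U I" "\<And>i. i \<in> I \<Longrightarrow> A i \<in> {Y \<in> obj T. tors M D Y}" "is_coproduct T I A P \<iota>"
  note c = coprod_Hom[OF a(3)]
  have "\<exists>r\<in>M. kills r f" if f: "f \<in> Hom (sh n D) P" for n f
  proof (rule compact_induct[OF _ a(1,3) f])
    show "sh n D \<in> compact_objects U T" by (rule triangD(3)[OF compact_triang D])
    show "\<exists>r\<in>M. kills r (zr (sh n D) P)"
      using Mc(3) kills_zr[OF R.one_even, of "sh n D" P] Do c(1) by (intro bexI[of _ "(0, \<one>\<^bsub>R\<^esub>)"]) auto
    fix f i h assume f: "f \<in> Hom (sh n D) P" and "\<exists>r\<in>M. kills r f" and i: "i \<in> I" and h: "h \<in> Hom (sh n D) (A i)"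
    then obtain r where r: "r \<in> M" "kills r f" by blast
    obtain s where s: "s \<in> M" "kills s h" using torsD[OF _ h] a(2)[OF i] by blast
    have E: "r \<in> E" "s \<in> E" using Mc(1) r(1) s(1) by blast+
    have ih: "\<iota> i \<bullet> h \<in> Hom (sh n D) P" using h c i by simp
    have "kills s (\<iota> i \<bullet> h)" by (rule kills_left[where Z = P, OF E(2) h _ s(2)]) (use c i in simp)
    then have "kills (R.mul r s) (\<iota> i \<bullet> h)" by (rule kills_mul_right[OF E ih])
    moreover have "kills (R.mul r s) f" by (rule kills_mul_left[OF E f r(2)])
    ultimately have "kills (R.mul r s) (\<iota> i \<bullet> h \<boxplus> f)" using R.mul_even[OF E] kills_add[OF _ ih f] by blast
    then show "\<exists>r\<in>M. kills r (\<iota> i \<bullet> h \<boxplus> f)" using Mc(4)[OF r(1) s(1)] by blast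
  qed
  then show "P \<in> {Y \<in> obj T. tors M D Y}" using c(1) unfolding tors_def by blast
qed

text \<open>The same argument in the first variable: if \<open>s\<close> kills the restriction of
  \<open>f\<close> to the middle vertex, then \<open>s f\<close> factors through the suspension of
  the first one, and an annihilator of the factor is multiplied with \<open>s\<close>.\<close>

lemma triang_tors:
  assumes M: "R.mult_closed M" and Y: "Y \<in> obj T"
  shows "triang {D \<in> obj T. tors M D Y}"
  unfolding triang_def
proof (intro conjI allI impI ballI)
  note Mc = mult_closedD[OF M]
  show "Z \<in> {D \<in> obj T. tors M D Y}" if Z: "is_zero T Z" for Z
  proof -
    have "kills (0, \<one>\<^bsub>R\<^esub>) f" if f: "f \<in> Hom (sh n Z) Y" for n f
      using from_zero[OF is_zero_sh[OF Z] f] kills_zr[OF R.one_even, of "sh n Z" Y] Y Z by simp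
    then show ?thesis using Z Mc(3) unfolding tors_def by (auto simp del: Hom_iff)
  qed
  show "sh m X \<in> {D \<in> obj T. tors M D Y}" if X: "X \<in> {D \<in> obj T. tors M D Y}" for X m
    using X unfolding tors_def by simp
  show "Z \<in> {D \<in> obj T. tors M D Y}" if d: "dist X W Z" and X: "X \<in> {D \<in> obj T. tors M D Y}"
    and W: "W \<in> {D \<in> obj T. tors M D Y}" for X W Z
  proof -
    have "\<exists>r\<in>M. kills r f" if f: "f \<in> Hom (sh n Z) Y" for n f
    proof -
      obtain a b c where t: "tri3 (sh n X) (sh n W) (sh n Z) a b c"
        using dist_sh[OF d] unfolding dist_def by blast
      note H = tri3_Hom[OF t]
      have fb: "f \<bullet> b \<in> Hom (sh n W) Y" using f H by simp
      then obtain s where s: "s \<in> M" "kills s (f \<bullet> b)" using torsD W by blast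
      have sE: "s \<in> E" by (rule Mc(1)[OF s(1)])
      have sf: "act s Y \<bullet> f \<in> Hom (sh n Z) (sh (fst s) Y)" using f sE by simp
      have "(act s Y \<bullet> f) \<bullet> b = zr (sh n W) (sh (fst s) Y)"
        using s(2) unfolding kills_Hom[OF fb] using f H sE by simp
      then obtain l where l: "l \<in> Hom (sh 1 (sh n X)) (sh (fst s) Y)" "act s Y \<bullet> f = l \<bullet> c"
        by (rule weak_cokernel2[OF t _ sf])
      have "l \<in> Hom (sh (1 + n) X) (sh (fst s) Y)" using l(1) X by simp
      then obtain r where r: "r \<in> M" "kills r l" using torsD'[of M X Y] X Mc(2) Y by blast
      have rE: "r \<in> E" by (rule Mc(1)[OF r(1)])
      have "kills r (act s Y \<bullet> f)" unfolding l(2)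
        by (rule kills_right[where W = "sh n Z", OF rE l(1) _ r(2)]) (use H in simp)
      then have "kills (R.mul r s) f" using kills_mul_act[OF rE sE f] by simp
      then show ?thesis using Mc(4)[OF r(1) s(1)] by blast
    qed
    then show ?thesis using dist_obj[OF d] unfolding tors_def by blast
  qed
qed auto

lemma graded_hom_carrier:
  assumes "C \<in> obj T" "X \<in> obj T"
  shows "carrier (graded_hom R T C X) = {h. (\<forall>i. h i \<in> Hom C (sh i X)) \<and> finite {i. h i \<noteq> zr C (sh i X)}}"
proof -
  have g: "group (hom_group T C (sh i X))" for i
    using comm_group.axioms(2)[OF mor_group[OF assms(1) sh_obj[OF assms(2)]]] .
  have c: "carrier (hom_group T C (sh i X)) = Hom C (sh i X)" for i
    using carrier_hom_group[OF assms(1) sh_obj[OF assms(2)]] .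
  show ?thesis unfolding graded_hom_def graded_hom_group_def using g by (auto simp: carrier_sum_group c simp del: Hom_iff)
qed

lemma graded_hom_zero: "\<zero>\<^bsub>graded_hom R T C X\<^esub> = (\<lambda>i. zr C (sh i X))"
  unfolding graded_hom_def graded_hom_group_def by (simp add: restrict_def)

lemma graded_hom_add: "h \<oplus>\<^bsub>graded_hom R T C X\<^esub> h' = (\<lambda>i. h i \<boxplus> h' i)"
  unfolding graded_hom_def graded_hom_group_def by (simp add: restrict_def)

text \<open>A homogeneous \<open>r\<close> has at most one nonzero component, so at most one term of
  the sum survives.\<close>

lemma graded_hom_smult:
  assumes "C \<in> obj T" "X \<in> obj T" "r \<in> grade R d" "\<And>i. h i \<in> Hom C (sh i X)"
  shows "(r \<odot>\<^bsub>graded_hom R T C X\<^esub> h) k = sm (k - d) (center_act T d r X) \<bullet> h (k - d)"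
proof -
  let ?F = "\<lambda>n. sm (k - n) (center_act T n (component R r n) X) \<bullet> h (k - n)"
  have z: "?F n = zr C (sh k X)" if "n \<noteq> d" for n
  proof -
    have "?F n = sm (k - n) (zr X (sh n X)) \<bullet> h (k - n)"
      using R.component_homogeneous[OF assms(3)] that center_zero[OF assms(2)] by simp
    then show ?thesis using assms(1,2) assms(4)[of "k - n"] by simp
  qed
  have d: "?F d = sm (k - d) (center_act T d r X) \<bullet> h (k - d)"
    using R.component_homogeneous[OF assms(3)] by simp
  have dH: "?F d \<in> Hom C (sh k X)"
    unfolding d using center_Hom[OF assms(3,2)] assms(4)[of "k - d"] assms(2) by simp
  interpret G: comm_group "hom_group T C (sh k X)" by (rule mor_group[OF assms(1) sh_obj[OF assms(2)]])
  have "gfinprod (hom_group T C (sh k X)) ?F UNIV = ?F d"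
  proof (cases "?F d = zr C (sh k X)")
    case True
    have "?F n = zr C (sh k X)" for n
    proof (cases "n = d")
      case True
      show ?thesis unfolding True by fact
    qed (rule z)
    then have "{n. ?F n \<noteq> zr C (sh k X)} = {}" by simp
    then show ?thesis using True by (simp add: gfinprod_def)
  next
    case False
    then have e: "{n. ?F n \<noteq> zr C (sh k X)} = {d}" using z by auto
    have "?F \<in> {d} \<rightarrow> carrier (hom_group T C (sh k X))" "?F d \<in> carrier (hom_group T C (sh k X))"
      using dH carrier_hom_group[OF assms(1) sh_obj[OF assms(2)]] by (auto simp del: Hom_iff)
    then show ?thesis using e dH by (simp add: gfinprod_def)
  qed
  then show ?thesis unfolding graded_hom_def d by simp
qed

end

section \<open>Homogeneous prime ideals\<close>

context graded_commutative_ring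
begin

lemma component_induct:
  assumes r: "r \<in> carrier R" and c: "\<And>n. Q (component R r n)" and z: "Q \<zero>"
    and a: "\<And>x y. x \<in> carrier R \<Longrightarrow> y \<in> carrier R \<Longrightarrow> Q x \<Longrightarrow> Q y \<Longrightarrow> Q (x \<oplus> y)"
  shows "Q r"
proof -
  let ?c = "component R r" and ?F = "{n. component R r n \<noteq> \<zero>}"
  have cc: "?c n \<in> carrier R" for n using grade_carrier component(1)[OF r] by blast
  have "finprod (add_monoid R) ?c F \<in> carrier R \<and> Q (finprod (add_monoid R) ?c F)" if "finite F" for F
    using that
  proof (induction F)
    case empty
    then show ?case using z by (simp add: comm_monoid.finprod_empty[OF a_comm_monoid])
  next
    case (insert n F)
    have "finprod (add_monoid R) ?c (insert n F) = ?c n \<oplus> finprod (add_monoid R) ?c F"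
      using comm_monoid.finprod_insert[OF a_comm_monoid insert.hyps, of ?c] cc by simp
    then show ?case using insert.IH cc c a by simp
  qed
  from this[OF component(2)[OF r]] have "Q (sum_of_components R ?c)"
    using component(2)[OF r] by (simp add: sum_of_components_def gfinprod_def)
  then show ?thesis using component(3)[OF r] by simp
qed

lemma ideal_of_components:
  assumes "ideal I R" "r \<in> carrier R" "\<And>n. component R r n \<in> I" shows "r \<in> I"
proof -
  interpret I: ideal I R by fact
  show ?thesis by (rule component_induct[OF assms(2), of "\<lambda>x. x \<in> I"]) (use assms(3) in auto)
qed

text \<open>Annihilators of morphisms and ideals of coefficients are known degree by degree; this
  assembles the pieces to a homogeneous ideal.\<close>

definition ideal_of_pieces :: "(int \<Rightarrow> 'r set) \<Rightarrow> 'r set" where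
  "ideal_of_pieces Q = {r \<in> carrier R. \<forall>n. component R r n \<in> Q n}"

lemma ideal_of_pieces_grade:
  "(\<And>n. \<zero> \<in> Q n) \<Longrightarrow> r \<in> grade R n \<Longrightarrow> r \<in> ideal_of_pieces Q \<longleftrightarrow> r \<in> Q n"
  unfolding ideal_of_pieces_def using component_homogeneous[of r n] grade_carrier[of r n] by auto

lemma homogeneous_ideal_of_pieces:
  assumes sub: "\<And>n. Q n \<subseteq> grade R n" and z: "\<And>n. \<zero> \<in> Q n"
    and add: "\<And>n x y. x \<in> Q n \<Longrightarrow> y \<in> Q n \<Longrightarrow> x \<oplus> y \<in> Q n"
    and mult: "\<And>m n r x. r \<in> grade R m \<Longrightarrow> x \<in> Q n \<Longrightarrow> r \<otimes> x \<in> Q (m + n)"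
  shows "homogeneous_ideal (ideal_of_pieces Q) R"
proof -
  let ?I = "ideal_of_pieces Q"
  have Ic: "x \<in> carrier R" if "x \<in> ?I" for x using that unfolding ideal_of_pieces_def by blast
  have Ih: "x \<in> ?I" if "x \<in> Q n" for x n
    using that sub[of n] ideal_of_pieces_grade[of Q x n] z by blast
  have Ia: "x \<oplus> y \<in> ?I" if "x \<in> ?I" "y \<in> ?I" for x y
    using that unfolding ideal_of_pieces_def by (auto simp: component_add add)
  have I0: "\<zero> \<in> ?I" using Ih z by blast
  have comp: "component R x n \<in> ?I" if "x \<in> ?I" for x n
    using that Ih unfolding ideal_of_pieces_def by blast
  have l1: "r \<otimes> x \<in> ?I" if r: "r \<in> grade R m" and x: "x \<in> ?I" for r m x
  proof (rule component_induct[OF Ic[OF x], of "\<lambda>x. r \<otimes> x \<in> ?I"])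
    show "r \<otimes> component R x n \<in> ?I" for n
      by (rule Ih[OF mult[OF r]]) (use x in \<open>auto simp: ideal_of_pieces_def\<close>)
    show "r \<otimes> \<zero> \<in> ?I" using I0 grade_carrier[OF r] by simp
    show "r \<otimes> (y \<oplus> z) \<in> ?I" if "y \<in> carrier R" "z \<in> carrier R" "r \<otimes> y \<in> ?I" "r \<otimes> z \<in> ?I" for y z
      using that Ia grade_carrier[OF r] by (simp add: r_distr)
  qed
  have l: "r \<otimes> x \<in> ?I" if r: "r \<in> carrier R" and x: "x \<in> ?I" for r x
  proof (rule component_induct[OF r, of "\<lambda>r. r \<otimes> x \<in> ?I"])
    show "component R r n \<otimes> x \<in> ?I" for n by (rule l1[OF component(1)[OF r] x])
    show "\<zero> \<otimes> x \<in> ?I" using I0 Ic[OF x] by simp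
    show "(y \<oplus> z) \<otimes> x \<in> ?I" if "y \<in> carrier R" "z \<in> carrier R" "y \<otimes> x \<in> ?I" "z \<otimes> x \<in> ?I" for y z
      using that Ia Ic[OF x] by (simp add: l_distr)
  qed
  have neg: "\<ominus> x \<in> ?I" if "x \<in> ?I" for x
    using l[OF a_inv_closed[OF one_closed] that] Ic[OF that] by (simp add: l_minus)
  \<comment> \<open>Graded commutativity turns right multiples into left multiples up to sign, but
    for homogeneous factors only; decomposing both factors into components then gives the general
    case.\<close>
  have r1: "y \<otimes> r \<in> ?I" if r: "r \<in> grade R m" and y: "y \<in> Q n" for r m y n
  proof -
    have yg: "y \<in> grade R n" using sub y by blast
    have "r \<otimes> y \<in> ?I" by (rule l1[OF r Ih[OF y]])
    then show ?thesis using graded_comm[OF yg r] neg by (auto split: if_splits)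
  qed
  have r: "x \<otimes> r \<in> ?I" if r: "r \<in> carrier R" and x: "x \<in> ?I" for r x
  proof (rule component_induct[OF r, of "\<lambda>r. x \<otimes> r \<in> ?I"])
    fix n
    have cn: "component R r n \<in> carrier R" by (rule grade_carrier[OF component(1)[OF r]])
    show "x \<otimes> component R r n \<in> ?I"
    proof (rule component_induct[OF Ic[OF x], of "\<lambda>x. x \<otimes> component R r n \<in> ?I"])
      show "component R x k \<otimes> component R r n \<in> ?I" for k
        by (rule r1[OF component(1)[OF r]]) (use x in \<open>auto simp: ideal_of_pieces_def\<close>)
      show "\<zero> \<otimes> component R r n \<in> ?I" using I0 cn by simp
      show "(y \<oplus> z) \<otimes> component R r n \<in> ?I"
        if "y \<in> carrier R" "z \<in> carrier R" "y \<otimes> component R r n \<in> ?I" "z \<otimes> component R r n \<in> ?I" for y z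
        using that Ia cn by (simp add: l_distr)
    qed
  next
    show "x \<otimes> \<zero> \<in> ?I" using I0 Ic[OF x] by simp
    show "x \<otimes> (y \<oplus> z) \<in> ?I" if "y \<in> carrier R" "z \<in> carrier R" "x \<otimes> y \<in> ?I" "x \<otimes> z \<in> ?I" for y z
      using that Ia Ic[OF x] by (simp add: r_distr)
  qed
  have sg: "subgroup ?I (add_monoid R)"
  proof (rule group.subgroupI[OF a_group])
    show "?I \<subseteq> carrier (add_monoid R)" using Ic by auto
    show "?I \<noteq> {}" using I0 by blast
    show "inv\<^bsub>add_monoid R\<^esub> x \<in> ?I" if "x \<in> ?I" for x using neg[OF that] by (simp add: a_inv_def)
    show "x \<otimes>\<^bsub>add_monoid R\<^esub> y \<in> ?I" if "x \<in> ?I" "y \<in> ?I" for x y using Ia[OF that] by simp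
  qed
  have "ideal ?I R" by (rule idealI[OF is_ring sg]) (use l r in auto)
  then show ?thesis unfolding homogeneous_ideal_def using comp by blast
qed

lemma homogeneous_idealD:
  assumes "homogeneous_ideal I R"
  shows "ideal I R" "r \<in> I \<Longrightarrow> component R r n \<in> I"
    "r \<in> I \<Longrightarrow> r \<in> carrier R" "r \<in> I \<Longrightarrow> s \<in> I \<Longrightarrow> r \<oplus> s \<in> I" "\<zero> \<in> I"
    "r \<in> I \<Longrightarrow> s \<in> carrier R \<Longrightarrow> s \<otimes> r \<in> I" "r \<in> I \<Longrightarrow> s \<in> carrier R \<Longrightarrow> r \<otimes> s \<in> I"
proof -
  show I: "ideal I R" and c: "r \<in> I \<Longrightarrow> component R r n \<in> I"
    using assms unfolding homogeneous_ideal_def by blast+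
  interpret I: ideal I R by (rule I)
  show "r \<in> I \<Longrightarrow> r \<in> carrier R" "r \<in> I \<Longrightarrow> s \<in> I \<Longrightarrow> r \<oplus> s \<in> I" "\<zero> \<in> I"
    "r \<in> I \<Longrightarrow> s \<in> carrier R \<Longrightarrow> s \<otimes> r \<in> I" "r \<in> I \<Longrightarrow> s \<in> carrier R \<Longrightarrow> r \<otimes> s \<in> I"
    by (auto intro: I.I_l_closed I.I_r_closed)
qed

lemma homogeneous_ideal_chain_Union:
  assumes "C \<noteq> {}" "\<And>I. I \<in> C \<Longrightarrow> homogeneous_ideal I R" "\<And>I J. I \<in> C \<Longrightarrow> J \<in> C \<Longrightarrow> I \<subseteq> J \<or> J \<subseteq> I"
  shows "homogeneous_ideal (\<Union>C) R"
proof -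
  have "ideal (\<Union>C) R"
  proof (rule idealI[OF is_ring])
    show "subgroup (\<Union>C) (add_monoid R)"
    proof (rule group.subgroupI[OF a_group])
      show "\<Union>C \<subseteq> carrier (add_monoid R)" using homogeneous_idealD(3)[OF assms(2)] by auto
      show "\<Union>C \<noteq> {}" using assms(1) homogeneous_idealD(5)[OF assms(2)] by blast
      show "inv\<^bsub>add_monoid R\<^esub> x \<in> \<Union>C" if x: "x \<in> \<Union>C" for x
      proof -
        obtain I where I: "I \<in> C" "x \<in> I" using x by blast
        have "\<ominus> \<one> \<otimes> x \<in> I" using homogeneous_idealD(6)[OF assms(2)[OF I(1)] I(2)] by simp
        then have "\<ominus> x \<in> I" using homogeneous_idealD(3)[OF assms(2)[OF I(1)] I(2)] by (simp add: l_minus)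
        then show ?thesis using I(1) by (auto simp: a_inv_def)
      qed
      show "x \<otimes>\<^bsub>add_monoid R\<^esub> y \<in> \<Union>C" if xy: "x \<in> \<Union>C" "y \<in> \<Union>C" for x y
      proof -
        obtain I J where IJ: "I \<in> C" "x \<in> I" "J \<in> C" "y \<in> J" using xy by blast
        obtain K where "K \<in> C" "x \<in> K" "y \<in> K" using IJ assms(3)[OF IJ(1,3)] by blast
        then show ?thesis using homogeneous_idealD(4)[OF assms(2)] by auto
      qed
    qed
  qed (use homogeneous_idealD(6,7)[OF assms(2)] in blast)+
  then show ?thesis unfolding homogeneous_ideal_def using homogeneous_idealD(2)[OF assms(2)] by blast
qed

text \<open>If neither \<open>r\<close> nor \<open>s\<close> lies in \<qq>, adjoining either one
  puts a power of \<open>u\<close> into the larger ideal. When \<open>r s\<close> is in \<qq>, the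
  product of these two powers lies in \<qq>, which is excluded.\<close>

lemma maximal_avoiding_prime:
  assumes u: "u \<in> even_elements" and q: "homogeneous_ideal \<qq> R" "\<And>k. snd (pw u k) \<notin> \<qq>"
    and max: "\<And>J. homogeneous_ideal J R \<Longrightarrow> \<qq> \<subseteq> J \<Longrightarrow> (\<And>k. snd (pw u k) \<notin> J) \<Longrightarrow> J = \<qq>"
  shows "\<qq> \<in> Spec R"
proof -
  note qD = homogeneous_idealD[OF q(1)]
  have powg: "snd (pw u k) \<in> grade R (fst (pw u k))" for k by (rule evenD(2)[OF pw_even[OF u]])
  have big: "\<exists>k a b. a \<in> \<qq> \<and> b \<in> carrier R \<and> snd (pw u k) = a \<oplus> b \<otimes> r"
    if r: "r \<in> grade R d" and rq: "r \<notin> \<qq>" for r d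
  proof -
    \<comment> \<open>The degree \<open>n\<close> piece of the ideal generated by \<qq> and
      \<open>r\<close>.\<close>
    define Q where "Q n = {x. \<exists>a b. x = a \<oplus> b \<otimes> r \<and> a \<in> \<qq> \<and> a \<in> grade R n \<and> b \<in> grade R (n - d)}" for n
    have rc: "r \<in> carrier R" by (rule grade_carrier[OF r])
    have z: "\<zero> \<in> Q n" for n unfolding Q_def
      using qD(5) rc by (intro CollectI exI[of _ \<zero>]) simp
    have hom: "homogeneous_ideal (ideal_of_pieces Q) R"
    proof (rule homogeneous_ideal_of_pieces)
      show "Q n \<subseteq> grade R n" for n unfolding Q_def
        using grade_add mult_grade[OF _ r, of _ "n - d"] by auto
      show "\<zero> \<in> Q n" for n by (rule z)
      show "x \<oplus> y \<in> Q n" if xy: "x \<in> Q n" "y \<in> Q n" for n x y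
      proof -
        obtain a b where x: "x = a \<oplus> b \<otimes> r" "a \<in> \<qq>" "a \<in> grade R n" "b \<in> grade R (n - d)"
          using xy(1) unfolding Q_def by blast
        obtain a' b' where y: "y = a' \<oplus> b' \<otimes> r" "a' \<in> \<qq>" "a' \<in> grade R n" "b' \<in> grade R (n - d)"
          using xy(2) unfolding Q_def by blast
        have c: "a \<in> carrier R" "b \<in> carrier R" "a' \<in> carrier R" "b' \<in> carrier R"
          using x y grade_carrier by blast+
        have "x \<oplus> y = (a \<oplus> a') \<oplus> (b \<oplus> b') \<otimes> r"
          unfolding x(1) y(1) using c rc by (simp add: l_distr a_ac)
        then show ?thesis unfolding Q_def using x y grade_add qD(4) by blast
      qed
      show "s \<otimes> x \<in> Q (m + n)" if s: "s \<in> grade R m" and x: "x \<in> Q n" for m n s x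
      proof -
        obtain a b where ab: "x = a \<oplus> b \<otimes> r" "a \<in> \<qq>" "a \<in> grade R n" "b \<in> grade R (n - d)"
          using x unfolding Q_def by blast
        have c: "a \<in> carrier R" "b \<in> carrier R" "s \<in> carrier R" using ab s grade_carrier by blast+
        have "s \<otimes> x = s \<otimes> a \<oplus> (s \<otimes> b) \<otimes> r" unfolding ab(1) using c rc by (simp add: r_distr m_assoc)
        moreover have "s \<otimes> a \<in> \<qq>" by (rule qD(6)[OF ab(2) c(3)])
        moreover have "s \<otimes> b \<in> grade R (m + n - d)" using mult_grade[OF s ab(4)] by (simp add: add_diff_eq)
        ultimately show ?thesis unfolding Q_def using mult_grade[OF s ab(3)] by blast
      qed
    qed
    have qs: "\<qq> \<subseteq> ideal_of_pieces Q"
    proof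
      fix x assume x: "x \<in> \<qq>"
      have "component R x n \<in> Q n" for n unfolding Q_def
        using qD(2,3)[OF x] component(1)[OF qD(3)[OF x], of n]
          grade_carrier[OF component(1)[OF qD(3)[OF x], of n]] rc
        by (intro CollectI, rule_tac x = "component R x n" in exI, rule_tac x = \<zero> in exI) simp
      then show "x \<in> ideal_of_pieces Q" unfolding ideal_of_pieces_def using qD(3)[OF x] by blast
    qed
    have "r \<in> Q d" unfolding Q_def
      using qD(5) one_grade rc by (intro CollectI, rule_tac x = \<zero> in exI, rule_tac x = \<one> in exI) simp
    then have "r \<in> ideal_of_pieces Q" using ideal_of_pieces_grade[of Q r d] z r by blast
    then have "ideal_of_pieces Q \<noteq> \<qq>" using rq by blast
    then obtain k where "snd (pw u k) \<in> ideal_of_pieces Q" using max[OF hom qs] by blast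
    then have "snd (pw u k) \<in> Q (fst (pw u k))" using ideal_of_pieces_grade[of Q "snd (pw u k)"] z powg by blast
    then obtain a b where "snd (pw u k) = a \<oplus> b \<otimes> r" "a \<in> \<qq>" "b \<in> grade R (fst (pw u k) - d)"
      unfolding Q_def by blast
    then show ?thesis using grade_carrier by blast
  qed
  have "r \<in> \<qq> \<or> s \<in> \<qq>" if r: "r \<in> grade R m" and s: "s \<in> grade R n" and rs: "r \<otimes> s \<in> \<qq>" for r m s n
  proof (rule ccontr)
    assume "\<not> (r \<in> \<qq> \<or> s \<in> \<qq>)"
    then obtain k a b l a' b' where 1: "a \<in> \<qq>" "b \<in> carrier R" "snd (pw u k) = a \<oplus> b \<otimes> r"
      and 2: "a' \<in> \<qq>" "b' \<in> carrier R" "snd (pw u l) = a' \<oplus> b' \<otimes> s"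
      using big[OF r] big[OF s] by metis
    have c: "a \<in> carrier R" "a' \<in> carrier R" "r \<in> carrier R" "s \<in> carrier R"
      using qD(3) 1(1) 2(1) grade_carrier r s by blast+
    \<comment> \<open>The coefficient \<open>b'\<close> is not homogeneous and need not commute with
      \<open>r\<close>, but each of its components does so up to sign.\<close>
    have rbs: "r \<otimes> b' \<otimes> s \<in> \<qq>"
    proof (rule component_induct[OF 2(2), of "\<lambda>b'. r \<otimes> b' \<otimes> s \<in> \<qq>"])
      fix i
      let ?b = "component R b' i"
      have bg: "?b \<in> grade R i" and bc: "?b \<in> carrier R" using component(1)[OF 2(2)] grade_carrier by blast+
      have 3: "?b \<otimes> (r \<otimes> s) \<in> \<qq>" by (rule qD(6)[OF rs bc])
      then have 4: "(\<ominus> ?b) \<otimes> (r \<otimes> s) \<in> \<qq>" by (intro qD(6)[OF rs]) (use bc in simp)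
      have "\<exists>e\<in>carrier R. r \<otimes> ?b = e \<otimes> r \<and> e \<otimes> (r \<otimes> s) \<in> \<qq>"
        using graded_comm[OF r bg] bc c(3) 3 4
        by (intro bexI[of _ "if odd m \<and> odd i then \<ominus> ?b else ?b"]) (auto simp: l_minus)
      then obtain e where e: "e \<in> carrier R" "r \<otimes> ?b = e \<otimes> r" "e \<otimes> (r \<otimes> s) \<in> \<qq>" by blast
      show "r \<otimes> ?b \<otimes> s \<in> \<qq>" unfolding e(2) using e(1,3) c by (simp add: m_assoc)
    next
      show "r \<otimes> \<zero> \<otimes> s \<in> \<qq>" using c qD(5) by simp
      show "r \<otimes> (x \<oplus> y) \<otimes> s \<in> \<qq>" if "x \<in> carrier R" "y \<in> carrier R" "r \<otimes> x \<otimes> s \<in> \<qq>" "r \<otimes> y \<otimes> s \<in> \<qq>" for x y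
        using that c qD(4) by (simp add: l_distr r_distr)
    qed
    have pc: "snd (pw u l) \<in> carrier R" by (rule grade_carrier[OF powg])
    \<comment> \<open>Expanding \<open>(a + b r) (a' + b' s)\<close>: all terms but the last have a
      factor in \<qq>, and the last one is a multiple of \<open>r b' s\<close>.\<close>
    have "snd (pw u (k + l)) = snd (pw u k) \<otimes> snd (pw u l)" unfolding pw_add[OF u] by (simp add: mul_def)
    also have "\<dots> = a \<otimes> snd (pw u l) \<oplus> b \<otimes> r \<otimes> snd (pw u l)"
      unfolding 1(3) using c 1(2) pc by (simp add: l_distr)
    also have "b \<otimes> r \<otimes> snd (pw u l) = (b \<otimes> r) \<otimes> a' \<oplus> b \<otimes> (r \<otimes> b' \<otimes> s)"
      unfolding 2(3) using c 1(2) 2(2) by (simp add: r_distr m_assoc)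
    finally have "snd (pw u (k + l)) = a \<otimes> snd (pw u l) \<oplus> ((b \<otimes> r) \<otimes> a' \<oplus> b \<otimes> (r \<otimes> b' \<otimes> s))" .
    moreover have "a \<otimes> snd (pw u l) \<in> \<qq>" by (rule qD(7)[OF 1(1) pc])
    moreover have "(b \<otimes> r) \<otimes> a' \<in> \<qq>" by (rule qD(6)[OF 2(1)]) (use 1(2) c in simp)
    moreover have "b \<otimes> (r \<otimes> b' \<otimes> s) \<in> \<qq>" by (rule qD(6)[OF rbs 1(2)])
    ultimately have "snd (pw u (k + l)) \<in> \<qq>" using qD(4) by simp
    then show False using q(2) by blast
  qed
  moreover have "\<qq> \<noteq> carrier R" using q(2)[of 0] by auto
  ultimately show ?thesis unfolding Spec_def homogeneous_def using q(1) by blast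
qed

lemma ex_prime_avoiding:
  assumes u: "u \<in> even_elements" and I: "homogeneous_ideal I R" "\<And>k. snd (pw u k) \<notin> I"
  obtains \<qq> where "\<qq> \<in> Spec R" "I \<subseteq> \<qq>" "snd u \<notin> \<qq>"
proof -
  let ?C = "{J. homogeneous_ideal J R \<and> I \<subseteq> J \<and> (\<forall>k. snd (pw u k) \<notin> J)}"
  have "\<exists>M\<in>?C. \<forall>X\<in>?C. M \<subseteq> X \<longrightarrow> X = M"
  proof (rule subset_Zorn)
    fix C assume C: "subset.chain ?C C"
    show "\<exists>V\<in>?C. \<forall>X\<in>C. X \<subseteq> V"
    proof (cases "C = {}")
      case True
      then show ?thesis using I by blast
    next
      case False
      have "homogeneous_ideal (\<Union>C) R"
        by (rule homogeneous_ideal_chain_Union[OF False]) (use C in \<open>auto simp: subset.chain_def\<close>)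
      then have "\<Union>C \<in> ?C" using C False unfolding subset.chain_def by blast
      then show ?thesis by blast
    qed
  qed
  then obtain \<qq> where q: "homogeneous_ideal \<qq> R" "I \<subseteq> \<qq>" "\<And>k. snd (pw u k) \<notin> \<qq>"
    and max: "\<forall>X\<in>?C. \<qq> \<subseteq> X \<longrightarrow> X = \<qq>" by blast
  have "\<qq> \<in> Spec R"
  proof (rule maximal_avoiding_prime[OF u q(1,3)])
    fix J assume "homogeneous_ideal J R" "\<qq> \<subseteq> J" "\<And>k. snd (pw u k) \<notin> J"
    then show "J = \<qq>" using max q(2) by blast
  qed
  moreover have "snd u \<notin> \<qq>" using q(3)[of 1] mul_one(1)[OF u] by simp
  ultimately show ?thesis using that q(2) by blast
qed

text \<open>Take the squares of the nonzero homogeneous components of finitely many generators of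
  \<pp>. They are even and finite in number, and a prime containing the squares contains the
  components and so the generators.\<close>

lemma ex_generators:
  assumes noeth: "noetherian_ring R" and p: "\<pp> \<in> Spec R"
  shows "\<exists>us. set us \<subseteq> even_elements \<and> (\<forall>u\<in>set us. snd u \<in> \<pp>) \<and>
    (\<forall>\<qq>\<in>Spec R. (\<forall>u\<in>set us. snd u \<in> \<qq>) \<longrightarrow> \<pp> \<subseteq> \<qq>)"
proof -
  note pD = SpecD[OF p]
  obtain A where A: "A \<subseteq> carrier R" "finite A" "\<pp> = Idl A"
    using noetherian_ring.finetely_gen[OF noeth pD(2)] by blast
  have Ap: "A \<subseteq> \<pp>" unfolding A(3) by (rule genideal_self[OF A(1)])
  let ?B = "\<Union>r\<in>A. (\<lambda>n. (n + n, component R r n \<otimes> component R r n)) ` {n. component R r n \<noteq> \<zero>}"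
  have "finite ?B"
    by (intro finite_UN_I A(2) finite_imageI component(2)) (use A(1) in blast)
  from finite_list[OF this] obtain us where us: "set us = ?B" by (elim exE)
  have 1: "u \<in> even_elements \<and> snd u \<in> \<pp>" if uB: "u \<in> ?B" for u
  proof -
    obtain r n where r: "r \<in> A" and u: "u = (n + n, component R r n \<otimes> component R r n)" using uB by blast
    have rc: "r \<in> carrier R" using r A(1) by blast
    have "component R r n \<in> \<pp>" using pD(6) r Ap by blast
    then have "component R r n \<otimes> component R r n \<in> \<pp>"
      using homogeneous_idealD(6)[OF pD(1)] pD(8) by blast
    then show ?thesis unfolding u using square_even[OF component(1)[OF rc]] by simp
  qed
  have 2: "\<pp> \<subseteq> \<qq>" if q: "\<qq> \<in> Spec R" and uq: "\<forall>u\<in>?B. snd u \<in> \<qq>" for \<qq>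
  proof -
    have "A \<subseteq> \<qq>"
    proof
      fix r assume r: "r \<in> A"
      then have rc: "r \<in> carrier R" using A(1) by blast
      have "component R r n \<in> \<qq>" for n
      proof (cases "component R r n = \<zero>")
        case True then show ?thesis using SpecD(5)[OF q] by simp
      next
        case False
        then have "component R r n \<otimes> component R r n \<in> \<qq>" using uq r by fastforce
        then show ?thesis using SpecD(7)[OF q component(1)[OF rc] component(1)[OF rc]] by blast
      qed
      then show "r \<in> \<qq>" by (rule ideal_of_components[OF SpecD(2)[OF q] rc])
    qed
    then show ?thesis unfolding A(3) by (rule genideal_minimal[OF SpecD(2)[OF q]])
  qed
  show ?thesis
  proof (rule exI[of _ us], intro conjI ballI impI)
    show "set us \<subseteq> even_elements" unfolding us by (rule subsetI, rule conjunct1[OF 1])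
    show "snd u \<in> \<pp>" if "u \<in> set us" for u using that unfolding us by (rule conjunct2[OF 1])
    show "\<pp> \<subseteq> \<qq>" if "\<qq> \<in> Spec R" "\<forall>u\<in>set us. snd u \<in> \<qq>" for \<qq>
      by (rule 2[OF that(1) that(2)[unfolded us]])
  qed
qed

end

section \<open>Homogeneous localization and Koszul objects\<close>

context linear_cocomplete
begin

section \<open>Vanishing of homogeneous localizations as torsion\<close>

lemma graded_hom_smult_zero:
  assumes "C \<in> obj T" "X \<in> obj T" "r \<in> grade R d"
  shows "r \<odot>\<^bsub>graded_hom R T C X\<^esub> \<zero>\<^bsub>graded_hom R T C X\<^esub> = \<zero>\<^bsub>graded_hom R T C X\<^esub>"
  unfolding graded_hom_zero
proof
  fix k
  show "(r \<odot>\<^bsub>graded_hom R T C X\<^esub> (\<lambda>i. zr C (sh i X))) k = zr C (sh k X)"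
    using graded_hom_smult[OF assms, of "\<lambda>i. zr C (sh i X)" k] center_Hom[OF assms(3,2)] assms by simp
qed

text \<open>Only finitely many components are nonzero, so annihilators of these can be
  multiplied.\<close>

lemma even_annihilator:
  assumes C: "C \<in> obj T" and X: "X \<in> obj T" and M: "R.mult_closed M" and t: "tors M C X"
    and h: "h \<in> carrier (graded_hom R T C X)"
  obtains w where "w \<in> M" "\<And>i. kills w (h i)"
proof -
  note Mc = mult_closedD[OF M]
  have hH: "h i \<in> Hom C (sh i X)" for i using h unfolding graded_hom_carrier[OF C X] by blast
  have fin: "finite {i. h i \<noteq> zr C (sh i X)}" using h unfolding graded_hom_carrier[OF C X] by blast
  have "\<exists>w\<in>M. \<forall>i\<in>F. kills w (h i)" if "finite F" for F
    using that
  proof (induction F)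
    case empty then show ?case using Mc(3) by blast
  next
    case (insert i F)
    then obtain w where w: "w \<in> M" "\<forall>i\<in>F. kills w (h i)" by blast
    have "h i \<in> Hom (sh 0 C) (sh i X)" using hH[of i] by simp
    then obtain v where v: "v \<in> M" "kills v (h i)" using torsD'[OF t Mc(2) _ C X] by blast
    have E: "w \<in> E" "v \<in> E" using Mc(1) w(1) v(1) by blast+
    have "kills (R.mul w v) (h j)" if j: "j \<in> insert i F" for j
    proof (cases "j = i")
      case True then show ?thesis using kills_mul_right[OF E hH[of j]] v(2) by simp
    next
      case False then show ?thesis using kills_mul_left[OF E hH[of j]] w(2) j by simp
    qed
    then show ?case using Mc(4)[OF w(1) v(1)] by blast
  qed
  from this[OF fin] obtain w where w: "w \<in> M" "\<forall>i\<in>{i. h i \<noteq> zr C (sh i X)}. kills w (h i)" by blast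
  have "kills w (h i)" for i
  proof (cases "h i = zr C (sh i X)")
    case True then show ?thesis using kills_zr[OF Mc(1)[OF w(1)] C] X by simp
  qed (use w(2) in blast)
  then show ?thesis by (rule that[OF w(1)])
qed

lemma annihilator_smult:
  assumes C: "C \<in> obj T" and X: "X \<in> obj T" and w: "w \<in> E" and h: "h \<in> carrier (graded_hom R T C X)"
    and k: "\<And>i. kills w (h i)" and s: "s \<in> grade R d"
  shows "(s \<otimes>\<^bsub>R\<^esub> snd w) \<odot>\<^bsub>graded_hom R T C X\<^esub> h = \<zero>\<^bsub>graded_hom R T C X\<^esub>"
  unfolding graded_hom_zero
proof
  fix l
  have hH: "h i \<in> Hom C (sh i X)" for i using h unfolding graded_hom_carrier[OF C X] by blast
  let ?n = "d + fst w"
  let ?i = "l - ?n"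
  have g: "s \<otimes>\<^bsub>R\<^esub> snd w \<in> grade R ?n" by (rule R.mult_grade[OF s R.evenD(2)[OF w]])
  have cs: "center_act T d s X \<in> Hom X (sh d X)" by (rule center_Hom[OF s X])
  have "((s \<otimes>\<^bsub>R\<^esub> snd w) \<odot>\<^bsub>graded_hom R T C X\<^esub> h) l = sm ?i (center_act T ?n (s \<otimes>\<^bsub>R\<^esub> snd w) X) \<bullet> h ?i"
    by (rule graded_hom_smult[OF C X g hH])
  also have "center_act T ?n (s \<otimes>\<^bsub>R\<^esub> snd w) X = sm (fst w) (center_act T d s X) \<bullet> act w X"
    using linear_structure.act_mult[OF linear s R.evenD(2)[OF w] X] by (simp add: act_def)
  also have "sm ?i (sm (fst w) (center_act T d s X) \<bullet> act w X) \<bullet> h ?i =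
      sm (?i + fst w) (center_act T d s X) \<bullet> (act w (sh ?i X) \<bullet> h ?i)"
    unfolding act_sh[OF w X] using cs w X hH[of ?i] by simp
  also have "act w (sh ?i X) \<bullet> h ?i = zr C (sh (fst w) (sh ?i X))"
    using k[of ?i] unfolding kills_Hom[OF hH] .
  finally show "((s \<otimes>\<^bsub>R\<^esub> snd w) \<odot>\<^bsub>graded_hom R T C X\<^esub> h) l = zr C (sh l X)"
    using cs X C by (simp add: algebra_simps)
qed

lemma vanishes_tors:
  assumes p: "\<pp> \<in> Spec R" and C: "C \<in> obj T" and X: "X \<in> obj T"
    and v: "vanishes_at R \<pp> (graded_hom R T C X)"
  shows "tors (R.avoiding \<pp>) C X"
  unfolding tors_def
proof (intro allI ballI)
  fix n f assume f: "f \<in> Hom (sh n C) X"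
  let ?H = "graded_hom R T C X" and ?one = "\<one>\<^bsub>R\<^esub>"
  \<comment> \<open>A morphism from \<open>sh n C\<close> to \<open>X\<close> corresponds to an
    element of degree \<open>-n\<close> of the graded Hom module.\<close>
  define h where "h i = (if i = -n then sm (-n) f else zr C (sh i X))" for i
  have f': "sm (-n) f \<in> Hom C (sh (-n) X)" using f C by simp
  have hH: "h i \<in> Hom C (sh i X)" for i unfolding h_def using f' C X by simp
  have "finite {i. h i \<noteq> zr C (sh i X)}" by (rule finite_subset[of _ "{-n}"]) (auto simp: h_def)
  then have h: "h \<in> carrier ?H" unfolding graded_hom_carrier[OF C X] using hH by blast
  have one: "?one \<in> denominators R \<pp>"
    unfolding denominators_def homogeneous_def using R.one_grade R.SpecD(4)[OF p] by blast
  let ?x = "(?one, h)"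
  have refl: "(?x, ?x) \<in> fraction_rel R \<pp> ?H"
    unfolding fraction_rel_def using one h by (auto intro!: bexI[of _ ?one])
  have xD: "?x \<in> denominators R \<pp> \<times> carrier ?H" by (rule SigmaI[OF one h])
  have "fraction_rel R \<pp> ?H `` {?x} \<in> localization R \<pp> ?H"
    unfolding localization_def by (rule quotientI[OF xD])
  then have "fraction_rel R \<pp> ?H `` {?x} = localization_zero R \<pp> ?H"
    unfolding v[unfolded vanishes_at_def] by (rule singletonD)
  moreover have "?x \<in> fraction_rel R \<pp> ?H `` {?x}" by (rule ImageI[OF refl singletonI])
  ultimately have "?x \<in> fraction_rel R \<pp> ?H `` {(?one, \<zero>\<^bsub>?H\<^esub>)}"
    unfolding localization_zero_def by (simp only:)
  then have "((?one, \<zero>\<^bsub>?H\<^esub>), ?x) \<in> fraction_rel R \<pp> ?H" by (rule Image_singleton_iff[THEN iffD1])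
  then obtain a a' where a: "a \<in> carrier R" "a' \<in> carrier R" "a \<otimes>\<^bsub>R\<^esub> ?one = a' \<otimes>\<^bsub>R\<^esub> ?one"
      "a \<otimes>\<^bsub>R\<^esub> ?one \<in> denominators R \<pp>" "a \<odot>\<^bsub>?H\<^esub> \<zero>\<^bsub>?H\<^esub> = a' \<odot>\<^bsub>?H\<^esub> h"
    unfolding fraction_rel_def by clarsimp
  have aa: "a' = a" "a \<in> denominators R \<pp>" using a(1-4) by simp_all
  then obtain d where d: "a \<in> grade R d" "a \<notin> \<pp>" unfolding denominators_def homogeneous_def by blast
  have "\<zero>\<^bsub>?H\<^esub> = a \<odot>\<^bsub>?H\<^esub> h" using a(5) graded_hom_smult_zero[OF C X d(1)] aa(1) by simp
  then have "zr C (sh (d - n) X) = (a \<odot>\<^bsub>?H\<^esub> h) (d - n)"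
    unfolding graded_hom_zero by (rule fun_cong)
  also have "\<dots> = sm (-n) (center_act T d a X) \<bullet> sm (-n) f"
    using graded_hom_smult[OF C X d(1) hH, of "d - n"] by (simp add: h_def[of "-n"])
  finally have 1: "sm (-n) (center_act T d a X) \<bullet> sm (-n) f = zr C (sh (d - n) X)" by simp
  have cH: "center_act T d a X \<in> Hom X (sh d X)" by (rule center_Hom[OF d(1) X])
  have "sm n (sm (-n) (center_act T d a X) \<bullet> sm (-n) f) = zr (sh n C) (sh d X)"
    unfolding 1 using C X by simp
  then have 2: "center_act T d a X \<bullet> f = zr (sh n C) (sh d X)" using cH f by simp
  \<comment> \<open>The denominator \<open>a\<close> may be odd; its square is even and kills
    \<open>f\<close> as well.\<close>
  let ?w = "(d + d, a \<otimes>\<^bsub>R\<^esub> a)"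
  have w: "?w \<in> R.avoiding \<pp>" by (rule R.square_avoiding[OF p d])
  have "act ?w X = sm d (center_act T d a X) \<bullet> center_act T d a X"
    using linear_structure.act_mult[OF linear d(1) d(1) X] by (simp add: act_def)
  then have "act ?w X \<bullet> f = sm d (center_act T d a X) \<bullet> (center_act T d a X \<bullet> f)" using cH f by simp
  also have "\<dots> = zr (sh n C) (sh (d + d) X)" unfolding 2 using cH C by simp
  finally have "kills ?w f" unfolding kills_Hom[OF f] by simp
  then show "\<exists>a\<in>R.avoiding \<pp>. kills a f" using w by blast
qed

lemma tors_vanishes:
  assumes p: "\<pp> \<in> Spec R" and C: "C \<in> obj T" and X: "X \<in> obj T" and t: "tors (R.avoiding \<pp>) C X"
  shows "vanishes_at R \<pp> (graded_hom R T C X)"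
proof -
  let ?H = "graded_hom R T C X" and ?one = "\<one>\<^bsub>R\<^esub>"
  let ?D = "denominators R \<pp> \<times> carrier ?H"
  have one: "?one \<in> denominators R \<pp>"
    unfolding denominators_def homogeneous_def using R.one_grade R.SpecD(4)[OF p] by blast
  have z: "\<zero>\<^bsub>?H\<^esub> \<in> carrier ?H" unfolding graded_hom_zero graded_hom_carrier[OF C X] using C X by simp
  have M: "R.mult_closed (R.avoiding \<pp>)" by (rule R.avoiding_mult_closed[OF p])
  \<comment> \<open>Any two fractions coincide. They are expanded by \<open>s' w\<close> and
    \<open>e w\<close>, where \<open>w\<close> kills both numerators and \<open>e\<close> is
    \<open>s\<close> with the sign that makes \<open>s' s = e s'\<close>.\<close>
  have rel: "((s, m), (s', m')) \<in> fraction_rel R \<pp> ?H"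
    if s: "s \<in> denominators R \<pp>" "s' \<in> denominators R \<pp>" and m: "m \<in> carrier ?H" "m' \<in> carrier ?H" for s s' m m'
  proof -
    obtain d where d: "s \<in> grade R d" "s \<notin> \<pp>" using s(1) unfolding denominators_def homogeneous_def by blast
    obtain d' where d': "s' \<in> grade R d'" "s' \<notin> \<pp>" using s(2) unfolding denominators_def homogeneous_def by blast
    obtain v where v: "v \<in> R.avoiding \<pp>" "\<And>i. kills v (m i)" using even_annihilator[OF C X M t m(1)] by blast
    obtain v' where v': "v' \<in> R.avoiding \<pp>" "\<And>i. kills v' (m' i)" using even_annihilator[OF C X M t m(2)] by blast
    define w where "w = R.mul v v'"
    have vE: "v \<in> E" "v' \<in> E" using v(1) v'(1) mult_closedD(1)[OF M] by blast+
    have w: "w \<in> R.avoiding \<pp>" "w \<in> E" unfolding w_def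
      using mult_closedD(4)[OF M v(1) v'(1)] mult_closedD(1)[OF M] by blast+
    have mH: "m i \<in> Hom C (sh i X)" "m' i \<in> Hom C (sh i X)" for i
      using m unfolding graded_hom_carrier[OF C X] by blast+
    have wm: "kills w (m i)" "kills w (m' i)" for i
      unfolding w_def using kills_mul_left[OF vE mH(1) v(2)] kills_mul_right[OF vE mH(2) v'(2)] .
    have wc: "snd w \<in> carrier R" "snd w \<notin> \<pp>" "snd w \<in> grade R (fst w)"
      using R.evenD[OF w(2)] w(1) unfolding R.avoiding_def by auto
    have sc: "s \<in> carrier R" "s' \<in> carrier R" using R.grade_carrier d d' by blast+
    define e where "e = (if odd d \<and> odd d' then \<ominus>\<^bsub>R\<^esub> s else s)"
    have e: "e \<in> grade R d" "e \<in> carrier R" unfolding e_def using d(1) sc R.grade_minus by auto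
    have es: "s' \<otimes>\<^bsub>R\<^esub> s = e \<otimes>\<^bsub>R\<^esub> s'" unfolding e_def
      using R.graded_comm[OF d'(1) d(1)] sc by (auto simp: R.l_minus)
    let ?a = "s' \<otimes>\<^bsub>R\<^esub> snd w" and ?a' = "e \<otimes>\<^bsub>R\<^esub> snd w"
    have cm: "snd w \<otimes>\<^bsub>R\<^esub> s = s \<otimes>\<^bsub>R\<^esub> snd w" "snd w \<otimes>\<^bsub>R\<^esub> s' = s' \<otimes>\<^bsub>R\<^esub> snd w"
      using R.grade_even_comm[OF wc(3) d(1)] R.grade_even_comm[OF wc(3) d'(1)] R.evenD(1)[OF w(2)] by auto
    have 1: "?a \<otimes>\<^bsub>R\<^esub> s = (s' \<otimes>\<^bsub>R\<^esub> s) \<otimes>\<^bsub>R\<^esub> snd w" using sc wc(1) cm(1) by (simp add: R.m_assoc)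
    have 2: "?a' \<otimes>\<^bsub>R\<^esub> s' = (e \<otimes>\<^bsub>R\<^esub> s') \<otimes>\<^bsub>R\<^esub> snd w" using sc e(2) wc(1) cm(2) by (simp add: R.m_assoc)
    have "s' \<otimes>\<^bsub>R\<^esub> s \<notin> \<pp>" using R.SpecD(7)[OF p d'(1) d(1)] d d' by blast
    then have "(s' \<otimes>\<^bsub>R\<^esub> s) \<otimes>\<^bsub>R\<^esub> snd w \<notin> \<pp>"
      using R.SpecD(7)[OF p R.mult_grade[OF d'(1) d(1)] wc(3)] wc(2) by blast
    then have den: "?a \<otimes>\<^bsub>R\<^esub> s \<in> denominators R \<pp>"
      unfolding 1 denominators_def homogeneous_def
      using R.mult_grade[OF R.mult_grade[OF d'(1) d(1)] wc(3)] by blast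
    have z1: "?a \<odot>\<^bsub>?H\<^esub> m = \<zero>\<^bsub>?H\<^esub>" by (rule annihilator_smult[OF C X w(2) m(1) wm(1) d'(1)])
    have z2: "?a' \<odot>\<^bsub>?H\<^esub> m' = \<zero>\<^bsub>?H\<^esub>" by (rule annihilator_smult[OF C X w(2) m(2) wm(2) e(1)])
    have eq: "?a \<otimes>\<^bsub>R\<^esub> s = ?a' \<otimes>\<^bsub>R\<^esub> s'" unfolding 1 2 es ..
    have ac: "?a \<in> carrier R" "?a' \<in> carrier R" using sc e(2) wc(1) by auto
    have "\<exists>a\<in>carrier R. \<exists>a'\<in>carrier R. a \<otimes>\<^bsub>R\<^esub> s = a' \<otimes>\<^bsub>R\<^esub> s' \<and>
        a \<otimes>\<^bsub>R\<^esub> s \<in> denominators R \<pp> \<and> a \<odot>\<^bsub>?H\<^esub> m = a' \<odot>\<^bsub>?H\<^esub> m'"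
      by (rule bexI[OF _ ac(1)], rule bexI[OF _ ac(2)], intro conjI eq den) (simp only: z1 z2)
    then show ?thesis unfolding fraction_rel_def using s m by blast
  qed
  have cls: "fraction_rel R \<pp> ?H `` {x} = ?D" if x: "x \<in> ?D" for x
  proof (intro subset_antisym subsetI)
    show "y \<in> ?D" if "y \<in> fraction_rel R \<pp> ?H `` {x}" for y
      using that unfolding fraction_rel_def by blast
    fix y assume "y \<in> ?D"
    then have "(x, y) \<in> fraction_rel R \<pp> ?H" using rel x by (cases x; cases y) blast
    then show "y \<in> fraction_rel R \<pp> ?H `` {x}" by blast
  qed
  have oz: "(?one, \<zero>\<^bsub>?H\<^esub>) \<in> ?D" using one z by blast
  have "localization R \<pp> ?H = {?D}"
    unfolding localization_def
  proof (intro subset_antisym subsetI)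
    fix A assume "A \<in> ?D // fraction_rel R \<pp> ?H"
    then obtain x where "x \<in> ?D" "A = fraction_rel R \<pp> ?H `` {x}" by (rule quotientE)
    then show "A \<in> {?D}" using cls by simp
  next
    fix A assume "A \<in> {?D}"
    then show "A \<in> ?D // fraction_rel R \<pp> ?H" using quotientI[OF oz, of "fraction_rel R \<pp> ?H"] unfolding cls[OF oz] by blast
  qed
  moreover have "localization_zero R \<pp> ?H = ?D" unfolding localization_zero_def by (rule cls[OF oz])
  ultimately show ?thesis unfolding vanishes_at_def by simp
qed

lemma torsion_objects_tors:
  "torsion_objects U R T V =
    {X \<in> obj T. \<forall>C\<in>compact_objects U T. \<forall>\<pp>\<in>Spec R - V. tors (R.avoiding \<pp>) C X}"
  unfolding torsion_objects_def using vanishes_tors tors_vanishes compact_obj by blast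

lemma localizing_Inter:
  assumes "\<SS> \<noteq> {}" "\<And>S. S \<in> \<SS> \<Longrightarrow> localizing U T S" shows "localizing U T (\<Inter>\<SS>)"
proof (rule localizingI)
  show "triang (\<Inter>\<SS>)" by (rule triang_Inter[OF assms(1)]) (rule localizingD[OF assms(2)])
  fix I :: "'u set" and A P \<iota>
  assume a: "small U I" "\<And>i. i \<in> I \<Longrightarrow> A i \<in> \<Inter>\<SS>" "is_coproduct T I A P \<iota>"
  show "P \<in> \<Inter>\<SS>"
  proof
    fix S assume S: "S \<in> \<SS>"
    show "P \<in> S" by (rule localizing_coprod[OF assms(2)[OF S] a(1) _ a(3)]) (use a(2) S in blast)
  qed
qed

lemma localizing_tors_family:
  assumes "\<And>M D. (M, D) \<in> \<F> \<Longrightarrow> R.mult_closed M \<and> D \<in> compact_objects U T"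
  shows "localizing U T {X \<in> obj T. \<forall>(M, D)\<in>\<F>. tors M D X}"
proof -
  have "{X \<in> obj T. \<forall>(M, D)\<in>\<F>. tors M D X} = \<Inter>(insert (obj T) ((\<lambda>(M, D). {X \<in> obj T. tors M D X}) ` \<F>))"
    by auto
  moreover have "localizing U T (\<Inter>(insert (obj T) ((\<lambda>(M, D). {X \<in> obj T. tors M D X}) ` \<F>)))"
    by (rule localizing_Inter) (use assms localizing_obj localizing_tors in auto)
  ultimately show ?thesis by simp
qed

lemma localizing_torsion_objects: "localizing U T (torsion_objects U R T V)"
proof -
  have "torsion_objects U R T V = {X \<in> obj T. \<forall>(M, D) \<in> (R.avoiding ` (Spec R - V)) \<times> compact_objects U T. tors M D X}"
    unfolding torsion_objects_tors by auto
  moreover have "localizing U T {X \<in> obj T. \<forall>(M, D) \<in> (R.avoiding ` (Spec R - V)) \<times> compact_objects U T. tors M D X}"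
    by (rule localizing_tors_family) (use R.avoiding_mult_closed in auto)
  ultimately show ?thesis by simp
qed

text \<open>The annihilator of \<open>f\<close> is a homogeneous ideal. If it contained no power of
  \<open>u\<close>, it would lie in a prime avoiding \<open>u\<close>, contradicting torsion at that
  prime.\<close>

lemma power_torsion:
  assumes D: "D \<in> obj T" and X: "X \<in> obj T" and u: "u \<in> E"
    and q: "\<And>\<qq>. \<qq> \<in> Spec R \<Longrightarrow> snd u \<notin> \<qq> \<Longrightarrow> tors (R.avoiding \<qq>) D X"
  shows "tors (range (R.pw u)) D X"
  unfolding tors_def
proof (intro allI ballI, rule ccontr)
  fix n f assume f: "f \<in> Hom (sh n D) X" and no: "\<not> (\<exists>a\<in>range (R.pw u). kills a f)"
  define Q where "Q m = {r \<in> grade R m. center_act T m r X \<bullet> f = zr (sh n D) (sh m X)}" for m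
  have cH: "center_act T m r X \<in> Hom X (sh m X)" if "r \<in> grade R m" for m r by (rule center_Hom[OF that X])
  have z: "\<zero>\<^bsub>R\<^esub> \<in> Q m" for m unfolding Q_def using center_zero[OF X] f X by simp
  have hom: "homogeneous_ideal (R.ideal_of_pieces Q) R"
  proof (rule R.homogeneous_ideal_of_pieces)
    show "Q m \<subseteq> grade R m" for m unfolding Q_def by blast
    show "\<zero>\<^bsub>R\<^esub> \<in> Q m" for m by (rule z)
    show "x \<oplus>\<^bsub>R\<^esub> y \<in> Q m" if "x \<in> Q m" "y \<in> Q m" for m x y
    proof -
      have g: "x \<in> grade R m" "y \<in> grade R m" using that unfolding Q_def by blast+
      have "center_act T m (x \<oplus>\<^bsub>R\<^esub> y) X \<bullet> f = center_act T m x X \<bullet> f \<boxplus> center_act T m y X \<bullet> f"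
        unfolding linear_structure.act_add[OF linear g X]
        by (rule cmp_add_l) (use cH[OF g(1)] cH[OF g(2)] f in auto)
      then show ?thesis using that R.grade_add[OF g] f X unfolding Q_def by simp
    qed
    show "r \<otimes>\<^bsub>R\<^esub> x \<in> Q (l + m)" if r: "r \<in> grade R l" and x: "x \<in> Q m" for l m r x
    proof -
      have g: "x \<in> grade R m" using x unfolding Q_def by blast
      have "center_act T (l + m) (r \<otimes>\<^bsub>R\<^esub> x) X \<bullet> f = sm m (center_act T l r X) \<bullet> (center_act T m x X \<bullet> f)"
        unfolding linear_structure.act_mult[OF linear r g X] using cH[OF r] cH[OF g] f by simp
      also have "\<dots> = zr (sh n D) (sh (l + m) X)"
        using x cH[OF r] f D unfolding Q_def by (simp add: add.commute)
      finally show ?thesis using R.mult_grade[OF r g] unfolding Q_def by blast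
    qed
  qed
  have mem: "snd a \<in> R.ideal_of_pieces Q \<longleftrightarrow> kills a f" if a: "a \<in> E" for a
  proof -
    have "snd a \<in> R.ideal_of_pieces Q \<longleftrightarrow> snd a \<in> Q (fst a)"
      using R.ideal_of_pieces_grade[of Q "snd a" "fst a"] z R.evenD(2)[OF a] by blast
    also have "\<dots> \<longleftrightarrow> kills a f" unfolding kills_Hom[OF f] Q_def act_def using R.evenD(2)[OF a] by blast
    finally show ?thesis .
  qed
  have "snd (R.pw u k) \<notin> R.ideal_of_pieces Q" for k using mem[OF R.pw_even[OF u]] no by blast
  then obtain \<qq> where qq: "\<qq> \<in> Spec R" "R.ideal_of_pieces Q \<subseteq> \<qq>" "snd u \<notin> \<qq>"
    using R.ex_prime_avoiding[OF u hom] by metis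
  obtain a where a: "a \<in> R.avoiding \<qq>" "kills a f" using torsD[OF q[OF qq(1,3)] f] by blast
  then have "snd a \<in> \<qq>" using mem qq(2) unfolding R.avoiding_def by blast
  then show False using a(1) unfolding R.avoiding_def by blast
qed

section \<open>Koszul objects\<close>

definition kos1 :: "int \<times> 'r \<Rightarrow> 'o \<Rightarrow> 'o" where
  "kos1 a C = (SOME E'. \<exists>g h. tri3 (sh (- fst a) C) C E' (act a (sh (- fst a) C)) g h)"

text \<open>The source of the action is shifted down, so that the morphism from \<open>C\<close> to
  its Koszul object has degree zero and can be iterated in \<open>kmap\<close>.\<close>

definition kmap1 :: "int \<times> 'r \<Rightarrow> 'o \<Rightarrow> 'm" where
  "kmap1 a C = (SOME g. \<exists>h. tri3 (sh (- fst a) C) C (kos1 a C) (act a (sh (- fst a) C)) g h)"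

lemma kos1_tri:
  assumes "a \<in> E" "C \<in> obj T"
  obtains h where "tri3 (sh (- fst a) C) C (kos1 a C) (act a (sh (- fst a) C)) (kmap1 a C) h"
proof -
  have "act a (sh (- fst a) C) \<in> Hom (sh (- fst a) C) C" using act_Hom[OF assms(1), of "sh (- fst a) C"] assms(2) by simp
  from ex_cone[OF this]
  have "\<exists>E' g h. tri3 (sh (- fst a) C) C E' (act a (sh (- fst a) C)) g h" by metis
  from someI_ex[OF this] have "\<exists>g h. tri3 (sh (- fst a) C) C (kos1 a C) (act a (sh (- fst a) C)) g h"
    unfolding kos1_def .
  from someI_ex[OF this] show ?thesis using that unfolding kmap1_def by blast
qed

primrec kos :: "(int \<times> 'r) list \<Rightarrow> 'o \<Rightarrow> 'o" where
  "kos [] C = C"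
| "kos (u # us) C = kos1 u (kos us C)"

primrec kmap :: "(int \<times> 'r) list \<Rightarrow> 'o \<Rightarrow> 'm" where
  "kmap [] C = ide T C"
| "kmap (u # us) C = kmap1 u (kos us C) \<bullet> kmap us C"

lemma kos1_triang:
  assumes "triang S" "a \<in> E" "C \<in> S" shows "kos1 a C \<in> S"
proof -
  have C: "C \<in> obj T" by (rule triangD(1)[OF assms(1,3)])
  obtain h where "tri3 (sh (- fst a) C) C (kos1 a C) (act a (sh (- fst a) C)) (kmap1 a C) h"
    by (rule kos1_tri[OF assms(2) C])
  then have "dist (sh (- fst a) C) C (kos1 a C)" unfolding dist_def by blast
  then show ?thesis by (rule triangD(4)[OF assms(1) _ triangD(3)[OF assms(1,3)] assms(3)])
qed

lemma kos_triang: "triang S \<Longrightarrow> set us \<subseteq> E \<Longrightarrow> C \<in> S \<Longrightarrow> kos us C \<in> S"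
  by (induction us) (auto intro: kos1_triang)

lemma kos_obj: "set us \<subseteq> E \<Longrightarrow> C \<in> obj T \<Longrightarrow> kos us C \<in> obj T"
  by (rule kos_triang[OF triang_obj])

definition annihilates :: "int \<times> 'r \<Rightarrow> 'o \<Rightarrow> bool" where
  "annihilates a X \<longleftrightarrow> X \<in> obj T \<and> act a X = zr X (sh (fst a) X)"

lemma annihilates_sh: assumes "a \<in> E" "annihilates a X" shows "annihilates a (sh i X)"
  using assms act_sh[OF assms(1), of X i] unfolding annihilates_def by (simp add: add.commute)

text \<open>Since \<open>b\<close> acts as zero on \<open>Y\<close>, its action on \<open>Z\<close>
  factors through the boundary \<open>h\<close>; acting by \<open>a\<close> on the factor amounts to
  acting on the suspension of \<open>X\<close>, where \<open>a\<close> is zero.\<close>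

lemma annihilates_dist:
  assumes a: "a \<in> E" and b: "b \<in> E" and X: "annihilates a X" and Y: "annihilates b Y" and d: "dist X Y Z"
  shows "annihilates (R.mul a b) Z"
proof -
  obtain f g h where t: "tri3 X Y Z f g h" using d unfolding dist_def by blast
  note H = tri3_Hom[OF t]
  have gH: "g \<in> Hom Y Z" and hH: "h \<in> Hom Z (sh 1 X)" using H by auto
  have "act b Z \<bullet> g = zr Y (sh (fst b) Z)"
    unfolding act_natural[OF b gH] using Y H unfolding annihilates_def by simp
  then obtain l where l: "l \<in> Hom (sh 1 X) (sh (fst b) Z)" "act b Z = l \<bullet> h"
    by (rule weak_cokernel2[OF t]) (use b H in simp)
  have "act (R.mul a b) Z = act a (sh (fst b) Z) \<bullet> (l \<bullet> h)" unfolding l(2)[symmetric] by (rule act_mul[OF a b H(12)])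
  also have "\<dots> = (act a (sh (fst b) Z) \<bullet> l) \<bullet> h" using a l(1) H by simp
  also have "\<dots> = (sm (fst a) l \<bullet> act a (sh 1 X)) \<bullet> h" unfolding act_natural[OF a l(1)] ..
  also have "act a (sh 1 X) = zr (sh 1 X) (sh (fst a) (sh 1 X))"
    using annihilates_sh[OF a X, of 1] unfolding annihilates_def by simp
  finally show ?thesis using l(1) H unfolding annihilates_def by (simp add: R.mul_def)
qed

text \<open>The action of \<open>a\<close> on the cone composes to zero with the boundary
  \<open>h\<close>, so it factors through \<open>C\<close> up to suspension. Acting once more
  involves the composite of \<open>g\<close> with the action on \<open>C\<close>, which is zero in
  the triangle. The action of \<open>a\<close> itself may be nonzero, hence the square.\<close>

lemma annihilates_kos1: assumes a: "a \<in> E" and C: "C \<in> obj T" shows "annihilates (R.mul a a) (kos1 a C)"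
proof -
  let ?N = "sh (- fst a) C" and ?n = "fst a" and ?Z = "kos1 a C"
  obtain g h where t: "tri3 ?N C ?Z (act a ?N) g h" using kos1_tri[OF a C] by blast
  note H = tri3_Hom[OF t]
  have gH: "g \<in> Hom C ?Z" and hH: "h \<in> Hom ?Z (sh 1 ?N)" using H by auto
  have NC: "sh ?n ?N = C" using C by simp
  have "sm ?n h \<bullet> act a ?Z = act a (sh 1 ?N) \<bullet> h" using act_natural[OF a hH] by simp
  also have "\<dots> = zr ?Z (sh 1 C)" unfolding act_sh[OF a sh_obj[OF C]] using tri3_comp_zero''[OF t] by simp
  finally have "sm ?n h \<bullet> act a ?Z = zr ?Z (sh (?n + 1) ?N)" using C by (simp add: add.commute)
  then obtain y where y: "y \<in> Hom ?Z (sh ?n C)" "act a ?Z = sm ?n g \<bullet> y"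
    by (rule weak_kernel2_sh[OF t]) (use a H in simp)
  have 1: "act a ?Z \<bullet> g = zr C (sh ?n ?Z)"
  proof -
    have "act a ?Z \<bullet> g = sm ?n g \<bullet> act a (sh ?n ?N)" unfolding act_natural[OF a gH] NC ..
    also have "\<dots> = sm ?n (g \<bullet> act a ?N)" unfolding act_sh[OF a sh_obj[OF C]] using H a by simp
    also have "\<dots> = zr C (sh ?n ?Z)" unfolding tri3_comp_zero[OF t] using H by simp
    finally show ?thesis .
  qed
  have "act (R.mul a a) ?Z = act a (sh ?n ?Z) \<bullet> (sm ?n g \<bullet> y)" unfolding y(2)[symmetric] by (rule act_mul[OF a a H(12)])
  also have "\<dots> = sm ?n (act a ?Z \<bullet> g) \<bullet> y" unfolding act_sh[OF a H(12)] using a H y(1) by simp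
  also have "\<dots> = zr ?Z (sh (?n + ?n) ?Z)" unfolding 1 using y(1) H by simp
  finally show ?thesis unfolding annihilates_def using H by (simp add: R.mul_def)
qed

definition nilpotent :: "int \<times> 'r \<Rightarrow> 'o \<Rightarrow> bool" where
  "nilpotent u X \<longleftrightarrow> (\<exists>k. annihilates (R.pw u k) X)"

text \<open>Exponents add up along a triangle. Hence an element that has become nilpotent stays so
  in all further Koszul steps, whatever elements these use.\<close>

lemma triang_nilpotent: assumes u: "u \<in> E" shows "triang {X \<in> obj T. nilpotent u X}"
  unfolding triang_def
proof (intro conjI allI impI ballI)
  show "Z \<in> {X \<in> obj T. nilpotent u X}" if Z: "is_zero T Z" for Z
  proof -
    have "annihilates (R.pw u 0) Z" using Z unfolding annihilates_def is_zero_iff by simp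
    then have "nilpotent u Z" unfolding nilpotent_def by (rule exI)
    then show ?thesis using Z by simp
  qed
  show "sh n X \<in> {X \<in> obj T. nilpotent u X}" if X: "X \<in> {X \<in> obj T. nilpotent u X}" for X n
  proof -
    obtain k where "annihilates (R.pw u k) X" using X unfolding nilpotent_def by blast
    then have "annihilates (R.pw u k) (sh n X)" by (rule annihilates_sh[OF R.pw_even[OF u]])
    then have "nilpotent u (sh n X)" unfolding nilpotent_def by (rule exI)
    then show ?thesis using X by simp
  qed
  show "Z \<in> {X \<in> obj T. nilpotent u X}" if d: "dist X Y Z" and X: "X \<in> {X \<in> obj T. nilpotent u X}"
    and Y: "Y \<in> {X \<in> obj T. nilpotent u X}" for X Y Z
  proof -
    obtain j where j: "annihilates (R.pw u j) X" using X unfolding nilpotent_def by blast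
    obtain k where k: "annihilates (R.pw u k) Y" using Y unfolding nilpotent_def by blast
    have "annihilates (R.pw u (j + k)) Z"
      unfolding R.pw_add[OF u] by (rule annihilates_dist[OF R.pw_even[OF u] R.pw_even[OF u] j k d])
    then show ?thesis using dist_obj[OF d] unfolding nilpotent_def by blast
  qed
qed auto

lemma nilpotent_kos:
  assumes "set us \<subseteq> E" "C \<in> obj T" "u \<in> set us" shows "nilpotent u (kos us C)"
  using assms
proof (induction us)
  case (Cons v us)
  have vus: "v \<in> E" "set us \<subseteq> E" using Cons.prems(1) by auto
  have K: "kos us C \<in> obj T" by (rule kos_obj[OF vus(2) Cons.prems(2)])
  show ?case
  proof (cases "u = v")
    case True
    have "annihilates (R.pw v 2) (kos1 v (kos us C))"
      using annihilates_kos1[OF vus(1) K] R.mul_one(1)[OF vus(1)] by (simp add: numeral_2_eq_2)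
    then have "nilpotent v (kos1 v (kos us C))" unfolding nilpotent_def by (rule exI)
    then show ?thesis unfolding True by simp
  next
    case False
    then have u: "u \<in> set us" "u \<in> E" using Cons.prems(1,3) by auto
    have "kos us C \<in> {X \<in> obj T. nilpotent u X}" using Cons.IH[OF vus(2) Cons.prems(2) u(1)] K by blast
    from kos1_triang[OF triang_nilpotent[OF u(2)] vus(1) this] show ?thesis by simp
  qed
qed simp

lemma annihilates_kills_into: assumes "a \<in> E" "annihilates a X" "f \<in> Hom D X" shows "kills a f"
  unfolding kills_Hom[OF assms(3)] using assms unfolding annihilates_def by simp

lemma annihilates_kills_from: assumes "a \<in> E" "annihilates a X" "f \<in> Hom (sh n X) Y" shows "kills a f"
  unfolding kills_right_iff[OF assms(1,3)] using annihilates_sh[OF assms(1,2), of n] assms(3) unfolding annihilates_def by simp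

text \<open>If \<open>a\<close> kills \<open>f\<close>, the composite of \<open>f\<close> with the
  action on its source is zero. So \<open>f\<close> factors through the Koszul object, from which
  all morphisms to \<open>Y\<close> vanish.\<close>

lemma kos1_injective:
  assumes a: "a \<in> E" and C: "C \<in> obj T" and o: "orth {kos1 a C} Y" and f: "f \<in> Hom (sh n C) Y" and k: "kills a f"
  shows "f = zr (sh n C) Y"
proof -
  let ?N = "sh (- fst a) C" and ?d = "fst a"
  have Y: "Y \<in> obj T" by (rule orth_obj[OF o])
  obtain g h where t: "tri3 ?N C (kos1 a C) (act a ?N) g h" using kos1_tri[OF a C] by blast
  note H = tri3_Hom[OF t]
  let ?f = "sm (-n) f"
  have fH: "?f \<in> Hom C (sh (-n) Y)" using f C by simp
  have "kills a ?f" using kills_sm[OF a f] k by simp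
  then have "sm ?d ?f \<bullet> act a C = zr C (sh ?d (sh (-n) Y))" using kills_right_iff[OF a fH] by simp
  then have "sm (-?d) (sm ?d ?f \<bullet> act a C) = zr ?N (sh (-n) Y)" using C Y by simp
  moreover have "sm (-?d) (sm ?d ?f \<bullet> act a C) = ?f \<bullet> act a ?N" unfolding act_sh[OF a C] using f C a by simp
  ultimately have "?f \<bullet> act a ?N = zr ?N (sh (-n) Y)" by simp
  then obtain l where l: "l \<in> Hom (kos1 a C) (sh (-n) Y)" "?f = l \<bullet> g" by (rule weak_cokernel[OF t _ fH])
  have "orth {kos1 a C} (sh (-n) Y)" by (rule orth_sh[OF o]) (use H in simp)
  then have "l = zr (kos1 a C) (sh (-n) Y)" by (rule orthD0[OF _ _ l(1)]) simp
  then have "?f = zr C (sh (-n) Y)" unfolding l(2) using H Y by simp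
  then have "sm n ?f = zr (sh n C) Y" using C Y by simp
  then show ?thesis using f by simp
qed

text \<open>Some power of \<open>a\<close> kills \<open>f\<close>, while acting by \<open>a\<close>
  is injective; so the exponent can be lowered to \<open>0\<close>.\<close>

lemma kos1_conservative:
  assumes a: "a \<in> E" and C: "C \<in> obj T" and o: "orth {kos1 a C} Y" and t: "tors (range (R.pw a)) C Y"
  shows "orth {C} Y"
proof (rule orthI)
  show Y: "Y \<in> obj T" by (rule orth_obj[OF o])
  have K: "kos1 a C \<in> obj T" by (rule kos1_triang[OF triang_obj a C])
  have inj: "f = zr (sh n C) (sh m Y)" if "f \<in> Hom (sh n C) (sh m Y)" "kills (R.pw a k) f" for f n m k
    using that
  proof (induction k arbitrary: f m)
    case 0
    then show ?case unfolding kills_Hom[OF 0(1)] using Y by simp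
  next
    case (Suc k)
    have pk: "R.pw a k \<in> E" by (rule R.pw_even[OF a])
    have 1: "act (R.pw a k) (sh m Y) \<bullet> f \<in> Hom (sh n C) (sh (fst (R.pw a k) + m) Y)"
      using Suc.prems(1) pk Y by simp
    have "kills a (act (R.pw a k) (sh m Y) \<bullet> f)"
      using Suc.prems(2) kills_mul_act[OF a pk Suc.prems(1)] by simp
    from kos1_injective[OF a C orth_sh[OF o] 1 this] K
    have "act (R.pw a k) (sh m Y) \<bullet> f = zr (sh n C) (sh (fst (R.pw a k)) (sh m Y))" using Y by simp
    then have "kills (R.pw a k) f" unfolding kills_Hom[OF Suc.prems(1)] .
    then show ?case by (rule Suc.IH[OF Suc.prems(1)])
  qed
  fix V n f assume "V \<in> {C}" and f: "f \<in> Hom (sh n V) Y"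
  then have V: "V = C" by simp
  obtain k where "kills (R.pw a k) f" using torsD[OF t] f unfolding V by blast
  then show "f = zr (sh n V) Y" using inj[of f n 0 k] f unfolding V by simp
qed

text \<open>Torsion in the first variable is inherited by Koszul objects, so the elements can be
  stripped off one at a time.\<close>

lemma kos_conservative:
  assumes "set us \<subseteq> E" "C \<in> obj T" "orth {kos us C} Y" "\<And>u. u \<in> set us \<Longrightarrow> tors (range (R.pw u)) C Y"
  shows "orth {C} Y"
  using assms
proof (induction us)
  case (Cons u us)
  have u: "u \<in> E" "set us \<subseteq> E" using Cons.prems(1) by auto
  have K: "kos us C \<in> obj T" by (rule kos_obj[OF u(2) Cons.prems(2)])
  have Y: "Y \<in> obj T" by (rule orth_obj[OF Cons.prems(3)])
  have "C \<in> {D \<in> obj T. tors (range (R.pw u)) D Y}" using Cons.prems(2,4) by simp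
  then have "tors (range (R.pw u)) (kos us C) Y"
    using kos_triang[OF triang_tors[OF R.powers_mult_closed[OF u(1)] Y] u(2)] by blast
  then have "orth {kos us C} Y" using kos1_conservative[OF u(1) K] Cons.prems(3) by simp
  then show ?case using Cons.IH[OF u(2) Cons.prems(2)] Cons.prems(4) by simp
qed simp

end

section \<open>Local cohomology and support\<close>

locale generated_category = linear_cocomplete T U R
  for T :: "('o, 'm, 'r) linear_category" (structure) and U :: "'u set" and R :: "'r graded_ring" +
  assumes noeth: "noetherian_ring R" and small_R: "small U (carrier R)" and gen: "compactly_generated U T"
begin

abbreviation "\<C> \<equiv> compact_objects U T"

definition generators :: "'o set" where
  "generators = (SOME G. G \<subseteq> \<C> \<and> small U G \<and> Loc U T G = obj T)"

lemma generators: "generators \<subseteq> \<C>" "small U generators" "Loc U T generators = obj T"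
proof -
  have "\<exists>G. G \<subseteq> \<C> \<and> small U G \<and> Loc U T G = obj T" using gen unfolding compactly_generated_def by blast
  from someI_ex[OF this] show "generators \<subseteq> \<C>" "small U generators" "Loc U T generators = obj T"
    unfolding generators_def[symmetric] by blast+
qed

lemma orth_generators_zero: assumes "\<And>C. C \<in> generators \<Longrightarrow> orth {C} Y" "Y \<in> obj T" shows "is_zero T Y"
proof -
  have "orth generators Y" using assms unfolding orth_def by blast
  then have "orth (obj T) Y"
    using orth_Loc[of generators Y] generators compact_obj by (metis subsetI subset_iff)
  then show ?thesis using assms(2) by (rule orth_self_zero)
qed

text \<open>
  These even elements determine \<open>\<V>(\<pp>)\<close>, which is all that matters; in general they do not
  generate the ideal \<open>\<pp>\<close>.
\<close>

definition prime_gens :: "'r set \<Rightarrow> (int \<times> 'r) list" where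
  "prime_gens \<pp> = (SOME us. set us \<subseteq> E \<and> (\<forall>u\<in>set us. snd u \<in> \<pp>) \<and>
    (\<forall>\<qq>\<in>Spec R. (\<forall>u\<in>set us. snd u \<in> \<qq>) \<longrightarrow> \<pp> \<subseteq> \<qq>))"

lemma prime_gens:
  assumes "\<pp> \<in> Spec R"
  shows "set (prime_gens \<pp>) \<subseteq> E" "u \<in> set (prime_gens \<pp>) \<Longrightarrow> snd u \<in> \<pp>" "u \<in> set (prime_gens \<pp>) \<Longrightarrow> u \<in> E"
    "\<qq> \<in> Spec R \<Longrightarrow> \<not> \<pp> \<subseteq> \<qq> \<Longrightarrow> \<exists>u\<in>set (prime_gens \<pp>). snd u \<notin> \<qq>"
proof -
  from someI_ex[OF R.ex_generators[OF noeth assms], folded prime_gens_def]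
  show "set (prime_gens \<pp>) \<subseteq> E" "u \<in> set (prime_gens \<pp>) \<Longrightarrow> snd u \<in> \<pp>" "u \<in> set (prime_gens \<pp>) \<Longrightarrow> u \<in> E"
    "\<qq> \<in> Spec R \<Longrightarrow> \<not> \<pp> \<subseteq> \<qq> \<Longrightarrow> \<exists>u\<in>set (prime_gens \<pp>). snd u \<notin> \<qq>" by blast+
qed

abbreviation koszul :: "'o \<Rightarrow> 'r set \<Rightarrow> 'o" where "koszul C \<pp> \<equiv> kos (prime_gens \<pp>) C"

lemma koszul_compact: "\<pp> \<in> Spec R \<Longrightarrow> C \<in> \<C> \<Longrightarrow> koszul C \<pp> \<in> \<C>"
  by (rule kos_triang[OF compact_triang prime_gens(1)])

lemma generator_compact: "C \<in> generators \<Longrightarrow> C \<in> \<C>" using generators by blast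

section \<open>Torsion subcategories and their localizations\<close>

abbreviation TV :: "'r set \<Rightarrow> 'o set" where "TV \<pp> \<equiv> torsion_objects U R T (closed_set R \<pp>)"
abbreviation TZ :: "'r set \<Rightarrow> 'o set" where "TZ \<pp> \<equiv> torsion_objects U R T (not_below R \<pp>)"

lemma powers_avoiding: assumes "\<qq> \<in> Spec R" "u \<in> E" "snd u \<notin> \<qq>" shows "range (R.pw u) \<subseteq> R.avoiding \<qq>"
proof -
  note M = mult_closedD[OF R.avoiding_mult_closed[OF assms(1)]]
  have "u \<in> R.avoiding \<qq>" using assms unfolding R.avoiding_def by blast
  then have "R.pw u k \<in> R.avoiding \<qq>" for k by (induction k) (use M in auto)
  then show ?thesis by blast
qed

text \<open>A prime not containing \<pp> misses one of the chosen elements \<open>u\<close>, and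
  torsion at all primes missing \<open>u\<close> is the same as torsion with respect to the powers
  of \<open>u\<close>.\<close>

lemma TV_iff:
  assumes p: "\<pp> \<in> Spec R"
  shows "X \<in> TV \<pp> \<longleftrightarrow> X \<in> obj T \<and> (\<forall>C\<in>\<C>. \<forall>u\<in>set (prime_gens \<pp>). tors (range (R.pw u)) C X)"
proof
  assume X: "X \<in> TV \<pp>"
  then have Xo: "X \<in> obj T" unfolding torsion_objects_tors by blast
  have "tors (range (R.pw u)) C X" if C: "C \<in> \<C>" and u: "u \<in> set (prime_gens \<pp>)" for C u
  proof (rule power_torsion[OF compact_obj[OF C] Xo prime_gens(3)[OF p u]])
    fix \<qq> assume q: "\<qq> \<in> Spec R" "snd u \<notin> \<qq>"
    then have "\<qq> \<in> Spec R - closed_set R \<pp>" using prime_gens(2)[OF p u] unfolding closed_set_def by blast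
    then show "tors (R.avoiding \<qq>) C X" using X C unfolding torsion_objects_tors by blast
  qed
  then show "X \<in> obj T \<and> (\<forall>C\<in>\<C>. \<forall>u\<in>set (prime_gens \<pp>). tors (range (R.pw u)) C X)" using Xo by blast
next
  assume a: "X \<in> obj T \<and> (\<forall>C\<in>\<C>. \<forall>u\<in>set (prime_gens \<pp>). tors (range (R.pw u)) C X)"
  have "tors (R.avoiding \<qq>) C X" if C: "C \<in> \<C>" and q: "\<qq> \<in> Spec R - closed_set R \<pp>" for C \<qq>
  proof -
    have q': "\<qq> \<in> Spec R" "\<not> \<pp> \<subseteq> \<qq>" using q unfolding closed_set_def by blast+
    obtain u where u: "u \<in> set (prime_gens \<pp>)" "snd u \<notin> \<qq>" using prime_gens(4)[OF p q'] by blast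
    have "tors (range (R.pw u)) C X" using a C u(1) by blast
    then show ?thesis by (rule tors_mono[OF _ powers_avoiding[OF q'(1) prime_gens(3)[OF p u(1)] u(2)]])
  qed
  then show "X \<in> TV \<pp>" using a unfolding torsion_objects_tors by blast
qed

lemma avoiding_mono: "\<pp> \<subseteq> \<qq> \<Longrightarrow> R.avoiding \<qq> \<subseteq> R.avoiding \<pp>"
  unfolding R.avoiding_def by blast

text \<open>The primes outside \<open>not_below R \<pp>\<close> are those contained in \<pp>. Among
  them \<pp> itself imposes the strongest condition, since it leaves the fewest elements
  outside.\<close>

lemma TZ_iff:
  assumes p: "\<pp> \<in> Spec R"
  shows "X \<in> TZ \<pp> \<longleftrightarrow> X \<in> obj T \<and> (\<forall>C\<in>\<C>. tors (R.avoiding \<pp>) C X)"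
proof -
  have 1: "Spec R - not_below R \<pp> = {\<qq> \<in> Spec R. \<qq> \<subseteq> \<pp>}" unfolding not_below_def by blast
  have "(\<forall>\<qq>\<in>Spec R - not_below R \<pp>. tors (R.avoiding \<qq>) C X) \<longleftrightarrow> tors (R.avoiding \<pp>) C X" for C
    unfolding 1 using p tors_mono[OF _ avoiding_mono] by blast
  then show ?thesis unfolding torsion_objects_tors by simp
qed

text \<open>For \<open>X\<close> in \<open>S\<close> the third vertex of the coreflection triangle
  lies in \<open>S\<close> and is orthogonal to \<open>G\<close>, hence zero. So \<open>G\<close>
  generates \<open>S\<close>, and the coreflections then yield a localization functor with kernel
  \<open>S\<close>.\<close>

lemma generated_kernel:
  assumes G: "G \<subseteq> \<C>" "small U G" and S: "localizing U T S" and GS: "G \<subseteq> S"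
    and z: "\<And>Y. Y \<in> S \<Longrightarrow> orth G Y \<Longrightarrow> is_zero T Y"
  shows "Loc U T G = S" "\<exists>L \<eta>. localization_functor T L \<eta> \<and> functor_kernel T L = S"
proof -
  have Go: "G \<subseteq> obj T" using G(1) compact_obj by blast
  have LS: "Loc U T G \<subseteq> S" by (rule Loc_least[OF S GS])
  note tS = localizingD[OF S] and LG = Loc_localizing[OF Go]
  show e: "Loc U T G = S"
  proof (rule subset_antisym[OF LS], rule subsetI)
    fix X assume X: "X \<in> S"
    have Xo: "X \<in> obj T" by (rule triangD(1)[OF tS X])
    obtain C W f g h where C: "C \<in> Loc U T G" "tri3 C X W f g h" "orth (Loc U T G) W"
      by (rule coreflection[OF G Xo])
    have d: "dist C X W" using C(2) unfolding dist_def by blast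
    have "W \<in> S" by (rule triangD(4)[OF tS d _ X]) (use C(1) LS in blast)
    then have "is_zero T W" by (rule z[OF _ orth_subset[OF C(3) Loc_incl]])
    then show "X \<in> Loc U T G"
      using triangD(5)[OF localizingD[OF LG] d C(1)] triangD(2)[OF localizingD[OF LG]] by blast
  qed
  show "\<exists>L \<eta>. localization_functor T L \<eta> \<and> functor_kernel T L = S"
  proof (rule bousfield[OF S])
    fix X assume X: "X \<in> obj T"
    obtain C W f g h where C: "C \<in> Loc U T G" "tri3 C X W f g h" "orth (Loc U T G) W"
      by (rule coreflection[OF G X])
    show "\<exists>C W f g h. C \<in> S \<and> tri3 C X W f g h \<and> orth S W"
      by (intro exI conjI) (rule C[unfolded e])+
  qed
qed

lemma small_koszul: "small U ((\<lambda>C. koszul C \<pp>) ` generators)"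
  by (rule small_image[OF generators(2)])

lemma nilpotent_tors_into: assumes u: "u \<in> E" and X: "nilpotent u X" shows "tors (range (R.pw u)) D X"
proof -
  obtain k where "annihilates (R.pw u k) X" using X unfolding nilpotent_def by blast
  then show ?thesis unfolding tors_def using annihilates_kills_into[OF R.pw_even[OF u]] by blast
qed

lemma koszul_TV: assumes p: "\<pp> \<in> Spec R" and C: "C \<in> obj T" shows "koszul C \<pp> \<in> TV \<pp>"
  unfolding TV_iff[OF p]
  using kos_obj[OF prime_gens(1)[OF p] C] nilpotent_tors_into[OF prime_gens(3)[OF p] nilpotent_kos[OF prime_gens(1)[OF p] C]] by blast

lemma TV_zero:
  assumes p: "\<pp> \<in> Spec R" and Y: "Y \<in> TV \<pp>" and o: "orth ((\<lambda>C. koszul C \<pp>) ` generators) Y"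
  shows "is_zero T Y"
proof (rule orth_generators_zero)
  have Y': "\<forall>C\<in>\<C>. \<forall>u\<in>set (prime_gens \<pp>). tors (range (R.pw u)) C Y" using Y TV_iff[OF p] by blast
  show "Y \<in> obj T" using o by (rule orth_obj)
  fix C assume C: "C \<in> generators"
  have Cc: "C \<in> \<C>" by (rule generator_compact[OF C])
  show "orth {C} Y"
  proof (rule kos_conservative[OF prime_gens(1)[OF p] compact_obj[OF Cc]])
    show "orth {koszul C \<pp>} Y" by (rule orth_subset[OF o]) (use C in blast)
    show "tors (range (R.pw u)) C Y" if "u \<in> set (prime_gens \<pp>)" for u using Y' Cc that by blast
  qed
qed

lemma TV_kernel:
  assumes p: "\<pp> \<in> Spec R"
  shows "Loc U T ((\<lambda>C. koszul C \<pp>) ` generators) = TV \<pp>"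
    "\<exists>L \<eta>. localization_functor T L \<eta> \<and> functor_kernel T L = TV \<pp>"
proof -
  have 1: "(\<lambda>C. koszul C \<pp>) ` generators \<subseteq> \<C>" using koszul_compact[OF p] generator_compact by blast
  have 2: "(\<lambda>C. koszul C \<pp>) ` generators \<subseteq> TV \<pp>"
    using koszul_TV[OF p] generator_compact compact_obj by blast
  note k = generated_kernel[OF 1 small_koszul localizing_torsion_objects 2]
  show "Loc U T ((\<lambda>C. koszul C \<pp>) ` generators) = TV \<pp>" by (rule k(1)) (rule TV_zero[OF p])
  show "\<exists>L \<eta>. localization_functor T L \<eta> \<and> functor_kernel T L = TV \<pp>"
    by (rule k(2)) (rule TV_zero[OF p])
qed

lemma small_elements: "small U E"
proof -
  have "small U ((UNIV :: int set) \<times> carrier R)"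
    by (intro small_Times universe small_countable small_R) auto
  then show ?thesis by (rule small_mono) (auto dest: R.evenD)
qed

text \<open>The square of \<open>a\<close> acts as zero on the cone and still lies outside
  \<pp>.\<close>

lemma kos1_TZ: assumes p: "\<pp> \<in> Spec R" and a: "a \<in> R.avoiding \<pp>" and C: "C \<in> obj T" shows "kos1 a C \<in> TZ \<pp>"
proof -
  note M = mult_closedD[OF R.avoiding_mult_closed[OF p]]
  have aE: "a \<in> E" by (rule M(1)[OF a])
  have "kills (R.mul a a) f" if "f \<in> Hom (sh n D) (kos1 a C)" for f n D
    by (rule annihilates_kills_into[OF R.mul_even[OF aE aE] annihilates_kos1[OF aE C] that])
  then show ?thesis unfolding TZ_iff[OF p] tors_def using M(4)[OF a a] kos1_triang[OF triang_obj aE C] by blast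
qed

text \<open>Cones of elements outside \<pp> are torsion, so these elements act injectively on
  morphisms into an object orthogonal to the torsion objects.\<close>

lemma TZ_injective:
  assumes p: "\<pp> \<in> Spec R" and o: "orth (TZ \<pp>) W" and C: "C \<in> obj T" and f: "f \<in> Hom (sh n C) W"
    and a: "a \<in> R.avoiding \<pp>" "kills a f"
  shows "f = zr (sh n C) W"
proof (rule kos1_injective[OF _ C _ f a(2)])
  show "a \<in> E" using a(1) unfolding R.avoiding_def by blast
  show "orth {kos1 a C} W" by (rule orth_subset[OF o]) (use kos1_TZ[OF p a(1) C] in blast)
qed

text \<open>The cones of all even elements outside \<pp> on the generators serve as generating set;
  it is small because \<open>R\<close> is.\<close>

lemma TZ_kernel:
  assumes p: "\<pp> \<in> Spec R"
  shows "\<exists>L \<eta>. localization_functor T L \<eta> \<and> functor_kernel T L = TZ \<pp>"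
proof -
  let ?G = "(\<lambda>(a, C). kos1 a C) ` (R.avoiding \<pp> \<times> generators)"
  have aE: "R.avoiding \<pp> \<subseteq> E" unfolding R.avoiding_def by blast
  have Gc: "?G \<subseteq> \<C>" using kos1_triang[OF compact_triang] aE generator_compact by auto
  have Gs: "small U ?G"
    by (intro small_image small_Times universe generators(2) small_mono[OF small_elements aE])
  have GT: "?G \<subseteq> TZ \<pp>" using kos1_TZ[OF p] generator_compact compact_obj by auto
  show ?thesis
  proof (rule generated_kernel(2)[OF Gc Gs localizing_torsion_objects GT])
    fix Y assume Y: "Y \<in> TZ \<pp>" and o: "orth ?G Y"
    show "is_zero T Y"
    proof (rule orth_generators_zero)
      show Yo: "Y \<in> obj T" by (rule orth_obj[OF o])
      fix C assume C: "C \<in> generators"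
      have Cc: "C \<in> \<C>" by (rule generator_compact[OF C])
      show "orth {C} Y"
      proof (rule orthI[OF Yo])
        fix V n f assume "V \<in> {C}" and f: "f \<in> Hom (sh n V) Y"
        then have V: "V = C" by simp
        have t: "tors (R.avoiding \<pp>) C Y" using Y TZ_iff[OF p] Cc by blast
        obtain a where a: "a \<in> R.avoiding \<pp>" "kills a f" using torsD[OF t] f unfolding V by blast
        have aC: "kos1 a C \<in> ?G" using a(1) C by force
        have oa: "orth {kos1 a C} Y" by (rule orth_subset[OF o]) (use aC in blast)
        show "f = zr (sh n V) Y"
          using kos1_injective[OF _ compact_obj[OF Cc] oa _ a(2)] a(1) aE f unfolding V by blast
      qed
    qed
  qed
qed

lemma L_functor:
  assumes "\<exists>L \<eta>. localization_functor T L \<eta> \<and> functor_kernel T L = torsion_objects U R T V"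
  shows "localization_functor T (fst (L_functor U R T V)) (snd (L_functor U R T V))"
    "functor_kernel T (fst (L_functor U R T V)) = torsion_objects U R T V"
proof -
  have "\<exists>Q. case Q of (L, \<eta>) \<Rightarrow> localization_functor T L \<eta> \<and> functor_kernel T L = torsion_objects U R T V"
    using assms by auto
  from someI_ex[OF this]
  have "case L_functor U R T V of (L, \<eta>) \<Rightarrow> localization_functor T L \<eta> \<and> functor_kernel T L = torsion_objects U R T V"
    unfolding L_functor_def .
  then show "localization_functor T (fst (L_functor U R T V)) (snd (L_functor U R T V))"
    "functor_kernel T (fst (L_functor U R T V)) = torsion_objects U R T V"
    by (simp_all add: case_prod_unfold)
qed

lemma Gamma_triangle:
  assumes ex: "\<exists>L \<eta>. localization_functor T L \<eta> \<and> functor_kernel T L = torsion_objects U R T V" and X: "X \<in> obj T"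
  shows "\<exists>f h. tri3 (Gamma_ob U R T V X) X (L_ob U R T V X) f (snd (L_functor U R T V) X) h"
proof -
  let ?L = "fst (L_functor U R T V)" and ?\<eta> = "snd (L_functor U R T V)"
  note L = L_functor[OF ex]
  obtain C f h where t: "tri3 C X (on_ob ?L X) f (?\<eta> X) h" by (rule ex_K_triangle[OF L(1) X])
  then have "C \<in> obj T \<and> (\<exists>f h. f \<in> mor T C X \<and> (f, ?\<eta> X, h) \<in> tri T)"
    unfolding tri3_def Hom_def by blast
  then have "\<exists>C. C \<in> obj T \<and> (\<exists>f h. f \<in> mor T C X \<and> (f, ?\<eta> X, h) \<in> tri T)" by blast
  from someI_ex[OF this]
  have "Gamma_ob U R T V X \<in> obj T \<and> (\<exists>f h. f \<in> mor T (Gamma_ob U R T V X) X \<and> (f, ?\<eta> X, h) \<in> tri T)"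
    unfolding Gamma_ob_def .
  then obtain f h where f: "f \<in> Hom (Gamma_ob U R T V X) X" "(f, ?\<eta> X, h) \<in> tri T"
    using X unfolding Hom_def by blast
  have "tri3 (Gamma_ob U R T V X) X (on_ob ?L X) f (?\<eta> X) h"
    using tri_tri3[OF f(2,1) eta_Hom[OF L(1) X]] by blast
  then show ?thesis unfolding L_ob_def by blast
qed

lemma torsion_triangle:
  assumes ex: "\<exists>L \<eta>. localization_functor T L \<eta> \<and> functor_kernel T L = torsion_objects U R T V" and X: "X \<in> obj T"
  shows "Gamma_ob U R T V X \<in> torsion_objects U R T V" "orth (torsion_objects U R T V) (L_ob U R T V X)"
    "dist (Gamma_ob U R T V X) X (L_ob U R T V X)"
    "is_zero T (Gamma_ob U R T V X) \<longleftrightarrow> orth (torsion_objects U R T V) X"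
    "\<exists>f g h. tri3 (Gamma_ob U R T V X) X (L_ob U R T V X) f g h"
proof -
  note L = L_functor[OF ex]
  obtain f h where t: "tri3 (Gamma_ob U R T V X) X (L_ob U R T V X) f (snd (L_functor U R T V) X) h"
    using Gamma_triangle[OF ex X] by blast
  note t' = t[unfolded L_ob_def]
  show "Gamma_ob U R T V X \<in> torsion_objects U R T V" using K_triangle[OF L(1) t'] unfolding L(2) .
  show "orth (torsion_objects U R T V) (L_ob U R T V X)"
    using L_orth[OF L(1) X] unfolding L(2) L_ob_def .
  show "is_zero T (Gamma_ob U R T V X) \<longleftrightarrow> orth (torsion_objects U R T V) X"
    using triangle_zero_iff[OF L(1) t'] unfolding L(2) .
  show "dist (Gamma_ob U R T V X) X (L_ob U R T V X)" "\<exists>f g h. tri3 (Gamma_ob U R T V X) X (L_ob U R T V X) f g h"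
    using t unfolding dist_def by blast+
qed

abbreviation localized :: "'r set \<Rightarrow> 'o \<Rightarrow> 'o" where "localized \<pp> X \<equiv> L_ob U R T (not_below R \<pp>) X"

lemma localized_obj: "\<pp> \<in> Spec R \<Longrightarrow> X \<in> obj T \<Longrightarrow> localized \<pp> X \<in> obj T"
  using orth_obj[OF torsion_triangle(2)[OF TZ_kernel]] .

text \<open>Morphisms from a compact object to the localization of \<open>X\<close> are the
  localized morphisms to \<open>X\<close>: the torsion vertex of the triangle contributes only
  torsion, and on the local vertex elements outside \<pp> act injectively.\<close>

lemma orth_localized_iff:
  assumes p: "\<pp> \<in> Spec R" and D: "D \<in> \<C>" and X: "X \<in> obj T"
  shows "orth {D} (localized \<pp> X) \<longleftrightarrow> tors (R.avoiding \<pp>) D X"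
proof -
  note tt = torsion_triangle[OF TZ_kernel[OF p] X]
  let ?C = "Gamma_ob U R T (not_below R \<pp>) X" and ?W = "localized \<pp> X"
  obtain e g h where t: "tri3 ?C X ?W e g h" using tt(5) by blast
  note H = tri3_Hom[OF t]
  note M = R.avoiding_mult_closed[OF p]
  have Do: "D \<in> obj T" by (rule compact_obj[OF D])
  have tC: "tors (R.avoiding \<pp>) D ?C" using tt(1) D TZ_iff[OF p] by blast
  show ?thesis
  proof
    assume o: "orth {D} ?W"
    show "tors (R.avoiding \<pp>) D X" unfolding tors_def
    proof (intro allI ballI)
      fix n f assume f: "f \<in> Hom (sh n D) X"
      have "g \<bullet> f = zr (sh n D) ?W" by (rule orthD[OF o]) (use f H in auto)
      then obtain l where l: "l \<in> Hom (sh n D) ?C" "f = e \<bullet> l" by (rule weak_kernel[OF t _ f])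
      obtain a where a: "a \<in> R.avoiding \<pp>" "kills a l" using torsD[OF tC l(1)] by blast
      have "kills a f" unfolding l(2)
        by (rule kills_left[where Z = X, OF mult_closedD(1)[OF M a(1)] l(1) _ a(2)]) (use H in simp)
      then show "\<exists>a\<in>R.avoiding \<pp>. kills a f" using a(1) by blast
    qed
  next
    assume tX: "tors (R.avoiding \<pp>) D X"
    have "?W \<in> {Y \<in> obj T. tors (R.avoiding \<pp>) D Y}"
      by (rule triangD(4)[OF localizingD[OF localizing_tors[OF M D]] tt(3)]) (use tC tX X H in auto)
    then have tW: "tors (R.avoiding \<pp>) D ?W" by blast
    show "orth {D} ?W"
    proof (rule orthI)
      show "?W \<in> obj T" by (rule H)
      fix V n f assume "V \<in> {D}" and f: "f \<in> Hom (sh n V) ?W"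
      then have V: "V = D" by simp
      obtain a where a: "a \<in> R.avoiding \<pp>" "kills a f" using torsD[OF tW] f unfolding V by blast
      show "f = zr (sh n V) ?W" using TZ_injective[OF p tt(2) Do _ a] f unfolding V by blast
    qed
  qed
qed

section \<open>Support in terms of Koszul objects\<close>

lemma Gamma_at_obj: assumes "\<pp> \<in> Spec R" "X \<in> obj T" shows "Gamma_at U R T \<pp> X \<in> obj T"
  using dist_obj[OF torsion_triangle(3)[OF TV_kernel(2)[OF assms(1)] localized_obj[OF assms]]]
  unfolding Gamma_at_def by blast

lemma orth_TV_iff:
  assumes p: "\<pp> \<in> Spec R" and Y: "Y \<in> obj T"
  shows "orth (TV \<pp>) Y \<longleftrightarrow> (\<forall>C\<in>generators. orth {koszul C \<pp>} Y)"
proof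
  assume o: "orth (TV \<pp>) Y"
  show "\<forall>C\<in>generators. orth {koszul C \<pp>} Y"
  proof
    fix C assume "C \<in> generators"
    then have "koszul C \<pp> \<in> TV \<pp>" using koszul_TV[OF p] generator_compact compact_obj by blast
    then show "orth {koszul C \<pp>} Y" by (intro orth_subset[OF o]) blast
  qed
next
  assume o: "\<forall>C\<in>generators. orth {koszul C \<pp>} Y"
  have "orth ((\<lambda>C. koszul C \<pp>) ` generators) Y" using o Y unfolding orth_def by blast
  then have "orth (Loc U T ((\<lambda>C. koszul C \<pp>) ` generators)) Y"
    by (rule orth_Loc[rotated]) (use koszul_compact[OF p] generator_compact compact_obj in blast)
  then show "orth (TV \<pp>) Y" unfolding TV_kernel(1)[OF p] .
qed

text \<open>Local cohomology of the localized object vanishes iff that object is orthogonal to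
  \<open>TV \<pp>\<close>, for which the compact Koszul objects on generators are enough; for a
  compact source, orthogonality to the localized object is torsion.\<close>

lemma Gamma_zero_iff:
  assumes p: "\<pp> \<in> Spec R" and X: "X \<in> obj T"
  shows "is_zero T (Gamma_at U R T \<pp> X) \<longleftrightarrow> (\<forall>C\<in>generators. tors (R.avoiding \<pp>) (koszul C \<pp>) X)"
proof -
  have "is_zero T (Gamma_at U R T \<pp> X) \<longleftrightarrow> orth (TV \<pp>) (localized \<pp> X)"
    unfolding Gamma_at_def by (rule torsion_triangle(4)[OF TV_kernel(2)[OF p] localized_obj[OF p X]])
  also have "\<dots> \<longleftrightarrow> (\<forall>C\<in>generators. orth {koszul C \<pp>} (localized \<pp> X))"
    by (rule orth_TV_iff[OF p localized_obj[OF p X]])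
  also have "\<dots> \<longleftrightarrow> (\<forall>C\<in>generators. tors (R.avoiding \<pp>) (koszul C \<pp>) X)"
    using orth_localized_iff[OF p koszul_compact[OF p generator_compact] X] by blast
  finally show ?thesis .
qed

abbreviation Supp :: "'o \<Rightarrow> 'r set set" where "Supp X \<equiv> supp U R T X"

lemma Supp_iff:
  assumes "X \<in> obj T"
  shows "\<pp> \<in> Supp X \<longleftrightarrow> \<pp> \<in> Spec R \<and> (\<exists>C\<in>generators. \<not> tors (R.avoiding \<pp>) (koszul C \<pp>) X)"
  unfolding supp_def using Gamma_zero_iff assms by blast

text \<open>Support is tested by torsion of morphisms from compact objects. Hence a prime is
  excluded from the support of a whole localizing subcategory by checking its generators.\<close>

lemma localizing_unsupported:
  assumes p: "\<pp> \<in> Spec R" shows "localizing U T {X \<in> obj T. \<pp> \<notin> Supp X}"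
proof -
  let ?F = "(\<lambda>C. (R.avoiding \<pp>, koszul C \<pp>)) ` generators"
  have "{X \<in> obj T. \<pp> \<notin> Supp X} = {X \<in> obj T. \<forall>(M, D)\<in>?F. tors M D X}"
    using Supp_iff p by auto
  moreover have "localizing U T {X \<in> obj T. \<forall>(M, D)\<in>?F. tors M D X}"
    by (rule localizing_tors_family)
      (use R.avoiding_mult_closed[OF p] koszul_compact[OF p generator_compact] in auto)
  ultimately show ?thesis by simp
qed

lemma Supp_TV:
  assumes p: "\<pp> \<in> Spec R" and Y: "Y \<in> TV \<pp>" shows "Supp Y \<subseteq> closed_set R \<pp>"
proof
  fix \<qq> assume q: "\<qq> \<in> Supp Y"
  have Yo: "Y \<in> obj T" using Y TV_iff[OF p] by blast
  have qS: "\<qq> \<in> Spec R" using q unfolding supp_def by blast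
  obtain C where C: "C \<in> generators" "\<not> tors (R.avoiding \<qq>) (koszul C \<qq>) Y" using q Supp_iff[OF Yo] by blast
  show "\<qq> \<in> closed_set R \<pp>"
  proof (rule ccontr)
    assume "\<qq> \<notin> closed_set R \<pp>"
    then have "tors (R.avoiding \<qq>) (koszul C \<qq>) Y"
      using Y koszul_compact[OF qS generator_compact[OF C(1)]] qS unfolding torsion_objects_tors by blast
    then show False using C(2) by blast
  qed
qed

lemma orth_tors:
  assumes "orth {D} Y" "D \<in> obj T" "R.mult_closed M" shows "tors M D Y"
proof -
  note Mc = mult_closedD[OF assms(3)]
  have "kills (0, \<one>\<^bsub>R\<^esub>) f" if f: "f \<in> Hom (sh n D) Y" for f n
    using orthD[OF assms(1) _ f] kills_zr[OF R.one_even, of "sh n D" Y] assms(2) orth_obj[OF assms(1)] by simp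
  then show ?thesis unfolding tors_def using Mc(3) by blast
qed

lemma TV_mono:
  assumes "\<pp> \<subseteq> \<qq>" shows "TV \<qq> \<subseteq> TV \<pp>"
proof -
  have "Spec R - closed_set R \<pp> \<subseteq> Spec R - closed_set R \<qq>" unfolding closed_set_def using assms by blast
  then show ?thesis unfolding torsion_objects_tors by blast
qed

lemma Supp_orth:
  assumes p: "\<pp> \<in> Spec R" and o: "orth (TV \<pp>) Y" shows "Supp Y \<inter> closed_set R \<pp> = {}"
proof -
  have Yo: "Y \<in> obj T" by (rule orth_obj[OF o])
  have "\<qq> \<notin> Supp Y" if q: "\<qq> \<in> Spec R" "\<pp> \<subseteq> \<qq>" for \<qq>
  proof -
    have oq: "orth (TV \<qq>) Y" by (rule orth_subset[OF o TV_mono[OF q(2)]])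
    have "tors (R.avoiding \<qq>) (koszul C \<qq>) Y" if C: "C \<in> generators" for C
      using orth_tors[OF _ _ R.avoiding_mult_closed[OF q(1)]] oq C orth_TV_iff[OF q(1) Yo]
        koszul_compact[OF q(1) generator_compact[OF C]] compact_obj by blast
    then show ?thesis using Supp_iff[OF Yo] by blast
  qed
  then show ?thesis unfolding closed_set_def by blast
qed

end

section \<open>Krull's intersection theorem\<close>

context linear_cocomplete
begin

context
  fixes B :: 'o
  assumes B: "B \<in> obj T"
begin

text \<open>
  Finite generation refers to all of \<open>R\<close>, so elements of odd degree are needed here.
\<close>

definition sc :: "int \<Rightarrow> 'r \<Rightarrow> int \<Rightarrow> 'm \<Rightarrow> 'm" where
  "sc d r i y = sm i (center_act T d r B) \<bullet> y"

abbreviation (input) H :: "int \<Rightarrow> 'm set" where "H i \<equiv> Hom B (sh i B)"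

lemma sc_Hom: assumes "r \<in> grade R d" "y \<in> H i" shows "sc d r i y \<in> H (i + d)"
  using center_Hom[OF assms(1) B] assms(2) unfolding sc_def by simp

lemma sc_zero: assumes "y \<in> H i" shows "sc d \<zero>\<^bsub>R\<^esub> i y = zr B (sh (i + d) B)"
  using center_zero[OF B, of d] assms B unfolding sc_def by simp

lemma sc_zr: assumes "r \<in> grade R d" shows "sc d r i (zr B (sh i B)) = zr B (sh (i + d) B)"
  using center_Hom[OF assms B] B unfolding sc_def by simp

lemma sc_add_left: assumes "r \<in> grade R d" "s \<in> grade R d" "y \<in> H i"
  shows "sc d (r \<oplus>\<^bsub>R\<^esub> s) i y = sc d r i y \<boxplus> sc d s i y"
proof -
  note r = center_Hom[OF assms(1) B] and s = center_Hom[OF assms(2) B]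
  have "sm i (center_act T d (r \<oplus>\<^bsub>R\<^esub> s) B) = sm i (center_act T d r B) \<boxplus> sm i (center_act T d s B)"
    unfolding linear_structure.act_add[OF linear assms(1,2) B] using r s by simp
  then show ?thesis unfolding sc_def by (simp only:) (rule cmp_add_l, use r s assms(3) in auto)
qed

lemma sc_add_right: assumes "r \<in> grade R d" "x \<in> H i" "y \<in> H i"
  shows "sc d r i (x \<boxplus> y) = sc d r i x \<boxplus> sc d r i y"
  unfolding sc_def by (rule cmp_add_r) (use center_Hom[OF assms(1) B] assms(2,3) in auto)

lemma sc_sc: assumes "t \<in> grade R e" "r \<in> grade R d" "y \<in> H i"
  shows "sc e t (i + d) (sc d r i y) = sc (e + d) (t \<otimes>\<^bsub>R\<^esub> r) i y"
proof -
  note t = center_Hom[OF assms(1) B] and r = center_Hom[OF assms(2) B]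
  have "sm i (center_act T (e + d) (t \<otimes>\<^bsub>R\<^esub> r) B) = sm (i + d) (center_act T e t B) \<bullet> sm i (center_act T d r B)"
    unfolding linear_structure.act_mult[OF linear assms(1,2) B] using t r by simp
  then show ?thesis unfolding sc_def using t r assms(3) by simp
qed

lemma sc_one: "y \<in> H i \<Longrightarrow> sc 0 \<one>\<^bsub>R\<^esub> i y = y"
  using linear_structure.act_one[OF linear B] B unfolding sc_def by simp

lemma sc_neg: assumes "r \<in> grade R d" "y \<in> H i" shows "sc d (\<ominus>\<^bsub>R\<^esub> r) i y = ng (sc d r i y)"
proof (rule ng_unique)
  have "sc d (\<ominus>\<^bsub>R\<^esub> r \<oplus>\<^bsub>R\<^esub> r) i y = sc d (\<ominus>\<^bsub>R\<^esub> r) i y \<boxplus> sc d r i y"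
    by (rule sc_add_left[OF R.grade_minus[OF assms(1)] assms])
  then show "sc d (\<ominus>\<^bsub>R\<^esub> r) i y \<boxplus> sc d r i y = zr B (sh (i + d) B)"
    using sc_zero[OF assms(2)] R.grade_carrier[OF assms(1)] by (simp add: R.l_neg)
  show "sc d r i y \<in> H (i + d)" "sc d (\<ominus>\<^bsub>R\<^esub> r) i y \<in> H (i + d)"
    by (rule sc_Hom[OF _ assms(2)], rule assms R.grade_minus[OF assms(1)])+
qed

lemma act_sc: assumes "a \<in> E" "y \<in> H i" shows "act a (sh i B) \<bullet> y = sc (fst a) (snd a) i y"
  using act_sh[OF assms(1) B, of i] unfolding sc_def act_def by simp

text \<open>The homogeneous submodules of the graded endomorphism module of \<open>B\<close>, with
  \<open>N i\<close> as the piece of degree \<open>i\<close>.\<close>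

definition gsub :: "(int \<Rightarrow> 'm set) \<Rightarrow> bool" where
  "gsub N \<longleftrightarrow> (\<forall>i. N i \<subseteq> H i) \<and> (\<forall>i. zr B (sh i B) \<in> N i) \<and> (\<forall>i. \<forall>x\<in>N i. \<forall>y\<in>N i. x \<boxplus> y \<in> N i) \<and>
    (\<forall>i d. \<forall>r\<in>grade R d. \<forall>x\<in>N i. sc d r i x \<in> N (i + d))"

lemma gsubD:
  assumes "gsub N"
  shows "x \<in> N i \<Longrightarrow> x \<in> H i" "zr B (sh i B) \<in> N i" "x \<in> N i \<Longrightarrow> y \<in> N i \<Longrightarrow> x \<boxplus> y \<in> N i"
    "r \<in> grade R d \<Longrightarrow> x \<in> N i \<Longrightarrow> sc d r i x \<in> N (i + d)" "x \<in> N i \<Longrightarrow> ng x \<in> N i"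
    "x \<in> N i \<Longrightarrow> y \<in> N i \<Longrightarrow> x \<boxminus> y \<in> N i"
proof -
  show 1: "x \<in> N i \<Longrightarrow> x \<in> H i" "zr B (sh i B) \<in> N i" and 3: "x \<in> N i \<Longrightarrow> y \<in> N i \<Longrightarrow> x \<boxplus> y \<in> N i"
    and 4: "r \<in> grade R d \<Longrightarrow> x \<in> N i \<Longrightarrow> sc d r i x \<in> N (i + d)" for x y i r d
    using assms unfolding gsub_def by (blast, blast, blast, blast)
  show 5: "x \<in> N i \<Longrightarrow> ng x \<in> N i" for x
  proof -
    assume x: "x \<in> N i"
    have "sc 0 (\<ominus>\<^bsub>R\<^esub> \<one>\<^bsub>R\<^esub>) i x \<in> N (i + 0)" by (rule 4[OF R.grade_minus[OF R.one_grade] x])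
    then show ?thesis using sc_neg[OF R.one_grade 1(1)[OF x]] sc_one[OF 1(1)[OF x]] by simp
  qed
  show "x \<in> N i \<Longrightarrow> y \<in> N i \<Longrightarrow> x \<boxminus> y \<in> N i" unfolding sb_def using 3 5 by blast
qed

text \<open>The recursion singles out the coefficient of the first generator, which is the leading
  coefficient in the induction below; its degree is forced by that of the element.\<close>

primrec span :: "(int \<times> 'm) list \<Rightarrow> int \<Rightarrow> 'm set" where
  "span [] = (\<lambda>i. {zr B (sh i B)})"
| "span (p # gs) = (\<lambda>i. {sc (i - fst p) r (fst p) (snd p) \<boxplus> x | r x. r \<in> grade R (i - fst p) \<and> x \<in> span gs i})"

definition homogs :: "(int \<times> 'm) list \<Rightarrow> bool" where
  "homogs gs \<longleftrightarrow> (\<forall>p\<in>set gs. snd p \<in> H (fst p))"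

lemma gsub_span: "homogs gs \<Longrightarrow> gsub (span gs)"
proof (induction gs)
  case Nil
  show ?case unfolding gsub_def using B by (simp add: sc_zr)
next
  case (Cons p gs)
  let ?j = "fst p" and ?g = "snd p"
  have g: "?g \<in> H ?j" and IH: "gsub (span gs)" using Cons unfolding homogs_def by auto
  note D = gsubD[OF IH]
  have scg: "sc (i - ?j) r ?j ?g \<in> H i" if "r \<in> grade R (i - ?j)" for r i
    using sc_Hom[OF that g] by simp
  show ?case unfolding gsub_def
  proof (intro conjI allI ballI subsetI)
    fix i x assume "x \<in> span (p # gs) i"
    then obtain r y where "r \<in> grade R (i - ?j)" "y \<in> span gs i" "x = sc (i - ?j) r ?j ?g \<boxplus> y" by auto
    then show "x \<in> H i" using scg D(1) Hom_add by blast
  next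
    fix i
    have "zr B (sh i B) = sc (i - ?j) \<zero>\<^bsub>R\<^esub> ?j ?g \<boxplus> zr B (sh i B)"
      using sc_zero[OF g, of "i - ?j"] B by simp
    then show "zr B (sh i B) \<in> span (p # gs) i" using D(2) R.grade_zero unfolding span.simps by blast
  next
    fix i x y assume "x \<in> span (p # gs) i" "y \<in> span (p # gs) i"
    then obtain r v s w where r: "r \<in> grade R (i - ?j)" "v \<in> span gs i" "x = sc (i - ?j) r ?j ?g \<boxplus> v"
      and s: "s \<in> grade R (i - ?j)" "w \<in> span gs i" "y = sc (i - ?j) s ?j ?g \<boxplus> w" by auto
    let ?r = "sc (i - ?j) r ?j ?g" and ?s = "sc (i - ?j) s ?j ?g"
    have h: "?r \<in> H i" "?s \<in> H i" "v \<in> H i" "w \<in> H i" using scg r s D(1) by blast+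
    have "x \<boxplus> y = (?r \<boxplus> ?s) \<boxplus> (v \<boxplus> w)"
      unfolding r(3) s(3) using h add_assoc[of ?r v "?s \<boxplus> w"] add_assoc[of v ?s w] add_commute[of v ?s]
        add_assoc[of ?s v w] add_assoc[of ?r ?s "v \<boxplus> w"] by simp
    also have "?r \<boxplus> ?s = sc (i - ?j) (r \<oplus>\<^bsub>R\<^esub> s) ?j ?g" by (rule sc_add_left[OF r(1) s(1) g, symmetric])
    finally show "x \<boxplus> y \<in> span (p # gs) i" using R.grade_add[OF r(1) s(1)] D(3)[OF r(2) s(2)] unfolding span.simps by blast
  next
    fix i d t x assume t: "t \<in> grade R d" and "x \<in> span (p # gs) i"
    then obtain r v where r: "r \<in> grade R (i - ?j)" "v \<in> span gs i" "x = sc (i - ?j) r ?j ?g \<boxplus> v" by auto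
    have e: "d + (i - ?j) = i + d - ?j" "?j + (i - ?j) = i" by auto
    have "sc d t i x = sc d t i (sc (i - ?j) r ?j ?g) \<boxplus> sc d t i v"
      unfolding r(3) by (rule sc_add_right[OF t scg[OF r(1)] D(1)[OF r(2)]])
    also have "sc d t i (sc (i - ?j) r ?j ?g) = sc (i + d - ?j) (t \<otimes>\<^bsub>R\<^esub> r) ?j ?g"
      using sc_sc[OF t r(1) g] unfolding e .
    finally show "sc d t i x \<in> span (p # gs) (i + d)"
      using R.mult_grade[OF t r(1)] D(4)[OF t r(2)] unfolding e span.simps by blast
  qed
qed

lemma span_mono: assumes "homogs (p # gs)" "x \<in> span gs i" shows "x \<in> span (p # gs) i"
proof -
  have g: "snd p \<in> H (fst p)" and h: "homogs gs" using assms(1) unfolding homogs_def by auto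
  have "x \<in> H i" by (rule gsubD(1)[OF gsub_span[OF h] assms(2)])
  then have "x = sc (i - fst p) \<zero>\<^bsub>R\<^esub> (fst p) (snd p) \<boxplus> x" using sc_zero[OF g, of "i - fst p"] by simp
  then show ?thesis using assms(2) R.grade_zero unfolding span.simps by blast
qed

lemma span_gen: assumes "homogs gs" "p \<in> set gs" shows "snd p \<in> span gs (fst p)"
  using assms
proof (induction gs)
  case (Cons q gs)
  have h: "homogs gs" using Cons.prems(1) unfolding homogs_def by auto
  show ?case
  proof (cases "p = q")
    case True
    have g: "snd q \<in> H (fst q)" using Cons.prems(1) unfolding homogs_def by auto
    have "snd q = sc (fst q - fst q) \<one>\<^bsub>R\<^esub> (fst q) (snd q) \<boxplus> zr B (sh (fst q) B)" using sc_one[OF g] g by simp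
    moreover have "\<one>\<^bsub>R\<^esub> \<in> grade R (fst q - fst q)" using R.one_grade by simp
    moreover have "zr B (sh (fst q) B) \<in> span gs (fst q)" by (rule gsubD(2)[OF gsub_span[OF h]])
    ultimately show ?thesis unfolding True span.simps by blast
  next
    case False
    then show ?thesis using Cons.IH[OF h] Cons.prems span_mono by auto
  qed
qed simp

text \<open>
  By induction on the generators: the leading coefficients form an increasing chain of ideals.
\<close>

lemma span_chain_stable:
  assumes noeth: "noetherian_ring R" and "homogs gs"
    and N: "\<And>n. gsub (N n)" and mono: "\<And>n i. N n i \<subseteq> N (Suc n) i"
  shows "\<exists>n0. \<forall>n\<ge>n0. \<forall>i. N n i \<inter> span gs i \<subseteq> N n0 i"
  using assms(2)
proof (induction gs)
  case Nil
  have "N n i \<inter> span [] i \<subseteq> N 0 i" for n i using gsubD(2)[OF N] by simp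
  then show ?case by blast
next
  case (Cons p gs)
  let ?j = "fst p" and ?g = "snd p"
  have g: "?g \<in> H ?j" and h: "homogs gs" using Cons.prems unfolding homogs_def by auto
  note S = gsubD[OF gsub_span[OF h]]
  have mono': "N m i \<subseteq> N n i" if "m \<le> n" for m n i by (rule lift_Suc_mono_le[of "\<lambda>n. N n i", OF mono that])
  obtain n2 where n2: "\<And>n i. n \<ge> n2 \<Longrightarrow> N n i \<inter> span gs i \<subseteq> N n2 i" using Cons.IH[OF h] by blast
  \<comment> \<open>Coefficients of the first generator in elements of \<open>N n\<close>, modulo
    the span of the remaining generators.\<close>
  define Q where "Q n d = {r \<in> grade R d. \<exists>x\<in>span gs (?j + d). sc d r ?j ?g \<boxplus> x \<in> N n (?j + d)}" for n d
  have Qz: "\<zero>\<^bsub>R\<^esub> \<in> Q n d" for n d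
  proof -
    have "sc d \<zero>\<^bsub>R\<^esub> ?j ?g \<boxplus> zr B (sh (?j + d) B) \<in> N n (?j + d)"
      using gsubD(2)[OF N] sc_zero[OF g, of d] B by simp
    then show ?thesis unfolding Q_def using S(2) R.grade_zero by blast
  qed
  have hom: "homogeneous_ideal (R.ideal_of_pieces (Q n)) R" for n
  proof (rule R.homogeneous_ideal_of_pieces)
    show "Q n d \<subseteq> grade R d" for d unfolding Q_def by blast
    show "\<zero>\<^bsub>R\<^esub> \<in> Q n d" for d by (rule Qz)
    show "r \<oplus>\<^bsub>R\<^esub> s \<in> Q n d" if rs: "r \<in> Q n d" "s \<in> Q n d" for d r s
    proof -
      obtain x where r: "r \<in> grade R d" and x: "x \<in> span gs (?j + d)" "sc d r ?j ?g \<boxplus> x \<in> N n (?j + d)"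
        using rs(1) unfolding Q_def by blast
      obtain y where s: "s \<in> grade R d" and y: "y \<in> span gs (?j + d)" "sc d s ?j ?g \<boxplus> y \<in> N n (?j + d)"
        using rs(2) unfolding Q_def by blast
      let ?r = "sc d r ?j ?g" and ?s = "sc d s ?j ?g"
      have hh: "?r \<in> H (?j + d)" "?s \<in> H (?j + d)" "x \<in> H (?j + d)" "y \<in> H (?j + d)"
        using sc_Hom[OF r g] sc_Hom[OF s g] S(1)[OF x(1)] S(1)[OF y(1)] by blast+
      have "sc d (r \<oplus>\<^bsub>R\<^esub> s) ?j ?g \<boxplus> (x \<boxplus> y) = (?r \<boxplus> x) \<boxplus> (?s \<boxplus> y)"
        unfolding sc_add_left[OF r s g] using hh add_assoc[of ?r x "?s \<boxplus> y"] add_assoc[of x ?s y] add_commute[of x ?s]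
        add_assoc[of ?s x y] add_assoc[of ?r ?s "x \<boxplus> y"] by simp
      moreover have "(?r \<boxplus> x) \<boxplus> (?s \<boxplus> y) \<in> N n (?j + d)" by (rule gsubD(3)[OF N x(2) y(2)])
      ultimately have "sc d (r \<oplus>\<^bsub>R\<^esub> s) ?j ?g \<boxplus> (x \<boxplus> y) \<in> N n (?j + d)" by simp
      then show ?thesis unfolding Q_def using R.grade_add[OF r s] S(3)[OF x(1) y(1)] by blast
    qed
    show "t \<otimes>\<^bsub>R\<^esub> r \<in> Q n (e + d)" if t: "t \<in> grade R e" and rQ: "r \<in> Q n d" for e d t r
    proof -
      obtain x where r: "r \<in> grade R d" and x: "x \<in> span gs (?j + d)" "sc d r ?j ?g \<boxplus> x \<in> N n (?j + d)"
        using rQ unfolding Q_def by blast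
      have e: "?j + d + e = ?j + (e + d)" by simp
      have "sc e t (?j + d) (sc d r ?j ?g \<boxplus> x) = sc e t (?j + d) (sc d r ?j ?g) \<boxplus> sc e t (?j + d) x"
        by (rule sc_add_right[OF t sc_Hom[OF r g] S(1)[OF x(1)]])
      also have "sc e t (?j + d) (sc d r ?j ?g) = sc (e + d) (t \<otimes>\<^bsub>R\<^esub> r) ?j ?g" by (rule sc_sc[OF t r g])
      finally have "sc (e + d) (t \<otimes>\<^bsub>R\<^esub> r) ?j ?g \<boxplus> sc e t (?j + d) x \<in> N n (?j + (e + d))"
        using gsubD(4)[OF N t x(2)] unfolding e by simp
      moreover have "sc e t (?j + d) x \<in> span gs (?j + (e + d))" using S(4)[OF t x(1)] unfolding e .
      ultimately show ?thesis unfolding Q_def using R.mult_grade[OF t r] by blast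
    qed
  qed
  let ?I = "\<lambda>n. R.ideal_of_pieces (Q n)"
  have Qmono: "Q m d \<subseteq> Q n d" if "m \<le> n" for m n d unfolding Q_def using mono'[OF that] by blast
  have Imono: "?I m \<subseteq> ?I n" if "m \<le> n" for m n
    unfolding R.ideal_of_pieces_def using Qmono[OF that] by blast
  have "subset.chain {I. ideal I R} (range ?I)"
    unfolding subset_chain_def
  proof (intro conjI subsetI ballI)
    show "J \<in> {I. ideal I R}" if "J \<in> range ?I" for J using that R.homogeneous_idealD(1)[OF hom] by blast
    fix J K assume JK: "J \<in> range ?I" "K \<in> range ?I"
    obtain m where m: "J = ?I m" using JK(1) by (rule rangeE)
    obtain n where n: "K = ?I n" using JK(2) by (rule rangeE)
    show "J \<subseteq> K \<or> K \<subseteq> J" unfolding m n using Imono[of m n] Imono[of n m] by (cases "m \<le> n") auto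
  qed
  then have "\<Union>(range ?I) \<in> range ?I"
    by (intro noetherian_ring.ideal_chain_is_trivial[OF noeth]) auto
  then obtain n1 where "\<Union>(range ?I) = ?I n1" by (rule rangeE)
  then have n1: "?I n \<subseteq> ?I n1" for n by blast
  have Qn1: "Q n d \<subseteq> Q n1 d" for n d
  proof
    fix r assume r: "r \<in> Q n d"
    then have rg: "r \<in> grade R d" unfolding Q_def by blast
    have "r \<in> ?I n" using R.ideal_of_pieces_grade[of "Q n" r d, OF Qz rg] r by blast
    then have "r \<in> ?I n1" using n1 by blast
    then show "r \<in> Q n1 d" using R.ideal_of_pieces_grade[of "Q n1" r d, OF Qz rg] by blast
  qed
  \<comment> \<open>From \<open>n1\<close> on the coefficient ideals are stable, from
    \<open>n2\<close> on the parts in the span of the remaining generators. An element of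
    \<open>N n\<close> is compared with one of \<open>N ?n0\<close> having the same leading
    coefficient; the difference falls under the induction hypothesis.\<close>
  let ?n0 = "max n1 n2"
  have "y \<in> N ?n0 i" if n: "n \<ge> ?n0" and y: "y \<in> N n i" "y \<in> span (p # gs) i" for n i y
  proof -
    obtain r x where r: "r \<in> grade R (i - ?j)" and x: "x \<in> span gs i" and yx: "y = sc (i - ?j) r ?j ?g \<boxplus> x"
      using y(2) by auto
    let ?r = "sc (i - ?j) r ?j ?g"
    have e: "?j + (i - ?j) = i" by simp
    have "r \<in> Q n (i - ?j)" unfolding Q_def e using r x y(1) yx by blast
    then have "r \<in> Q n1 (i - ?j)" using Qn1 by blast
    then have "r \<in> Q ?n0 (i - ?j)" using Qmono[of n1 ?n0] by auto
    then obtain x' where x': "x' \<in> span gs i" "?r \<boxplus> x' \<in> N ?n0 i" unfolding Q_def e by blast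
    have hh: "?r \<in> H i" "x \<in> H i" "x' \<in> H i" using sc_Hom[OF r g] S(1) x x'(1) unfolding e by blast+
    have "?r \<boxplus> x' \<in> N n i" using x'(2) mono'[OF n] by blast
    then have 1: "y \<boxminus> (?r \<boxplus> x') \<in> N n i" by (rule gsubD(6)[OF N y(1)])
    have d: "y \<boxminus> (?r \<boxplus> x') = x \<boxminus> x'"
    proof -
      have "(x \<boxminus> x') \<boxplus> (?r \<boxplus> x') = ?r \<boxplus> ((x \<boxminus> x') \<boxplus> x')"
        using hh add_assoc[of "x \<boxminus> x'" ?r x'] add_commute[of "x \<boxminus> x'" ?r] add_assoc[of ?r "x \<boxminus> x'" x'] by simp
      also have "\<dots> = y" unfolding yx using hh by simp
      finally have 2: "(x \<boxminus> x') \<boxplus> (?r \<boxplus> x') = y" .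
      have cancel: "y \<boxminus> v = w" if wv: "w \<boxplus> v = y" "w \<in> H i" "v \<in> H i" for v w
      proof (rule add_left_cancel)
        have yH: "y \<in> H i" unfolding wv(1)[symmetric] by (rule Hom_add[OF wv(2,3)])
        show h: "arr v" "arr (y \<boxminus> v)" "arr w" "dm v = dm (y \<boxminus> v)" "cd v = cd (y \<boxminus> v)"
          "dm (y \<boxminus> v) = dm w" "cd (y \<boxminus> v) = cd w" using yH wv(2,3) by auto
        have "v \<boxplus> (y \<boxminus> v) = (y \<boxminus> v) \<boxplus> v" by (rule add_commute) (use h in auto)
        also have "\<dots> = y" using yH wv(3) by simp
        also have "y = v \<boxplus> w" unfolding wv(1)[symmetric] by (rule add_commute) (use wv(2,3) in auto)
        finally show "v \<boxplus> (y \<boxminus> v) = v \<boxplus> w" .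
      qed
      show ?thesis by (rule cancel[OF 2]) (use hh in auto)
    qed
    have "x \<boxminus> x' \<in> span gs i" by (rule S(6)[OF x x'(1)])
    then have "y \<boxminus> (?r \<boxplus> x') \<in> N n2 i" using n2[of n i] n 1 unfolding d by auto
    then have "y \<boxminus> (?r \<boxplus> x') \<in> N ?n0 i" using mono'[of n2 ?n0 i] by auto
    then have "(y \<boxminus> (?r \<boxplus> x')) \<boxplus> (?r \<boxplus> x') \<in> N ?n0 i" using gsubD(3)[OF N] x'(2) by blast
    then show ?thesis using hh yx by simp
  qed
  then show ?case by blast
qed

text \<open>The given module generators need not be homogeneous, so their finitely many nonzero
  components are used.\<close>

lemma fg_span:
  assumes "finitely_generated R (graded_hom R T B B)"
  obtains gs where "homogs gs" "\<And>i f. f \<in> H i \<Longrightarrow> f \<in> span gs i"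
proof -
  let ?M = "graded_hom R T B B"
  obtain F where F: "F \<subseteq> carrier ?M" "finite F" "\<Inter>{N. submodule N R ?M \<and> F \<subseteq> N} = carrier ?M"
    using assms unfolding finitely_generated_def by blast
  have Mh: "(\<forall>i. h i \<in> H i) \<and> finite {i. h i \<noteq> zr B (sh i B)}" if "h \<in> carrier ?M" for h
    using that unfolding graded_hom_carrier[OF B B] by blast
  let ?G = "\<Union>h\<in>F. (\<lambda>i. (i, h i)) ` {i. h i \<noteq> zr B (sh i B)}"
  have "finite ?G" by (intro finite_UN_I F(2) finite_imageI) (use F(1) Mh in blast)
  from finite_list[OF this] obtain gs where gs: "set gs = ?G" by (elim exE)
  have hg: "homogs gs" unfolding homogs_def gs
  proof
    fix p assume "p \<in> ?G"
    then obtain h i where "h \<in> F" "p = (i, h i)" by blast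
    then show "snd p \<in> H (fst p)" using Mh F(1) by fastforce
  qed
  note S = gsubD[OF gsub_span[OF hg]]
  \<comment> \<open>The elements whose components all lie in the span form a submodule containing
    the given generators, hence everything.\<close>
  define W where "W = {h \<in> carrier ?M. \<forall>i. h i \<in> span gs i}"
  have grp: "group (hom_group T B (sh i B))" for i
    using comm_group.axioms(2)[OF mor_group[OF B sh_obj[OF B]]] .
  have cg: "carrier (hom_group T B (sh i B)) = H i" for i using carrier_hom_group[OF B sh_obj[OF B]] .
  have invM: "inv\<^bsub>add_monoid ?M\<^esub> x = inv\<^bsub>graded_hom_group T B B\<^esub> x" for x
    unfolding m_inv_def graded_hom_def by simp
  have "submodule W R ?M"
  proof (intro submodule.intro subgroup.intro submodule_axioms.intro)
    show "W \<subseteq> carrier (add_monoid ?M)" unfolding W_def by auto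
    show "x \<otimes>\<^bsub>add_monoid ?M\<^esub> y \<in> W" if xy: "x \<in> W" "y \<in> W" for x y
    proof -
      have f: "finite ({i. x i \<noteq> zr B (sh i B)} \<union> {i. y i \<noteq> zr B (sh i B)})" using xy Mh unfolding W_def by blast
      have "finite {i. x i \<boxplus> y i \<noteq> zr B (sh i B)}"
        by (rule finite_subset[OF _ f]) (use B in auto)
      moreover have "x i \<boxplus> y i \<in> span gs i" for i using xy S(3) unfolding W_def by blast
      ultimately show ?thesis unfolding W_def graded_hom_carrier[OF B B]
        by (simp add: graded_hom_add S(1) del: Hom_iff)
    qed
    have z: "(\<lambda>i. zr B (sh i B)) \<in> W" unfolding W_def graded_hom_carrier[OF B B] using S(2) B by simp
    then show "\<one>\<^bsub>add_monoid ?M\<^esub> \<in> W" by (simp add: graded_hom_zero)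
    show "inv\<^bsub>add_monoid ?M\<^esub> x \<in> W" if x: "x \<in> W" for x
    proof -
      have xc: "x \<in> carrier (sum_group UNIV (\<lambda>i. hom_group T B (sh i B)))"
        using x unfolding W_def graded_hom_def graded_hom_group_def by simp
      have xH: "x i \<in> H i" "finite {i. x i \<noteq> zr B (sh i B)}" for i using x Mh unfolding W_def by blast+
      have "inv\<^bsub>add_monoid ?M\<^esub> x = (\<lambda>i\<in>UNIV. inv\<^bsub>hom_group T B (sh i B)\<^esub> x i)"
        unfolding invM graded_hom_group_def by (rule inv_sum_group[OF grp xc])
      also have "\<dots> = (\<lambda>i. ng (x i))"
        using xH(1) by (auto simp: ng_def minus_mor_def)
      finally have e: "inv\<^bsub>add_monoid ?M\<^esub> x = (\<lambda>i. ng (x i))" .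
      have "finite {i. ng (x i) \<noteq> zr B (sh i B)}" by (rule finite_subset[OF _ xH(2)]) (use B in auto)
      moreover have "ng (x i) \<in> span gs i" for i using x S(5) unfolding W_def by blast
      ultimately have "(\<lambda>i. ng (x i)) \<in> W" unfolding W_def graded_hom_carrier[OF B B]
        by (simp add: S(1) del: Hom_iff)
      then show ?thesis unfolding e .
    qed
    show "a \<odot>\<^bsub>?M\<^esub> x \<in> W" if a: "a \<in> carrier R" and x: "x \<in> W" for a x
    proof -
      let ?t = "\<lambda>k n. sm (k - n) (center_act T n (component R a n) B) \<bullet> x (k - n)"
      have ax: "(a \<odot>\<^bsub>?M\<^esub> x) k = gfinprod (hom_group T B (sh k B)) (?t k) UNIV" for k
        unfolding graded_hom_def by simp
      have xH: "x i \<in> H i" "x i \<in> span gs i" for i using x Mh unfolding W_def by blast+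
      have fx: "finite {i. x i \<noteq> zr B (sh i B)}" using x Mh unfolding W_def by blast
      have t: "?t k n \<in> span gs k" for k n
        using S(4)[OF R.component(1)[OF a, of n] xH(2)[of "k - n"]] unfolding sc_def by simp
      have tz: "?t k n = zr B (sh k B)" if "component R a n = \<zero>\<^bsub>R\<^esub> \<or> x (k - n) = zr B (sh (k - n) B)" for k n
        using that sc_zero[OF xH(1)[of "k - n"], of n] sc_zr[OF R.component(1)[OF a, of n], of "k - n"]
        unfolding sc_def by auto
      have in_span: "(a \<odot>\<^bsub>?M\<^esub> x) k \<in> span gs k" for k
      proof -
        interpret G: comm_group "hom_group T B (sh k B)" by (rule mor_group[OF B sh_obj[OF B]])
        have "finprod (hom_group T B (sh k B)) (?t k) A \<in> span gs k" if "finite A" for A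
          using that
        proof (induction A)
          case empty then show ?case using S(2) by simp
        next
          case (insert n A)
          have c: "?t k \<in> A \<rightarrow> carrier (hom_group T B (sh k B))" "?t k n \<in> carrier (hom_group T B (sh k B))"
            unfolding cg using S(1)[OF t] by blast+
          show ?case using G.finprod_insert[OF insert.hyps c] S(3)[OF t insert.IH] by simp
        qed
        then show ?thesis unfolding ax gfinprod_def using S(2) by simp
      qed
      have "finite {k. (a \<odot>\<^bsub>?M\<^esub> x) k \<noteq> zr B (sh k B)}"
      proof (rule finite_subset)
        show "{k. (a \<odot>\<^bsub>?M\<^esub> x) k \<noteq> zr B (sh k B)} \<subseteq>
            (\<lambda>(n, i). n + i) ` ({n. component R a n \<noteq> \<zero>\<^bsub>R\<^esub>} \<times> {i. x i \<noteq> zr B (sh i B)})"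
        proof
          fix k assume k: "k \<in> {k. (a \<odot>\<^bsub>?M\<^esub> x) k \<noteq> zr B (sh k B)}"
          have "\<exists>n. ?t k n \<noteq> zr B (sh k B)"
          proof (rule ccontr)
            assume "\<nexists>n. ?t k n \<noteq> zr B (sh k B)"
            then have "{n \<in> UNIV. ?t k n \<noteq> \<one>\<^bsub>hom_group T B (sh k B)\<^esub>} = {}" by auto
            then have "(a \<odot>\<^bsub>?M\<^esub> x) k = finprod (hom_group T B (sh k B)) (?t k) {}" unfolding ax gfinprod_def by simp
            then show False
              using k by (simp add: comm_monoid.finprod_empty[OF comm_group.axioms(1)[OF mor_group[OF B sh_obj[OF B]]]])
          qed
          then obtain n where "?t k n \<noteq> zr B (sh k B)" by blast
          then have "component R a n \<noteq> \<zero>\<^bsub>R\<^esub>" "x (k - n) \<noteq> zr B (sh (k - n) B)" using tz by blast+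
          then show "k \<in> (\<lambda>(n, i). n + i) ` ({n. component R a n \<noteq> \<zero>\<^bsub>R\<^esub>} \<times> {i. x i \<noteq> zr B (sh i B)})"
            by (intro image_eqI[of _ _ "(n, k - n)"]) auto
        qed
        show "finite ((\<lambda>(n, i). n + i) ` ({n. component R a n \<noteq> \<zero>\<^bsub>R\<^esub>} \<times> {i. x i \<noteq> zr B (sh i B)}))"
          using R.component(2)[OF a] fx by simp
      qed
      then show ?thesis unfolding W_def graded_hom_carrier[OF B B]
        by (simp add: S(1)[OF in_span] in_span del: Hom_iff)
    qed
  qed
  moreover have "F \<subseteq> W"
  proof
    fix h assume h: "h \<in> F"
    have "h i \<in> span gs i" for i
    proof (cases "h i = zr B (sh i B)")
      case True then show ?thesis using S(2) by simp
    next
      case False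
      then have "(i, h i) \<in> set gs" unfolding gs using h by blast
      from span_gen[OF hg this] show ?thesis by simp
    qed
    then show "h \<in> W" unfolding W_def using h F(1) by blast
  qed
  ultimately have "carrier ?M \<subseteq> W" using F(3) by blast
  have "f \<in> span gs i" if f: "f \<in> H i" for f i
  proof -
    define h where "h k = (if k = i then f else zr B (sh k B))" for k
    have "finite {k. h k \<noteq> zr B (sh k B)}" by (rule finite_subset[of _ "{i}"]) (auto simp: h_def)
    moreover have "h k \<in> H k" for k unfolding h_def using f B by simp
    ultimately have "h \<in> carrier ?M" unfolding graded_hom_carrier[OF B B] by blast
    then have "h i \<in> span gs i" using \<open>carrier ?M \<subseteq> W\<close> unfolding W_def by blast
    then show ?thesis by (simp add: h_def)
  qed
  then show ?thesis using that hg by blast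
qed

text \<open>
  The submodules \<open>N\<^sub>m = {y. u\<^sup>m y \<in> R f}\<close> form an increasing chain.  If it is stable from \<open>n\<close> on,
  then \<open>s f = u\<^sup>n\<^sup>+\<^sup>1 x\<close> implies \<open>u\<^sup>n x = r f\<close> for some \<open>r\<close>, and \<open>s - u r \<notin> \<qq>\<close> annihilates \<open>f\<close>.
\<close>

lemma krull:
  assumes noeth: "noetherian_ring R" and fg: "finitely_generated R (graded_hom R T B B)"
    and q: "\<qq> \<in> Spec R" and u: "u \<in> E" "snd u \<in> \<qq>" and f: "f \<in> Hom B B"
    and div: "\<And>m. \<exists>s\<in>R.avoiding \<qq>. \<exists>x\<in>H (fst s - fst (R.pw u m)).
      act s B \<bullet> f = act (R.pw u m) (sh (fst s - fst (R.pw u m)) B) \<bullet> x"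
  shows "\<exists>s\<in>R.avoiding \<qq>. kills s f"
proof -
  have f0: "f \<in> H 0" using f by simp
  note M = mult_closedD[OF R.avoiding_mult_closed[OF q]]
  obtain gs where gs: "homogs gs" "\<And>i f. f \<in> H i \<Longrightarrow> f \<in> span gs i" by (rule fg_span[OF fg]) blast
  let ?p = "\<lambda>m. R.pw u m" and ?w = "\<lambda>m. fst (R.pw u m)"
  have pE: "?p m \<in> E" for m by (rule R.pw_even[OF u(1)])
  note pg = R.evenD(2)[OF pE]
  define N where "N m i = {y \<in> H i. \<exists>r\<in>grade R (i + ?w m). sc (?w m) (snd (?p m)) i y = sc (i + ?w m) r 0 f}" for m i
  have sub: "gsub (N m)" for m
    unfolding gsub_def
  proof (intro conjI allI ballI)
    show "N m i \<subseteq> H i" for i unfolding N_def by blast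
    show "zr B (sh i B) \<in> N m i" for i
    proof -
      have "sc (?w m) (snd (?p m)) i (zr B (sh i B)) = sc (i + ?w m) \<zero>\<^bsub>R\<^esub> 0 f"
        using sc_zr[OF pg, of m i] sc_zero[OF f0, of "i + ?w m"] by simp
      then show ?thesis unfolding N_def using R.grade_zero B by auto
    qed
    show "x \<boxplus> y \<in> N m i" if xy: "x \<in> N m i" "y \<in> N m i" for i x y
    proof -
      obtain r where r: "x \<in> H i" "r \<in> grade R (i + ?w m)" "sc (?w m) (snd (?p m)) i x = sc (i + ?w m) r 0 f"
        using xy(1) unfolding N_def by blast
      obtain s where s: "y \<in> H i" "s \<in> grade R (i + ?w m)" "sc (?w m) (snd (?p m)) i y = sc (i + ?w m) s 0 f"
        using xy(2) unfolding N_def by blast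
      have "sc (?w m) (snd (?p m)) i (x \<boxplus> y) = sc (i + ?w m) (r \<oplus>\<^bsub>R\<^esub> s) 0 f"
        unfolding sc_add_right[OF pg r(1) s(1)] sc_add_left[OF r(2) s(2) f0] r(3) s(3) ..
      then show ?thesis unfolding N_def using R.grade_add[OF r(2) s(2)] Hom_add[OF r(1) s(1)] by blast
    qed
    show "sc d t i x \<in> N m (i + d)" if t: "t \<in> grade R d" and xN: "x \<in> N m i" for i d t x
    proof -
      obtain r where r: "x \<in> H i" "r \<in> grade R (i + ?w m)" "sc (?w m) (snd (?p m)) i x = sc (i + ?w m) r 0 f"
        using xN unfolding N_def by blast
      have "sc (?w m) (snd (?p m)) (i + d) (sc d t i x) = sc (?w m + d) (snd (?p m) \<otimes>\<^bsub>R\<^esub> t) i x"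
        by (rule sc_sc[OF pg t r(1)])
      also have "snd (?p m) \<otimes>\<^bsub>R\<^esub> t = t \<otimes>\<^bsub>R\<^esub> snd (?p m)" by (rule R.grade_even_comm[OF pg t R.evenD(1)[OF pE]])
      also have "sc (?w m + d) (t \<otimes>\<^bsub>R\<^esub> snd (?p m)) i x = sc d t (i + ?w m) (sc (?w m) (snd (?p m)) i x)"
        using sc_sc[OF t pg r(1)] by (simp add: add.commute)
      also have "\<dots> = sc (d + (i + ?w m)) (t \<otimes>\<^bsub>R\<^esub> r) 0 f"
        unfolding r(3) using sc_sc[OF t r(2) f0] by simp
      also have "d + (i + ?w m) = i + d + ?w m" by simp
      finally have "sc (?w m) (snd (?p m)) (i + d) (sc d t i x) = sc (i + d + ?w m) (t \<otimes>\<^bsub>R\<^esub> r) 0 f" .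
      moreover have "t \<otimes>\<^bsub>R\<^esub> r \<in> grade R (i + d + ?w m)"
        using R.mult_grade[OF t r(2)] by (simp add: algebra_simps)
      ultimately show ?thesis unfolding N_def using sc_Hom[OF t r(1)] by blast
    qed
  qed
  have mono: "N m i \<subseteq> N (Suc m) i" for m i
  proof
    fix y assume "y \<in> N m i"
    then obtain r where r: "y \<in> H i" "r \<in> grade R (i + ?w m)" "sc (?w m) (snd (?p m)) i y = sc (i + ?w m) r 0 f"
      unfolding N_def by blast
    have ug: "snd u \<in> grade R (fst u)" by (rule R.evenD(2)[OF u(1)])
    have "sc (?w (Suc m)) (snd (?p (Suc m))) i y = sc (fst u) (snd u) (i + ?w m) (sc (?w m) (snd (?p m)) i y)"
      using sc_sc[OF ug pg r(1)] by (simp add: R.mul_def)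
    also have "\<dots> = sc (fst u + (i + ?w m)) (snd u \<otimes>\<^bsub>R\<^esub> r) 0 f"
      unfolding r(3) using sc_sc[OF ug r(2) f0] by simp
    also have "fst u + (i + ?w m) = i + ?w (Suc m)" by (simp add: R.mul_def)
    finally have "sc (?w (Suc m)) (snd (?p (Suc m))) i y = sc (i + ?w (Suc m)) (snd u \<otimes>\<^bsub>R\<^esub> r) 0 f" .
    moreover have "snd u \<otimes>\<^bsub>R\<^esub> r \<in> grade R (i + ?w (Suc m))"
      using R.mult_grade[OF ug r(2)] by (simp add: R.mul_def algebra_simps)
    ultimately show "y \<in> N (Suc m) i" unfolding N_def using r(1) by blast
  qed
  obtain n where "\<forall>k\<ge>n. \<forall>i. N k i \<inter> span gs i \<subseteq> N n i" using span_chain_stable[of gs N, OF noeth gs(1) sub mono] by blast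
  then have n: "N (Suc n) i \<inter> span gs i \<subseteq> N n i" for i by simp
  obtain s x where s: "s \<in> R.avoiding \<qq>" and x: "x \<in> H (fst s - ?w (Suc n))"
    and sx: "act s B \<bullet> f = act (?p (Suc n)) (sh (fst s - ?w (Suc n)) B) \<bullet> x" using div[of "Suc n"] by blast
  let ?i = "fst s - ?w (Suc n)"
  have sE: "s \<in> E" by (rule M(1)[OF s])
  note sg = R.evenD(2)[OF sE]
  have sf: "act s B \<bullet> f = sc (fst s) (snd s) 0 f" using act_sc[OF sE f0] by simp
  have px: "sc (?w (Suc n)) (snd (?p (Suc n))) ?i x = sc (fst s) (snd s) 0 f"
    using sx unfolding sf act_sc[OF pE x] by simp
  \<comment> \<open>The coefficient witnessing membership in stage \<open>n + 1\<close> is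
    \<open>s\<close>; stability gives a second coefficient \<open>r\<close> in stage
    \<open>n\<close>.\<close>
  have "x \<in> N (Suc n) ?i" unfolding N_def using x px sg by auto
  then have "x \<in> N n ?i" using n gs(2)[OF x] by blast
  then obtain r where r: "r \<in> grade R (?i + ?w n)" "sc (?w n) (snd (?p n)) ?i x = sc (?i + ?w n) r 0 f"
    unfolding N_def by blast
  have ug: "snd u \<in> grade R (fst u)" by (rule R.evenD(2)[OF u(1)])
  have dg: "fst u + (?i + ?w n) = fst s" by (simp add: R.mul_def)
  have "sc (fst u) (snd u) (?i + ?w n) (sc (?w n) (snd (?p n)) ?i x)
      = sc (fst u + ?w n) (snd u \<otimes>\<^bsub>R\<^esub> snd (?p n)) ?i x" by (rule sc_sc[OF ug pg x])
  also have "\<dots> = sc (?w (Suc n)) (snd (?p (Suc n))) ?i x" by (simp add: R.mul_def)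
  finally have "sc (fst s) (snd s) 0 f = sc (fst u) (snd u) (?i + ?w n) (sc (?i + ?w n) r 0 f)"
    unfolding px r(2) ..
  also have "\<dots> = sc (fst u + (?i + ?w n)) (snd u \<otimes>\<^bsub>R\<^esub> r) 0 f"
    using sc_sc[OF ug r(1) f0] by (simp only: add_0)
  finally have eq: "sc (fst s) (snd s) 0 f = sc (fst s) (snd u \<otimes>\<^bsub>R\<^esub> r) 0 f" unfolding dg .
  have urg: "snd u \<otimes>\<^bsub>R\<^esub> r \<in> grade R (fst s)" using R.mult_grade[OF ug r(1)] unfolding dg .
  let ?v = "snd s \<oplus>\<^bsub>R\<^esub> \<ominus>\<^bsub>R\<^esub> (snd u \<otimes>\<^bsub>R\<^esub> r)"
  have vg: "?v \<in> grade R (fst s)" by (rule R.grade_add[OF sg R.grade_minus[OF urg]])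
  have "sc (fst s) ?v 0 f = zr B (sh (fst s) B)"
    unfolding sc_add_left[OF sg R.grade_minus[OF urg] f0] sc_neg[OF urg f0] eq
    using sc_Hom[OF urg f0] add_commute[of "sc (fst s) (snd u \<otimes>\<^bsub>R\<^esub> r) 0 f" "ng (sc (fst s) (snd u \<otimes>\<^bsub>R\<^esub> r) 0 f)"]
    by simp
  moreover have vE: "(fst s, ?v) \<in> E" by (rule R.evenI[OF R.evenD(1)[OF sE] vg])
  ultimately have "kills (fst s, ?v) f" unfolding kills_Hom[OF f] using act_sc[OF vE f0] by simp
  moreover have "?v \<notin> \<qq>"
  proof
    assume v: "?v \<in> \<qq>"
    note I = R.homogeneous_idealD[OF R.SpecD(1)[OF q]]
    have "snd u \<otimes>\<^bsub>R\<^esub> r \<in> \<qq>" by (rule I(7)[OF u(2) R.grade_carrier[OF r(1)]])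
    then have "?v \<oplus>\<^bsub>R\<^esub> (snd u \<otimes>\<^bsub>R\<^esub> r) \<in> \<qq>" using I(4)[OF v] by blast
    then have "snd s \<in> \<qq>" using R.grade_carrier[OF sg] R.grade_carrier[OF urg] by (simp add: R.a_assoc R.l_neg)
    then show False using s unfolding R.avoiding_def by blast
  qed
  ultimately show ?thesis using vE unfolding R.avoiding_def by (intro bexI[of _ "(fst s, ?v)"]) auto
qed

end

end

text \<open>The direct sum of \<open>D\<close> and \<open>C\<close> is obtained as the cone of a
  zero morphism from the desuspension of \<open>C\<close> to \<open>D\<close>; only the two
  retractions are kept.\<close>

lemma (in triangulated_category) ex_sum:
  assumes S: "triang S" and D: "D \<in> S" and C: "C \<in> S"
  obtains B i p j q where "B \<in> S" "i \<in> Hom D B" "p \<in> Hom B D" "p \<bullet> i = ide T D"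
    "j \<in> Hom C B" "q \<in> Hom B C" "q \<bullet> j = ide T C"
proof -
  have Do: "D \<in> obj T" and Co: "C \<in> obj T" using triangD(1)[OF S] D C by blast+
  have "zr (sh (-1) C) D \<in> Hom (sh (-1) C) D" using Do Co by simp
  from ex_cone[OF this] obtain B i q where t: "tri3 (sh (-1) C) D B (zr (sh (-1) C) D) i q" by metis
  note H = tri3_Hom[OF t]
  have d: "dist (sh (-1) C) D B" using t unfolding dist_def by blast
  have B: "B \<in> S" by (rule triangD(4)[OF S d triangD(3)[OF S C] D])
  have Bo: "B \<in> obj T" by (rule triangD(1)[OF S B])
  have iH: "i \<in> Hom D B" and qH: "q \<in> Hom B C" using H Co by auto
  have 1: "ide T D \<bullet> zr (sh (-1) C) D = zr (sh (-1) C) D" using Do Co by simp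
  obtain p where p: "p \<in> Hom B D" "ide T D = p \<bullet> i"
    by (rule weak_cokernel[OF t 1]) (use Do in auto)
  have t2: "tri3 D B C i q (ng (sm 1 (zr (sh (-1) C) D)))" using tri3_rotate[OF t] Co by simp
  have 3: "ng (sm 1 (zr (sh (-1) C) D)) \<bullet> ide T C = zr C (sh 1 D)"
    using Do Co tri3_Hom[OF t2] by simp
  obtain j where j: "j \<in> Hom C B" "ide T C = q \<bullet> j"
    by (rule weak_kernel[OF tri3_rotate[OF t2] 3]) (use Co in auto)
  show ?thesis by (rule that[OF B iH p(1) p(2)[symmetric] j(1) qH j(2)[symmetric]])
qed

lemma (in linear_cocomplete) kmap_Hom:
  "set us \<subseteq> E \<Longrightarrow> C \<in> obj T \<Longrightarrow> kmap us C \<in> Hom C (kos us C)"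
proof (induction us)
  case (Cons u us)
  then have h: "u \<in> E" "set us \<subseteq> E" "C \<in> obj T" by auto
  obtain k where "tri3 (sh (- fst u) (kos us C)) (kos us C) (kos1 u (kos us C))
      (act u (sh (- fst u) (kos us C))) (kmap1 u (kos us C)) k"
    by (rule kos1_tri[OF h(1) kos_obj[OF h(2,3)]])
  from tri3_Hom[OF this] show ?case using Cons.IH[OF h(2,3)] by simp
qed simp

locale stratified_category = generated_category T U R
  for T :: "('o, 'm, 'r) linear_category" (structure) and U :: "'u set" and R :: "'r graded_ring" +
  assumes noeth_cat: "noetherian_category U R T" and strat: "stratified U R T"
begin

text \<open>Finite generation is given for endomorphisms. So \<open>f\<close> is turned into the
  endomorphism \<open>j \<bullet> (f \<bullet> p)\<close> of the direct sum \<open>B\<close>, from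
  which it is recovered by composing with \<open>k\<close> and \<open>i\<close>.\<close>

lemma krull_compact:
  assumes q: "\<qq> \<in> Spec R" and u: "u \<in> E" "snd u \<in> \<qq>" and D: "D \<in> \<C>" and C: "C \<in> \<C>" and f: "f \<in> Hom D C"
    and div: "\<And>m. \<exists>s\<in>R.avoiding \<qq>. \<exists>x\<in>Hom D (sh (fst s - fst (R.pw u m)) C).
      act s C \<bullet> f = act (R.pw u m) (sh (fst s - fst (R.pw u m)) C) \<bullet> x"
  shows "\<exists>s\<in>R.avoiding \<qq>. kills s f"
proof -
  obtain B i p j k where B: "B \<in> \<C>" and i: "i \<in> Hom D B" and p: "p \<in> Hom B D" and pi: "p \<bullet> i = ide T D"
    and j: "j \<in> Hom C B" and k: "k \<in> Hom B C" and kj: "k \<bullet> j = ide T C" by (rule ex_sum[OF compact_triang D C])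
  have Bo: "B \<in> obj T" by (rule compact_obj[OF B])
  let ?F = "j \<bullet> (f \<bullet> p)"
  have F: "?F \<in> Hom B B" using f p j by simp
  have fg: "finitely_generated R (graded_hom R T B B)" using noeth_cat B unfolding noetherian_category_def by blast
  have "\<exists>s\<in>R.avoiding \<qq>. kills s ?F"
  proof (rule krull[OF Bo noeth fg q u F])
    fix m
    obtain s x where s: "s \<in> R.avoiding \<qq>" and x: "x \<in> Hom D (sh (fst s - fst (R.pw u m)) C)"
      and e: "act s C \<bullet> f = act (R.pw u m) (sh (fst s - fst (R.pw u m)) C) \<bullet> x" using div[of m] by blast
    have sE: "s \<in> E" using s unfolding R.avoiding_def by blast
    have pE: "R.pw u m \<in> E" by (rule R.pw_even[OF u(1)])
    let ?d = "fst s - fst (R.pw u m)"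
    have sj: "sm ?d j \<in> Hom (sh ?d C) (sh ?d B)" using j by simp
    have "act s B \<bullet> ?F = (act s B \<bullet> j) \<bullet> (f \<bullet> p)" using sE j f p by simp
    also have "\<dots> = sm (fst s) j \<bullet> ((act s C \<bullet> f) \<bullet> p)" unfolding act_natural[OF sE j] using sE j f p by simp
    also have "\<dots> = (sm (fst (R.pw u m)) (sm ?d j) \<bullet> act (R.pw u m) (sh ?d C)) \<bullet> (x \<bullet> p)"
      unfolding e using pE j x p by simp
    also have "\<dots> = act (R.pw u m) (sh ?d B) \<bullet> (sm ?d j \<bullet> (x \<bullet> p))"
      unfolding act_natural[OF pE sj, symmetric] using pE j x p by simp
    finally have "act s B \<bullet> ?F = act (R.pw u m) (sh ?d B) \<bullet> (sm ?d j \<bullet> (x \<bullet> p))" .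
    moreover have "sm ?d j \<bullet> (x \<bullet> p) \<in> Hom B (sh ?d B)" using j x p by simp
    ultimately show "\<exists>s\<in>R.avoiding \<qq>. \<exists>x\<in>Hom B (sh (fst s - fst (R.pw u m)) B).
      act s B \<bullet> ?F = act (R.pw u m) (sh (fst s - fst (R.pw u m)) B) \<bullet> x" using s by blast
  qed
  then obtain s where s: "s \<in> R.avoiding \<qq>" "kills s ?F" by blast
  have sE: "s \<in> E" using s(1) unfolding R.avoiding_def by blast
  have Fi: "?F \<bullet> i \<in> Hom D B" using F i by (simp del: assoc)
  have "kills s (k \<bullet> (?F \<bullet> i))"
    by (rule kills_left[OF sE Fi k kills_right[OF sE F i s(2)]])
  also have "k \<bullet> (?F \<bullet> i) = (k \<bullet> j) \<bullet> (f \<bullet> (p \<bullet> i))" using k j f p i by (simp del: kj pi)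
  also have "\<dots> = f" unfolding kj pi using f by simp
  finally show ?thesis using s(1) by blast
qed

text \<open>
  If \<open>f\<close> became torsion in the cone of \<open>u\<^sup>m\<close> for all \<open>m\<close>, then up to torsion it would be
  divisible by all powers of \<open>u\<close>.
\<close>

lemma kos_exponents:
  assumes q: "\<qq> \<in> Spec R" and D: "D \<in> \<C>" and C: "C \<in> \<C>" and f: "f \<in> Hom D C"
    and nk: "\<not> (\<exists>s\<in>R.avoiding \<qq>. kills s f)"
    and vs: "set vs \<subseteq> E" "\<And>u. u \<in> set vs \<Longrightarrow> snd u \<in> \<qq>"
  shows "\<exists>ns. \<not> (\<exists>s\<in>R.avoiding \<qq>. kills s (kmap (map2 R.pw vs ns) C \<bullet> f)) \<and> length ns = length vs"
  using vs
proof (induction vs)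
  case Nil
  have "kmap (map2 R.pw [] []) C \<bullet> f = f" using f by simp
  then show ?case using nk by auto
next
  case (Cons u vs)
  have vs: "set vs \<subseteq> E" "u \<in> E" "snd u \<in> \<qq>" "\<And>u. u \<in> set vs \<Longrightarrow> snd u \<in> \<qq>" using Cons.prems by auto
  obtain ns where ns: "\<not> (\<exists>s\<in>R.avoiding \<qq>. kills s (kmap (map2 R.pw vs ns) C \<bullet> f))" "length ns = length vs"
    using Cons.IH[OF vs(1,4)] by blast
  let ?vs = "map2 R.pw vs ns"
  let ?C = "kos ?vs C" and ?f = "kmap ?vs C \<bullet> f"
  have vsE: "set ?vs \<subseteq> E" using R.pw_even vs(1) by (auto dest: set_zip_leftD)
  have C': "?C \<in> \<C>" by (rule kos_triang[OF compact_triang vsE C])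
  have Co: "?C \<in> obj T" by (rule compact_obj[OF C'])
  have kH: "kmap ?vs C \<in> Hom C ?C" by (rule kmap_Hom[OF vsE compact_obj[OF C]])
  have f': "?f \<in> Hom D ?C" using kH f by simp
  have "\<exists>m. \<not> (\<exists>s\<in>R.avoiding \<qq>. kills s (kmap1 (R.pw u m) ?C \<bullet> ?f))"
  proof (rule ccontr)
    assume c: "\<not> ?thesis"
    have "\<exists>s\<in>R.avoiding \<qq>. kills s ?f"
    proof (rule krull_compact[OF q vs(2,3) D C' f'])
      fix m
      let ?a = "R.pw u m"
      have aE: "?a \<in> E" by (rule R.pw_even[OF vs(2)])
      obtain s where s: "s \<in> R.avoiding \<qq>" "kills s (kmap1 ?a ?C \<bullet> ?f)" using c by blast
      have sE: "s \<in> E" using s(1) unfolding R.avoiding_def by blast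
      obtain h where t: "tri3 (sh (- fst ?a) ?C) ?C (kos1 ?a ?C) (act ?a (sh (- fst ?a) ?C)) (kmap1 ?a ?C) h"
        by (rule kos1_tri[OF aE Co])
      note H = tri3_Hom[OF t]
      have gH: "kmap1 ?a ?C \<in> Hom ?C (kos1 ?a ?C)" using H by simp
      have gf: "kmap1 ?a ?C \<bullet> ?f \<in> Hom D (kos1 ?a ?C)" using gH f' by (simp del: assoc)
      have sf: "act s ?C \<bullet> ?f \<in> Hom D (sh (fst s) ?C)" using sE f' Co by simp
      have "sm (fst s) (kmap1 ?a ?C) \<bullet> (act s ?C \<bullet> ?f) = (sm (fst s) (kmap1 ?a ?C) \<bullet> act s ?C) \<bullet> ?f"
        using sE f' gH kH f by simp
      also have "\<dots> = act s (kos1 ?a ?C) \<bullet> (kmap1 ?a ?C \<bullet> ?f)"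
        unfolding act_natural[OF sE gH, symmetric] using sE f' gH kH f by simp
      also have "\<dots> = zr D (sh (fst s) (kos1 ?a ?C))" using s(2) unfolding kills_Hom[OF gf] .
      finally obtain l where l: "l \<in> Hom D (sh (fst s) (sh (- fst ?a) ?C))"
          "act s ?C \<bullet> ?f = sm (fst s) (act ?a (sh (- fst ?a) ?C)) \<bullet> l"
        by (rule weak_kernel_sh[OF t _ sf])
      have "sh (fst s) (sh (- fst ?a) ?C) = sh (fst s - fst ?a) ?C" using Co by simp
      moreover have "sm (fst s) (act ?a (sh (- fst ?a) ?C)) = act ?a (sh (fst s - fst ?a) ?C)"
        using act_sh[OF aE, of "sh (- fst ?a) ?C" "fst s"] Co by simp
      ultimately show "\<exists>s\<in>R.avoiding \<qq>. \<exists>x\<in>Hom D (sh (fst s - fst ?a) ?C).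
          act s ?C \<bullet> ?f = act ?a (sh (fst s - fst ?a) ?C) \<bullet> x"
        using l s(1) by (intro bexI[of _ s] bexI[of _ l]) simp_all
    qed
    then show False using ns(1) by blast
  qed
  then obtain m where m: "\<not> (\<exists>s\<in>R.avoiding \<qq>. kills s (kmap1 (R.pw u m) ?C \<bullet> ?f))" by blast
  have aE: "R.pw u m \<in> E" by (rule R.pw_even[OF vs(2)])
  obtain h where t: "tri3 (sh (- fst (R.pw u m)) ?C) ?C (kos1 (R.pw u m) ?C) (act (R.pw u m) (sh (- fst (R.pw u m)) ?C))
      (kmap1 (R.pw u m) ?C) h" by (rule kos1_tri[OF aE Co])
  have "kmap (map2 R.pw (u # vs) (m # ns)) C \<bullet> f = kmap1 (R.pw u m) ?C \<bullet> ?f"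
    using tri3_Hom[OF t] kH f by simp
  then show ?case using m ns(2) by (intro exI[of _ "m # ns"]) simp
qed

end

section \<open>Subcategories determined by their support\<close>

context generated_category
begin

lemma zero_iff_orth_generators: "X \<in> obj T \<Longrightarrow> is_zero T X \<longleftrightarrow> orth generators X"
  using orth_generators_zero orth_zero orth_subset[of generators X] by blast

lemma localizing_zero: "localizing U T {X. is_zero T X}"
proof -
  have "{X. is_zero T X} = {X. orth generators X}"
    using zero_iff_orth_generators orth_obj by (metis zero_obj)
  then show ?thesis using localizing_orth[OF generators(1)] by simp
qed

text \<open>The objects not supported at \<pp> form a localizing subcategory. If it contained all
  generators, it would be everything.\<close>

lemma supported_generator:
  assumes "\<pp> \<in> supp_sub U R T (obj T)" obtains C where "C \<in> generators" "\<pp> \<in> Supp C"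
proof -
  obtain X where X: "X \<in> obj T" "\<pp> \<in> Supp X" using assms unfolding supp_sub_def by blast
  then have p: "\<pp> \<in> Spec R" using Supp_iff by blast
  have "\<not> generators \<subseteq> {X \<in> obj T. \<pp> \<notin> Supp X}"
  proof
    assume "generators \<subseteq> {X \<in> obj T. \<pp> \<notin> Supp X}"
    from Loc_least[OF localizing_unsupported[OF p] this]
    have "obj T \<subseteq> {X \<in> obj T. \<pp> \<notin> Supp X}" unfolding generators(3) .
    then show False using X by blast
  qed
  then show ?thesis using that generator_compact compact_obj by blast
qed

text \<open>A prime \<pp> strictly above \<qq> is excluded by an element \<open>u\<close> of \<pp>
  outside \<qq>: some power of \<open>u\<close> annihilates each Koszul object for \<pp>, while it
  acts injectively on morphisms into the local object \<open>W\<close>.\<close>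

lemma Supp_local_torsion:
  assumes q: "\<qq> \<in> Spec R" and W: "W \<in> TV \<qq>" and o: "orth (TZ \<qq>) W"
  shows "Supp W \<subseteq> {\<qq>}"
proof
  fix \<pp> assume p: "\<pp> \<in> Supp W"
  have Wo: "W \<in> obj T" by (rule orth_obj[OF o])
  have pS: "\<pp> \<in> Spec R" using p Supp_iff[OF Wo] by blast
  have qp: "\<qq> \<subseteq> \<pp>" using Supp_TV[OF q W] p unfolding closed_set_def by blast
  show "\<pp> \<in> {\<qq>}"
  proof (rule ccontr)
    assume "\<pp> \<notin> {\<qq>}"
    then have "\<not> \<pp> \<subseteq> \<qq>" using qp by blast
    then obtain u where u: "u \<in> set (prime_gens \<pp>)" "snd u \<notin> \<qq>" using prime_gens(4)[OF pS q] by blast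
    have uE: "u \<in> E" by (rule prime_gens(3)[OF pS u(1)])
    have "tors (R.avoiding \<pp>) (koszul C \<pp>) W" if C: "C \<in> generators" for C
    proof -
      have Co: "C \<in> obj T" by (rule compact_obj[OF generator_compact[OF C]])
      have ko: "koszul C \<pp> \<in> obj T" by (rule kos_obj[OF prime_gens(1)[OF pS] Co])
      obtain k where k: "annihilates (R.pw u k) (koszul C \<pp>)"
        using nilpotent_kos[OF prime_gens(1)[OF pS] Co u(1)] unfolding nilpotent_def by blast
      have av: "R.pw u k \<in> R.avoiding \<qq>" using powers_avoiding[OF q uE u(2)] by blast
      have "orth {koszul C \<pp>} W"
      proof (rule orthI[OF Wo])
        fix Y n f assume "Y \<in> {koszul C \<pp>}" and f: "f \<in> Hom (sh n Y) W"
        then have Y: "Y = koszul C \<pp>" by simp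
        show "f = zr (sh n Y) W"
          using TZ_injective[OF q o ko _ av annihilates_kills_from[OF R.pw_even[OF uE] k]] f unfolding Y by blast
      qed
      then show ?thesis by (rule orth_tors[OF _ ko R.avoiding_mult_closed[OF pS]])
    qed
    then show False using p Supp_iff[OF Wo] by blast
  qed
qed

text \<open>A morphism into the localization lifts to \<open>X\<close> after multiplication by some
  \<open>s\<close> outside \<qq>. A power of \<open>u\<close> kills the lift, and \<open>s\<close>
  can be cancelled because it acts injectively on morphisms into the localization.\<close>

lemma localized_TV:
  assumes q: "\<qq> \<in> Spec R" and X: "X \<in> TV \<qq>" shows "localized \<qq> X \<in> TV \<qq>"
proof -
  have Xo: "X \<in> obj T" using X TV_iff[OF q] by blast
  note tt = torsion_triangle[OF TZ_kernel[OF q] Xo]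
  let ?C = "Gamma_ob U R T (not_below R \<qq>) X" and ?W = "localized \<qq> X"
  obtain e g h where t: "tri3 ?C X ?W e g h" using tt(5) by blast
  note H = tri3_Hom[OF t]
  note M = mult_closedD[OF R.avoiding_mult_closed[OF q]]
  have Wo: "?W \<in> obj T" by (rule localized_obj[OF q Xo])
  have "tors (range (R.pw u)) D ?W" if D: "D \<in> \<C>" and u: "u \<in> set (prime_gens \<qq>)" for D u
    unfolding tors_def
  proof (intro allI ballI)
    fix n f assume f: "f \<in> Hom (sh n D) ?W"
    have Do: "D \<in> obj T" by (rule compact_obj[OF D])
    have uE: "u \<in> E" by (rule prime_gens(3)[OF q u])
    have tC: "tors (R.avoiding \<qq>) D ?C" using tt(1) D TZ_iff[OF q] by blast
    have hf: "h \<bullet> f \<in> Hom (sh n D) (sh 1 ?C)" using f H by simp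
    obtain s where s: "s \<in> R.avoiding \<qq>" "kills s (h \<bullet> f)"
      using torsD'[OF tC M(2) hf Do] H by blast
    have sE: "s \<in> E" by (rule M(1)[OF s(1)])
    have sf: "act s ?W \<bullet> f \<in> Hom (sh n D) (sh (fst s) ?W)" using f sE by simp
    have hH: "h \<in> Hom ?W (sh 1 ?C)" using H by simp
    have "sm (fst s) h \<bullet> (act s ?W \<bullet> f) = (sm (fst s) h \<bullet> act s ?W) \<bullet> f" using f sE H by simp
    also have "\<dots> = act s (sh 1 ?C) \<bullet> (h \<bullet> f)"
      unfolding act_natural[OF sE hH, symmetric] using H f sE by simp
    also have "\<dots> = zr (sh n D) (sh (fst s + 1) ?C)" using s(2) H unfolding kills_Hom[OF hf] by simp
    finally obtain y where y: "y \<in> Hom (sh n D) (sh (fst s) X)" "act s ?W \<bullet> f = sm (fst s) g \<bullet> y"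
      by (rule weak_kernel2_sh[OF t _ sf])
    have tX: "tors (range (R.pw u)) D X" using X TV_iff[OF q] D u by blast
    have rE: "range (R.pw u) \<subseteq> E" using R.pw_even[OF uE] by blast
    obtain k where k: "kills (R.pw u k) y" using torsD'[OF tX rE y(1) Do Xo] by blast
    have pE: "R.pw u k \<in> E" by (rule R.pw_even[OF uE])
    have "kills (R.pw u k) (act s ?W \<bullet> f)" unfolding y(2)
      by (rule kills_left[where Z = "sh (fst s) ?W", OF pE y(1) _ k]) (use H in simp)
    then have "kills (R.mul (R.pw u k) s) f" using kills_mul_act[OF pE sE f] by simp
    then have "kills (R.mul s (R.pw u k)) f" using R.mul_comm[OF sE pE] by simp
    then have ks: "kills s (act (R.pw u k) ?W \<bullet> f)" using kills_mul_act[OF sE pE f] by simp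
    have uf: "act (R.pw u k) ?W \<bullet> f \<in> Hom (sh n D) (sh (fst (R.pw u k)) ?W)" using f pE by simp
    have oW: "orth (TZ \<qq>) (sh (fst (R.pw u k)) ?W)"
      by (rule orth_sh[OF tt(2)]) (use TZ_iff[OF q] in blast)
    have "act (R.pw u k) ?W \<bullet> f = zr (sh n D) (sh (fst (R.pw u k)) ?W)"
      by (rule TZ_injective[OF q oW Do uf s(1) ks])
    then have "kills (R.pw u k) f" unfolding kills_Hom[OF f] .
    then show "\<exists>a\<in>range (R.pw u). kills a f" by blast
  qed
  then show ?thesis unfolding TV_iff[OF q] using Wo by blast
qed

lemma Supp_localized: "\<qq> \<in> Spec R \<Longrightarrow> X \<in> TV \<qq> \<Longrightarrow> Supp (localized \<qq> X) \<subseteq> {\<qq>}"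
  using Supp_local_torsion[OF _ localized_TV torsion_triangle(2)[OF TZ_kernel]] TV_iff by blast

lemma TZ_unsupported:
  assumes q: "\<qq> \<in> Spec R" and Y: "Y \<in> TZ \<qq>" shows "\<qq> \<notin> Supp Y"
proof -
  have Yo: "Y \<in> obj T" using Y TZ_iff[OF q] by blast
  have "tors (R.avoiding \<qq>) (koszul C \<qq>) Y" if "C \<in> generators" for C
    using Y koszul_compact[OF q generator_compact[OF that]] TZ_iff[OF q] by blast
  then show ?thesis using Supp_iff[OF Yo] by blast
qed

text \<open>Local cohomology is taken first and the localization afterwards, the reverse of the
  order in \<open>Gamma_at\<close>, so that \<open>Supp_localized\<close> applies. The prime \<qq>
  survives because the other vertices of both triangles are not supported there.\<close>

lemma ex_Supp_singleton:
  assumes "\<qq> \<in> supp_sub U R T (obj T)" shows "\<exists>W\<in>obj T. Supp W = {\<qq>}"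
proof -
  obtain X where X: "X \<in> obj T" "\<qq> \<in> Supp X" using assms unfolding supp_sub_def by blast
  then have q: "\<qq> \<in> Spec R" using Supp_iff by blast
  note tV = torsion_triangle[OF TV_kernel(2)[OF q] X(1)]
  let ?E = "Gamma_ob U R T (closed_set R \<qq>) X"
  have Eo: "?E \<in> obj T" using tV(1) TV_iff[OF q] by blast
  note tZ = torsion_triangle[OF TZ_kernel[OF q] Eo]
  have Wo: "localized \<qq> ?E \<in> obj T" by (rule localized_obj[OF q Eo])
  note tr = localizingD[OF localizing_unsupported[OF q]]
  have "\<qq> \<in> Supp (localized \<qq> ?E)"
  proof (rule ccontr)
    assume n: "\<qq> \<notin> Supp (localized \<qq> ?E)"
    have "Gamma_ob U R T (not_below R \<qq>) ?E \<in> {X \<in> obj T. \<qq> \<notin> Supp X}"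
      using TZ_unsupported[OF q tZ(1)] TZ_iff[OF q] tZ(1) by blast
    then have 1: "?E \<in> {X \<in> obj T. \<qq> \<notin> Supp X}"
      by (rule triangD(5)[OF tr tZ(3)]) (use n Wo in blast)
    have "\<qq> \<in> closed_set R \<qq>" using q unfolding closed_set_def by blast
    then have "L_ob U R T (closed_set R \<qq>) X \<in> {X \<in> obj T. \<qq> \<notin> Supp X}"
      using Supp_orth[OF q tV(2)] orth_obj[OF tV(2)] by blast
    then have "X \<in> {X \<in> obj T. \<qq> \<notin> Supp X}" by (rule triangD(5)[OF tr tV(3) 1])
    then show False using X(2) by blast
  qed
  then show ?thesis using Supp_localized[OF q tV(1)] Wo by blast
qed

text \<open>A power of a power of \<open>u\<close> is a power of \<open>u\<close>, so
  \<open>u\<close> is nilpotent on the Koszul object whatever exponents are chosen.\<close>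

lemma kos_powers_TV:
  assumes q: "\<qq> \<in> Spec R" and C: "C \<in> obj T" and l: "length ns = length (prime_gens \<qq>)"
  shows "kos (map2 R.pw (prime_gens \<qq>) ns) C \<in> TV \<qq>"
proof -
  let ?vs = "map2 R.pw (prime_gens \<qq>) ns"
  have vE: "set ?vs \<subseteq> E" using R.pw_even prime_gens(1)[OF q] by (auto dest: set_zip_leftD)
  have "tors (range (R.pw u)) D (kos ?vs C)" if u: "u \<in> set (prime_gens \<qq>)" for u D
  proof -
    have uE: "u \<in> E" by (rule prime_gens(3)[OF q u])
    obtain i where i: "i < length (prime_gens \<qq>)" "u = prime_gens \<qq> ! i" using u by (auto simp: in_set_conv_nth)
    have "R.pw u (ns ! i) \<in> set ?vs" using nth_mem[of i ?vs] i l by (simp del: nth_mem set_map)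
    from nilpotent_kos[OF vE C this] obtain k where k: "annihilates (R.pw (R.pw u (ns ! i)) k) (kos ?vs C)"
      unfolding nilpotent_def by blast
    have "R.pw (R.pw u (ns ! i)) k = R.pw u (ns ! i * k)"
      by (induction k) (simp_all add: R.pw_add[OF uE])
    then have "nilpotent u (kos ?vs C)" using k unfolding nilpotent_def by auto
    then show ?thesis by (rule nilpotent_tors_into[OF uE])
  qed
  then show ?thesis unfolding TV_iff[OF q] using kos_obj[OF vE C] by blast
qed

end

context stratified_category
begin

section \<open>Consequences of stratification\<close>

lemma Loc_Gamma: "X \<in> obj T \<Longrightarrow> Loc U T {X} = Loc U T {Gamma_at U R T \<pp> X |\<pp>. \<pp> \<in> Spec R}"
  using strat unfolding stratified_def local_global_principle_def by blast

lemma Supp_empty: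
  assumes X: "X \<in> obj T" and e: "Supp X = {}" shows "is_zero T X"
proof -
  have "{Gamma_at U R T \<pp> X |\<pp>. \<pp> \<in> Spec R} \<subseteq> {X. is_zero T X}" using e unfolding supp_def by blast
  then have "Loc U T {X} \<subseteq> {X. is_zero T X}" unfolding Loc_Gamma[OF X] by (rule Loc_least[OF localizing_zero])
  then show ?thesis using Loc_incl by blast
qed

text \<open>By the local-global principle membership of \<open>X\<close> is decided by the objects
  \<open>Gamma_at U R T \<pp> X\<close>. At a prime in the support of \<open>S\<close> the
  intersection of \<open>S\<close> with the minimal subcategory \<open>Gamma_image\<close> is
  nonzero, so \<open>S\<close> contains all of it.\<close>

lemma localizing_Supp:
  assumes S: "localizing U T S" shows "S = {X \<in> obj T. Supp X \<subseteq> supp_sub U R T S}"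
proof (rule subset_antisym)
  show "S \<subseteq> {X \<in> obj T. Supp X \<subseteq> supp_sub U R T S}"
    using triangD(1)[OF localizingD[OF S]] unfolding supp_sub_def by blast
  show "{X \<in> obj T. Supp X \<subseteq> supp_sub U R T S} \<subseteq> S"
  proof
    fix X assume "X \<in> {X \<in> obj T. Supp X \<subseteq> supp_sub U R T S}"
    then have X: "X \<in> obj T" "Supp X \<subseteq> supp_sub U R T S" by blast+
    have "Gamma_at U R T \<pp> X \<in> S" if p: "\<pp> \<in> Spec R" for \<pp>
    proof (cases "\<pp> \<in> Supp X")
      case False
      then have "is_zero T (Gamma_at U R T \<pp> X)" using p unfolding supp_def by blast
      then show ?thesis by (rule triangD(2)[OF localizingD[OF S]])
    next
      case True
      then obtain Y where Y: "Y \<in> S" "\<pp> \<in> Supp Y" using X(2) unfolding supp_sub_def by blast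
      have Yo: "Y \<in> obj T" by (rule triangD(1)[OF localizingD[OF S] Y(1)])
      let ?I = "Gamma_image U R T \<pp>"
      have image: "Gamma_at U R T \<pp> Z \<in> ?I" if "Z \<in> obj T" for Z
        unfolding Gamma_image_def using Gamma_at_obj[OF p that] isomorphic_refl that by blast
      have nz: "\<not> is_zero T (Gamma_at U R T \<pp> Y)" using Y(2) unfolding supp_def by blast
      have "\<not> zero_subcategory T ?I" using nz image[OF Yo] unfolding zero_subcategory_def by blast
      then have min: "minimal_localizing U T ?I" using strat p unfolding stratified_def by blast
      have "Gamma_at U R T \<pp> Y \<in> Loc U T {Y}" unfolding Loc_Gamma[OF Yo] using p by (intro subsetD[OF Loc_incl]) blast
      also have "Loc U T {Y} \<subseteq> S" by (rule Loc_least[OF S]) (use Y in blast)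
      finally have G: "Gamma_at U R T \<pp> Y \<in> S" .
      have "localizing U T ?I" using min unfolding minimal_localizing_def by blast
      then have "localizing U T (\<Inter>{S, ?I})" by (intro localizing_Inter) (use S in auto)
      then have "localizing U T (S \<inter> ?I)" by simp
      moreover have "\<not> zero_subcategory T (S \<inter> ?I)"
        using G nz image[OF Yo] unfolding zero_subcategory_def by blast
      ultimately have "S \<inter> ?I = ?I" using min unfolding minimal_localizing_def by blast
      then show ?thesis using image[OF X(1)] by blast
    qed
    then have "Loc U T {X} \<subseteq> S" unfolding Loc_Gamma[OF X(1)] by (intro Loc_least[OF S]) blast
    then show "X \<in> S" using Loc_incl by blast
  qed
qed

text \<open>If the support of \<open>X\<close> misses the closed set of \<pp>, so does that of the
  torsion vertex, by the triangle. But this vertex is supported only there, so its support is empty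
  and it is zero.\<close>

lemma orth_TV_Supp:
  assumes p: "\<pp> \<in> Spec R" and X: "X \<in> obj T"
  shows "orth (TV \<pp>) X \<longleftrightarrow> Supp X \<inter> closed_set R \<pp> = {}"
proof
  assume d: "Supp X \<inter> closed_set R \<pp> = {}"
  note t = torsion_triangle[OF TV_kernel(2)[OF p] X]
  let ?C = "Gamma_ob U R T (closed_set R \<pp>) X"
  have Co: "?C \<in> obj T" using t(1) TV_iff[OF p] by blast
  have "Supp ?C = {}"
  proof (rule ccontr)
    assume "Supp ?C \<noteq> {}"
    then obtain \<qq> where q: "\<qq> \<in> Supp ?C" by blast
    then have qV: "\<qq> \<in> closed_set R \<pp>" using Supp_TV[OF p t(1)] by blast
    have qS: "\<qq> \<in> Spec R" using q Supp_iff[OF Co] by blast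
    have "X \<in> {X \<in> obj T. \<qq> \<notin> Supp X}" using X d qV by blast
    moreover have "L_ob U R T (closed_set R \<pp>) X \<in> {X \<in> obj T. \<qq> \<notin> Supp X}"
      using Supp_orth[OF p t(2)] qV orth_obj[OF t(2)] by blast
    ultimately have "?C \<in> {X \<in> obj T. \<qq> \<notin> Supp X}"
      by (rule triangD(6)[OF localizingD[OF localizing_unsupported[OF qS]] t(3)])
    then show False using q by blast
  qed
  then have "is_zero T ?C" by (rule Supp_empty[OF Co])
  then show "orth (TV \<pp>) X" using t(4) by blast
qed (rule Supp_orth[OF p])

definition koszul_objects :: "'r set set \<Rightarrow> 'o set" where
  "koszul_objects V = (\<Union>\<pp>\<in>V. (\<lambda>C. koszul C \<pp>) ` generators)"

lemma koszul_objects: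
  assumes "V \<subseteq> Spec R" shows "koszul_objects V \<subseteq> \<C>" "small U (koszul_objects V)"
proof -
  show "koszul_objects V \<subseteq> \<C>" unfolding koszul_objects_def using koszul_compact generator_compact assms by blast
  \<comment> \<open>The objects are indexed by primes, so smallness comes from the power set of
    \<open>R\<close>.\<close>
  have "Spec R \<subseteq> Pow (carrier R)"
    using R.SpecD(1) R.homogeneous_idealD(1) ideal.Icarr by fastforce
  then have "small U V" using small_mono[OF small_Pow[OF universe small_R]] assms by blast
  then show "small U (koszul_objects V)" unfolding koszul_objects_def
    by (rule small_UN[OF universe]) (rule small_koszul)
qed

lemma orth_koszul_objects:
  assumes V: "V \<subseteq> Spec R"
  shows "orth (koszul_objects V) X \<longleftrightarrow> X \<in> obj T \<and> (\<forall>\<pp>\<in>V. Supp X \<inter> closed_set R \<pp> = {})"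
proof (cases "X \<in> obj T")
  case True
  have "orth (koszul_objects V) X \<longleftrightarrow> (\<forall>\<pp>\<in>V. \<forall>C\<in>generators. orth {koszul C \<pp>} X)"
    using True unfolding orth_def koszul_objects_def by blast
  also have "\<dots> \<longleftrightarrow> (\<forall>\<pp>\<in>V. Supp X \<inter> closed_set R \<pp> = {})"
    using orth_TV_Supp orth_TV_iff V True by blast
  finally show ?thesis using True by blast
qed (use orth_obj in blast)

abbreviation "supp_T \<equiv> supp_sub U R T (obj T)"

lemma Supp_supp_T: "X \<in> obj T \<Longrightarrow> Supp X \<subseteq> supp_T" unfolding supp_sub_def by blast

lemma supp_T_Spec: "supp_T \<subseteq> Spec R" unfolding supp_sub_def supp_def by blast

text \<open>Supports lie in \<open>supp_T\<close>, within which \<open>supp_T - V\<close> is closed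
  under passing to larger primes. Missing this set is therefore the same as missing the closed sets
  of all its members, and that is orthogonality to their Koszul objects.\<close>

lemma supported_orth:
  assumes V: "generalization_closed_in supp_T V"
  shows "{X \<in> obj T. Supp X \<subseteq> V} = {X. orth (koszul_objects (supp_T - V)) X}"
proof -
  have V': "V \<subseteq> supp_T" "\<And>\<pp> \<qq>. \<pp> \<in> supp_T - V \<Longrightarrow> \<qq> \<in> supp_T \<Longrightarrow> \<pp> \<subseteq> \<qq> \<Longrightarrow> \<qq> \<in> supp_T - V"
    using V unfolding generalization_closed_in_def specialization_closed_in_def by blast+
  have "supp_T - V \<subseteq> Spec R" using supp_T_Spec by blast
  note o = orth_koszul_objects[OF this]
  have "Supp X \<subseteq> V \<longleftrightarrow> (\<forall>\<pp>\<in>supp_T - V. Supp X \<inter> closed_set R \<pp> = {})" if X: "X \<in> obj T" for X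
  proof
    assume s: "Supp X \<subseteq> V"
    have "\<qq> \<in> supp_T - V" if "\<pp> \<in> supp_T - V" "\<qq> \<in> Supp X" "\<qq> \<in> closed_set R \<pp>" for \<pp> \<qq>
    proof (rule V'(2)[OF that(1)])
      show "\<qq> \<in> supp_T" using that(2) Supp_supp_T[OF X] by blast
      show "\<pp> \<subseteq> \<qq>" using that(3) unfolding closed_set_def by blast
    qed
    then show "\<forall>\<pp>\<in>supp_T - V. Supp X \<inter> closed_set R \<pp> = {}" using s by blast
  next
    assume d: "\<forall>\<pp>\<in>supp_T - V. Supp X \<inter> closed_set R \<pp> = {}"
    show "Supp X \<subseteq> V"
    proof
      fix \<pp> assume p: "\<pp> \<in> Supp X"
      then have "\<pp> \<in> closed_set R \<pp>" using Supp_iff[OF X] unfolding closed_set_def by blast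
      then show "\<pp> \<in> V" using d p Supp_supp_T[OF X] by blast
    qed
  qed
  then show ?thesis using o by blast
qed

lemma orth_closed_under_products: "G \<subseteq> obj T \<Longrightarrow> closed_under_products U T {X. orth G X}"
  unfolding closed_under_products_def
proof (intro allI impI)
  fix I :: "'u set" and A P \<pi>
  assume G: "G \<subseteq> obj T" and a: "small U I \<and> (\<forall>i\<in>I. A i \<in> {X. orth G X}) \<and> is_product T I A P \<pi>"
  have "orth G P" by (rule orth_products[OF G]) (use a in blast)+
  then show "P \<in> {X. orth G X}" by blast
qed

lemma supported_subcategory:
  assumes V: "generalization_closed_in supp_T V"
  shows "localizing U T {X \<in> obj T. Supp X \<subseteq> V}" "closed_under_products U T {X \<in> obj T. Supp X \<subseteq> V}"
    "supp_sub U R T {X \<in> obj T. Supp X \<subseteq> V} = V"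
proof -
  have "supp_T - V \<subseteq> Spec R" using supp_T_Spec by blast
  note G = koszul_objects[OF this]
  have Go: "koszul_objects (supp_T - V) \<subseteq> obj T" using G(1) compact_obj by blast
  show "localizing U T {X \<in> obj T. Supp X \<subseteq> V}" unfolding supported_orth[OF V] by (rule localizing_orth[OF G(1)])
  show "closed_under_products U T {X \<in> obj T. Supp X \<subseteq> V}"
    unfolding supported_orth[OF V] by (rule orth_closed_under_products[OF Go])
  show "supp_sub U R T {X \<in> obj T. Supp X \<subseteq> V} = V"
  proof (rule subset_antisym)
    show "V \<subseteq> supp_sub U R T {X \<in> obj T. Supp X \<subseteq> V}"
    proof
      fix \<qq> assume q: "\<qq> \<in> V"
      then have "\<qq> \<in> supp_T" using V unfolding generalization_closed_in_def by blast
      then obtain W where W: "W \<in> obj T" "Supp W = {\<qq>}" using ex_Supp_singleton by blast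
      then have "W \<in> {X \<in> obj T. Supp X \<subseteq> V}" using q by simp
      moreover have "\<qq> \<in> Supp W" using W(2) by simp
      ultimately show "\<qq> \<in> supp_sub U R T {X \<in> obj T. Supp X \<subseteq> V}" unfolding supp_sub_def by (rule UN_I)
    qed
  qed (auto simp: supp_sub_def)
qed


text \<open>For a given \<open>s\<close> the exponents come from \<open>kos_exponents\<close>
  applied to \<open>s f\<close>: no \<open>t\<close> outside \<qq> kills it, because
  \<open>t s\<close> lies outside \<pp>. The localization loses nothing since its torsion vertex is
  killed by elements outside \<qq>. The morphisms \<open>e\<close> are fixed in advance because one
  morphism into the product has to serve all \<open>s\<close>.\<close>

lemma detected_by_localized_kos:
  assumes pq: "\<pp> \<in> Spec R" "\<qq> \<in> Spec R" "\<pp> \<subseteq> \<qq>" and D: "D \<in> \<C>" and C: "C \<in> \<C>" and f: "f \<in> Hom D C"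
    and nk: "\<And>s. s \<in> R.avoiding \<pp> \<Longrightarrow> \<not> kills s f"
    and e: "\<And>ns. length ns = length (prime_gens \<qq>) \<Longrightarrow>
      e ns \<in> Hom (kos (map2 R.pw (prime_gens \<qq>) ns) C) (localized \<qq> (kos (map2 R.pw (prime_gens \<qq>) ns) C)) \<and>
      (\<exists>i h. tri3 (Gamma_ob U R T (not_below R \<qq>) (kos (map2 R.pw (prime_gens \<qq>) ns) C)) (kos (map2 R.pw (prime_gens \<qq>) ns) C)
        (localized \<qq> (kos (map2 R.pw (prime_gens \<qq>) ns) C)) i (e ns) h)"
    and s: "s \<in> R.avoiding \<pp>"
  shows "\<exists>ns. length ns = length (prime_gens \<qq>) \<and> \<not> kills s (e ns \<bullet> (kmap (map2 R.pw (prime_gens \<qq>) ns) C \<bullet> f))"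
proof -
  note Mp = mult_closedD[OF R.avoiding_mult_closed[OF pq(1)]] and Mq = mult_closedD[OF R.avoiding_mult_closed[OF pq(2)]]
  have Do: "D \<in> obj T" and Co: "C \<in> obj T" using D C compact_obj by blast+
  have sE: "s \<in> E" by (rule Mp(1)[OF s])
  \<comment> \<open>Desuspended so that the target is \<open>C\<close> again.\<close>
  let ?f = "sm (- fst s) (act s C \<bullet> f)" and ?D = "sh (- fst s) D"
  have sf: "act s C \<bullet> f \<in> Hom D (sh (fst s) C)" using sE f by simp
  have f': "?f \<in> Hom ?D C" using sf Co by simp
  have D': "?D \<in> \<C>" by (rule triangD(3)[OF compact_triang D])
  have "\<not> (\<exists>t\<in>R.avoiding \<qq>. kills t ?f)"
  proof
    assume "\<exists>t\<in>R.avoiding \<qq>. kills t ?f"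
    then obtain t where t: "t \<in> R.avoiding \<qq>" "kills t ?f" by blast
    have tE: "t \<in> E" by (rule Mq(1)[OF t(1)])
    have "kills t (act s C \<bullet> f)" using t(2) kills_sm[OF tE sf] by simp
    then have "kills (R.mul t s) f" using kills_mul_act[OF tE sE f] by simp
    moreover have "R.mul t s \<in> R.avoiding \<pp>" using Mp(4) avoiding_mono[OF pq(3)] t(1) s by blast
    ultimately show False using nk by blast
  qed
  from kos_exponents[OF pq(2) D' C f' this prime_gens(1)[OF pq(2)] prime_gens(2)[OF pq(2)]]
  obtain ns where ns: "\<not> (\<exists>t\<in>R.avoiding \<qq>. kills t (kmap (map2 R.pw (prime_gens \<qq>) ns) C \<bullet> ?f))" "length ns = length (prime_gens \<qq>)"
    by blast
  let ?vs = "map2 R.pw (prime_gens \<qq>) ns"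
  let ?E = "kos ?vs C" and ?k = "kmap ?vs C"
  let ?G = "Gamma_ob U R T (not_below R \<qq>) ?E" and ?W = "localized \<qq> ?E"
  have vE: "set ?vs \<subseteq> E" using R.pw_even prime_gens(1)[OF pq(2)] by (auto dest: set_zip_leftD)
  have kH: "?k \<in> Hom C ?E" by (rule kmap_Hom[OF vE Co])
  have Eo: "?E \<in> obj T" by (rule kos_obj[OF vE Co])
  have eH: "e ns \<in> Hom ?E ?W" using e[OF ns(2)] by blast
  obtain i h where t: "tri3 ?G ?E ?W i (e ns) h" using e[OF ns(2)] by blast
  have "\<not> kills s (e ns \<bullet> (?k \<bullet> f))"
  proof
    assume k: "kills s (e ns \<bullet> (?k \<bullet> f))"
    have kf: "?k \<bullet> f \<in> Hom D ?E" using kH f by simp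
    have ekf: "e ns \<bullet> (?k \<bullet> f) \<in> Hom D ?W" using eH kf by (simp del: assoc)
    have skf: "act s ?E \<bullet> (?k \<bullet> f) \<in> Hom D (sh (fst s) ?E)" using sE kf by (simp del: assoc)
    have "sm (fst s) (e ns) \<bullet> (act s ?E \<bullet> (?k \<bullet> f)) = (sm (fst s) (e ns) \<bullet> act s ?E) \<bullet> (?k \<bullet> f)"
      using sE eH kH f by simp
    also have "\<dots> = act s ?W \<bullet> (e ns \<bullet> (?k \<bullet> f))"
      unfolding act_natural[OF sE eH, symmetric] using sE eH kH f by simp
    also have "\<dots> = zr D (sh (fst s) ?W)" using k unfolding kills_Hom[OF ekf] .
    \<comment> \<open>If \<open>s\<close> killed the localized image, then the image of
      \<open>s f\<close> in the Koszul object would come from the torsion vertex and be killed by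
      some \<open>r\<close> outside \<qq>, against the choice of exponents.\<close>
    finally obtain l where l: "l \<in> Hom D (sh (fst s) ?G)" "act s ?E \<bullet> (?k \<bullet> f) = sm (fst s) i \<bullet> l"
      by (rule weak_kernel_sh[OF t _ skf])
    have Go: "?G \<in> obj T" using tri3_Hom[OF t] by simp
    have tG: "tors (R.avoiding \<qq>) D ?G"
      using torsion_triangle(1)[OF TZ_kernel[OF pq(2)] Eo] D TZ_iff[OF pq(2)] by blast
    have l0: "l \<in> Hom (sh 0 D) (sh (fst s) ?G)" using l(1) Do by simp
    obtain r where r: "r \<in> R.avoiding \<qq>" "kills r l" using torsD'[OF tG Mq(2) l0 Do Go] by blast
    have rE: "r \<in> E" by (rule Mq(1)[OF r(1)])
    have "kills r (act s ?E \<bullet> (?k \<bullet> f))" unfolding l(2)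
      by (rule kills_left[where Z = "sh (fst s) ?E", OF rE l(1) _ r(2)]) (use tri3_Hom[OF t] in simp)
    then have 1: "kills r (sm (- fst s) (act s ?E \<bullet> (?k \<bullet> f)))" using kills_sm[OF rE skf] by simp
    have "act s ?E \<bullet> (?k \<bullet> f) = (act s ?E \<bullet> ?k) \<bullet> f" using sE kH f by simp
    also have "\<dots> = sm (fst s) ?k \<bullet> (act s C \<bullet> f)" unfolding act_natural[OF sE kH] using sE kH f by simp
    finally have "sm (- fst s) (act s ?E \<bullet> (?k \<bullet> f)) = ?k \<bullet> ?f" using sE kH f by simp
    then show False using ns(1) r(1) 1 by auto
  qed
  then show ?thesis using ns(2) by blast
qed

lemma product_closed_generalization:
  assumes S: "localizing U T S" "closed_under_products U T S"
    and q: "\<qq> \<in> supp_sub U R T S" and p: "\<pp> \<in> supp_T" "\<pp> \<subseteq> \<qq>"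
  shows "\<pp> \<in> supp_sub U R T S"
proof -
  have pS: "\<pp> \<in> Spec R" using p(1) supp_T_Spec by blast
  have qS: "\<qq> \<in> Spec R" using q unfolding supp_sub_def supp_def by blast
  \<comment> \<open>An object witnessing \<pp> in the support of the category need not be compact,
    but Krull's theorem requires a compact one; a supported generator takes its place.\<close>
  obtain C where C: "C \<in> generators" "\<pp> \<in> Supp C" by (rule supported_generator[OF p(1)])
  have Cc: "C \<in> \<C>" and Co: "C \<in> obj T" using generator_compact[OF C(1)] compact_obj by blast+
  obtain C' where C': "C' \<in> generators" "\<not> tors (R.avoiding \<pp>) (koszul C' \<pp>) C" using C(2) Supp_iff[OF Co] by blast
  then obtain n f where f: "f \<in> Hom (sh n (koszul C' \<pp>)) C" "\<And>s. s \<in> R.avoiding \<pp> \<Longrightarrow> \<not> kills s f"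
    unfolding tors_def by blast
  let ?D = "sh n (koszul C' \<pp>)"
  have D: "?D \<in> \<C>" by (rule triangD(3)[OF compact_triang koszul_compact[OF pS generator_compact[OF C'(1)]]])
  \<comment> \<open>All tuples of exponents, as the right tuple varies with the annihilator
    considered; there are countably many.\<close>
  define N where "N = {ns :: nat list. length ns = length (prime_gens \<qq>)}"
  define K where "K ns = kos (map2 R.pw (prime_gens \<qq>) ns) C" for ns
  have KT: "K ns \<in> TV \<qq>" if "ns \<in> N" for ns
    using kos_powers_TV[OF qS Co] that unfolding N_def K_def by blast
  have Ko: "K ns \<in> obj T" if "ns \<in> N" for ns using KT[OF that] TV_iff[OF qS] by blast
  have "small U N" by (rule small_countable[OF universe]) simp
  \<comment> \<open>Closure under products speaks of index sets inside \<open>U\<close>, so the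
    tuples are encoded there.\<close>
  then obtain j where j: "inj_on j N" "j ` N \<subseteq> U" by (rule small_embeds)
  have sj: "small U (j ` N)" by (rule small_image[OF \<open>small U N\<close>])
  let ?A = "\<lambda>i. localized \<qq> (K (inv_into N j i))"
  have inv: "inv_into N j i \<in> N" if "i \<in> j ` N" for i using that by (rule inv_into_into)
  have Ao: "?A i \<in> obj T" if "i \<in> j ` N" for i by (rule localized_obj[OF qS Ko[OF inv[OF that]]])
  obtain P \<pi> where P: "is_product T (j ` N) ?A P \<pi>" by (rule prod_ex[OF gen sj Ao])
  \<comment> \<open>Each factor is supported at most at \<qq>, and \<open>S\<close> contains every
    object whose support lies in that of \<open>S\<close>.\<close>
  have AS: "?A i \<in> S" if i: "i \<in> j ` N" for i
  proof -
    have "Supp (?A i) \<subseteq> {\<qq>}" by (rule Supp_localized[OF qS KT[OF inv[OF i]]])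
    then have "?A i \<in> {X \<in> obj T. Supp X \<subseteq> supp_sub U R T S}" using Ao[OF i] q by blast
    then show ?thesis using localizing_Supp[OF S(1)] by (rule ssubst[rotated])
  qed
  have "\<forall>i\<in>j ` N. ?A i \<in> S" by (rule ballI[OF AS])
  then have PS: "P \<in> S"
    by (rule S(2)[unfolded closed_under_products_def, rule_format, OF j(2) conjI[OF sj conjI[OF _ P]]])
  have "\<exists>e. e \<in> Hom (K ns) (localized \<qq> (K ns)) \<and>
    (\<exists>i h. tri3 (Gamma_ob U R T (not_below R \<qq>) (K ns)) (K ns) (localized \<qq> (K ns)) i e h)" if ns: "ns \<in> N" for ns
  proof -
    obtain i e h where t: "tri3 (Gamma_ob U R T (not_below R \<qq>) (K ns)) (K ns) (localized \<qq> (K ns)) i e h"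
      using torsion_triangle(5)[OF TZ_kernel[OF qS] Ko[OF ns]] by blast
    have "e \<in> Hom (K ns) (localized \<qq> (K ns))" using tri3_Hom[OF t] by simp
    then show ?thesis using t by blast
  qed
  then obtain e where e: "\<And>ns. ns \<in> N \<Longrightarrow> e ns \<in> Hom (K ns) (localized \<qq> (K ns)) \<and>
    (\<exists>i h. tri3 (Gamma_ob U R T (not_below R \<qq>) (K ns)) (K ns) (localized \<qq> (K ns)) i (e ns) h)" by metis
  let ?x = "\<lambda>ns. e ns \<bullet> (kmap (map2 R.pw (prime_gens \<qq>) ns) C \<bullet> f)"
  have xH: "?x ns \<in> Hom ?D (localized \<qq> (K ns))" if ns: "ns \<in> N" for ns
  proof -
    have "set (map2 R.pw (prime_gens \<qq>) ns) \<subseteq> E" using R.pw_even prime_gens(1)[OF qS] by (auto dest: set_zip_leftD)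
    then have "kmap (map2 R.pw (prime_gens \<qq>) ns) C \<in> Hom C (K ns)" unfolding K_def by (rule kmap_Hom[OF _ Co])
    then show ?thesis using f(1) conjunct1[OF e[OF ns]] by simp
  qed
  have "\<exists>x\<in>Hom ?D P. \<forall>i\<in>j ` N. \<pi> i \<bullet> x = ?x (inv_into N j i)"
  proof (rule prod_factor[OF P compact_obj[OF D], of "\<lambda>i. ?x (inv_into N j i)"])
    show "?x (inv_into N j i) \<in> Hom ?D (?A i)" if "i \<in> j ` N" for i by (rule xH[OF inv[OF that]])
    fix u assume "u \<in> Hom ?D P" "\<And>i. i \<in> j ` N \<Longrightarrow> \<pi> i \<bullet> u = ?x (inv_into N j i)"
    then show ?thesis by (intro bexI[of _ u] ballI)
  qed
  then obtain x where x: "x \<in> Hom ?D P" "\<forall>i\<in>j ` N. \<pi> i \<bullet> x = ?x (inv_into N j i)" by (elim bexE)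
  have "\<not> kills s x" if s: "s \<in> R.avoiding \<pp>" for s
  proof
    assume k: "kills s x"
    have "\<exists>ns. length ns = length (prime_gens \<qq>) \<and> \<not> kills s (?x ns)"
      by (rule detected_by_localized_kos[OF pS qS p(2) D Cc f(1) f(2) _ s]) (use e in \<open>simp_all add: N_def K_def del: Hom_iff\<close>)
    then obtain ns where ns: "ns \<in> N" "\<not> kills s (?x ns)" unfolding N_def by blast
    have jn: "j ns \<in> j ` N" using ns(1) by blast
    have sE: "s \<in> E" using s unfolding R.avoiding_def by blast
    have "kills s (\<pi> (j ns) \<bullet> x)" by (rule kills_left[OF sE x(1) prod_Hom(2)[OF P jn] k])
    then show False using ns(2) unfolding x(2)[rule_format, OF jn] inv_into_f_f[OF j(1) ns(1)] by blast
  qed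
  then have "\<not> tors (R.avoiding \<pp>) (koszul C' \<pp>) P" using x(1) unfolding tors_def by blast
  then have "\<pp> \<in> Supp P" using Supp_iff[OF prod_Hom(1)[OF P]] pS C'(1) by blast
  then show ?thesis using PS unfolding supp_sub_def by blast
qed

lemma supp_sub_generalization_closed:
  assumes S: "localizing U T S" "closed_under_products U T S"
  shows "generalization_closed_in supp_T (supp_sub U R T S)"
proof -
  have 1: "supp_sub U R T S \<subseteq> supp_T"
    using triangD(1)[OF localizingD[OF S(1)]] unfolding supp_sub_def by blast
  have "\<qq> \<notin> supp_sub U R T S" if "\<pp> \<in> supp_T - supp_sub U R T S" "\<pp> \<subseteq> \<qq>" for \<pp> \<qq>
    using product_closed_generalization[OF S] that by blast
  then show ?thesis
    unfolding generalization_closed_in_def specialization_closed_in_def using 1 by blast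
qed

text \<open>\<open>G\<close> is chosen to have the same right orthogonal as the kernel. It lies in
  the kernel because the kernel is the left orthogonal of that class; and an object of the kernel
  orthogonal to \<open>G\<close> is orthogonal to itself, so nothing is left out.\<close>

lemma kernel_compactly_generated:
  assumes L: "localization_functor T L \<eta>" and c: "preserves_coproducts U T L"
  shows "\<exists>G \<subseteq> \<C>. functor_kernel T L = Loc U T G"
proof -
  let ?K = "functor_kernel T L" and ?S = "{X. orth (functor_kernel T L) X}"
  have KO: "?K \<subseteq> obj T" unfolding functor_kernel_def by blast
  have S: "localizing U T ?S" "closed_under_products U T ?S"
    by (rule orth_K_localizing[OF L c], rule orth_closed_under_products[OF KO])
  define G where "G = koszul_objects (supp_T - supp_sub U R T ?S)"
  have SG: "?S = {X. orth G X}"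
    using localizing_Supp[OF S(1)] supported_orth[OF supp_sub_generalization_closed[OF S]]
    unfolding G_def by (rule trans)
  have "supp_T - supp_sub U R T ?S \<subseteq> Spec R" using supp_T_Spec by blast
  note G = koszul_objects[OF this, folded G_def]
  have "G \<subseteq> ?K"
  proof
    fix X assume X: "X \<in> G"
    have Xo: "X \<in> obj T" using G(1) X compact_obj by blast
    have "X \<in> left_orth Y" if Y: "orth ?K Y" for Y
    proof -
      have "orth G Y" using Y SG by blast
      then have "orth {X} Y" by (rule orth_subset) (use X in blast)
      then show ?thesis unfolding left_orth_def using Xo by blast
    qed
    then show "X \<in> ?K" unfolding K_iff_left_orth[OF L] using Xo by blast
  qed
  have "Loc U T G = ?K"
  proof (rule generated_kernel(1)[OF G K_localizing[OF L] \<open>G \<subseteq> ?K\<close>])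
    fix Y assume Y: "Y \<in> ?K" "orth G Y"
    then have "orth ?K Y" using SG by blast
    then show "is_zero T Y" using Y(1) by (rule orth_self_zero)
  qed
  then show ?thesis using G(1) by blast
qed

lemma supp_sub_bij:
  "bij_betw (supp_sub U R T) {S. localizing U T S \<and> closed_under_products U T S}
    {V. generalization_closed_in supp_T V}"
  unfolding bij_betw_def
proof (intro conjI subset_antisym)
  show "inj_on (supp_sub U R T) {S. localizing U T S \<and> closed_under_products U T S}"
  proof (rule inj_onI)
    fix S S' assume S: "S \<in> {S. localizing U T S \<and> closed_under_products U T S}"
      "S' \<in> {S. localizing U T S \<and> closed_under_products U T S}" "supp_sub U R T S = supp_sub U R T S'"
    have "S = {X \<in> obj T. Supp X \<subseteq> supp_sub U R T S}" by (rule localizing_Supp) (use S(1) in blast)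
    also have "\<dots> = {X \<in> obj T. Supp X \<subseteq> supp_sub U R T S'}" unfolding S(3) ..
    also have "\<dots> = S'" by (rule localizing_Supp[symmetric]) (use S(2) in blast)
    finally show "S = S'" .
  qed
  show "supp_sub U R T ` {S. localizing U T S \<and> closed_under_products U T S} \<subseteq> {V. generalization_closed_in supp_T V}"
    using supp_sub_generalization_closed by blast
  show "{V. generalization_closed_in supp_T V} \<subseteq> supp_sub U R T ` {S. localizing U T S \<and> closed_under_products U T S}"
  proof
    fix V assume "V \<in> {V. generalization_closed_in supp_T V}"
    then have V: "generalization_closed_in supp_T V" by blast
    show "V \<in> supp_sub U R T ` {S. localizing U T S \<and> closed_under_products U T S}"
    proof (rule image_eqI)
      show "V = supp_sub U R T {X \<in> obj T. Supp X \<subseteq> V}" by (rule supported_subcategory(3)[OF V, symmetric])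
      show "{X \<in> obj T. Supp X \<subseteq> V} \<in> {S. localizing U T S \<and> closed_under_products U T S}"
        using supported_subcategory(1,2)[OF V] by blast
    qed
  qed
qed

end

theorem theorem6p3:
  fixes U :: "'u set" and R :: "'r graded_ring" and T :: "('o, 'm, 'r) linear_category"
  assumes "universe U"
    and "graded_commutative_ring R" and "noetherian_ring R" and "small U (carrier R)"
    and "triangulated_category T" and "locally_small U T" and "has_coproducts U T"
    and "linear_structure R T"
    and "compactly_generated U T"
    and "noetherian_category U R T"
    and "stratified U R T"
  shows "bij_betw (supp_sub U R T)
           {S. localizing U T S \<and> closed_under_products U T S}
           {V. generalization_closed_in (supp_sub U R T (obj T)) V} \<and>
         (\<forall>L \<eta>. localization_functor T L \<eta> \<and> preserves_coproducts U T L \<longrightarrow>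
           (\<exists>G \<subseteq> compact_objects U T. functor_kernel T L = Loc U T G))"
proof -
  interpret stratified_category T U R
    by (intro stratified_category.intro generated_category.intro linear_cocomplete.intro
        cocomplete_category.intro stratified_category_axioms.intro generated_category_axioms.intro
        linear_cocomplete_axioms.intro cocomplete_category_axioms.intro assms)
  show ?thesis using supp_sub_bij kernel_compactly_generated by blast
qed

end
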